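(* Let $X$ be a closed Riemann surface of genus $g$ in the standard polygon model described in the context, let $G=(V,E)$ be a finite graph embedded in $X$ as described there, let $s\in F_2^{2g}$, and let $p$ be a prime reduced cycle of $G$ that traverses each edge of $G$ at most once. Then $$rot_s(p^g)\equiv 1+\mathrm{si}(p)+q_s([p])\pmod 2,$$ where $\mathrm{si}(p)$ is the number of self-intersections of $p$ and $[p]\in H_1(X,F_2)$ is the homology class of the (even) edge set of $p$.
   Context: Model of $X$: a regular $4g$-gon $R$ whose sides, labelled anticlockwise $z_1,\dots,z_{4g}$, are identified in pairs $z_i\sim z_{i+2}^{-1}$, $z_{i+1}\sim z_{i+3}^{-1}$ for $i=1,5,\dots,4g-3$. $G$ is embedded with vertices in the interior of $R$, edges straight segments meeting $\partial R$ transversally. The highway surface $S_g$ is $R$ with $2g$ rectangular bridges attached: $R_{2i-1}$ joins the pair of identified sides with indices $4i-3,4i-1$, and $R_{2i}$ the pair with indices $4i-2,4i$; $X$ is $S_g$ plus a disk. After isotopy $G\subset S_g$ and each edge $e$ meets bridge $R_i$ in $r_i(e)$ disjoint straight segments joining its glued sides; $r(A)_i=\sum_{e\in A}r_i(e)$ for $A\subseteq E$. An orientation-preserving immersion $\Phi:S_g\to\mathbb R^2$, injective except that $\Phi(R_{2i-1})\cap\Phi(R_{2i})$ is a square, yields the planar drawing $G^g=\Phi(G)$ with piecewise-linear edges. A prime reduced cycle is a circular sequence of directed edges $o_1,\dots,o_n$ forming a closed walk with $o_{j+1}\neq o_j^{-1}$ (cyclically) and not a proper power; $p^g$ denotes its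 image curve in $G^g$. $rot_0(p^g)=\frac1{2\pi}\sum_t z_0(t)\pmod 2$, summing the signed turning angles (positive anticlockwise) over all transitions between consecutive linear pieces of $p^g$; $rot_s(p^g)=rot_0(p^g)+s\cdot r(p)\pmod 2$. Self-intersections: for a prime reduced cycle $p$ traversing each edge at most once and a vertex $v$, the directed chord diagram at $v$ consists of the cyclic order of edges at $v$ (from the embedding in $X$) together with a chord $(e,e')$ for each transition of $p$ at $v$ entering along $e$ and leaving along $e'$; $\mathrm{si}(p)$ is the total number, over all $v$, of pairs of crossing chords. $q_s$: for an even edge set $E'$ (all degrees in $(V,E')$ even), choose at each vertex $v$ a partition of the edges of $E'$ at $v$ into pairwise non-crossing pairs (w.r.t. the cyclic order at $v$); these transitions decompose $E'$ into edge-disjoint closed walks $W(E')$; set $q_s([E'])=\sum_{p'\in W(E')}(1+rot_s(p'^g))\pmod 2$. This is well defined on the homology classes of even edge sets (independent of $E'$ in its class and of the pairings). *)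

theory Defs
  imports
    "HOL-Library.Z2"
    "HOL-Complex_Analysis.Winding_Numbers"
    "HOL-Homology.Homology"
begin

section \<open>The polygon model of the closed surface of genus \<open>g\<close>\<close>

text \<open>
  The plane is \<^typ>\<open>complex\<close>, and \<^typ>\<open>bit\<close> is the field with two elements.
  Sides and bridges are numbered from 1: sides \<open>1, \<dots>, 4 * g\<close>, bridges \<open>1, \<dots>, 2 * g\<close>.
\<close>

definition corner :: "nat \<Rightarrow> nat \<Rightarrow> complex" where
  "corner g k = cis (2 * pi * real k / real (4 * g))"

definition polygon :: "nat \<Rightarrow> complex set" where
  "polygon g = convex hull (corner g ` {..<4 * g})"

definition side_pt :: "nat \<Rightarrow> nat \<Rightarrow> real \<Rightarrow> complex" where
  "side_pt g m = linepath (corner g (m - 1)) (corner g m)"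

text \<open>
  Side \<open>m\<close> is glued to the side \<open>partner m\<close> with the opposite direction; in each block of four
  consecutive sides, the first is glued to the third and the second to the fourth.
\<close>

definition partner :: "nat \<Rightarrow> nat" where
  "partner m = (if (m - 1) mod 4 < 2 then m + 2 else m - 2)"

definition side_gluing :: "nat \<Rightarrow> (complex \<times> complex) set" where
  "side_gluing g =
    {(side_pt g m t, side_pt g (partner m) (1 - t)) | m t. m \<in> {1..4 * g} \<and> t \<in> {0..1}}"

definition surface_pt :: "nat \<Rightarrow> complex \<Rightarrow> complex set" where
  "surface_pt g z = (side_gluing g)\<^sup>* `` {z}"

definition surface :: "nat \<Rightarrow> complex set topology" where
  "surface g = topology (\<lambda>U. U \<subseteq> surface_pt g ` polygon g \<and>
     openin (top_of_set (polygon g)) {z \<in> polygon g. surface_pt g z \<in> U})"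

lemma openin_surface:
  "openin (surface g) U \<longleftrightarrow> U \<subseteq> surface_pt g ` polygon g \<and>
     openin (top_of_set (polygon g)) {z \<in> polygon g. surface_pt g z \<in> U}"
proof -
  define pre where "pre U = {z \<in> polygon g. surface_pt g z \<in> U}" for U
  have pre_Int: "pre (S \<inter> T) = pre S \<inter> pre T" for S T
    unfolding pre_def by blast
  have pre_Union: "pre (\<Union>K) = \<Union>(pre ` K)" for K
    unfolding pre_def by blast
  have "istopology (\<lambda>U. U \<subseteq> surface_pt g ` polygon g \<and> openin (top_of_set (polygon g)) (pre U))"
    unfolding istopology_def pre_Int pre_Union
    by (blast intro: openin_Int openin_Union)
  then show ?thesis unfolding surface_def pre_def by (simp only: topology_inverse')
qed

section \<open>First homology with coefficients in the two-element field\<close>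

text \<open>
  The library's singular chains have integer coefficients.  Chains modulo 2 are integral chains
  modulo doubles of chains, so two chains are homologous modulo 2 iff their difference is the sum
  of a boundary and a double; a homology class is a class of this relation.
\<close>

definition homologous_mod2 :: "'a topology \<Rightarrow> 'a chain \<Rightarrow> 'a chain \<Rightarrow> bool" where
  "homologous_mod2 X c c' \<longleftrightarrow>
    (\<exists>d b. singular_chain 2 X d \<and> singular_chain 1 X b \<and>
       c - c' = chain_boundary 2 d + frag_cmul 2 b)"

definition H1_class :: "'a topology \<Rightarrow> 'a chain \<Rightarrow> 'a chain set" where
  "H1_class X c = {c'. singular_chain 1 X c' \<and> homologous_mod2 X c c'}"

section \<open>Embedded graphs\<close>

text \<open>
  Loops and multiple edges are allowed; \<open>tail\<close> and \<open>head\<close> fix a reference direction of each edge.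
  \<open>crossings e\<close> lists, in this direction, the points where \<open>e\<close> leaves the polygon: the entry
  \<open>(m, t)\<close> stands for leaving through \<open>side_pt g m t\<close> and re-entering at the identified point
  \<open>side_pt g (partner m) (1 - t)\<close>.  In between, the edge is a straight segment.
\<close>

record ('v, 'e) drawn_graph =
  verts :: "'v set"
  edges :: "'e set"
  tail :: "'e \<Rightarrow> 'v"
  head :: "'e \<Rightarrow> 'v"
  pos :: "'v \<Rightarrow> complex"
  crossings :: "'e \<Rightarrow> (nat \<times> real) list"

fun route :: "nat \<Rightarrow> complex \<Rightarrow> (nat \<times> real) list \<Rightarrow> complex \<Rightarrow> (complex \<times> complex) list" where
  "route g a [] b = [(a, b)]"
| "route g a ((m, t) # cs) b =
     (a, side_pt g m t) # route g (side_pt g (partner m) (1 - t)) cs b"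

definition segments :: "nat \<Rightarrow> ('v, 'e) drawn_graph \<Rightarrow> 'e \<Rightarrow> (complex \<times> complex) list" where
  "segments g G e = route g (pos G (tail G e)) (crossings G e) (pos G (head G e))"

definition embedded_graph :: "nat \<Rightarrow> ('v, 'e) drawn_graph \<Rightarrow> bool" where
  "embedded_graph g G \<longleftrightarrow>
     finite (verts G) \<and> finite (edges G) \<and>
     tail G ` edges G \<subseteq> verts G \<and> head G ` edges G \<subseteq> verts G \<and>
     inj_on (pos G) (verts G) \<and> pos G ` verts G \<subseteq> interior (polygon g) \<and>
     (\<forall>e\<in>edges G. \<forall>(m, t)\<in>set (crossings G e). m \<in> {1..4 * g} \<and> 0 < t \<and> t < 1) \<and>
     (\<forall>e\<in>edges G. \<forall>(a, b)\<in>set (segments g G e).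
        a \<noteq> b \<and> open_segment a b \<subseteq> interior (polygon g) - pos G ` verts G) \<and>
     (\<forall>e\<in>edges G. \<forall>e'\<in>edges G. \<forall>i<length (segments g G e). \<forall>j<length (segments g G e').
        (e, i) \<noteq> (e', j) \<longrightarrow>
        (case (segments g G e ! i, segments g G e' ! j) of
          ((a, b), (a', b')) \<Rightarrow> open_segment a b \<inter> open_segment a' b' = {})) \<and>
     (\<forall>e\<in>edges G. \<forall>e'\<in>edges G. \<forall>i<length (crossings G e). \<forall>j<length (crossings G e').
        (e, i) \<noteq> (e', j) \<longrightarrow>
        (case (crossings G e ! i, crossings G e' ! j) of
          ((m, t), (m', t')) \<Rightarrow> surface_pt g (side_pt g m t) \<noteq> surface_pt g (side_pt g m' t')))"

definition segment_simplex ::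
    "nat \<Rightarrow> complex \<times> complex \<Rightarrow> (nat \<Rightarrow> real) \<Rightarrow> complex set" where
  "segment_simplex g = (\<lambda>(a, b).
     restrict (\<lambda>x. surface_pt g (x 0 *\<^sub>R a + x 1 *\<^sub>R b)) (standard_simplex 1))"

definition edge_set_chain :: "nat \<Rightarrow> ('v, 'e) drawn_graph \<Rightarrow> 'e set \<Rightarrow> complex set chain" where
  "edge_set_chain g G E' =
     (\<Sum>e\<in>E'. \<Sum>ab\<leftarrow>segments g G e. frag_of (segment_simplex g ab))"

definition homology_class ::
    "nat \<Rightarrow> ('v, 'e) drawn_graph \<Rightarrow> 'e set \<Rightarrow> complex set chain set" where
  "homology_class g G E' = H1_class (surface g) (edge_set_chain g G E')"

section \<open>The highway surface and its immersion in the plane\<close>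

definition bridge_of :: "nat \<Rightarrow> nat" where
  "bridge_of m = 2 * ((m - 1) div 4) + (if odd m then 1 else 2)"

definition bridge_side :: "nat \<Rightarrow> nat" where
  "bridge_side i = (if odd i then 2 * i - 1 else 2 * i - 2)"

text \<open>
  Bridge \<open>i\<close> is the rectangle \<open>[0, 1] \<times> [0, 1]\<close> with coordinates \<open>(t, u)\<close>; its edge \<open>u = 0\<close> is glued
  to the side \<open>bridge_side i\<close> and its edge \<open>u = 1\<close> to \<open>bridge_side i + 2\<close>.  Glued points are
  represented as points of the polygon, so a point \<open>Bridge i t u\<close> of the highway surface
  always has \<open>0 < u < 1\<close>, and equality of points of the surface is equality of terms.
\<close>

datatype hw_point = Base complex | Bridge nat real real

definition bridge_pt :: "nat \<Rightarrow> nat \<Rightarrow> real \<Rightarrow> real \<Rightarrow> hw_point" where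
  "bridge_pt g i t u =
     (if u = 0 then Base (side_pt g (bridge_side i) t)
      else if u = 1 then Base (side_pt g (bridge_side i + 2) (1 - t))
      else Bridge i t u)"

definition bridge :: "nat \<Rightarrow> hw_point set" where
  "bridge i = {Bridge i t u | t u. 0 \<le> t \<and> t \<le> 1 \<and> 0 < u \<and> u < 1}"

definition highway :: "nat \<Rightarrow> hw_point set" where
  "highway g = Base ` polygon g \<union> (\<Union>i\<in>{1..2 * g}. bridge i)"

text \<open>
  \<open>pl_via \<gamma> ps\<close>: the path \<open>\<gamma>\<close>, parametrised by \<open>[0, 1]\<close>, runs through the consecutive segments
  of the polygonal line with vertices \<open>ps\<close>.  The speed need not be constant on a segment; the notion
  is only used for injective paths.
\<close>

definition pl_via :: "(real \<Rightarrow> complex) \<Rightarrow> complex list \<Rightarrow> bool" where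
  "pl_via \<gamma> ps \<longleftrightarrow> 2 \<le> length ps \<and>
     (\<exists>\<tau>. \<tau> 0 = 0 \<and> \<tau> (length ps - 1) = 1 \<and>
        (\<forall>k<length ps - 1. \<tau> k < \<tau> (Suc k) \<and>
           ps ! k = \<gamma> (\<tau> k) \<and> ps ! Suc k = \<gamma> (\<tau> (Suc k)) \<and> ps ! k \<noteq> ps ! Suc k \<and>
           \<gamma> ` {\<tau> k..\<tau> (Suc k)} = closed_segment (ps ! k) (ps ! Suc k)))"

definition is_square :: "complex set \<Rightarrow> bool" where
  "is_square Q \<longleftrightarrow>
     (\<exists>a c. c \<noteq> 0 \<and> Q = {a + Complex x y * c | x y. 0 \<le> x \<and> x \<le> 1 \<and> 0 \<le> y \<and> y \<le> 1})"

text \<open>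
  Since \<open>bridge i\<close> omits the two glued sides, corners of the polygon shared by adjacent
  bridges do not count as common points of their images.  The double points then lie at positive
  distance from the image of the polygon, and the last two conditions make the map locally
  injective.  As the highway surface is connected, preservation of the orientation is tested on
  the polygon alone: small anticlockwise circles are mapped to curves winding once, positively.
\<close>

definition highway_immersion :: "nat \<Rightarrow> (hw_point \<Rightarrow> complex) \<Rightarrow> bool" where
  "highway_immersion g \<Phi> \<longleftrightarrow>
     continuous_on (polygon g) (\<lambda>z. \<Phi> (Base z)) \<and>
     (\<forall>i\<in>{1..2 * g}. continuous_on ({0..1} \<times> {0..1}) (\<lambda>(t, u). \<Phi> (bridge_pt g i t u))) \<and>
     (\<forall>a\<in>polygon g. \<forall>b\<in>polygon g. a \<noteq> b \<longrightarrow>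
        (\<exists>ps. pl_via (\<lambda>x. \<Phi> (Base (linepath a b x))) ps)) \<and>
     (\<forall>i\<in>{1..2 * g}. \<forall>t\<in>{0..1}. \<exists>ps. pl_via (\<lambda>u. \<Phi> (bridge_pt g i t u)) ps) \<and>
     (\<forall>z r. 0 < r \<and> cball z r \<subseteq> interior (polygon g) \<longrightarrow>
        winding_number (\<lambda>x. \<Phi> (Base (circlepath z r x))) (\<Phi> (Base z)) = 1) \<and>
     (\<forall>x\<in>highway g. \<forall>y\<in>highway g. x \<noteq> y \<and> \<Phi> x = \<Phi> y \<longrightarrow>
        (\<exists>k\<in>{1..g}. x \<in> bridge (2 * k - 1) \<and> y \<in> bridge (2 * k) \<or>
                    y \<in> bridge (2 * k - 1) \<and> x \<in> bridge (2 * k))) \<and>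
     (\<forall>k\<in>{1..g}. is_square (\<Phi> ` bridge (2 * k - 1) \<inter> \<Phi> ` bridge (2 * k)))"

section \<open>The planar drawing and rotation numbers\<close>

definition pl_points :: "(real \<Rightarrow> complex) \<Rightarrow> complex list" where
  "pl_points \<gamma> = (SOME ps. pl_via \<gamma> ps)"

text \<open>
  \<open>strand g m t\<close> crosses the bridge at side \<open>m\<close>, from \<open>side_pt g m t\<close> to the identified point.
\<close>

definition strand :: "nat \<Rightarrow> nat \<Rightarrow> real \<Rightarrow> real \<Rightarrow> hw_point" where
  "strand g m t u =
     (if m = bridge_side (bridge_of m) then bridge_pt g (bridge_of m) t u
      else bridge_pt g (bridge_of m) (1 - t) (1 - u))"

fun route_points ::
    "nat \<Rightarrow> (hw_point \<Rightarrow> complex) \<Rightarrow> complex \<Rightarrow> (nat \<times> real) list \<Rightarrow> complex \<Rightarrow> complex list" where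
  "route_points g \<Phi> a [] b = pl_points (\<lambda>x. \<Phi> (Base (linepath a b x)))"
| "route_points g \<Phi> a ((m, t) # cs) b =
     butlast (pl_points (\<lambda>x. \<Phi> (Base (linepath a (side_pt g m t) x)))) @
     butlast (pl_points (\<lambda>u. \<Phi> (strand g m t u))) @
     route_points g \<Phi> (side_pt g (partner m) (1 - t)) cs b"

definition edge_points ::
    "nat \<Rightarrow> (hw_point \<Rightarrow> complex) \<Rightarrow> ('v, 'e) drawn_graph \<Rightarrow> 'e \<Rightarrow> complex list" where
  "edge_points g \<Phi> G e =
     route_points g \<Phi> (pos G (tail G e)) (crossings G e) (pos G (head G e))"

text \<open>
  A directed edge is a pair \<open>(e, f)\<close>, where \<open>f\<close> tells whether \<open>e\<close> is traversed in its reference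
  direction.  It also stands for the end of \<open>e\<close> at its initial vertex, so that a loop has two
  ends there.
\<close>

type_synonym 'e dart = "'e \<times> bool"

definition rev_dart :: "'e dart \<Rightarrow> 'e dart" where
  "rev_dart d = (fst d, \<not> snd d)"

definition start_vert :: "('v, 'e) drawn_graph \<Rightarrow> 'e dart \<Rightarrow> 'v" where
  "start_vert G d = (if snd d then tail G (fst d) else head G (fst d))"

definition end_vert :: "('v, 'e) drawn_graph \<Rightarrow> 'e dart \<Rightarrow> 'v" where
  "end_vert G d = start_vert G (rev_dart d)"

definition dart_points ::
    "nat \<Rightarrow> (hw_point \<Rightarrow> complex) \<Rightarrow> ('v, 'e) drawn_graph \<Rightarrow> 'e dart \<Rightarrow> complex list" where
  "dart_points g \<Phi> G d =
     (if snd d then edge_points g \<Phi> G (fst d) else rev (edge_points g \<Phi> G (fst d)))"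

definition walk_points ::
    "nat \<Rightarrow> (hw_point \<Rightarrow> complex) \<Rightarrow> ('v, 'e) drawn_graph \<Rightarrow> 'e dart list \<Rightarrow> complex list" where
  "walk_points g \<Phi> G p = concat (map (\<lambda>d. butlast (dart_points g \<Phi> G d)) p)"

definition total_turning :: "complex list \<Rightarrow> real" where
  "total_turning ps =
     (let n = length ps; P = (\<lambda>k. ps ! (k mod n)) in
      \<Sum>k<n. Arg ((P (k + 2) - P (k + 1)) / (P (k + 1) - P k)))"

text \<open>The real number under the floor brackets is an integer for closed polygons.\<close>

definition rot0 ::
    "nat \<Rightarrow> (hw_point \<Rightarrow> complex) \<Rightarrow> ('v, 'e) drawn_graph \<Rightarrow> 'e dart list \<Rightarrow> bit" where
  "rot0 g \<Phi> G p = of_int \<lfloor>total_turning (walk_points g \<Phi> G p) / (2 * pi)\<rfloor>"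

definition bridge_count :: "('v, 'e) drawn_graph \<Rightarrow> 'e \<Rightarrow> nat \<Rightarrow> nat" where
  "bridge_count G e i = length (filter (\<lambda>(m, t). bridge_of m = i) (crossings G e))"

definition rot ::
    "nat \<Rightarrow> (hw_point \<Rightarrow> complex) \<Rightarrow> ('v, 'e) drawn_graph \<Rightarrow> (nat \<Rightarrow> bit) \<Rightarrow> 'e dart list \<Rightarrow> bit"
  where
  "rot g \<Phi> G s p =
     rot0 g \<Phi> G p + (\<Sum>i\<in>{1..2 * g}. s i * of_nat (\<Sum>d\<leftarrow>p. bridge_count G (fst d) i))"

section \<open>Cycles and self-intersections\<close>

definition next_dart :: "'e dart list \<Rightarrow> nat \<Rightarrow> 'e dart" where
  "next_dart p j = p ! (Suc j mod length p)"

definition prime_reduced_cycle :: "('v, 'e) drawn_graph \<Rightarrow> 'e dart list \<Rightarrow> bool" where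
  "prime_reduced_cycle G p \<longleftrightarrow>
     p \<noteq> [] \<and> fst ` set p \<subseteq> edges G \<and>
     (\<forall>j<length p. end_vert G (p ! j) = start_vert G (next_dart p j)) \<and>
     (\<forall>j<length p. next_dart p j \<noteq> rev_dart (p ! j)) \<and>
     \<not> (\<exists>k q. 2 \<le> k \<and> p = concat (replicate k q))"

text \<open>The polygon carries the orientation of the plane, so edge ends at a vertex are cyclically
  ordered by the arguments of their initial directions in the polygon.\<close>

definition direction :: "nat \<Rightarrow> ('v, 'e) drawn_graph \<Rightarrow> 'e dart \<Rightarrow> complex" where
  "direction g G d =
     (if snd d then (case hd (segments g G (fst d)) of (a, b) \<Rightarrow> b - a)
      else (case last (segments g G (fst d)) of (a, b) \<Rightarrow> a - b))"

definition between :: "nat \<Rightarrow> ('v, 'e) drawn_graph \<Rightarrow> 'e dart \<Rightarrow> 'e dart \<Rightarrow> 'e dart \<Rightarrow> bool" where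
  "between g G a b x \<longleftrightarrow>
     0 < Arg2pi (direction g G x / direction g G a) \<and>
     Arg2pi (direction g G x / direction g G a) < Arg2pi (direction g G b / direction g G a)"

text \<open>Only applied to chords with four distinct ends at one vertex.\<close>

definition chords_cross ::
    "nat \<Rightarrow> ('v, 'e) drawn_graph \<Rightarrow> 'e dart \<times> 'e dart \<Rightarrow> 'e dart \<times> 'e dart \<Rightarrow> bool" where
  "chords_cross g G = (\<lambda>(a, b) (c, d). between g G a b c \<noteq> between g G a b d)"

text \<open>The \<open>j\<close>-th transition of \<open>p\<close>, as a pair of edge ends at the vertex where it takes place.\<close>

definition transition :: "'e dart list \<Rightarrow> nat \<Rightarrow> 'e dart \<times> 'e dart" where
  "transition p j = (rev_dart (p ! j), next_dart p j)"

definition self_intersections :: "nat \<Rightarrow> ('v, 'e) drawn_graph \<Rightarrow> 'e dart list \<Rightarrow> nat" where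
  "self_intersections g G p =
     (\<Sum>v\<in>verts G. card {(j, k). j < k \<and> k < length p \<and>
        end_vert G (p ! j) = v \<and> end_vert G (p ! k) = v \<and>
        chords_cross g G (transition p j) (transition p k)})"

section \<open>The quadratic form\<close>

definition ends_at :: "('v, 'e) drawn_graph \<Rightarrow> 'e set \<Rightarrow> 'v \<Rightarrow> 'e dart set" where
  "ends_at G E' v = {d. fst d \<in> E' \<and> start_vert G d = v}"

definition even_edge_set :: "('v, 'e) drawn_graph \<Rightarrow> 'e set \<Rightarrow> bool" where
  "even_edge_set G E' \<longleftrightarrow> E' \<subseteq> edges G \<and> (\<forall>v\<in>verts G. even (card (ends_at G E' v)))"

text \<open>\<open>T\<close> maps each edge end to the end it is paired with.\<close>

definition noncrossing_pairing ::
    "nat \<Rightarrow> ('v, 'e) drawn_graph \<Rightarrow> 'e set \<Rightarrow> ('e dart \<Rightarrow> 'e dart) \<Rightarrow> bool" where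
  "noncrossing_pairing g G E' T \<longleftrightarrow>
     (\<forall>v\<in>verts G. \<forall>d\<in>ends_at G E' v.
        T d \<in> ends_at G E' v \<and> T d \<noteq> d \<and> T (T d) = d \<and>
        (\<forall>d'\<in>ends_at G E' v - {d, T d}. \<not> chords_cross g G (d, T d) (d', T d')))"

text \<open>\<open>W\<close> lists the closed walks, each of them once, with an arbitrary starting point and direction.\<close>

definition walk_decomposition ::
    "'e set \<Rightarrow> ('e dart \<Rightarrow> 'e dart) \<Rightarrow> 'e dart list list \<Rightarrow> bool" where
  "walk_decomposition E' T W \<longleftrightarrow>
     distinct (map fst (concat W)) \<and> fst ` set (concat W) = E' \<and>
     (\<forall>w\<in>set W. w \<noteq> [] \<and> (\<forall>j<length w. next_dart w j = T (rev_dart (w ! j))))"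

definition q_values ::
    "nat \<Rightarrow> (hw_point \<Rightarrow> complex) \<Rightarrow> ('v, 'e) drawn_graph \<Rightarrow> (nat \<Rightarrow> bit) \<Rightarrow>
     complex set chain set \<Rightarrow> bit set" where
  "q_values g \<Phi> G s c =
     {(\<Sum>w\<leftarrow>W. 1 + rot g \<Phi> G s w) | E' T W.
        even_edge_set G E' \<and> homology_class g G E' = c \<and>
        noncrossing_pairing g G E' T \<and> walk_decomposition E' T W}"

text \<open>The common value over all even edge sets in the class \<open>c\<close> and all pairings.\<close>

definition q_form ::
    "nat \<Rightarrow> (hw_point \<Rightarrow> complex) \<Rightarrow> ('v, 'e) drawn_graph \<Rightarrow> (nat \<Rightarrow> bit) \<Rightarrow>
     complex set chain set \<Rightarrow> bit" where
  "q_form g \<Phi> G s c = the_elem (q_values g \<Phi> G s c)"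

end

theory Submission
  imports Defs "HOL-Complex_Analysis.Riemann_Mapping"
begin

text \<open>
  The crossing index of two arcs measures how their end points wind around each other; it is additive
  and vanishes on disjoint arcs.  As in Hopf's proof of the Umlaufsatz, the rotation number of a closed
  polygonal curve is, modulo 2, one plus the sum of the crossing indices over all pairs of arcs into
  which the curve is cut.  For a closed walk in the planar drawing only two kinds of pairs contribute:
  transitions at the same vertex with crossing chords, and strands on the two crossing bridges
  \<open>2 * k - 1\<close> and \<open>2 * k\<close>.  So if \<open>r\<close> counts the bridge crossings of
  the walk modulo 2, then \<open>rot\<^sub>s = 1 + si + Q r\<close> with
  \<open>Q r = (\<Sum>k. r (2 * k - 1) * r (2 * k)) + (\<Sum>i. s i * r i)\<close>.  Edge-disjoint closed walks
  cross evenly, so for a noncrossing decomposition of an even edge set the same count gives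
  \<open>Q r\<close> as the sum of all \<open>1 + rot\<^sub>s\<close>.  Finally, \<open>r i\<close> is the winding modulo 2
  of a circle-valued map on the surface, hence depends only on the homology class.
\<close>

section \<open>Crossing indices of plane paths\<close>

text \<open>Little is known about the drawing: the immersion is merely continuous, every segment has
  some polygonal image whose vertices \<open>pl_points\<close> picks by \<open>SOME\<close>, and
  orientation enters only through winding numbers of images of small circles. Hence nothing is
  computed from coordinates in the image. Arcs are compared through logarithms of their secants, and
  the index of two arcs in the polygon passes unchanged through \<open>\<Phi>\<close> because the
  secant quotient \<open>(f x - f y) / (x - y)\<close> has a continuous logarithm on all pairs of
  distinct points. This carries the cyclic order at a vertex, given in the polygon, over to the
  planar curve. Paired bridges overlap in a square, but nothing makes two strands cross there just
  once, so their index is found globally, by closing them up in the polygon. Additivity of the index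
  needs end points off the other arc, while adjacent arcs share an end; cutting every segment into
  thirds separates all arcs that may intersect. Finally, \<open>q_form\<close> is
  \<open>the_elem\<close> of a set, so both the existence of a noncrossing decomposition and
  independence of all choices are required.\<close>

definition cross_index :: "(real \<Rightarrow> complex) \<Rightarrow> (real \<Rightarrow> complex) \<Rightarrow> complex" where
  "cross_index \<alpha> \<beta> = winding_number \<beta> (\<alpha> 0) + winding_number \<alpha> (\<beta> 1)
     - winding_number \<beta> (\<alpha> 1) - winding_number \<alpha> (\<beta> 0)"

text \<open>The logarithm \<open>g\<close> lives on a space through which the arc \<open>c\<close>
  runs, so that one logarithm on a square or a triangle yields the windings along all its
  edges.\<close>

lemma winding_number_exp_log:
  fixes c :: "real \<Rightarrow> 'a::topological_space"
  assumes "continuous_on S g" "continuous_on {0..1} c" "c ` {0..1} \<subseteq> S"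
    and "\<And>t. t \<in> {0..1} \<Longrightarrow> f t - z = exp (g (c t))"
  shows "winding_number f z = (g (c 1) - g (c 0)) / (2 * of_real pi * \<i>)"
proof -
  have "path (g \<circ> c)"
    unfolding path_def using assms by (metis continuous_on_compose continuous_on_subset)
  then have "winding_number (exp \<circ> (g \<circ> c)) 0 = (g (c 1) - g (c 0)) / (2 * of_real pi * \<i>)"
    by (simp add: winding_number_compose_exp pathfinish_def pathstart_def)
  moreover have "winding_number f z = winding_number (exp \<circ> (g \<circ> c)) 0"
    by (subst winding_number_offset) (auto intro!: winding_number_cong simp: assms)
  ultimately show ?thesis by simp
qed

text \<open>Values of \<open>g\<close> differ by multiples of \<open>2 * pi * \<i>\<close>, and a
  continuous function with uniformly separated values is constant on a connected set.\<close>

lemma exp_eq_const_imp_const: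
  fixes g :: "'a::topological_space \<Rightarrow> complex"
  assumes "connected S" "continuous_on S g" "\<And>x. x \<in> S \<Longrightarrow> exp (g x) = c"
    "x \<in> S" "y \<in> S"
  shows "g x = g y"
proof -
  have "2 * pi \<le> norm (g y - g x)" if "x \<in> S" "y \<in> S" "g y \<noteq> g x" for x y
  proof -
    have "exp (g y) = exp (g x)" using assms that by auto
    then obtain n :: int where n: "g y = g x + of_int (2 * n) * pi * \<i>"
      using exp_eq by metis
    with that have "n \<noteq> 0" by auto
    then have "1 \<le> \<bar>real_of_int n\<bar>" by linarith
    moreover have "norm (g y - g x) = 2 * \<bar>real_of_int n\<bar> * pi"
      using n by (simp add: norm_mult)
    ultimately show ?thesis by simp
  qed
  moreover have "0 < 2 * pi" by simp
  ultimately have "g constant_on S"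
    using continuous_discrete_range_constant[OF assms(1,2)] by blast
  then show ?thesis using assms(4,5) unfolding constant_on_def by metis
qed

text \<open>The secant \<open>\<beta> t - \<alpha> s\<close> has no zero on the parameter square,
  hence has a logarithm there. The four windings are the increments of this logarithm along the four
  edges, taken around the boundary of the square, so they cancel. In general
  \<open>cross_index\<close> is thus the winding of the secant around this boundary, a signed count
  of intersections.\<close>

lemma cross_index_disjoint:
  assumes "path \<alpha>" "path \<beta>" "path_image \<alpha> \<inter> path_image \<beta> = {}"
  shows "cross_index \<alpha> \<beta> = 0"
proof -
  let ?S = "{0..1::real} \<times> {0..1::real}"
  let ?f = "\<lambda>(s, t). \<beta> t - \<alpha> s"
  have "convex ?S" by (intro convex_Times) auto
  then have "contractible ?S" by (rule convex_imp_contractible)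
  moreover have "continuous_on ?S ?f"
  proof -
    have "continuous_on ?S (\<lambda>x. \<beta> (snd x))" "continuous_on ?S (\<lambda>x. \<alpha> (fst x))"
      using assms(1,2) unfolding path_def
      by (auto elim!: continuous_on_compose2 intro!: continuous_on_snd continuous_on_fst continuous_on_id)
    then have "continuous_on ?S (\<lambda>x. \<beta> (snd x) - \<alpha> (fst x))" by (rule continuous_on_diff)
    then show ?thesis by (simp add: case_prod_beta)
  qed
  moreover have "?f z \<noteq> 0" if "z \<in> ?S" for z
    using that assms(3) unfolding path_image_def
    by (auto simp: disjoint_iff) (metis atLeastAtMost_iff imageI)
  ultimately obtain g where g: "continuous_on ?S g" "\<And>z. z \<in> ?S \<Longrightarrow> ?f z = exp (g z)"
    using continuous_logarithm_on_contractible[of ?S ?f] by blast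
  have v: "winding_number \<beta> (\<alpha> s) = (g (s, 1) - g (s, 0)) / (2 * of_real pi * \<i>)" if "s \<in> {0..1}" for s
  proof (rule winding_number_exp_log[OF g(1), of "\<lambda>t. (s, t)"])
    show "continuous_on {0..1} (Pair s)" by (intro continuous_on_Pair continuous_on_const continuous_on_id)
    show "\<beta> t - \<alpha> s = exp (g (s, t))" if "t \<in> {0..1}" for t
      using g(2)[of "(s, t)"] that \<open>s \<in> {0..1}\<close> by simp
  qed (use that in auto)
  have h: "winding_number \<alpha> (\<beta> t) = (g (1, t) - g (0, t)) / (2 * of_real pi * \<i>)" if "t \<in> {0..1}" for t
  proof -
    \<comment> \<open>The secant is traversed with the opposite sign; this adds
      \<open>pi * \<i>\<close> to the logarithm and disappears in the difference.\<close>
    have "winding_number \<alpha> (\<beta> t) =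
        ((g (1, t) + \<i> * of_real pi) - (g (0, t) + \<i> * of_real pi)) / (2 * of_real pi * \<i>)"
    proof (rule winding_number_exp_log[of ?S "\<lambda>z. g z + \<i> * of_real pi" "\<lambda>s. (s, t)"])
      fix s :: real assume s: "s \<in> {0..1}"
      with that g(2)[of "(s, t)"] have "\<beta> t - \<alpha> s = exp (g (s, t))" by simp
      then show "\<alpha> s - \<beta> t = exp (g (s, t) + \<i> * of_real pi)"
        by (simp add: exp_add algebra_simps)
    next
      show "continuous_on ?S (\<lambda>z. g z + \<i> * of_real pi)"
        by (intro continuous_on_add g(1) continuous_on_const)
      show "continuous_on {0..1} (\<lambda>s. (s, t))" by (intro continuous_on_Pair continuous_on_const continuous_on_id)
    qed (use that in auto)
    then show ?thesis by simp
  qed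
  show ?thesis by (simp add: cross_index_def v h diff_divide_distrib)
qed

lemma cross_index_commute: "cross_index \<beta> \<alpha> = - cross_index \<alpha> \<beta>"
  by (simp add: cross_index_def)

text \<open>Only windings around the ends of \<open>\<alpha>\<close> are split at the junction, so
  the interiors may cross freely; the windings of \<open>\<alpha>\<close> around the junction itself
  cancel.\<close>

lemma cross_index_join_right:
  assumes "path \<beta>" "path \<beta>'" "pathfinish \<beta> = pathstart \<beta>'"
    and "\<alpha> 0 \<notin> path_image \<beta> \<union> path_image \<beta>'" "\<alpha> 1 \<notin> path_image \<beta> \<union> path_image \<beta>'"
  shows "cross_index \<alpha> (\<beta> +++ \<beta>') = cross_index \<alpha> \<beta> + cross_index \<alpha> \<beta>'"
proof -
  have "(\<beta> +++ \<beta>') 0 = \<beta> 0" "(\<beta> +++ \<beta>') 1 = \<beta>' 1" "\<beta> 1 = \<beta>' 0"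
    using assms(3) by (auto simp: joinpaths_def pathfinish_def pathstart_def)
  then show ?thesis
    using assms by (simp add: cross_index_def winding_number_join)
qed

lemma cross_index_join_left:
  assumes "path \<alpha>" "path \<alpha>'" "pathfinish \<alpha> = pathstart \<alpha>'"
    and "\<beta> 0 \<notin> path_image \<alpha> \<union> path_image \<alpha>'" "\<beta> 1 \<notin> path_image \<alpha> \<union> path_image \<alpha>'"
  shows "cross_index (\<alpha> +++ \<alpha>') \<beta> = cross_index \<alpha> \<beta> + cross_index \<alpha>' \<beta>"
  using cross_index_join_right[OF assms] by (simp add: cross_index_commute[of _ \<beta>])

text \<open>The exponential of a winding is the quotient of the final and the initial secant. For
  the four windings these quotients consist of the same four differences of end points and multiply
  to 1.\<close>

lemma cross_index_Ints:
  assumes "path \<alpha>" "path \<beta>" "\<alpha> 0 \<notin> path_image \<beta>" "\<alpha> 1 \<notin> path_image \<beta>"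
    "\<beta> 0 \<notin> path_image \<alpha>" "\<beta> 1 \<notin> path_image \<alpha>"
  shows "cross_index \<alpha> \<beta> \<in> \<int>"
proof -
  let ?E = "\<lambda>z. exp (2 * pi * \<i> * z)"
  have nz: "\<alpha> 0 \<noteq> \<beta> 0" "\<alpha> 0 \<noteq> \<beta> 1" "\<alpha> 1 \<noteq> \<beta> 0" "\<alpha> 1 \<noteq> \<beta> 1"
    using assms unfolding path_image_def by auto
  have e: "?E (winding_number \<gamma> z) = (\<gamma> 1 - z) / (\<gamma> 0 - z)"
    if "path \<gamma>" "z \<notin> path_image \<gamma>" for \<gamma> z
  proof -
    have "\<gamma> 0 \<noteq> z" using that(2) by (auto simp: path_image_def)
    then show ?thesis
      using winding_number_exp_2pi[OF that] by (simp add: pathfinish_def pathstart_def field_simps)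
  qed
  have "?E (cross_index \<alpha> \<beta>) = ?E (winding_number \<beta> (\<alpha> 0)) * ?E (winding_number \<alpha> (\<beta> 1))
     / ?E (winding_number \<beta> (\<alpha> 1)) / ?E (winding_number \<alpha> (\<beta> 0))"
    by (simp add: cross_index_def exp_add exp_diff ring_distribs)
  also have "\<dots> = ((\<beta> 1 - \<alpha> 0) / (\<beta> 0 - \<alpha> 0)) * ((\<alpha> 1 - \<beta> 1) / (\<alpha> 0 - \<beta> 1))
     / ((\<beta> 1 - \<alpha> 1) / (\<beta> 0 - \<alpha> 1)) / ((\<alpha> 1 - \<beta> 0) / (\<alpha> 0 - \<beta> 0))"
    using assms by (simp only: e not_False_eq_True)
  also have "\<dots> = 1"
  proof -
    have "(\<beta> 1 - \<alpha> 0) = - (\<alpha> 0 - \<beta> 1)" "(\<beta> 0 - \<alpha> 0) = - (\<alpha> 0 - \<beta> 0)"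
      "(\<beta> 1 - \<alpha> 1) = - (\<alpha> 1 - \<beta> 1)" "(\<beta> 0 - \<alpha> 1) = - (\<alpha> 1 - \<beta> 0)" by simp_all
    moreover have "\<alpha> 0 - \<beta> 1 \<noteq> 0" "\<alpha> 0 - \<beta> 0 \<noteq> 0" "\<alpha> 1 - \<beta> 1 \<noteq> 0" "\<alpha> 1 - \<beta> 0 \<noteq> 0"
      using nz by auto
    moreover have "(- A / - B) * (C / A) / (- C / - D) / (D / B) = 1"
      if "A \<noteq> 0" "B \<noteq> 0" "C \<noteq> 0" "D \<noteq> 0" for A B C D :: complex
      using that by (simp add: field_simps)
    ultimately show ?thesis by (simp only:)
  qed
  finally have "exp (2 * pi * \<i> * cross_index \<alpha> \<beta>) = exp 0" by simp
  then obtain n :: int where "2 * pi * \<i> * cross_index \<alpha> \<beta> = of_int (2 * n) * pi * \<i>"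
    unfolding exp_eq by auto
  then have "cross_index \<alpha> \<beta> = of_int n" by simp
  then show ?thesis by simp
qed

section \<open>Logarithms of secant quotients of orientation-preserving maps\<close>

lemma winding_secant_minus_1:
  fixes f :: "complex \<Rightarrow> complex"
  assumes "0 < r" "continuous_on (cball 0 r) f" "inj_on f (cball 0 r)"
    and "winding_number (\<lambda>x. f (circlepath 0 r x)) (f 0) = 1"
  obtains k where "continuous_on (cball 0 r - {0}) k"
    "\<And>z. z \<in> cball 0 r - {0} \<Longrightarrow> f z - f 0 = z * exp (k z)"
proof -
  \<comment> \<open>\<open>H\<close> covers the punctured disk by \<open>exp\<close>. On it
    \<open>f - f 0\<close> has a logarithm \<open>l\<close>; winding number 1 says that
    \<open>l\<close> grows by \<open>2 * pi * \<i>\<close> per period, exactly like the identity, so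
    that \<open>l w - w\<close> descends to the punctured disk.\<close>
  define H where "H = {w::complex. Re w \<le> ln r}"
  have H: "exp w \<in> cball 0 r - {0}" if "w \<in> H" for w
  proof -
    have "exp (Re w) \<le> exp (ln r)" using that unfolding H_def by simp
    then show ?thesis using assms(1) by simp
  qed
  have "convex H" unfolding H_def by (rule convex_halfspace_Re_le)
  have "continuous_on H (\<lambda>w. f (exp w) - f 0)"
  proof (intro continuous_on_diff continuous_on_const)
    show "continuous_on H (\<lambda>w. f (exp w))"
      by (rule continuous_on_compose2[OF assms(2)]) (use H in \<open>auto intro: continuous_on_exp continuous_on_id\<close>)
  qed
  moreover have "f (exp w) - f 0 \<noteq> 0" if "w \<in> H" for w
    using inj_onD[OF assms(3), of "exp w" 0] H[OF that] assms(1) by auto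
  ultimately obtain l where l: "continuous_on H l" "\<And>w. w \<in> H \<Longrightarrow> f (exp w) - f 0 = exp (l w)"
    using continuous_logarithm_on_contractible[of H "\<lambda>w. f (exp w) - f 0"]
      convex_imp_contractible[OF \<open>convex H\<close>] by blast
  let ?p = "2 * of_real pi * \<i> :: complex"
  have shift: "w + ?p \<in> H" "w - ?p \<in> H" if "w \<in> H" for w
    using that by (auto simp: H_def)
  have period: "l (w + ?p) - l w = ?p" if "w \<in> H" for w
  proof -
    let ?w0 = "of_real (ln r) :: complex"
    have "?w0 \<in> H" by (simp add: H_def)
    have "l (w + ?p) - l w = l (?w0 + ?p) - l ?w0"
    proof (rule exp_eq_const_imp_const[of H "\<lambda>w. l (w + ?p) - l w" 1])
      show "connected H" using \<open>convex H\<close> by (rule convex_connected)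
      show "continuous_on H (\<lambda>w. l (w + ?p) - l w)"
      proof (intro continuous_on_diff l(1))
        show "continuous_on H (\<lambda>w. l (w + ?p))"
          by (rule continuous_on_compose2[OF l(1)])
            (use shift in \<open>auto intro!: continuous_on_add continuous_on_id continuous_on_const\<close>)
      qed
      fix w assume "w \<in> H"
      then show "exp (l (w + ?p) - l w) = 1"
        using l(2)[of w] l(2)[of "w + ?p"] shift by (simp add: exp_diff exp_add)
    qed (use that \<open>?w0 \<in> H\<close> in auto)
    also have "\<dots> = ?p"
    proof -
      have "winding_number (\<lambda>x. f (circlepath 0 r x)) (f 0)
        = (l (?w0 + of_real 1 * ?p) - l (?w0 + of_real 0 * ?p)) / ?p"
      proof (rule winding_number_exp_log[OF l(1), of "\<lambda>t. ?w0 + of_real t * ?p"])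
        show "continuous_on {0..1} (\<lambda>t::real. ?w0 + of_real t * ?p)"
          by (intro continuous_on_add continuous_on_mult continuous_on_const continuous_on_of_real continuous_on_id)
        fix t :: real assume "t \<in> {0..1}"
        have "?w0 + of_real t * ?p \<in> H" by (simp add: H_def)
        then show "f (circlepath 0 r t) - f 0 = exp (l (?w0 + of_real t * ?p))"
          using assms(1) by (simp add: l(2)[symmetric] circlepath exp_add exp_of_real mult_ac)
      qed (auto simp: H_def)
      then show ?thesis using assms(4) by (simp add: field_simps)
    qed
    finally show ?thesis .
  qed
  define k where "k z = l (Ln z) - Ln z" for z
  have kp: "l (w + ?p) - (w + ?p) = l w - w" if "w \<in> H" for w
    using period[OF that] by (simp add: algebra_simps)
  have LnH: "Ln z \<in> H" if "z \<in> cball 0 r - {0}" for z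
    using that assms(1) by (simp add: H_def)
  have LnH': "Ln (- z) + \<i> * of_real pi \<in> H" if "z \<in> cball 0 r - {0}" for z
    using that assms(1) by (simp add: H_def)
  \<comment> \<open>\<open>Ln\<close> is discontinuous at the negative axis. The second branch is
    continuous off the positive axis and gives the same value by periodicity of
    \<open>l w - w\<close>, so the two branches together show continuity everywhere.\<close>
  have k2: "k z = l (Ln (- z) + \<i> * of_real pi) - (Ln (- z) + \<i> * of_real pi)"
    if "z \<in> cball 0 r - {0}" for z
  proof (cases "Ln (- z) + \<i> * of_real pi = Ln z")
    case False
    then have "Ln (- z) + \<i> * of_real pi = Ln z + ?p"
      using Ln_minus[of z] that by (auto split: if_splits simp: algebra_simps)
    then show ?thesis using kp[OF LnH[OF that]] by (simp only: k_def)
  qed (simp add: k_def)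
  let ?D = "cball 0 r - {0} :: complex set"
  have c1: "continuous_on (?D - \<real>\<^sub>\<le>\<^sub>0) k"
    unfolding k_def
  proof (intro continuous_on_diff)
    show c: "continuous_on (?D - \<real>\<^sub>\<le>\<^sub>0) Ln" by (intro continuous_on_Ln') (auto intro: continuous_intros)
    show "continuous_on (?D - \<real>\<^sub>\<le>\<^sub>0) (\<lambda>z. l (Ln z))"
      by (rule continuous_on_compose2[OF l(1) c]) (use LnH in blast)
  qed
  have c2: "continuous_on (?D - \<real>\<^sub>\<ge>\<^sub>0) k"
  proof (rule continuous_on_eq)
    have c: "continuous_on (?D - \<real>\<^sub>\<ge>\<^sub>0) (\<lambda>z. Ln (- z) + \<i> * of_real pi)"
      by (intro continuous_on_add continuous_on_Ln' continuous_on_const continuous_on_minus continuous_on_id)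
        (auto simp: complex_nonpos_Reals_iff complex_nonneg_Reals_iff)
    show "continuous_on (?D - \<real>\<^sub>\<ge>\<^sub>0) (\<lambda>z. l (Ln (- z) + \<i> * of_real pi) - (Ln (- z) + \<i> * of_real pi))"
      by (intro continuous_on_diff c, rule continuous_on_compose2[OF l(1) c]) (use LnH' in blast)
  qed (use k2 in auto)
  show ?thesis
  proof
    show "continuous_on ?D k"
    proof -
      have "?D = (?D - \<real>\<^sub>\<le>\<^sub>0) \<union> (?D - \<real>\<^sub>\<ge>\<^sub>0)"
        by (auto simp: complex_nonpos_Reals_iff complex_nonneg_Reals_iff complex_eq_iff)
      moreover have "openin (top_of_set ?D) (?D - \<real>\<^sub>\<le>\<^sub>0)" "openin (top_of_set ?D) (?D - \<real>\<^sub>\<ge>\<^sub>0)"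
        by (simp_all add: Diff_eq openin_open_Int open_Compl)
      ultimately show ?thesis
        using continuous_on_Un_local_open[of "?D - \<real>\<^sub>\<le>\<^sub>0" "?D - \<real>\<^sub>\<ge>\<^sub>0" k] c1 c2 by metis
    qed
    fix z :: complex assume z: "z \<in> ?D"
    then have "f (exp (Ln z)) - f 0 = exp (l (Ln z))" using l(2) LnH by blast
    then show "f z - f 0 = z * exp (k z)"
      using z by (simp add: k_def exp_diff)
  qed
qed

lemma homotopic_canonI:
  fixes f :: "'a::topological_space \<Rightarrow> 'b::topological_space" and h :: "real \<Rightarrow> 'a \<Rightarrow> 'b"
  assumes "continuous_on ({0..1} \<times> S) (\<lambda>(t, x). h t x)"
    and "\<And>t x. t \<in> {0..1} \<Longrightarrow> x \<in> S \<Longrightarrow> h t x \<in> T"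
    and "\<And>x. x \<in> S \<Longrightarrow> h 0 x = f x" "\<And>x. x \<in> S \<Longrightarrow> h 1 x = f' x"
  shows "homotopic_with_canon (\<lambda>_. True) S T f f'"
proof -
  have "continuous_map (prod_topology (top_of_set {0..1}) (top_of_set S)) (top_of_set T) (\<lambda>(t, x). h t x)"
    using assms(1,2) by auto
  with assms(3,4) have "\<exists>k. continuous_map (prod_topology (top_of_set {0..1::real}) (top_of_set S)) (top_of_set T) k \<and>
    (\<forall>x\<in>topspace (top_of_set S). k (0, x) = f x) \<and> (\<forall>x\<in>topspace (top_of_set S). k (1, x) = f' x) \<and>
    (\<forall>t\<in>{0..1}. True)"
    by - (rule exI[of _ "\<lambda>(t, x). h t x"], simp)
  then show ?thesis by (subst homotopic_with) simp_all
qed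

text \<open>A map into the punctured plane has a logarithm iff it is null-homotopic. A homotopy
  through pairs of distinct points moves the second point to 0 and then shrinks the first into a
  small disk, where the winding hypothesis supplies a logarithm.\<close>

lemma secant_ratio_log:
  fixes f :: "complex \<Rightarrow> complex"
  assumes "convex P" "\<And>z. z \<in> P \<Longrightarrow> - z \<in> P" "P \<subseteq> cball 0 R" "0 < r" "cball 0 r \<subseteq> P"
    and "continuous_on P f" "inj_on f P"
    and "winding_number (\<lambda>x. f (circlepath 0 r x)) (f 0) = 1"
  obtains k where "continuous_on {(x, y). x \<in> P \<and> y \<in> P \<and> x \<noteq> y} k"
    "\<And>x y. x \<in> P \<Longrightarrow> y \<in> P \<Longrightarrow> x \<noteq> y \<Longrightarrow> f x - f y = (x - y) * exp (k (x, y))"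
proof -
  let ?C = "{(x, y). x \<in> P \<and> y \<in> P \<and> x \<noteq> y}"
  define F where "F = (\<lambda>(x, y). (f x - f y) / (x - y))"
  have contF: "continuous_on ?C F"
  proof -
    have "continuous_on ?C (\<lambda>p. f (fst p))" "continuous_on ?C (\<lambda>p. f (snd p))"
      by (rule continuous_on_compose2[OF assms(6)]; auto intro: continuous_on_fst continuous_on_snd continuous_on_id)+
    then have "continuous_on ?C (\<lambda>p. (f (fst p) - f (snd p)) / (fst p - snd p))"
      by (intro continuous_on_divide continuous_on_diff continuous_on_fst continuous_on_snd continuous_on_id) auto
    then show ?thesis by (simp add: F_def case_prod_beta)
  qed
  have nzF: "F p \<noteq> 0" if "p \<in> ?C" for p
    using that inj_onD[OF assms(7)] by (auto simp: F_def)
  have "0 \<in> P" using assms(4,5) by auto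
  have "0 < R"
  proof -
    have "of_real r \<in> P" using assms(4,5) by (auto intro!: subsetD[OF assms(5)])
    then have "norm (of_real r :: complex) \<le> R" using assms(3) by auto
    then show ?thesis using assms(4) by simp
  qed
  have rR: "r \<le> R"
  proof -
    have "of_real r \<in> P" using assms(4,5) by (auto intro!: subsetD[OF assms(5)])
    then have "norm (of_real r :: complex) \<le> R" using assms(3) by auto
    then show ?thesis using assms(4) by simp
  qed
  have comb: "u *\<^sub>R x + v *\<^sub>R y \<in> P" if "x \<in> P" "y \<in> P" "0 \<le> u" "0 \<le> v" "u + v = 1" for x y u v
    using that assms(1) unfolding convex_def by blast
  \<comment> \<open>Both points are averaged with \<open>- y\<close>, which lies in \<open>P\<close>
    by symmetry. Their difference is only scaled by \<open>1 / (1 + t)\<close>, so they stay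
    distinct; at time 1 the second point is 0 and the first is half of \<open>x - y\<close>.\<close>
  define h1 where "h1 = (\<lambda>(t::real) (x::complex, y::complex).
     ((1 / (1 + t)) *\<^sub>R x + (t / (1 + t)) *\<^sub>R (- y), (1 / (1 + t)) *\<^sub>R y + (t / (1 + t)) *\<^sub>R (- y)))"
  have h1C: "h1 t p \<in> ?C" if "t \<in> {0..1}" "p \<in> ?C" for t p
  proof -
    obtain x y where p: "p = (x, y)" by force
    have t: "0 \<le> t" and xy: "x \<in> P" "y \<in> P" "- y \<in> P" "x \<noteq> y" using that p assms(2) by auto
    then have c: "1 / (1 + t) + t / (1 + t) = 1" "0 \<le> 1 / (1 + t)" "0 \<le> t / (1 + t)" "1 / (1 + t) \<noteq> 0"
      by (simp_all add: add_divide_distrib[symmetric])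
    show ?thesis using xy c comb[OF xy(1,3) c(2,3,1)] comb[OF xy(2,3) c(2,3,1)]
      by (simp add: h1_def p)
  qed
  have ch1: "continuous_on ({0..1} \<times> ?C) (\<lambda>(t, p). h1 t p)"
    unfolding h1_def case_prod_beta
    by (intro continuous_on_Pair continuous_on_add continuous_on_scaleR continuous_on_divide
        continuous_on_minus continuous_on_const continuous_on_fst continuous_on_snd continuous_on_id) auto
  have hom1: "homotopic_with_canon (\<lambda>_. True) ?C (- {0}) F (\<lambda>p. F (h1 1 p))"
  proof (rule homotopic_canonI[where h = "\<lambda>t p. F (h1 t p)"])
    show "continuous_on ({0..1} \<times> ?C) (\<lambda>(t, p). F (h1 t p))"
      using continuous_on_compose2[OF contF ch1] h1C by (simp add: case_prod_beta image_subset_iff del: split_paired_All)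
  qed (use nzF h1C in \<open>auto simp: h1_def\<close>)
  \<comment> \<open>The factor \<open>r / R\<close> carries \<open>P\<close>, which is contained in
    the ball of radius \<open>R\<close>, into the ball of radius \<open>r\<close>.\<close>
  define h2 where "h2 = (\<lambda>(t::real) (x::complex, y::complex).
     ((1 - t + t * (r / R)) *\<^sub>R ((1/2) *\<^sub>R x + (1/2) *\<^sub>R (- y)), 0::complex))"
  have h2C: "h2 t p \<in> ?C" if "t \<in> {0..1}" "p \<in> ?C" for t p
  proof -
    obtain x y where p: "p = (x, y)" by force
    define z where "z = (1/2) *\<^sub>R x + (1/2) *\<^sub>R (- y)"
    define c where "c = 1 - t + t * (r / R)"
    have "z \<in> P" "z \<noteq> 0" using comb[of x "- y" "1/2" "1/2"] that p assms(2) by (auto simp: z_def complex_eq_iff)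
    have q: "0 < r / R" "r / R \<le> 1" using \<open>0 < R\<close> rR assms(4) by auto
    have "c \<le> 1 - t + t" unfolding c_def using q that
      using mult_left_le[of "r / R" t] by auto
    then have "c \<le> 1" by simp
    have "0 < c"
    proof (cases "t = 1")
      case False
      then have "0 < 1 - t" "0 \<le> t" using that by auto
      then show ?thesis unfolding c_def using q(1) by (intro add_pos_nonneg mult_nonneg_nonneg) auto
    qed (use q in \<open>simp add: c_def\<close>)
    have "c *\<^sub>R z \<in> P" using comb[of z 0 c "1 - c"] \<open>z \<in> P\<close> \<open>0 \<in> P\<close> \<open>c \<le> 1\<close> \<open>0 < c\<close> by simp
    moreover have "h2 t p = (c *\<^sub>R z, 0)" by (simp only: h2_def p case_prod_conv z_def c_def)
    ultimately show ?thesis using \<open>z \<noteq> 0\<close> \<open>0 < c\<close> \<open>0 \<in> P\<close> by simp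
  qed
  have ch2: "continuous_on ({0..1} \<times> ?C) (\<lambda>(t, p). h2 t p)"
    unfolding h2_def case_prod_beta using \<open>0 < R\<close>
    by (intro continuous_on_Pair continuous_on_add continuous_on_scaleR continuous_on_mult continuous_on_diff
        continuous_on_minus continuous_on_const continuous_on_fst continuous_on_snd continuous_on_id)
  have hom2: "homotopic_with_canon (\<lambda>_. True) ?C (- {0}) (\<lambda>p. F (h1 1 p)) (\<lambda>p. F (h2 1 p))"
  proof (rule homotopic_canonI[where h = "\<lambda>t p. F (h2 t p)"])
    show "continuous_on ({0..1} \<times> ?C) (\<lambda>(t, p). F (h2 t p))"
      using continuous_on_compose2[OF contF ch2] h2C by (simp add: case_prod_beta image_subset_iff del: split_paired_All)
  qed (use nzF h2C in \<open>auto simp: h1_def h2_def\<close>)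
  obtain k where k: "continuous_on (cball 0 r - {0}) k"
    "\<And>z. z \<in> cball 0 r - {0} \<Longrightarrow> f z - f 0 = z * exp (k z)"
  proof (rule winding_secant_minus_1[OF assms(4) _ _ assms(8)])
    show "continuous_on (cball 0 r) f" "inj_on f (cball 0 r)"
      using assms(5,6,7) continuous_on_subset inj_on_subset by blast+
  qed blast
  have small: "fst (h2 1 p) \<in> cball 0 r - {0}" "snd (h2 1 p) = 0" if "p \<in> ?C" for p
  proof -
    obtain x y where p: "p = (x, y)" by force
    define z where "z = (1/2) *\<^sub>R x + (1/2) *\<^sub>R (- y)"
    have "z \<in> P" "z \<noteq> 0" using comb[of x "- y" "1/2" "1/2"] that p assms(2) by (auto simp: z_def complex_eq_iff)
    then have "norm z \<le> R" using assms(3) by auto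
    then have "norm ((r / R) *\<^sub>R z) \<le> r" using assms(4) \<open>0 < R\<close> by (simp add: field_simps)
    moreover have "h2 1 p = ((r / R) *\<^sub>R z, 0)" by (simp add: h2_def p z_def)
    ultimately show "fst (h2 1 p) \<in> cball 0 r - {0}" "snd (h2 1 p) = 0"
      using \<open>z \<noteq> 0\<close> \<open>0 < R\<close> assms(4) by simp_all
  qed
  have "\<exists>g. continuous_on ?C g \<and> (\<forall>x\<in>?C. F (h2 1 x) = exp (g x))"
  proof (intro exI[of _ "\<lambda>p. k (fst (h2 1 p))"] conjI ballI)
    have "continuous_on ?C (\<lambda>p. fst (h2 1 p))"
      unfolding h2_def case_prod_beta fst_conv
      by (intro continuous_on_add continuous_on_scaleR continuous_on_minus continuous_on_const
         continuous_on_fst continuous_on_snd continuous_on_id)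
    then show "continuous_on ?C (\<lambda>p. k (fst (h2 1 p)))"
      by (rule continuous_on_compose2[OF k(1)]) (use small in auto)
    fix p assume p: "p \<in> ?C"
    have "F (h2 1 p) = (f (fst (h2 1 p)) - f 0) / fst (h2 1 p)"
      using small(2)[OF p] by (simp add: F_def case_prod_beta)
    then show "F (h2 1 p) = exp (k (fst (h2 1 p)))"
      using k(2)[OF small(1)[OF p]] small(1)[OF p] by simp
  qed
  then obtain a where "homotopic_with_canon (\<lambda>_. True) ?C (- {0}) (\<lambda>p. F (h2 1 p)) (\<lambda>_. a)"
    using inessential_eq_continuous_logarithm[of ?C "\<lambda>p. F (h2 1 p)"] by blast
  then have "homotopic_with_canon (\<lambda>_. True) ?C (- {0}) F (\<lambda>_. a)"
    using hom1 hom2 homotopic_with_trans by blast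
  then obtain g where g: "continuous_on ?C g" "\<forall>x\<in>?C. F x = exp (g x)"
    using inessential_eq_continuous_logarithm[of ?C F] by blast
  show ?thesis
  proof
    fix x y assume "x \<in> P" "y \<in> P" "x \<noteq> y"
    then have "F (x, y) = exp (g (x, y))" using g(2) by blast
    then show "f x - f y = (x - y) * exp (g (x, y))"
      using \<open>x \<noteq> y\<close> by (simp add: F_def field_simps)
  qed (rule g(1))
qed

text \<open>The intersection number of paths in \<open>P\<close> is invariant because the secant quotient
  has a logarithm on the whole configuration space of \<open>P\<close>.\<close>

lemma cross_index_image:
  fixes f :: "complex \<Rightarrow> complex"
  assumes "convex P" "\<And>z. z \<in> P \<Longrightarrow> - z \<in> P" "P \<subseteq> cball 0 R" "0 < r" "cball 0 r \<subseteq> P"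
    and "continuous_on P f" "inj_on f P"
    and "winding_number (\<lambda>x. f (circlepath 0 r x)) (f 0) = 1"
    and paths: "path \<alpha>" "path \<beta>" "path_image \<alpha> \<subseteq> P" "path_image \<beta> \<subseteq> P"
    and ends: "\<alpha> 0 \<notin> path_image \<beta>" "\<alpha> 1 \<notin> path_image \<beta>" "\<beta> 0 \<notin> path_image \<alpha>" "\<beta> 1 \<notin> path_image \<alpha>"
  shows "cross_index (f \<circ> \<alpha>) (f \<circ> \<beta>) = cross_index \<alpha> \<beta>"
proof -
  let ?p = "2 * of_real pi * \<i> :: complex"
  obtain k where k: "continuous_on {(x, y). x \<in> P \<and> y \<in> P \<and> x \<noteq> y} k"
    "\<And>x y. x \<in> P \<Longrightarrow> y \<in> P \<Longrightarrow> x \<noteq> y \<Longrightarrow> f x - f y = (x - y) * exp (k (x, y))"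
    using secant_ratio_log[OF assms(1-8)] by blast
  have log: "\<exists>q. continuous_on {0..1} q \<and> q 1 - q 0 = ?p * winding_number \<gamma> a \<and>
      (\<forall>t\<in>{0..1}. \<gamma> t = a + exp (q t))" if "path \<gamma>" "a \<notin> path_image \<gamma>" for \<gamma> a
  proof -
    note g = that
    obtain q where "path q" "pathfinish q - pathstart q = 2 * of_real pi * \<i> * winding_number \<gamma> a"
      "\<And>t. t \<in> {0..1} \<Longrightarrow> \<gamma> t = a + exp (q t)"
      using winding_number_as_continuous_log[OF g] by blast
    then show ?thesis unfolding path_def pathfinish_def pathstart_def by blast
  qed
  \<comment> \<open>\<open>k\<close> is not known to be symmetric, so the moving point comes first
    in one formula and second in the other. Then every correction term has the form \<open>k\<close>
    (point of \<open>\<beta>\<close>, point of \<open>\<alpha>\<close>), and these cancel in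
    \<open>cross_index\<close>.\<close>
  have w1: "winding_number (f \<circ> \<gamma>) (f a) = winding_number \<gamma> a + (k (\<gamma> 1, a) - k (\<gamma> 0, a)) / ?p"
    and w2: "winding_number (f \<circ> \<gamma>) (f a) = winding_number \<gamma> a + (k (a, \<gamma> 1) - k (a, \<gamma> 0)) / ?p"
    if g: "path \<gamma>" "path_image \<gamma> \<subseteq> P" "a \<in> P" "a \<notin> path_image \<gamma>" for \<gamma> a
  proof -
    obtain q where q: "continuous_on {0..1} q" "q 1 - q 0 = ?p * winding_number \<gamma> a"
      "\<And>t. t \<in> {0..1} \<Longrightarrow> \<gamma> t = a + exp (q t)"
      using log[OF g(1,4)] by blast
    have cg: "continuous_on {0..1} \<gamma>" using g(1) by (simp add: path_def)
    have gP: "\<gamma> t \<in> P" "\<gamma> t \<noteq> a" if "t \<in> {0..1}" for t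
      using g that by (auto simp: path_image_def)
    have "continuous_on {0..1} (\<lambda>t. k (\<gamma> t, a))" "continuous_on {0..1} (\<lambda>t. k (a, \<gamma> t))"
      by (rule continuous_on_compose2[OF k(1)];
          use gP g(3) in \<open>force intro: continuous_on_Pair cg continuous_on_const\<close>)+
    then have c: "continuous_on {0..1} (\<lambda>t. q t + k (\<gamma> t, a))" "continuous_on {0..1} (\<lambda>t. q t + k (a, \<gamma> t))"
      using q(1) continuous_on_add by blast+
    have "winding_number (f \<circ> \<gamma>) (f a) = ((q 1 + k (\<gamma> 1, a)) - (q 0 + k (\<gamma> 0, a))) / ?p"
    proof (rule winding_number_exp_log[OF c(1), of "\<lambda>t. t"])
      fix t :: real assume t: "t \<in> {0..1}"
      show "(f \<circ> \<gamma>) t - f a = exp (q t + k (\<gamma> t, a))"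
        using k(2)[OF gP(1)[OF t] g(3) gP(2)[OF t]] q(3)[OF t] by (simp add: exp_add)
    qed (auto intro: continuous_on_id)
    then show "winding_number (f \<circ> \<gamma>) (f a) = winding_number \<gamma> a + (k (\<gamma> 1, a) - k (\<gamma> 0, a)) / ?p"
      using q(2) by (simp add: field_simps)
    have "winding_number (f \<circ> \<gamma>) (f a) = ((q 1 + k (a, \<gamma> 1)) - (q 0 + k (a, \<gamma> 0))) / ?p"
    proof (rule winding_number_exp_log[OF c(2), of "\<lambda>t. t"])
      fix t :: real assume t: "t \<in> {0..1}"
      have "f (\<gamma> t) - f a = - (f a - f (\<gamma> t))" by simp
      also have "\<dots> = (\<gamma> t - a) * exp (k (a, \<gamma> t))"
        using k(2)[OF g(3) gP(1)[OF t]] gP(2)[OF t] by (simp add: algebra_simps)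
      finally show "(f \<circ> \<gamma>) t - f a = exp (q t + k (a, \<gamma> t))"
        using q(3)[OF t] by (simp add: exp_add)
    qed (auto intro: continuous_on_id)
    then show "winding_number (f \<circ> \<gamma>) (f a) = winding_number \<gamma> a + (k (a, \<gamma> 1) - k (a, \<gamma> 0)) / ?p"
      using q(2) by (simp add: field_simps)
  qed
  have "\<alpha> 0 \<in> P" "\<alpha> 1 \<in> P" "\<beta> 0 \<in> P" "\<beta> 1 \<in> P"
    using paths by (auto simp: path_image_def)
  then show ?thesis
    by (simp add: cross_index_def w1[OF paths(2,4) _ ends(1)] w1[OF paths(2,4) _ ends(2)]
      w2[OF paths(1,3) _ ends(3)] w2[OF paths(1,3) _ ends(4)] diff_divide_distrib)
qed

section \<open>The crossing index of two wedges with a common apex\<close>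

lemma winding_number_linepath_Ln:
  assumes "z \<notin> closed_segment a b"
  shows "winding_number (linepath a b) z = Ln ((b - z) / (a - z)) / (2 * of_real pi * \<i>)"
proof -
  have az: "a \<noteq> z" using assms by auto
  \<comment> \<open>Seen from a point off the segment, the segment spans less than a half-turn, so
    the quotient stays off the cut and the principal logarithm is continuous along the path.\<close>
  have ns: "(linepath a b t - z) / (a - z) \<notin> \<real>\<^sub>\<le>\<^sub>0" if "t \<in> {0..1}" for t
  proof
    assume "(linepath a b t - z) / (a - z) \<in> \<real>\<^sub>\<le>\<^sub>0"
    then obtain r where r: "r \<le> 0" "(linepath a b t - z) / (a - z) = of_real r"
      by (auto elim: nonpos_Reals_cases)
    then have e: "linepath a b t - z = of_real r * (a - z)" using az by (simp add: field_simps)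
    \<comment> \<open>A nonpositive ratio \<open>r\<close> puts \<open>z\<close> between
      \<open>a\<close> and the current point; \<open>w\<close> is the barycentric weight of the
      latter.\<close>
    define w where "w = 1 / (1 - r)"
    have w: "0 \<le> w" "w \<le> 1" "w * (1 - r) = 1" using r(1) by (simp_all add: w_def)
    then have wc: "of_real w * (1 - of_real r) = (1::complex)"
      by (metis of_real_1 of_real_diff of_real_mult)
    have "z = of_real w * (linepath a b t) - of_real w * of_real r * a"
    proof -
      have "linepath a b t - of_real r * a = z * (1 - of_real r)" using e by (simp add: algebra_simps)
      then have "of_real w * (linepath a b t - of_real r * a) = z * (of_real w * (1 - of_real r))" by simp
      then show ?thesis unfolding wc by (simp add: algebra_simps)
    qed
    also have "\<dots> = linepath a b (w * t)"
    proof -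
      have "of_real w * of_real r = (of_real w - 1 :: complex)" using wc by (simp add: algebra_simps)
      then have "a * (of_real w * of_real r) = a * (of_real w - 1)" by simp
      then have "a + a * (of_real r * of_real w) = a * of_real w" by (simp add: algebra_simps)
      then show ?thesis by (simp add: linepath_def scaleR_conv_of_real algebra_simps)
    qed
    finally have "z = linepath a b (w * t)" .
    moreover have "w * t \<in> {0..1}" using w that by (simp add: mult_le_one)
    ultimately show False using assms by (metis imageI path_image_def path_image_linepath)
  qed
  have "winding_number (linepath a b) z =
     ((Ln ((linepath a b 1 - z) / (a - z)) + Ln (a - z)) - (Ln ((linepath a b 0 - z) / (a - z)) + Ln (a - z)))
       / (2 * of_real pi * \<i>)"
  proof (rule winding_number_exp_log[of "{0..1}" _ "\<lambda>t. t"])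
    show "continuous_on {0..1} (\<lambda>t. Ln ((linepath a b t - z) / (a - z)) + Ln (a - z))"
      using ns az by (intro continuous_on_add continuous_on_Ln' continuous_on_divide continuous_on_diff
        continuous_on_linepath continuous_on_const) auto
    fix t :: real assume t: "t \<in> {0..1}"
    have "(linepath a b t - z) / (a - z) \<noteq> 0" using ns[OF t] by (metis nonpos_Reals_zero_I)
    then show "linepath a b t - z = exp (Ln ((linepath a b t - z) / (a - z)) + Ln (a - z))"
      using az by (simp add: exp_add)
  qed (auto intro: continuous_on_id)
  then show ?thesis using az by (simp add: linepath_def)
qed

lemma Arg_minus_Arg2pi:
  assumes "z \<notin> \<real>\<^sub>\<ge>\<^sub>0"
  shows "Arg (- z) = Arg2pi z - pi"
proof (rule Arg_unique'[of "norm z"])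
  have "z \<noteq> 0" using assms by auto
  then show "0 < norm z" by simp
  have "Arg2pi z \<noteq> 0" using assms Arg2pi_eq_0[of z] by (auto simp: complex_nonneg_Reals_iff complex_is_Real_iff)
  then show "Arg2pi z - pi \<in> {-pi<..pi}" using Arg2pi[of z] by auto
  have "rcis (norm z) (Arg2pi z - pi) = - (of_real (norm z) * cis (Arg2pi z))"
    by (simp add: rcis_def complex_eq_iff cos_diff sin_diff)
  also have "of_real (norm z) * cis (Arg2pi z) = z" using Arg2pi_eq[of z] by (simp add: cis_conv_exp)
  finally show "- z = rcis (norm z) (Arg2pi z - pi)" by simp
qed

text \<open>The quotient of the two numbers on the left is the number on the right, so the identity
  holds modulo \<open>2 * pi\<close>. Relative to \<open>u / v\<close>, the first has an imaginary
  part of opposite sign and the second one of equal sign, which leaves only the multiple 0.\<close>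

lemma Arg_secant_quotient:
  assumes "u \<noteq> 0" "v \<noteq> 0" "u / v \<notin> \<real>\<^sub>\<ge>\<^sub>0"
  shows "Arg (u / (u - v)) - Arg (v / (v - u)) = Arg (- (u / v))"
proof -
  define w where "w = u / v"
  have uv: "u - v \<noteq> 0" "v - u \<noteq> 0" using assms by auto
  have "w \<noteq> 1" "w \<noteq> 0" using assms by (auto simp: w_def)
  have x: "u / (u - v) = 1 + 1 / (w - 1)" and y: "v / (v - u) = 1 / (1 - w)"
    using assms uv by (simp_all add: w_def field_simps)
  let ?x = "1 + 1 / (w - 1)" and ?y = "1 / (1 - w)"
  have quot: "?x = - w * ?y" using \<open>w \<noteq> 1\<close> by (simp add: field_simps)
  have nz: "?x \<noteq> 0" "?y \<noteq> 0" using quot \<open>w \<noteq> 1\<close> \<open>w \<noteq> 0\<close> by auto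
  have Imx: "Im ?x = - Im w / (cmod (w - 1))\<^sup>2" by (simp add: Im_divide cmod_def power2_eq_square)
  have Imy: "Im ?y = Im w / (cmod (w - 1))\<^sup>2"
    by (simp add: Im_divide cmod_def power2_eq_square) (simp add: algebra_simps)
  have pos: "0 < (cmod (w - 1))\<^sup>2" using \<open>w \<noteq> 1\<close> by simp
  have key: "\<exists>n::int. Arg ?x - Arg ?y - Arg (- w) = 2 * pi * n"
  proof -
    have "exp (\<i> * of_real (Arg ?x - Arg ?y - Arg (- w))) = (?x / of_real (norm ?x)) / (?y / of_real (norm ?y)) / (- w / of_real (norm w))"
      using nz \<open>w \<noteq> 0\<close>  cis_Arg[of ?x] cis_Arg[of ?y] cis_Arg[of "- w"]
      by (simp add: exp_diff right_diff_distrib sgn_eq cis_conv_exp)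
    also have "\<dots> = of_real (norm ?y * norm w / norm ?x)"
      unfolding quot using nz \<open>w \<noteq> 0\<close> by (simp add: field_simps)
    also have "\<dots> = 1" unfolding quot norm_mult norm_minus_cancel using nz \<open>w \<noteq> 0\<close> by simp
    finally have "exp (\<i> * of_real (Arg ?x - Arg ?y - Arg (- w))) = 1" .
    then show ?thesis unfolding exp_eq_1 by (auto simp: mult_ac)
  qed
  then obtain n :: int where n: "Arg ?x - Arg ?y - Arg (- w) = 2 * pi * n" by blast
  have "Arg ?x - Arg ?y = Arg (- w)"
  proof (cases "Im w = 0")
    case True
    then have w: "w = of_real (Re w)" by (simp add: complex_eq_iff)
    have "Re w < 0" using assms(3) True by (auto simp: w_def[symmetric] complex_nonneg_Reals_iff)
    then have "0 \<le> - Re w" "0 \<le> 1 + 1 / (Re w - 1)" "0 \<le> 1 / (1 - Re w)"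
      by (auto simp: field_simps)
    then have "Arg (of_real (- Re w)) = 0" "Arg (of_real (1 + 1 / (Re w - 1))) = 0" "Arg (of_real (1 / (1 - Re w))) = 0"
      unfolding Arg_of_real by simp_all
    moreover have "?x = of_real (1 + 1 / (Re w - 1))" "?y = of_real (1 / (1 - Re w))" "- w = of_real (- Re w)"
      by (subst w, simp)+
    ultimately show ?thesis by simp
  next
    case False
    then have sgn: "0 < Im w \<and> Im ?x < 0 \<and> 0 < Im ?y \<or> Im w < 0 \<and> 0 < Im ?x \<and> Im ?y < 0"
      unfolding Imx Imy using pos by (auto simp: divide_simps)
    have b: "0 < Arg z \<and> Arg z < pi" if "0 < Im z" for z using Arg_lt_pi that by blast
    have b': "- pi < Arg z \<and> Arg z < 0" if "Im z < 0" for z using Arg_neg_iff Arg_bounded that by blast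
    have "\<bar>2 * pi * n\<bar> < 2 * pi"
      unfolding n[symmetric] using sgn b[of ?y] b'[of ?x] b'[of "- w"] b[of ?x] b'[of ?y] b[of "- w"] by fastforce
    then have "\<bar>real_of_int n\<bar> < 1" by (simp add: abs_mult)
    then have "n = 0" by linarith
    then show ?thesis using n by simp
  qed
  then show ?thesis by (simp add: x y w_def)
qed

text \<open>The winding along a wedge is a sum of two principal logarithms. The resulting eight
  angles fall into four pairs, one for each triangle spanned by \<open>o'\<close>, an end of the
  first wedge and an end of the second; \<open>Arg_secant_quotient\<close> expresses each pair by
  the angle at \<open>o'\<close>.\<close>

lemma cross_index_wedge_Arg:
  fixes o' :: complex
  assumes nz: "a \<noteq> o'" "b \<noteq> o'" "c \<noteq> o'" "d \<noteq> o'"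
    and rays: "(a - o') / (c - o') \<notin> \<real>\<^sub>\<ge>\<^sub>0" "(a - o') / (d - o') \<notin> \<real>\<^sub>\<ge>\<^sub>0"
      "(b - o') / (c - o') \<notin> \<real>\<^sub>\<ge>\<^sub>0" "(b - o') / (d - o') \<notin> \<real>\<^sub>\<ge>\<^sub>0"
  shows "2 * pi * Re (cross_index (linepath a o' +++ linepath o' b) (linepath c o' +++ linepath o' d)) =
     Arg (- ((a - o') / (c - o'))) - Arg (- ((a - o') / (d - o')))
     + Arg (- ((b - o') / (d - o'))) - Arg (- ((b - o') / (c - o')))"
    and "a \<notin> closed_segment c o' \<union> closed_segment o' d" "b \<notin> closed_segment c o' \<union> closed_segment o' d"
      "c \<notin> closed_segment a o' \<union> closed_segment o' b" "d \<notin> closed_segment a o' \<union> closed_segment o' b"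
proof -
  have inv: "(v - o') / (u - o') \<notin> \<real>\<^sub>\<ge>\<^sub>0" if "(u - o') / (v - o') \<notin> \<real>\<^sub>\<ge>\<^sub>0" for u v
  proof
    assume "(v - o') / (u - o') \<in> \<real>\<^sub>\<ge>\<^sub>0"
    then obtain r where "0 \<le> r" "(v - o') / (u - o') = of_real r" by (auto elim: nonneg_Reals_cases)
    then have "(u - o') / (v - o') = of_real (1 / r)" by (metis inverse_divide inverse_eq_divide of_real_inverse)
    then show False using that \<open>0 \<le> r\<close> by (simp add: nonneg_Reals_of_real_iff)
  qed
  have off: "u \<notin> closed_segment v o'" if "(u - o') / (v - o') \<notin> \<real>\<^sub>\<ge>\<^sub>0" "v \<noteq> o'" for u v
  proof
    assume "u \<in> closed_segment v o'"
    then obtain t where t: "0 \<le> t" "t \<le> 1" "u = (1 - t) *\<^sub>R v + t *\<^sub>R o'" by (auto simp: in_segment)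
    then have "u - o' = of_real (1 - t) * (v - o')" by (simp add: scaleR_conv_of_real algebra_simps)
    then have "(u - o') / (v - o') = of_real (1 - t)" using that(2) by simp
    then show False using that t by (metis diff_ge_0_iff_ge nonneg_Reals_of_real_iff)
  qed
  show A: "a \<notin> closed_segment c o' \<union> closed_segment o' d" "b \<notin> closed_segment c o' \<union> closed_segment o' d"
      "c \<notin> closed_segment a o' \<union> closed_segment o' b" "d \<notin> closed_segment a o' \<union> closed_segment o' b"
    using off inv rays nz by (auto simp: closed_segment_commute[of o'])
  have w: "winding_number (linepath u o' +++ linepath o' v) z =
      (Ln ((o' - z) / (u - z)) + Ln ((v - z) / (o' - z))) / (2 * of_real pi * \<i>)"
    if "z \<notin> closed_segment u o' \<union> closed_segment o' v" for u v z
    using that by (simp add: winding_number_join winding_number_linepath_Ln add_divide_distrib)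
  have ends: "(linepath u o' +++ linepath o' v) 0 = u" "(linepath u o' +++ linepath o' v) 1 = v" for u v
    by (simp_all add: joinpaths_def linepath_def)
  have R: "2 * pi * Re (z / (2 * of_real pi * \<i>)) = Im z" for z
    by (simp add: Re_divide power2_eq_square)
  have L: "Im (Ln z) = Arg z" if "z \<noteq> 0" for z using Arg_eq_Im_Ln that by simp
  have dist: "a \<noteq> c" "a \<noteq> d" "b \<noteq> c" "b \<noteq> d" using rays nz by auto
  have inv': "Arg ((v - u) / (v - o')) = - Arg ((v - o') / (v - u))"
    if "(u - o') / (v - o') \<notin> \<real>\<^sub>\<ge>\<^sub>0" "v \<noteq> o'" "u \<noteq> o'" for u v
  proof -
    let ?z = "(v - u) / (v - o')"
    have "u \<noteq> v" using that by auto
    have e: "?z = 1 - (u - o') / (v - o')" using that by (simp add: field_simps)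
    have "?z \<in> \<real> \<Longrightarrow> 0 \<le> Re ?z"
    proof -
      assume "?z \<in> \<real>"
      then have "(u - o') / (v - o') \<in> \<real>" using e by (metis Reals_1 Reals_diff diff_diff_eq2 add_diff_cancel_left')
      with that(1) have "Re ((u - o') / (v - o')) < 0"
        by (auto simp: complex_nonneg_Reals_iff complex_is_Real_iff)
      then show ?thesis unfolding e by simp
    qed
    then have "?z \<in> \<real> \<Longrightarrow> Arg ?z = 0" using \<open>u \<noteq> v\<close> that by (auto simp: Arg_eq_0)
    moreover have "Arg (inverse ?z) = (if ?z \<in> \<real> then Arg ?z else - Arg ?z)" by (rule Arg_inverse)
    ultimately have "Arg (inverse ?z) = - Arg ?z" by auto
    then show ?thesis by (simp add: inverse_divide)
  qed
  have quot: "(o' - z) / (u - z) = (z - o') / (z - u)" "(u - z) / (o' - z) = (z - u) / (z - o')" for u z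
    by (metis minus_diff_eq minus_divide_divide)+
  have sec: "Arg ((u - o') / (u - v)) - Arg ((v - o') / (v - u)) = Arg (- ((u - o') / (v - o')))"
    if "(u - o') / (v - o') \<notin> \<real>\<^sub>\<ge>\<^sub>0" "v \<noteq> o'" "u \<noteq> o'" for u v
    using Arg_secant_quotient[of "u - o'" "v - o'"] that by simp
  let ?\<alpha> = "linepath a o' +++ linepath o' b" and ?\<beta> = "linepath c o' +++ linepath o' d"
  have "2 * pi * Re (cross_index ?\<alpha> ?\<beta>) =
     2 * pi * Re (winding_number ?\<beta> a) + 2 * pi * Re (winding_number ?\<alpha> d)
     - 2 * pi * Re (winding_number ?\<beta> b) - 2 * pi * Re (winding_number ?\<alpha> c)"
    by (simp add: cross_index_def ends algebra_simps)
  also have "\<dots> = (Arg ((a - o') / (a - c)) + Arg ((a - d) / (a - o')))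
     + (Arg ((d - o') / (d - a)) + Arg ((d - b) / (d - o')))
     - (Arg ((b - o') / (b - c)) + Arg ((b - d) / (b - o')))
     - (Arg ((c - o') / (c - a)) + Arg ((c - b) / (c - o')))"
    using dist nz A by (simp only: w R plus_complex.sel quot L divide_eq_0_iff eq_iff_diff_eq_0[symmetric] simp_thms not_sym)
  also have "\<dots> = Arg (- ((a - o') / (c - o'))) - Arg (- ((a - o') / (d - o')))
     + Arg (- ((b - o') / (d - o'))) - Arg (- ((b - o') / (c - o')))"
    using inv'[OF inv[OF rays(2)] nz(1,4)] inv'[OF rays(4) nz(4,2)] inv'[OF inv[OF rays(4)] nz(2,4)]
      inv'[OF rays(3) nz(3,2)] sec[OF rays(1) nz(3,1)] sec[OF rays(2) nz(4,1)] sec[OF rays(4) nz(4,2)]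
      sec[OF rays(3) nz(3,2)] by linarith
  finally show "2 * pi * Re (cross_index ?\<alpha> ?\<beta>) = \<dots>" .
qed

lemma Arg2pi_divide:
  assumes "u \<noteq> 0" "v \<noteq> 0"
  shows "Arg2pi (u / v) = (if Arg2pi v \<le> Arg2pi u then Arg2pi u - Arg2pi v else Arg2pi u - Arg2pi v + 2 * pi)"
proof (rule Arg2pi_unique[of "norm u / norm v"])
  have "u = of_real (norm u) * exp (\<i> * of_real (Arg2pi u))" "v = of_real (norm v) * exp (\<i> * of_real (Arg2pi v))"
    using Arg2pi_eq by blast+
  then have "u / v = of_real (norm u / norm v) * exp (\<i> * of_real (Arg2pi u - Arg2pi v))"
    by (metis exp_diff of_real_diff of_real_divide right_diff_distrib times_divide_times_eq)
  moreover have "exp (\<i> * of_real (x + 2 * pi)) = exp (\<i> * of_real x)" for x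
    by (simp add: distrib_left exp_add mult_ac)
  then have "exp (\<i> * of_real (if P then x else x + 2 * pi)) = exp (\<i> * of_real x)" for P x
    by presburger
  ultimately show "of_real (norm u / norm v) *
    exp (\<i> * of_real (if Arg2pi v \<le> Arg2pi u then Arg2pi u - Arg2pi v else Arg2pi u - Arg2pi v + 2 * pi)) = u / v"
    by presburger
qed (use assms Arg2pi[of u] Arg2pi[of v] in auto)

text \<open>With all angles measured from the ray through \<open>a\<close>, the half-turns of
  \<open>Arg_minus_Arg2pi\<close> cancel and only wrap-arounds remain. The value is odd exactly if
  one of the rays through \<open>c\<close> and \<open>d\<close> lies in the sector from
  \<open>a\<close> to \<open>b\<close> and the other does not: the test for crossing chords.\<close>

theorem cross_index_wedge:
  fixes o' :: complex
  assumes nz: "a \<noteq> o'" "b \<noteq> o'" "c \<noteq> o'" "d \<noteq> o'"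
    and rays: "(a - o') / (c - o') \<notin> \<real>\<^sub>\<ge>\<^sub>0" "(a - o') / (d - o') \<notin> \<real>\<^sub>\<ge>\<^sub>0"
      "(b - o') / (c - o') \<notin> \<real>\<^sub>\<ge>\<^sub>0" "(b - o') / (d - o') \<notin> \<real>\<^sub>\<ge>\<^sub>0"
  shows "Re (cross_index (linepath a o' +++ linepath o' b) (linepath c o' +++ linepath o' d)) =
      of_bool (Arg2pi ((b - o') / (a - o')) < Arg2pi ((d - o') / (a - o')))
      - of_bool (Arg2pi ((b - o') / (a - o')) < Arg2pi ((c - o') / (a - o')))"
proof -
  have m: "Arg (- ((u - o') / (v - o'))) = Arg2pi (((u - o') / (a - o')) / ((v - o') / (a - o'))) - pi"
    if "(u - o') / (v - o') \<notin> \<real>\<^sub>\<ge>\<^sub>0" for u v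
    using Arg_minus_Arg2pi[OF that] nz by simp
  have a1: "Arg2pi ((a - o') / (a - o')) = 0" using nz Arg2pi_eq_0[of 1] by simp
  have q: "(u - o') / (a - o') \<noteq> 0" if "u \<noteq> o'" for u using that nz by simp
  have pos: "0 < Arg2pi ((c - o') / (a - o'))" "0 < Arg2pi ((d - o') / (a - o'))"
  proof -
    have "0 < Arg2pi ((u - o') / (a - o'))" if "u \<noteq> o'" "(a - o') / (u - o') \<notin> \<real>\<^sub>\<ge>\<^sub>0" for u
    proof (rule ccontr)
      assume "\<not> ?thesis"
      then have "Arg2pi ((u - o') / (a - o')) = 0" using Arg2pi[of "(u - o') / (a - o')"] by simp
      then have "(u - o') / (a - o') \<in> \<real>" "0 \<le> Re ((u - o') / (a - o'))" using Arg2pi_eq_0 by blast+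
      then obtain r where "0 \<le> r" "(u - o') / (a - o') = of_real r" by (auto elim!: Reals_cases)
      then have "(a - o') / (u - o') = of_real (1 / r)" by (metis inverse_divide inverse_eq_divide of_real_inverse)
      then show False using that(2) \<open>0 \<le> r\<close> by (simp add: nonneg_Reals_of_real_iff)
    qed
    then show "0 < Arg2pi ((c - o') / (a - o'))" "0 < Arg2pi ((d - o') / (a - o'))" using rays nz by auto
  qed
  have "2 * pi * Re (cross_index (linepath a o' +++ linepath o' b) (linepath c o' +++ linepath o' d)) =
    2 * pi * (of_bool (Arg2pi ((b - o') / (a - o')) < Arg2pi ((d - o') / (a - o')))
      - of_bool (Arg2pi ((b - o') / (a - o')) < Arg2pi ((c - o') / (a - o'))))"
    unfolding cross_index_wedge_Arg(1)[OF nz rays] m[OF rays(1)] m[OF rays(2)] m[OF rays(3)] m[OF rays(4)]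
      Arg2pi_divide[OF q[OF nz(1)] q[OF nz(3)]] Arg2pi_divide[OF q[OF nz(1)] q[OF nz(4)]]
      Arg2pi_divide[OF q[OF nz(2)] q[OF nz(3)]] Arg2pi_divide[OF q[OF nz(2)] q[OF nz(4)]] a1
    using pos by (auto simp: of_bool_def algebra_simps)
  then show ?thesis by simp
qed

section \<open>The turning of closed chains of arcs\<close>

definition nonadjacent_pairs :: "nat \<Rightarrow> (nat \<times> nat) set" where
  "nonadjacent_pairs N = {(i, j). i + 2 \<le> j \<and> j < N \<and> (i, j) \<noteq> (0, N - 1)}"

text \<open>Terms that telescope in \<open>i\<close> are summed by columns, those that telescope in
  \<open>j\<close> by rows. Leaving out the corner \<open>(0, N - 1)\<close> makes the last column
  exceptional here and the first row in the companion lemma.\<close>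

lemma sum_nonadjacent_by_column:
  fixes f :: "nat \<Rightarrow> nat \<Rightarrow> complex"
  assumes "3 \<le> N"
  shows "(\<Sum>(i, j)\<in>nonadjacent_pairs N. f i j) =
    (\<Sum>j\<in>{2..<N - 1}. \<Sum>i<j - 1. f i j) + (\<Sum>i\<in>{1..<N - 2}. f i (N - 1))"
proof -
  let ?A = "SIGMA j:{2..<N - 1}. {..<j - 1}" and ?B = "{1..<N - 2} \<times> {N - 1}"
  have e: "nonadjacent_pairs N = (\<lambda>(j, i). (i, j)) ` ?A \<union> ?B"
    using assms by (auto simp: nonadjacent_pairs_def image_iff)
  have d: "(\<lambda>(j, i). (i, j)) ` ?A \<inter> ?B = {}" by auto
  have "(\<Sum>(i, j)\<in>nonadjacent_pairs N. f i j) =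
     (\<Sum>(i, j)\<in>(\<lambda>(j, i). (i, j)) ` ?A. f i j) + (\<Sum>(i, j)\<in>?B. f i j)"
    unfolding e by (rule sum.union_disjoint) (use d in auto)
  also have "(\<Sum>(i, j)\<in>(\<lambda>(j, i). (i, j)) ` ?A. f i j) = (\<Sum>(j, i)\<in>?A. f i j)"
    by (subst sum.reindex) (auto simp: inj_on_def case_prod_beta)
  also have "\<dots> = (\<Sum>j\<in>{2..<N - 1}. \<Sum>i<j - 1. f i j)" by (rule sum.Sigma[symmetric]) auto
  also have "(\<Sum>(i, j)\<in>?B. f i j) = (\<Sum>i\<in>{1..<N - 2}. f i (N - 1))"
    by (subst sum.cartesian_product[symmetric]) simp
  finally show ?thesis .
qed

lemma sum_nonadjacent_by_row:
  fixes f :: "nat \<Rightarrow> nat \<Rightarrow> complex"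
  assumes "3 \<le> N"
  shows "(\<Sum>(i, j)\<in>nonadjacent_pairs N. f i j) =
    (\<Sum>i\<in>{1..<N - 2}. \<Sum>j\<in>{i + 2..<N}. f i j) + (\<Sum>j\<in>{2..<N - 1}. f 0 j)"
proof -
  let ?A = "SIGMA i:{1..<N - 2}. {i + 2..<N}" and ?B = "{0} \<times> {2..<N - 1}"
  have e: "nonadjacent_pairs N = ?A \<union> ?B"
    using assms by (auto simp: nonadjacent_pairs_def)
  have d: "?A \<inter> ?B = {}" by auto
  have "(\<Sum>(i, j)\<in>nonadjacent_pairs N. f i j) = (\<Sum>(i, j)\<in>?A. f i j) + (\<Sum>(i, j)\<in>?B. f i j)"
    unfolding e by (rule sum.union_disjoint) (use d in auto)
  also have "(\<Sum>(i, j)\<in>?A. f i j) = (\<Sum>i\<in>{1..<N - 2}. \<Sum>j\<in>{i + 2..<N}. f i j)"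
    by (rule sum.Sigma[symmetric]) auto
  also have "(\<Sum>(i, j)\<in>?B. f i j) = (\<Sum>j\<in>{2..<N - 1}. f 0 j)"
    by (subst sum.cartesian_product[symmetric]) simp
  finally show ?thesis .
qed

text \<open>\<open>A i j\<close> stands for the winding of the \<open>j\<close>-th arc of a closed curve around the \<open>i\<close>-th cut point.
  As in Hopf's proof of the Umlaufsatz, the sum of the defects over the triangle \<open>i < j\<close> telescopes to
  twice the winding along its legs, which is an odd multiple of a half-turn.\<close>

lemma hopf_sum:
  fixes A :: "nat \<Rightarrow> nat \<Rightarrow> complex" and c :: "nat \<Rightarrow> complex"
  assumes N: "3 \<le> N"
    and per: "\<And>i j. A (i + N) j = A i j" "\<And>i j. A i (j + N) = A i j" "\<And>i. c (i + N) = c i"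
    and wind: "\<And>i j. i < N \<Longrightarrow> j < N \<Longrightarrow> i \<noteq> j \<Longrightarrow> i \<noteq> Suc j mod N \<Longrightarrow>
        c (Suc j) - c i = exp (2 * of_real pi * \<i> * A i j) * (c j - c i)"
    and dist: "\<And>i j. i < N \<Longrightarrow> j < N \<Longrightarrow> i \<noteq> j \<Longrightarrow> c i \<noteq> c j"
  obtains m :: int where
    "(\<Sum>i<N. A i (Suc i) + A (i + 2) i) = of_int (1 + 2 * m)
      - (\<Sum>(i, j)\<in>nonadjacent_pairs N. A i j + A (Suc j) i - A (Suc i) j - A j i)"
proof -
  let ?E = "\<lambda>z. exp (2 * of_real pi * \<i> * z :: complex)"
  have "N = Suc (Suc (Suc (N - 3)))" using N by simp
  then obtain n where n: "N = Suc (Suc (Suc n))" by blast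
  have cN: "c N = c 0" using per(3)[of 0] by simp
  have AN: "A N j = A 0 j" "A (Suc N) j = A 1 j" "A i N = A i 0" for i j
    using per(1)[of 0 j] per(1)[of 1 j] per(2)[of i 0] by simp_all
  \<comment> \<open>Seen from \<open>c 0\<close>, consecutive arcs sweep out the angle from
    \<open>c 1\<close> to \<open>c k\<close>.\<close>
  have S: "?E (\<Sum>j\<in>{1..<k}. A 0 j) = (c k - c 0) / (c 1 - c 0)" if "1 \<le> k" "k < N" for k
    using that
  proof (induction k rule: dec_induct)
    case base then show ?case using dist[of 1 0] N by simp
  next
    case (step k)
    then have "?E (\<Sum>j\<in>{1..<Suc k}. A 0 j) = (c k - c 0) / (c 1 - c 0) * ?E (A 0 k)"
      by (simp add: distrib_left exp_add)
    also have "\<dots> = (c (Suc k) - c 0) / (c 1 - c 0)"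
    proof -
      have w: "c (Suc k) - c 0 = ?E (A 0 k) * (c k - c 0)" using wind[of 0 k] step by simp
      show ?thesis unfolding w by (simp add: mult_ac)
    qed
    finally show ?case .
  qed
  \<comment> \<open>Measured in full turns, the three summands are the angles of the triangle
    \<open>c 0\<close>, \<open>c 1\<close>, \<open>c (N - 1)\<close> at the corners
    \<open>c 0\<close>, \<open>c (N - 1)\<close> and \<open>c 1\<close>. The angles of a triangle
    add up to a half-turn, so \<open>Z\<close> is 1/2 modulo 1.\<close>
  define Z where "Z = (\<Sum>j\<in>{1..<N - 1}. A 0 j) + A (N - 1) 0 + A 1 (N - 1)"
  have "?E Z = (c (N - 1) - c 0) / (c 1 - c 0) * ?E (A (N - 1) 0) * ?E (A 1 (N - 1))"
    using S[of "N - 1"] N unfolding Z_def by (simp add: distrib_left exp_add)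
  also have "?E (A (N - 1) 0) = (c 1 - c (N - 1)) / (c 0 - c (N - 1))"
    using wind[of "N - 1" 0] dist[of 0 "N - 1"] N by simp
  also have "?E (A 1 (N - 1)) = (c 0 - c 1) / (c (N - 1) - c 1)"
  proof -
    have "1 \<noteq> N - 1" using N by linarith
    then show ?thesis using wind[of 1 "N - 1"] dist[of 1 "N - 1"] N cN by simp
  qed
  also have "(c (N - 1) - c 0) / (c 1 - c 0) * ((c 1 - c (N - 1)) / (c 0 - c (N - 1))) * ((c 0 - c 1) / (c (N - 1) - c 1)) = - 1"
  proof -
    have "x / y * (z / - x) * (- y / - z) = - 1" if "x \<noteq> 0" "y \<noteq> 0" "z \<noteq> 0" for x y z :: complex
      using that by (simp add: field_simps)
    from this[of "c (N - 1) - c 0" "c 1 - c 0" "c 1 - c (N - 1)"]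
    show ?thesis using dist[of 0 "N - 1"] dist[of 1 "N - 1"] dist[of 1 0] N by simp
  qed
  finally have "?E Z = ?E (1 / 2)" by (simp add: exp_pi_i mult_ac)
  then obtain m :: int where "2 * of_real pi * \<i> * Z = 2 * of_real pi * \<i> * (1 / 2) + of_int (2 * m) * pi * \<i>"
    unfolding exp_eq by blast
  then have "2 * of_real pi * \<i> * Z = 2 * of_real pi * \<i> * (1 / 2 + of_int m)" by (simp add: algebra_simps)
  then have Z: "Z = 1 / 2 + of_int m" by simp
  \<comment> \<open>Telescoping leaves two kinds of boundary terms: near the diagonal the windings
    of adjacent arcs, which form the left-hand side of the claim, and far from it the windings that
    go into \<open>Z\<close>.\<close>
  have col: "(\<Sum>(i, j)\<in>nonadjacent_pairs N. A i j - A (Suc i) j) =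
     (\<Sum>j\<in>{2..<N - 1}. A 0 j - A (j - 1) j) + (A 1 (N - 1) - A (N - 2) (N - 1))"
  proof -
    have "(\<Sum>i<j - 1. A i j - A (Suc i) j) = A 0 j - A (j - 1) j" for j
      by (rule sum_lessThan_telescope')
    moreover have "(\<Sum>i\<in>{1..<N - 2}. A i (N - 1) - A (Suc i) (N - 1)) = A 1 (N - 1) - A (N - 2) (N - 1)"
      using sum_Suc_diff'[of 1 "N - 2" "\<lambda>i. - A i (N - 1)"] N by simp
    ultimately show ?thesis using sum_nonadjacent_by_column[OF N, of "\<lambda>i j. A i j - A (Suc i) j"] by simp
  qed
  have row: "(\<Sum>(i, j)\<in>nonadjacent_pairs N. A (Suc j) i - A j i) =
     (\<Sum>i\<in>{1..<N - 2}. A 0 i - A (i + 2) i) + (A (N - 1) 0 - A 2 0)"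
  proof -
    have "(\<Sum>j\<in>{i + 2..<N}. A (Suc j) i - A j i) = A 0 i - A (i + 2) i" if "i \<in> {1..<N - 2}" for i
    proof -
      have "i + 2 \<le> N" using that by auto
      then show ?thesis using sum_Suc_diff'[of "i + 2" N "\<lambda>j. A j i"] AN by simp
    qed
    moreover have "(\<Sum>j\<in>{2..<N - 1}. A (Suc j) 0 - A j 0) = A (N - 1) 0 - A 2 0"
      using sum_Suc_diff'[of 2 "N - 1" "\<lambda>j. A j 0"] N by simp
    ultimately show ?thesis using sum_nonadjacent_by_row[OF N, of "\<lambda>i j. A (Suc j) i - A j i"] by simp
  qed
  have s1: "(\<Sum>j\<in>{2..<N - 1}. A (j - 1) j) + A (N - 2) (N - 1) = (\<Sum>i\<in>{1..<N - 1}. A i (Suc i))"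
  proof -
    have "(\<Sum>j\<in>{2..<N - 1}. A (j - 1) j) = (\<Sum>i\<in>{1..<N - 2}. A i (Suc i))"
      using sum.shift_bounds_Suc_ivl[of "\<lambda>j. A (j - 1) j" 1 "N - 2"] n by (simp add: numeral_2_eq_2)
    then show ?thesis using n by simp
  qed
  have t1: "(\<Sum>i<N. A i (Suc i)) = A 0 1 + (\<Sum>i\<in>{1..<N - 1}. A i (Suc i)) + A (N - 1) 0"
  proof -
    have "{..<N} = insert 0 (insert (N - 1) {1..<N - 1})" using n by auto
    then show ?thesis using n AN(3) by simp
  qed
  have t2: "(\<Sum>i<N. A (i + 2) i) = A 2 0 + (\<Sum>i\<in>{1..<N - 2}. A (i + 2) i) + A 0 (N - 2) + A 1 (N - 1)"
  proof -
    have "{..<N} = insert 0 (insert (N - 1) (insert (N - 2) {1..<N - 2}))" if "N \<noteq> 3" using n that by auto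
    moreover have "N - 1 + 2 = Suc N" "N - 2 + 2 = N" using n by simp_all
    ultimately show ?thesis using n AN
      by (cases "N = 3") (simp_all add: numeral_3_eq_3 numeral_2_eq_2 lessThan_Suc)
  qed
  have z1: "(\<Sum>j\<in>{1..<N - 1}. A 0 j) = A 0 1 + (\<Sum>j\<in>{2..<N - 1}. A 0 j)"
    using sum.atLeast_Suc_lessThan[of 1 "N - 1" "A 0"] N by (simp add: numeral_2_eq_2)
  have z2: "(\<Sum>j\<in>{1..<N - 1}. A 0 j) = (\<Sum>j\<in>{1..<N - 2}. A 0 j) + A 0 (N - 2)"
    using n by simp
  have "(\<Sum>(i, j)\<in>nonadjacent_pairs N. A i j + A (Suc j) i - A (Suc i) j - A j i) =
     (\<Sum>(i, j)\<in>nonadjacent_pairs N. A i j - A (Suc i) j) + (\<Sum>(i, j)\<in>nonadjacent_pairs N. A (Suc j) i - A j i)"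
    by (simp add: sum.distrib[symmetric] case_prod_beta algebra_simps)
  also have "\<dots> = 2 * Z - (\<Sum>i<N. A i (Suc i) + A (i + 2) i)"
    unfolding col row sum_subtractf sum.distrib t1 t2 Z_def s1[symmetric] using z1 z2 by (simp add: algebra_simps)
  finally have "(\<Sum>i<N. A i (Suc i) + A (i + 2) i) = 2 * Z
     - (\<Sum>(i, j)\<in>nonadjacent_pairs N. A i j + A (Suc j) i - A (Suc i) j - A j i)" by simp
  then show ?thesis using that[of m] by (simp add: Z)
qed

section \<open>Turning of open and cyclic lists of directions\<close>

definition lturn :: "complex list \<Rightarrow> real" where
  "lturn ds = (\<Sum>k<length ds - 1. Arg (ds ! Suc k / ds ! k))"

definition cturn :: "complex list \<Rightarrow> real" where
  "cturn ds = (\<Sum>k<length ds. Arg (ds ! (Suc k mod length ds) / ds ! k))"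

definition dirs :: "complex list \<Rightarrow> complex list" where
  "dirs ps = map2 (\<lambda>a b. b - a) ps (tl ps)"

lemma length_dirs: "length (dirs ps) = length ps - 1"
  by (simp add: dirs_def)

lemma nth_dirs: "k < length ps - 1 \<Longrightarrow> dirs ps ! k = ps ! Suc k - ps ! k"
  by (simp add: dirs_def nth_tl)

lemma lturn_Nil [simp]: "lturn [] = 0" and lturn_single [simp]: "lturn [d] = 0"
  by (simp_all add: lturn_def)

lemma lturn_Cons: "ds \<noteq> [] \<Longrightarrow> lturn (d # ds) = Arg (hd ds / d) + lturn ds"
  by (cases ds) (simp_all add: lturn_def sum.lessThan_Suc_shift del: sum.lessThan_Suc)

lemma lturn_append:
  assumes "xs \<noteq> []" "ys \<noteq> []"
  shows "lturn (xs @ ys) = lturn xs + Arg (hd ys / last xs) + lturn ys"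
  using assms
proof (induction xs rule: list_nonempty_induct)
  case (cons x xs)
  then show ?case by (simp add: lturn_Cons)
qed (simp add: lturn_Cons)

lemma cturn_eq_lturn: "ds \<noteq> [] \<Longrightarrow> cturn ds = lturn ds + Arg (hd ds / last ds)"
proof -
  assume "ds \<noteq> []"
  then obtain n where n: "length ds = Suc n" by (cases ds) auto
  have "cturn ds = (\<Sum>k<n. Arg (ds ! (Suc k mod Suc n) / ds ! k)) + Arg (ds ! 0 / ds ! n)"
    by (simp add: cturn_def n)
  also have "(\<Sum>k<n. Arg (ds ! (Suc k mod Suc n) / ds ! k)) = lturn ds"
    unfolding lturn_def n by (intro sum.cong) auto
  finally show ?thesis using n \<open>ds \<noteq> []\<close> by (simp add: hd_conv_nth last_conv_nth)
qed

lemma cturn_append_commute: "cturn (xs @ ys) = cturn (ys @ xs)"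
  by (cases "xs = []"; cases "ys = []") (simp_all add: cturn_eq_lturn lturn_append)

text \<open>Direction lists with the same turning whose first and last directions agree up to positive factors
  can replace each other inside a closed polygon.\<close>

definition turn_equiv :: "complex list \<Rightarrow> complex list \<Rightarrow> bool" where
  "turn_equiv xs ys \<longleftrightarrow> xs \<noteq> [] \<and> ys \<noteq> [] \<and> lturn xs = lturn ys \<and>
     sgn (hd xs) = sgn (hd ys) \<and> sgn (last xs) = sgn (last ys) \<and>
     hd xs \<noteq> 0 \<and> hd ys \<noteq> 0 \<and> last xs \<noteq> 0 \<and> last ys \<noteq> 0"

lemma Arg_divide_sgn:
  assumes "sgn a = sgn a'" "sgn b = sgn b'" "a \<noteq> 0" "a' \<noteq> 0" "b \<noteq> 0" "b' \<noteq> 0"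
  shows "Arg (a / b) = Arg (a' / b')"
proof -
  have "sgn (a / b) = sgn (a' / b')" using assms by (simp add: sgn_divide)
  moreover have "Arg z = Arg (sgn z)" if "z \<noteq> 0" for z
  proof -
    have "z = of_real (norm z) * sgn z" by (simp add: sgn_eq that)
    then show ?thesis using that by (metis Arg_times_of_real zero_less_norm_iff)
  qed
  ultimately show ?thesis using assms by (metis divide_eq_0_iff)
qed

lemma turn_equiv_append:
  assumes "turn_equiv xs xs'" "turn_equiv ys ys'"
  shows "turn_equiv (xs @ ys) (xs' @ ys')"
proof -
  have "Arg (hd ys / last xs) = Arg (hd ys' / last xs')"
    using assms unfolding turn_equiv_def by (intro Arg_divide_sgn) auto
  then show ?thesis using assms by (auto simp: turn_equiv_def lturn_append)
qed

lemma turn_equiv_cturn: "turn_equiv xs ys \<Longrightarrow> cturn xs = cturn ys"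
  unfolding turn_equiv_def by (auto simp: cturn_eq_lturn intro!: Arg_divide_sgn)

lemma turn_equiv_concat:
  assumes "list_all2 turn_equiv xss yss" "xss \<noteq> []"
  shows "turn_equiv (concat xss) (concat yss)"
  using assms
proof (induction rule: list_all2_induct)
  case (Cons x xs y ys)
  then show ?case by (cases "xs = []") (auto intro: turn_equiv_append)
qed simp

lemma cturn_concat:
  assumes "xss \<noteq> []" "\<And>xs. xs \<in> set xss \<Longrightarrow> xs \<noteq> []"
  shows "cturn (concat xss) = (\<Sum>i<length xss. lturn (xss ! i)
    + Arg (hd (xss ! (Suc i mod length xss)) / last (xss ! i)))"
proof -
  have "lturn (concat xss) = (\<Sum>i<length xss. lturn (xss ! i)) +
      (\<Sum>i<length xss - 1. Arg (hd (xss ! Suc i) / last (xss ! i)))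
     \<and> hd (concat xss) = hd (xss ! 0) \<and> last (concat xss) = last (xss ! (length xss - 1)) \<and> concat xss \<noteq> []"
    using assms
  proof (induction xss rule: list_nonempty_induct)
    case (cons x xs)
    then have IH: "lturn (concat xs) = (\<Sum>i<length xs. lturn (xs ! i)) +
      (\<Sum>i<length xs - 1. Arg (hd (xs ! Suc i) / last (xs ! i)))"
      "hd (concat xs) = hd (xs ! 0)" "last (concat xs) = last (xs ! (length xs - 1))" "concat xs \<noteq> []"
      and x: "x \<noteq> []" by auto
    obtain m where m: "length xs = Suc m" using cons.hyps by (cases xs) auto
    show ?case using x IH(4) by (simp add: lturn_append IH(1-3) m sum.lessThan_Suc_shift del: sum.lessThan_Suc)
  qed simp
  moreover obtain m where m: "length xss = Suc m" using assms(1) by (cases xss) auto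
  moreover have "(\<Sum>i<m. Arg (hd (xss ! (Suc i mod Suc m)) / last (xss ! i))) =
     (\<Sum>i<m. Arg (hd (xss ! Suc i) / last (xss ! i)))"
    by (intro sum.cong) auto
  ultimately show ?thesis by (simp add: cturn_eq_lturn sum.distrib)
qed

lemma total_turning_eq_cturn:
  assumes "length ps \<ge> 2" "last ps = hd ps"
  shows "total_turning (butlast ps) = cturn (dirs ps)"
proof -
  define n where "n = length ps - 1"
  have n: "length ps = Suc n" "0 < n" using assms by (auto simp: n_def)
  have P: "butlast ps ! (k mod n) = ps ! (k mod n)" for k using n by (intro nth_butlast) auto
  have last: "ps ! n = ps ! 0" using assms n by (metis diff_Suc_1 hd_conv_nth last_conv_nth list.size(3) nat.distinct(1))
  have Suc_mod: "ps ! (Suc k mod n) = ps ! Suc (k mod n)" for k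
  proof (cases "Suc (k mod n) = n")
    case True
    then show ?thesis using last by (simp add: mod_Suc)
  qed (simp add: mod_Suc)
  have D: "dirs ps ! (k mod n) = ps ! (Suc k mod n) - ps ! (k mod n)" for k
    using n nth_dirs[of "k mod n" ps] by (simp add: Suc_mod)
  show ?thesis
    unfolding total_turning_def cturn_def Let_def length_butlast length_dirs n diff_Suc_1 P
  proof (intro sum.cong refl)
    fix k assume "k \<in> {..<n}"
    then show "Arg ((ps ! ((k + 2) mod n) - ps ! ((k + 1) mod n)) / (ps ! ((k + 1) mod n) - ps ! (k mod n))) =
        Arg (dirs ps ! (Suc k mod n) / dirs ps ! k)"
      using D[of "Suc k"] D[of k] by simp
  qed
qed

lemma dirs_join:
  assumes "ps \<noteq> []" "qs \<noteq> []" "last ps = hd qs"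
  shows "dirs (butlast ps @ qs) = dirs ps @ dirs qs"
  using assms
proof (induction ps rule: list_nonempty_induct)
  case (single x)
  then show ?case by (simp add: dirs_def)
next
  case (cons x xs)
  have "dirs (x # ys) = (hd ys - x) # dirs ys" if "ys \<noteq> []" for ys
    using that by (cases ys) (auto simp: dirs_def)
  then show ?case using cons by (cases xs) auto
qed

lemma dirs_concat_butlast:
  assumes "pss \<noteq> []" "\<And>ps. ps \<in> set pss \<Longrightarrow> ps \<noteq> []"
    and "\<And>i. Suc i < length pss \<Longrightarrow> last (pss ! i) = hd (pss ! Suc i)"
  shows "dirs (concat (map butlast pss) @ [last (last pss)]) = concat (map dirs pss)
    \<and> hd (concat (map butlast pss) @ [last (last pss)]) = hd (hd pss)"
  using assms
proof (induction pss rule: list_nonempty_induct)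
  case (single x)
  then show ?case by (cases x rule: rev_cases) auto
next
  case (cons x xs)
  let ?q = "concat (map butlast xs) @ [last (last xs)]"
  have IH: "dirs ?q = concat (map dirs xs)" "hd ?q = hd (hd xs)"
    using cons.IH cons.prems(1) cons.prems(2)[of "Suc _"] by auto
  have x: "x \<noteq> []" "last x = hd (hd xs)"
    using cons.prems(1)[of x] cons.prems(2)[of 0] cons.hyps by (auto simp: hd_conv_nth)
  have "dirs (butlast x @ ?q) = dirs x @ dirs ?q"
    using x IH by (intro dirs_join) auto
  moreover have "hd (butlast x @ ?q) = hd x"
    using x IH(2) by (cases x) (auto simp: hd_append split: if_splits)
  ultimately show ?case using cons.hyps IH(1) by simp
qed

lemma dirs_rev: "dirs (rev ps) = map uminus (rev (dirs ps))"
proof (rule nth_equalityI)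
  fix i assume "i < length (dirs (rev ps))"
  then have i: "i < length ps - 1" by (simp add: length_dirs)
  then have "length ps - Suc i = Suc (length ps - Suc (Suc i))" by simp
  then show "dirs (rev ps) ! i = map uminus (rev (dirs ps)) ! i"
    using i by (simp add: length_dirs nth_dirs rev_nth)
qed (simp add: length_dirs)

text \<open>The relation \<open>pl_via\<close> on an arbitrary interval, keeping only the edge
  vectors. In this form concatenation, reparametrisation and reversal are direct inductions, and two
  subdivisions of the same path can be compared.\<close>

inductive pl_dirs :: "(real \<Rightarrow> complex) \<Rightarrow> real \<Rightarrow> real \<Rightarrow> complex list \<Rightarrow> bool" for \<gamma> where
  single: "a < b \<Longrightarrow> \<gamma> a \<noteq> \<gamma> b \<Longrightarrow> \<gamma> ` {a..b} = closed_segment (\<gamma> a) (\<gamma> b) \<Longrightarrow> pl_dirs \<gamma> a b [\<gamma> b - \<gamma> a]"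
| cons: "a < b \<Longrightarrow> \<gamma> a \<noteq> \<gamma> b \<Longrightarrow> \<gamma> ` {a..b} = closed_segment (\<gamma> a) (\<gamma> b) \<Longrightarrow> pl_dirs \<gamma> b c ds \<Longrightarrow>
    pl_dirs \<gamma> a c ((\<gamma> b - \<gamma> a) # ds)"

lemma pl_dirs_less: "pl_dirs \<gamma> a b ds \<Longrightarrow> a < b"
  by (induction rule: pl_dirs.induct) auto

lemma pl_dirs_nonempty: "pl_dirs \<gamma> a b ds \<Longrightarrow> ds \<noteq> []"
  by (cases rule: pl_dirs.cases) auto

lemma pl_dirs_nonzero: "pl_dirs \<gamma> a b ds \<Longrightarrow> hd ds \<noteq> 0 \<and> last ds \<noteq> 0"
  by (induction rule: pl_dirs.induct) (auto dest: pl_dirs_nonempty)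

lemma pl_dirs_append: "pl_dirs \<gamma> a b xs \<Longrightarrow> pl_dirs \<gamma> b c ys \<Longrightarrow> pl_dirs \<gamma> a c (xs @ ys)"
  by (induction rule: pl_dirs.induct) (auto intro: pl_dirs.cons)

lemma pl_dirs_reparam:
  assumes "pl_dirs \<gamma> a b ds" "0 < k"
    and "\<And>x. x \<in> {a..b} \<Longrightarrow> \<delta> (k * x + l) = \<gamma> x"
  shows "pl_dirs \<delta> (k * a + l) (k * b + l) ds"
  using assms
proof (induction rule: pl_dirs.induct)
  case (single a b)
  have "\<delta> ` {k * a + l..k * b + l} = \<delta> ` ((\<lambda>x. k * x + l) ` {a..b})"
    using single by (simp add: image_affinity_atLeastAtMost)
  also have "\<dots> = \<gamma> ` {a..b}" using single by (auto simp: image_image intro!: image_cong)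
  finally show ?case using pl_dirs.single[of "k * a + l" "k * b + l" \<delta>] single by simp
next
  case (cons a b c ds)
  have bc: "b < c" using cons pl_dirs_less by blast
  have "\<delta> ` {k * a + l..k * b + l} = \<delta> ` ((\<lambda>x. k * x + l) ` {a..b})"
    using cons by (simp add: image_affinity_atLeastAtMost)
  also have "\<dots> = \<gamma> ` {a..b}" using cons bc by (auto simp: image_image intro!: image_cong)
  finally show ?case
    using pl_dirs.cons[of "k * a + l" "k * b + l" \<delta> "k * c + l" ds] cons bc by simp
qed

lemma pl_dirs_reverse:
  assumes "pl_dirs \<gamma> a b ds" "\<And>x. \<delta> (- x) = \<gamma> x"
  shows "pl_dirs \<delta> (- b) (- a) (map uminus (rev ds))"
  using assms
proof (induction rule: pl_dirs.induct)
  case (single a b)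
  have "\<delta> ` {- b..- a} = \<delta> ` (uminus ` {a..b})" by simp
  also have "\<dots> = \<gamma> ` {a..b}" using single.prems by (simp only: image_image)
  finally show ?case using pl_dirs.single[of "- b" "- a" \<delta>] single by (simp add: closed_segment_commute)
next
  case (cons a b c ds)
  have "\<delta> ` {- b..- a} = \<delta> ` (uminus ` {a..b})" by simp
  also have "\<dots> = \<gamma> ` {a..b}" using cons.prems by (simp only: image_image)
  finally have "pl_dirs \<delta> (- b) (- a) [\<gamma> a - \<gamma> b]"
    using pl_dirs.single[of "- b" "- a" \<delta>] cons by (simp add: closed_segment_commute)
  then show ?case using pl_dirs_append cons by fastforce
qed

lemma pl_via_imp_pl_dirs:
  assumes "pl_via \<gamma> ps"
  shows "pl_dirs \<gamma> 0 1 (dirs ps)" "hd ps = \<gamma> 0" "last ps = \<gamma> 1" "2 \<le> length ps"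
proof -
  obtain \<tau> where len: "2 \<le> length ps" and \<tau>0: "\<tau> 0 = 0" "\<tau> (length ps - 1) = 1"
    and \<tau>: "\<And>k. k < length ps - 1 \<Longrightarrow> \<tau> k < \<tau> (Suc k) \<and>
           ps ! k = \<gamma> (\<tau> k) \<and> ps ! Suc k = \<gamma> (\<tau> (Suc k)) \<and> ps ! k \<noteq> ps ! Suc k \<and>
           \<gamma> ` {\<tau> k..\<tau> (Suc k)} = closed_segment (ps ! k) (ps ! Suc k)"
    using assms unfolding pl_via_def by blast
  show "2 \<le> length ps" by (rule len)
  obtain n where n: "length ps = Suc (Suc n)" using len by (metis Suc_le_D numeral_2_eq_2 Suc_le_mono)
  have \<tau>': "\<tau> k < \<tau> (Suc k)" "ps ! k = \<gamma> (\<tau> k)" "ps ! Suc k = \<gamma> (\<tau> (Suc k))"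
    "\<gamma> (\<tau> k) \<noteq> \<gamma> (\<tau> (Suc k))"
    "\<gamma> ` {\<tau> k..\<tau> (Suc k)} = closed_segment (\<gamma> (\<tau> k)) (\<gamma> (\<tau> (Suc k)))" if "k \<le> n" for k
    using \<tau>[of k] that n by auto
  have *: "pl_dirs \<gamma> (\<tau> k) (\<tau> (Suc n)) (drop k (dirs ps))" if "k \<le> n" for k
    using that
  proof (induction k rule: inc_induct)
    case base
    have "drop n (dirs ps) = [\<gamma> (\<tau> (Suc n)) - \<gamma> (\<tau> n)]"
      using \<tau>'[of n] n by (simp add: Cons_nth_drop_Suc[symmetric] length_dirs nth_dirs)
    then show ?case using pl_dirs.single[OF \<tau>'(1,4,5)[of n]] by simp
  next
    case (step k)
    then have "drop k (dirs ps) = (\<gamma> (\<tau> (Suc k)) - \<gamma> (\<tau> k)) # drop (Suc k) (dirs ps)"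
      using \<tau>'[of k] n by (simp add: Cons_nth_drop_Suc[symmetric] length_dirs nth_dirs)
    moreover have "k \<le> n" using step by simp
    ultimately show ?case using pl_dirs.cons[OF \<tau>'(1,4,5)[of k] step.IH] by simp
  qed
  show "pl_dirs \<gamma> 0 1 (dirs ps)" using *[of 0] \<tau>0 n by simp
  have "ps \<noteq> []" using n by auto
  then show "hd ps = \<gamma> 0" "last ps = \<gamma> 1"
    using \<tau>'[of 0] \<tau>'[of n] \<tau>0 n by (simp_all add: hd_conv_nth last_conv_nth)
qed

section \<open>Secant angles of injective polygonal paths\<close>

lemma log_minus_Ln_const:
  fixes g f :: "'a::topological_space \<Rightarrow> complex"
  assumes "connected S" "continuous_on S g" "continuous_on S f"
    "\<And>x. x \<in> S \<Longrightarrow> f x \<notin> \<real>\<^sub>\<le>\<^sub>0" "\<And>x. x \<in> S \<Longrightarrow> exp (g x) = e * f x" "x \<in> S" "y \<in> S"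
  shows "g x - Ln (f x) = g y - Ln (f y)"
proof (rule exp_eq_const_imp_const[OF assms(1) _ _ assms(6,7)])
  show "continuous_on S (\<lambda>x. g x - Ln (f x))"
    using assms(4) by (intro continuous_on_diff assms(2) continuous_on_Ln' assms(3)) auto
  fix z assume z: "z \<in> S"
  then have "f z \<noteq> 0" using assms(4)[OF z] by auto
  then show "exp (g z - Ln (f z)) = e" using assms(5)[OF z] by (simp add: exp_diff)
qed

text \<open>The speed along a segment is arbitrary, but the real coordinate of the path in its
  segment is continuous and injective, hence strictly monotone.\<close>

lemma segment_path_monotone:
  fixes \<gamma> :: "real \<Rightarrow> complex"
  assumes "continuous_on {a..b} \<gamma>" "inj_on \<gamma> {a..b}" "a < b"
    and img: "\<gamma> ` {a..b} = closed_segment (\<gamma> a) (\<gamma> b)"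
    and st: "a \<le> s" "s < t" "t \<le> b"
  obtains r where "0 < r" "\<gamma> t - \<gamma> s = of_real r * (\<gamma> b - \<gamma> a)"
proof -
  define e where "e = \<gamma> b - \<gamma> a"
  have "\<gamma> a \<noteq> \<gamma> b" using assms(2,3) by (auto dest: inj_onD)
  then have e0: "e \<noteq> 0" by (simp add: e_def)
  define h where "h x = Re ((\<gamma> x - \<gamma> a) / e)" for x
  have h: "\<gamma> x = \<gamma> a + of_real (h x) * e" if "x \<in> {a..b}" for x
  proof -
    have "\<gamma> x \<in> closed_segment (\<gamma> a) (\<gamma> b)" using img that by blast
    then obtain u where "\<gamma> x = (1 - u) *\<^sub>R \<gamma> a + u *\<^sub>R \<gamma> b" by (auto simp: in_segment)
    then have "\<gamma> x = \<gamma> a + of_real u * e" by (simp add: e_def scaleR_conv_of_real algebra_simps)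
    moreover from this have "h x = u" using e0 by (simp add: h_def)
    ultimately show ?thesis by simp
  qed
  have ch: "continuous_on {a..b} h"
    unfolding h_def using e0 by (intro continuous_on_Re continuous_on_divide continuous_on_diff assms(1) continuous_on_const) auto
  have ih: "inj_on h {a..b}" using h assms(2) by (metis (no_types, lifting) inj_on_def)
  have ab: "h a = 0" "h b = 1" using e0 by (auto simp: h_def e_def)
  have first: "h a < h x" if "a < x" "x \<le> b" for x
  proof (cases "x = b")
    case False
    then have "a < x" "x < b" using that by auto
    from continuous_inj_imp_mono[OF this ch ih] show ?thesis unfolding ab by linarith
  qed (use ab in simp)
  have "h s < h t"
  proof (cases "s = a")
    case False
    then have "h s \<noteq> h t" using st ih by (auto dest: inj_onD)
    have sub: "{a..t} \<subseteq> {a..b}" using st by auto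
    have "a < s" using False st by simp
    from continuous_inj_imp_mono[OF this st(2) continuous_on_subset[OF ch sub] inj_on_subset[OF ih sub]]
    show ?thesis using first[of s] \<open>a < s\<close> st by linarith
  qed (use first[of t] st in simp)
  moreover have "\<gamma> t - \<gamma> s = of_real (h t - h s) * e"
    using h[of s] h[of t] st by (simp add: algebra_simps)
  ultimately show ?thesis using that[of "h t - h s"] by (simp add: e_def)
qed

text \<open>Two consecutive edges with opposite directions would overlap next to their common
  corner, against injectivity.\<close>

lemma no_backtracking:
  fixes \<gamma> :: "real \<Rightarrow> complex"
  assumes inj: "inj_on \<gamma> {a..c}" and ab: "a < b" "b < c"
    and img: "\<gamma> ` {a..b} = closed_segment (\<gamma> a) (\<gamma> b)" "\<gamma> ` {b..c} = closed_segment (\<gamma> b) (\<gamma> c)"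
    and k: "0 < k"
  shows "\<gamma> c - \<gamma> b \<noteq> - of_real k * (\<gamma> b - \<gamma> a)"
proof
  assume eq: "\<gamma> c - \<gamma> b = - of_real k * (\<gamma> b - \<gamma> a)"
  \<comment> \<open>The point at \<open>m\<close> times the first edge vector before the corner lies
    on both edges, since \<open>m\<close> is at most 1 and at most \<open>k\<close>.\<close>
  define m where "m = min 1 k"
  have m: "0 < m" "m \<le> 1" "m / k \<le> 1" using k by (auto simp: m_def)
  define x where "x = \<gamma> b - of_real m * (\<gamma> b - \<gamma> a)"
  have "x = (1 - (1 - m)) *\<^sub>R \<gamma> a + (1 - m) *\<^sub>R \<gamma> b"
    by (simp add: x_def scaleR_conv_of_real algebra_simps)
  then have "x \<in> \<gamma> ` {a..b}" unfolding img using m by (auto simp: in_segment intro!: exI[of _ "1 - m"])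
  moreover have "x = (1 - m / k) *\<^sub>R \<gamma> b + (m / k) *\<^sub>R \<gamma> c"
  proof -
    define e where "e = \<gamma> b - \<gamma> a"
    have "\<gamma> c = \<gamma> b - of_real k * e" using eq by (simp add: e_def algebra_simps)
    then have "(m / k) *\<^sub>R \<gamma> c = (m / k) *\<^sub>R \<gamma> b - of_real m * e"
      using k by (simp add: scaleR_conv_of_real right_diff_distrib)
    then show ?thesis by (simp add: x_def e_def[symmetric] algebra_simps)
  qed
  then have "x \<in> \<gamma> ` {b..c}" unfolding img using m k by (auto simp: in_segment intro!: exI[of _ "m / k"])
  ultimately obtain s t where "x = \<gamma> s" "s \<in> {a..b}" "x = \<gamma> t" "t \<in> {b..c}" by blast
  then have "s = t" using inj_onD[OF inj, of s t] ab by auto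
  then have "x = \<gamma> b" using \<open>x = \<gamma> s\<close> \<open>s \<in> {a..b}\<close> \<open>t \<in> {b..c}\<close> by (auto simp: antisym_conv)
  then have "of_real m * (\<gamma> b - \<gamma> a) = 0" by (simp add: x_def)
  then have "\<gamma> b = \<gamma> a" using m by simp
  then show False using inj_onD[OF inj, of b a] ab by auto
qed

text \<open>A polygonal path has no tangents at its corners, so the logarithm is not extended to the
  diagonal \<open>s = t\<close>, as one does for smooth curves. Its values on secants within one
  edge take the place of tangent angles.\<close>

definition secant_log :: "(real \<Rightarrow> complex) \<Rightarrow> real \<Rightarrow> real \<Rightarrow> (real \<times> real \<Rightarrow> complex) \<Rightarrow> bool" where
  "secant_log \<gamma> a b g \<longleftrightarrow> continuous_on {(s, t). a \<le> s \<and> s < t \<and> t \<le> b} g \<and>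
     (\<forall>s t. a \<le> s \<and> s < t \<and> t \<le> b \<longrightarrow> \<gamma> t - \<gamma> s = exp (g (s, t)))"

lemma convex_triangle: "convex {(s, t). a \<le> s \<and> s < t \<and> t \<le> (b::real)}"
proof -
  have "{(s, t). a \<le> s \<and> s < t \<and> t \<le> b} = ({a..} \<times> {..b}) \<inter> {x. inner (1, - 1) x < (0::real)}"
    by auto
  also have "convex \<dots>" by (intro convex_Int convex_Times convex_halfspace_lt) auto
  finally show ?thesis .
qed

lemma secant_log_subset:
  "secant_log \<gamma> a b g \<Longrightarrow> a \<le> c \<Longrightarrow> d \<le> b \<Longrightarrow> secant_log \<gamma> c d g"
  unfolding secant_log_def by (auto elim!: continuous_on_subset)

lemma continuous_on_secant:
  assumes "continuous_on {a..b} \<gamma>" "S \<subseteq> {(s, t). a \<le> s \<and> s \<le> b \<and> a \<le> t \<and> t \<le> b}"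
  shows "continuous_on S (\<lambda>(s, t). \<gamma> t - \<gamma> s :: complex)"
proof -
  have "continuous_on S (\<lambda>p. \<gamma> (snd p))" "continuous_on S (\<lambda>p. \<gamma> (fst p))"
    by (rule continuous_on_compose2[OF assms(1)];
        use assms(2) in \<open>auto intro: continuous_on_fst continuous_on_snd continuous_on_id\<close>)+
  then show ?thesis unfolding case_prod_beta by (intro continuous_on_diff)
qed

lemma secant_log_exists:
  assumes "continuous_on {a..b} \<gamma>" "inj_on \<gamma> {a..b}"
  obtains g where "secant_log \<gamma> a b g"
proof -
  let ?T = "{(s, t). a \<le> s \<and> s < t \<and> t \<le> b}"
  have "continuous_on ?T (\<lambda>(s, t). \<gamma> t - \<gamma> s)" by (rule continuous_on_secant[OF assms(1)]) auto
  moreover have "(\<lambda>(s, t). \<gamma> t - \<gamma> s) z \<noteq> 0" if "z \<in> ?T" for z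
    using that inj_onD[OF assms(2)] by fastforce
  ultimately obtain g where "continuous_on ?T g" "\<And>x. x \<in> ?T \<Longrightarrow> (\<lambda>(s, t). \<gamma> t - \<gamma> s) x = exp (g x)"
    using continuous_logarithm_on_contractible[of ?T "\<lambda>(s, t). \<gamma> t - \<gamma> s"]
      convex_imp_contractible[OF convex_triangle[of a b]] by blast
  then have "secant_log \<gamma> a b g" unfolding secant_log_def by fastforce
  then show ?thesis by (rule that)
qed

lemma secant_log_unique:
  assumes "secant_log \<gamma> a b g" "secant_log \<gamma> a b g'" "a \<le> s" "s < t" "t \<le> b" "a \<le> s'" "s' < t'" "t' \<le> b"
  shows "g (s, t) - g' (s, t) = g (s', t') - g' (s', t')"
proof (rule exp_eq_const_imp_const[of "{(s, t). a \<le> s \<and> s < t \<and> t \<le> b}" "\<lambda>p. g p - g' p" 1])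
  show "connected {(s, t). a \<le> s \<and> s < t \<and> t \<le> b}" by (rule convex_connected[OF convex_triangle])
  show "continuous_on {(s, t). a \<le> s \<and> s < t \<and> t \<le> b} (\<lambda>p. g p - g' p)"
    using assms(1,2) unfolding secant_log_def by (intro continuous_on_diff) auto
  show "exp (g p - g' p) = 1" if "p \<in> {(s, t). a \<le> s \<and> s < t \<and> t \<le> b}" for p
  proof -
    from that obtain s t where p: "p = (s, t)" "a \<le> s" "s < t" "t \<le> b" by auto
    then have "exp (g p) = exp (g' p)" using assms(1,2) unfolding secant_log_def by metis
    then show ?thesis by (simp add: exp_diff)
  qed
qed (use assms in auto)

text \<open>The turning of an injective polygonal path is the increment of the argument of its secants
  between the two ends.\<close>

lemma lturn_eq_secant_angle:
  assumes "pl_dirs \<gamma> a b ds" "continuous_on {a..b} \<gamma>" "inj_on \<gamma> {a..b}" "secant_log \<gamma> a b g"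
  shows "\<exists>\<tau> \<tau>'. a < \<tau> \<and> \<tau> \<le> b \<and> a \<le> \<tau>' \<and> \<tau>' < b \<and>
     hd ds = \<gamma> \<tau> - \<gamma> a \<and> \<gamma> ` {a..\<tau>} = closed_segment (\<gamma> a) (\<gamma> \<tau>) \<and> last ds = \<gamma> b - \<gamma> \<tau>' \<and>
     (\<forall>s t. a \<le> s \<and> s < t \<and> t \<le> \<tau> \<longrightarrow> Im (g (s, t)) = Im (g (a, \<tau>))) \<and>
     (\<forall>s t. \<tau>' \<le> s \<and> s < t \<and> t \<le> b \<longrightarrow> Im (g (s, t)) = Im (g (\<tau>', b))) \<and>
     Im (g (\<tau>', b)) - Im (g (a, \<tau>)) = lturn ds"
proof -
  \<comment> \<open>All secants within one edge are positive multiples of the edge vector, so the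
    argument is constant there.\<close>
  have piece: "Im (g (s, t)) = Im (g (a, b))"
    if "a < b" "continuous_on {a..b} \<gamma>" "inj_on \<gamma> {a..b}" "secant_log \<gamma> a b g"
      "\<gamma> ` {a..b} = closed_segment (\<gamma> a) (\<gamma> b)" "a \<le> s" "s < t" "t \<le> b" for a b s t
  proof -
    let ?T = "{(s, t). a \<le> s \<and> s < t \<and> t \<le> b}"
    let ?e = "\<gamma> b - \<gamma> a"
    let ?f = "\<lambda>(s, t). (\<gamma> t - \<gamma> s) / ?e"
    have e0: "?e \<noteq> 0" using that(1,3) by (auto dest: inj_onD)
    have pos: "\<exists>r>0. (\<gamma> t - \<gamma> s) / ?e = of_real r" if "a \<le> s" "s < t" "t \<le> b" for s t
    proof -
      note st = that
      obtain r where "0 < r" "\<gamma> t - \<gamma> s = of_real r * ?e"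
        using segment_path_monotone[OF \<open>continuous_on {a..b} \<gamma>\<close> \<open>inj_on \<gamma> {a..b}\<close> \<open>a < b\<close>
          \<open>\<gamma> ` {a..b} = closed_segment (\<gamma> a) (\<gamma> b)\<close> st] by blast
      then show ?thesis using e0 by auto
    qed
    have "g (s, t) - Ln (?f (s, t)) = g (a, b) - Ln (?f (a, b))"
    proof (rule log_minus_Ln_const[of ?T g ?f ?e])
      show "connected ?T" by (rule convex_connected[OF convex_triangle])
      show "continuous_on ?T g" using that(4) by (simp add: secant_log_def)
      have "continuous_on ?T (\<lambda>p. (\<lambda>(s, t). \<gamma> t - \<gamma> s) p / ?e)"
      proof (intro continuous_on_divide continuous_on_const)
        show "continuous_on ?T (\<lambda>(s, t). \<gamma> t - \<gamma> s)" by (rule continuous_on_secant[OF that(2)]) auto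
      qed (use e0 in auto)
      then show "continuous_on ?T ?f" by (simp add: case_prod_beta)
      show "?f x \<notin> \<real>\<^sub>\<le>\<^sub>0" if "x \<in> ?T" for x
        using that pos by (fastforce simp: complex_nonpos_Reals_iff)
      show "exp (g x) = ?e * ?f x" if "x \<in> ?T" for x
        using that e0 \<open>secant_log \<gamma> a b g\<close> by (auto simp: secant_log_def)
    qed (use that in auto)
    have "Im (Ln (?f (s, t))) = 0" if "a \<le> s" "s < t" "t \<le> b" for s t
      using pos[OF that] by (auto simp: Ln_of_real)
    note z = this
    have "Im (g (s, t)) - Im (Ln (?f (s, t))) = Im (g (a, b)) - Im (Ln (?f (a, b)))"
      using \<open>g (s, t) - Ln (?f (s, t)) = g (a, b) - Ln (?f (a, b))\<close> by (metis minus_complex.sel(2))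
    then show ?thesis using z[OF \<open>a \<le> s\<close> \<open>s < t\<close> \<open>t \<le> b\<close>] z[OF order_refl \<open>a < b\<close> order_refl] by linarith
  qed
  show ?thesis using assms
  proof (induction rule: pl_dirs.induct)
    case (single a b)
    have *: "\<forall>s t. a \<le> s \<and> s < t \<and> t \<le> b \<longrightarrow> Im (g (s, t)) = Im (g (a, b))"
      using piece[OF single.hyps(1) single.prems single.hyps(3)] by blast
    show ?case
      by (intro exI[of _ b] exI[of _ a] conjI) (rule order_refl single.hyps * | simp)+
  next
    case (cons a b c ds)
    have bc: "b < c" using cons.hyps(4) by (rule pl_dirs_less)
    have sub: "continuous_on {a..b} \<gamma>" "inj_on \<gamma> {a..b}" "secant_log \<gamma> a b g"
      "continuous_on {b..c} \<gamma>" "inj_on \<gamma> {b..c}" "secant_log \<gamma> b c g"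
    proof -
      have s: "{a..b} \<subseteq> {a..c}" "{b..c} \<subseteq> {a..c}" using bc cons.hyps(1) by auto
      show "continuous_on {a..b} \<gamma>" "continuous_on {b..c} \<gamma>" "inj_on \<gamma> {a..b}" "inj_on \<gamma> {b..c}"
        using continuous_on_subset[OF cons.prems(1)] inj_on_subset[OF cons.prems(2)] s by blast+
      show "secant_log \<gamma> a b g" "secant_log \<gamma> b c g"
        using secant_log_subset[OF cons.prems(3)] bc cons.hyps(1) by auto
    qed
    from cons.IH[OF sub(4-6)] obtain \<tau> \<tau>' where
      IH: "b < \<tau>" "\<tau> \<le> c" "b \<le> \<tau>'" "\<tau>' < c" "hd ds = \<gamma> \<tau> - \<gamma> b" "\<gamma> ` {b..\<tau>} = closed_segment (\<gamma> b) (\<gamma> \<tau>)"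
       "last ds = \<gamma> c - \<gamma> \<tau>'"
       "\<forall>s t. b \<le> s \<and> s < t \<and> t \<le> \<tau> \<longrightarrow> Im (g (s, t)) = Im (g (b, \<tau>))"
       "\<forall>s t. \<tau>' \<le> s \<and> s < t \<and> t \<le> c \<longrightarrow> Im (g (s, t)) = Im (g (\<tau>', c))"
       "Im (g (\<tau>', c)) - Im (g (b, \<tau>)) = lturn ds"
      by blast
    let ?e = "\<gamma> b - \<gamma> a" and ?f = "\<gamma> \<tau> - \<gamma> b"
    have e0: "?e \<noteq> 0" using cons.hyps(2) by simp
    have sub': "continuous_on {b..\<tau>} \<gamma>" "inj_on \<gamma> {b..\<tau>}" "inj_on \<gamma> {a..\<tau>}"
    proof -
      have s: "{b..\<tau>} \<subseteq> {a..c}" "{a..\<tau>} \<subseteq> {a..c}" using IH(2) cons.hyps(1) by auto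
      show "continuous_on {b..\<tau>} \<gamma>" "inj_on \<gamma> {b..\<tau>}" "inj_on \<gamma> {a..\<tau>}"
        using continuous_on_subset[OF cons.prems(1)] inj_on_subset[OF cons.prems(2)] s by blast+
    qed
    have f0: "?f \<noteq> 0" using IH(1) inj_onD[OF sub'(2), of \<tau> b] by auto
    \<comment> \<open>With \<open>s\<close> on the first edge and \<open>t\<close> on the next, the
      secant is a nonnegative combination of the two edge vectors and never points against the first
      one. So the principal logarithm of its quotient by the first edge vector follows
      \<open>g\<close>, and the secant angle changes from one edge to the next by exactly the
      \<open>Arg\<close> that \<open>lturn\<close> sums.\<close>
    let ?S = "{a..b} \<times> {b..\<tau>} \<inter> {x. inner (1, - 1) x < (0::real)}"
    have S: "(s, t) \<in> ?S \<longleftrightarrow> a \<le> s \<and> s \<le> b \<and> b \<le> t \<and> t \<le> \<tau> \<and> s < t" for s t by auto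
    let ?h = "\<lambda>(s, t). (\<gamma> t - \<gamma> s) / ?e"
    have "g (a, b) - Ln (?h (a, b)) = g (b, \<tau>) - Ln (?h (b, \<tau>))"
    proof (rule log_minus_Ln_const[of ?S g ?h ?e])
      show "connected ?S" by (intro convex_connected convex_Int convex_Times convex_halfspace_lt) auto
      show "continuous_on ?S g"
      proof (rule continuous_on_subset)
        show "continuous_on {(s, t). a \<le> s \<and> s < t \<and> t \<le> c} g"
          using cons.prems(3) by (simp add: secant_log_def)
      qed (use IH(2) in auto)
      have "continuous_on ?S (\<lambda>p. (\<lambda>(s, t). \<gamma> t - \<gamma> s) p / ?e)"
      proof (intro continuous_on_divide continuous_on_const)
        show "continuous_on ?S (\<lambda>(s, t). \<gamma> t - \<gamma> s)"
          by (rule continuous_on_secant[OF cons.prems(1)]) (use IH(2) cons.hyps(1) in auto)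
      qed (use e0 in auto)
      then show "continuous_on ?S ?h" by (simp add: case_prod_beta)
      show "exp (g x) = ?e * ?h x" if "x \<in> ?S" for x
      proof -
        from that obtain s t where x: "x = (s, t)" "a \<le> s" "s < t" "t \<le> c" using IH(2) by auto
        then have "\<gamma> t - \<gamma> s = exp (g (s, t))" using cons.prems(3) by (simp add: secant_log_def)
        then show ?thesis using e0 x by simp
      qed
      show "?h x \<notin> \<real>\<^sub>\<le>\<^sub>0" if "x \<in> ?S" for x
      proof
        assume neg: "?h x \<in> \<real>\<^sub>\<le>\<^sub>0"
        from that obtain s t where x: "x = (s, t)" "a \<le> s" "s \<le> b" "b \<le> t" "t \<le> \<tau>" "s < t" by auto
        obtain p where p: "0 \<le> p" "s < b \<longrightarrow> 0 < p" "\<gamma> b - \<gamma> s = of_real p * ?e"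
        proof (cases "s = b")
          case False
          then have "s < b" using x by simp
          then show ?thesis
            using segment_path_monotone[OF sub(1,2) cons.hyps(1,3) x(2), of b] that by (metis less_imp_le order_refl)
        qed (use that[of 0] in auto)
        obtain q where q: "0 \<le> q" "b < t \<longrightarrow> 0 < q" "\<gamma> t - \<gamma> b = of_real q * ?f"
        proof (cases "t = b")
          case False
          then have "b < t" using x by simp
          then show ?thesis
            using segment_path_monotone[OF sub'(1,2) IH(1,6) order_refl _ x(5)] that by (metis less_imp_le)
        qed (use that[of 0] in auto)
        have h: "?h x = of_real p + of_real q * (?f / ?e)"
        proof -
          have "\<gamma> t - \<gamma> s = (\<gamma> b - \<gamma> s) + (\<gamma> t - \<gamma> b)" by simp
          then have "\<gamma> t - \<gamma> s = of_real p * ?e + of_real q * ?f" unfolding p(3) q(3) .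
          then show ?thesis using x e0 by (simp add: add_divide_distrib)
        qed
        obtain r where r: "r \<le> 0" "?h x = of_real r" using neg by (auto elim: nonpos_Reals_cases)
        have "q \<noteq> 0"
        proof
          assume "q = 0"
          then have "t = b" using q x by auto
          then have "0 < p" using p x by auto
          moreover have "p = r" using h r \<open>q = 0\<close> by (metis add.right_neutral mult_zero_left of_real_0 of_real_eq_iff)
          ultimately show False using r by simp
        qed
        then have "?f / ?e = of_real ((r - p) / q)"
        proof -
          have "of_real q * (?f / ?e) = of_real (r - p)"
            using h r(2) by (metis add_diff_cancel_left' of_real_diff)
          moreover have "of_real q \<noteq> (0::complex)" using \<open>q \<noteq> 0\<close> by simp
          ultimately show ?thesis by (metis nonzero_mult_div_cancel_left of_real_divide)
        qed
        then have fe: "?f = of_real ((r - p) / q) * ?e" using e0 by (simp add: field_simps)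
        have "(r - p) / q \<noteq> 0" using fe f0 by auto
        moreover have "(r - p) / q \<le> 0" using r p q by (simp add: divide_nonpos_nonneg)
        ultimately have "0 < - ((r - p) / q)" by linarith
        moreover have "?f = - of_real (- ((r - p) / q)) * ?e" using fe by simp
        ultimately show False
          using no_backtracking[OF sub'(3) cons.hyps(1) IH(1) cons.hyps(3) IH(6)] by blast
      qed
      show "(a, b) \<in> ?S" "(b, \<tau>) \<in> ?S" unfolding S using cons.hyps(1) IH(1) by simp_all
    qed
    then have "g (b, \<tau>) - g (a, b) = Ln (?f / ?e)" using e0 by (simp add: algebra_simps)
    then have "Im (g (b, \<tau>)) - Im (g (a, b)) = Arg (?f / ?e)"
      using f0 e0 by (metis Arg_eq_Im_Ln divide_eq_0_iff minus_complex.sel(2))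
    then have turn: "Im (g (\<tau>', c)) - Im (g (a, b)) = lturn (?e # ds)"
      using IH(5,10) pl_dirs_nonempty[OF cons.hyps(4)] by (simp add: lturn_Cons)
    have *: "\<forall>s t. a \<le> s \<and> s < t \<and> t \<le> b \<longrightarrow> Im (g (s, t)) = Im (g (a, b))"
      using piece[OF cons.hyps(1) sub(1-3) cons.hyps(3)] by blast
    have l: "last (?e # ds) = \<gamma> c - \<gamma> \<tau>'" "a \<le> \<tau>'" "b \<le> c"
      using IH(3,7) pl_dirs_nonempty[OF cons.hyps(4)] cons.hyps(1) bc by simp_all
    show ?case
      by (intro exI[of _ b] exI[of _ \<tau>'] conjI) (rule list.sel(1) turn l IH(4,9) cons.hyps(1,3) *)+
  qed
qed

text \<open>Both subdivisions read their end directions and their turning off one secant logarithm,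
  whose imaginary part is constant near either end. This frees the turning from the vertices chosen
  by \<open>SOME\<close> in \<open>pl_points\<close> and allows further cutting.\<close>

lemma turn_equivI:
  assumes "pl_dirs \<gamma> a b ds" "pl_dirs \<gamma> a b ds'" "continuous_on {a..b} \<gamma>" "inj_on \<gamma> {a..b}"
  shows "turn_equiv ds ds'"
proof -
  obtain g where g: "secant_log \<gamma> a b g" using secant_log_exists assms(3,4) by blast
  have angle: "\<exists>\<tau> \<tau>'. a < \<tau> \<and> \<tau> \<le> b \<and> a \<le> \<tau>' \<and> \<tau>' < b \<and>
     sgn (hd ds) = cis (Im (g (a, \<tau>))) \<and> sgn (last ds) = cis (Im (g (\<tau>', b))) \<and>
     (\<forall>t. a < t \<and> t \<le> \<tau> \<longrightarrow> Im (g (a, t)) = Im (g (a, \<tau>))) \<and>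
     (\<forall>s. \<tau>' \<le> s \<and> s < b \<longrightarrow> Im (g (s, b)) = Im (g (\<tau>', b))) \<and>
     Im (g (\<tau>', b)) - Im (g (a, \<tau>)) = lturn ds" if ds: "pl_dirs \<gamma> a b ds" for ds
  proof -
    obtain \<tau> \<tau>' where T: "a < \<tau>" "\<tau> \<le> b" "a \<le> \<tau>'" "\<tau>' < b" "hd ds = \<gamma> \<tau> - \<gamma> a" "last ds = \<gamma> b - \<gamma> \<tau>'"
      "\<forall>s t. a \<le> s \<and> s < t \<and> t \<le> \<tau> \<longrightarrow> Im (g (s, t)) = Im (g (a, \<tau>))"
      "\<forall>s t. \<tau>' \<le> s \<and> s < t \<and> t \<le> b \<longrightarrow> Im (g (s, t)) = Im (g (\<tau>', b))"
      "Im (g (\<tau>', b)) - Im (g (a, \<tau>)) = lturn ds"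
      using lturn_eq_secant_angle[OF ds assms(3,4) g] by blast
    have ex: "\<gamma> t - \<gamma> s = exp (g (s, t))" if "a \<le> s" "s < t" "t \<le> b" for s t
      using g that unfolding secant_log_def by blast
    have "hd ds = exp (g (a, \<tau>))" "last ds = exp (g (\<tau>', b))"
      unfolding T(5,6) by (rule ex[OF order_refl T(1,2)], rule ex[OF T(3,4) order_refl])
    moreover have "sgn (exp z) = cis (Im z)" for z
      by (simp add: sgn_eq exp_eq_polar norm_mult)
    ultimately have "sgn (hd ds) = cis (Im (g (a, \<tau>)))" "sgn (last ds) = cis (Im (g (\<tau>', b)))" by simp_all
    moreover have "\<forall>t. a < t \<and> t \<le> \<tau> \<longrightarrow> Im (g (a, t)) = Im (g (a, \<tau>))"
      "\<forall>s. \<tau>' \<le> s \<and> s < b \<longrightarrow> Im (g (s, b)) = Im (g (\<tau>', b))"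
      using T(7)[rule_format, of a] T(8)[rule_format, of _ b] by blast+
    ultimately show ?thesis using T(1-4,9) by (intro exI[of _ \<tau>] exI[of _ \<tau>'] conjI)
  qed
  obtain \<tau> \<tau>' where 1: "a < \<tau>" "\<tau> \<le> b" "a \<le> \<tau>'" "\<tau>' < b"
     "sgn (hd ds) = cis (Im (g (a, \<tau>)))" "sgn (last ds) = cis (Im (g (\<tau>', b)))"
     "\<And>t. a < t \<Longrightarrow> t \<le> \<tau> \<Longrightarrow> Im (g (a, t)) = Im (g (a, \<tau>))"
     "\<And>s. \<tau>' \<le> s \<Longrightarrow> s < b \<Longrightarrow> Im (g (s, b)) = Im (g (\<tau>', b))"
     "Im (g (\<tau>', b)) - Im (g (a, \<tau>)) = lturn ds" using angle[OF assms(1)] by blast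
  obtain \<sigma> \<sigma>' where 2: "a < \<sigma>" "\<sigma> \<le> b" "a \<le> \<sigma>'" "\<sigma>' < b"
     "sgn (hd ds') = cis (Im (g (a, \<sigma>)))" "sgn (last ds') = cis (Im (g (\<sigma>', b)))"
     "\<And>t. a < t \<Longrightarrow> t \<le> \<sigma> \<Longrightarrow> Im (g (a, t)) = Im (g (a, \<sigma>))"
     "\<And>s. \<sigma>' \<le> s \<Longrightarrow> s < b \<Longrightarrow> Im (g (s, b)) = Im (g (\<sigma>', b))"
     "Im (g (\<sigma>', b)) - Im (g (a, \<sigma>)) = lturn ds'" using angle[OF assms(2)] by blast
  have s: "Im (g (a, \<tau>)) = Im (g (a, \<sigma>))"
    using 1(7)[of "min \<tau> \<sigma>"] 2(7)[of "min \<tau> \<sigma>"] 1(1) 2(1) by simp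
  have e: "Im (g (\<tau>', b)) = Im (g (\<sigma>', b))"
    using 1(8)[of "max \<tau>' \<sigma>'"] 2(8)[of "max \<tau>' \<sigma>'"] 1(4) 2(4) by simp
  show ?thesis
    unfolding turn_equiv_def 1(5,6) 2(5,6) s e 1(9)[symmetric] 2(9)[symmetric]
    using pl_dirs_nonzero assms(1,2) pl_dirs_nonempty by auto
qed

text \<open>\<open>end_turns \<gamma> ds \<alpha> \<beta>\<close> splits the turning of an arc at its chord: from the initial direction to
  the chord, and from the chord to the final direction.\<close>

definition end_turns :: "(real \<Rightarrow> complex) \<Rightarrow> complex list \<Rightarrow> real \<Rightarrow> real \<Rightarrow> bool" where
  "end_turns \<gamma> ds \<alpha> \<beta> \<longleftrightarrow> lturn ds = \<alpha> + \<beta> \<and>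
     (\<forall>g. secant_log \<gamma> 0 1 g \<longrightarrow>
        (\<exists>\<tau>>0. \<tau> \<le> 1 \<and> (\<forall>t. 0 < t \<and> t \<le> \<tau> \<longrightarrow> Im (g (0, 1)) - Im (g (0, t)) = \<alpha>)) \<and>
        (\<exists>\<tau><1. 0 \<le> \<tau> \<and> (\<forall>s. \<tau> \<le> s \<and> s < 1 \<longrightarrow> Im (g (s, 1)) - Im (g (0, 1)) = \<beta>)))"

lemma end_turns_exist:
  assumes "arc \<gamma>" "pl_dirs \<gamma> 0 1 ds"
  obtains \<alpha> \<beta> where "end_turns \<gamma> ds \<alpha> \<beta>"
proof -
  have c: "continuous_on {0..1} \<gamma>" "inj_on \<gamma> {0..1}"
    using assms(1) by (auto simp: arc_def path_def)
  obtain g where g: "secant_log \<gamma> 0 1 g" using secant_log_exists c by blast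
  obtain \<tau> \<tau>' where T: "0 < \<tau>" "\<tau> \<le> 1" "0 \<le> \<tau>'" "\<tau>' < 1"
    "\<And>s t. 0 \<le> s \<and> s < t \<and> t \<le> \<tau> \<longrightarrow> Im (g (s, t)) = Im (g (0, \<tau>))"
    "\<And>s t. \<tau>' \<le> s \<and> s < t \<and> t \<le> 1 \<longrightarrow> Im (g (s, t)) = Im (g (\<tau>', 1))"
    "Im (g (\<tau>', 1)) - Im (g (0, \<tau>)) = lturn ds"
    using lturn_eq_secant_angle[OF assms(2) c g] by blast
  have "end_turns \<gamma> ds (Im (g (0, 1)) - Im (g (0, \<tau>))) (Im (g (\<tau>', 1)) - Im (g (0, 1)))"
    unfolding end_turns_def
  proof (intro conjI allI impI)
    fix h assume h: "secant_log \<gamma> 0 1 h"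
    have d: "Im (h (0, 1)) - Im (g (0, 1)) = Im (h (s, t)) - Im (g (s, t))" if "0 \<le> s" "s < t" "t \<le> 1" for s t
      using secant_log_unique[OF h g order_refl zero_less_one order_refl that] by (metis minus_complex.sel(2))
    show "\<exists>\<sigma>>0. \<sigma> \<le> 1 \<and> (\<forall>t. 0 < t \<and> t \<le> \<sigma> \<longrightarrow>
        Im (h (0, 1)) - Im (h (0, t)) = Im (g (0, 1)) - Im (g (0, \<tau>)))"
    proof (intro exI[of _ \<tau>] conjI allI impI T)
      fix t assume t: "0 < t \<and> t \<le> \<tau>"
      then show "Im (h (0, 1)) - Im (h (0, t)) = Im (g (0, 1)) - Im (g (0, \<tau>))"
        using d[of 0 t] T(5)[of 0 t] T(2) by linarith
    qed
    show "\<exists>\<sigma><1. 0 \<le> \<sigma> \<and> (\<forall>s. \<sigma> \<le> s \<and> s < 1 \<longrightarrow>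
        Im (h (s, 1)) - Im (h (0, 1)) = Im (g (\<tau>', 1)) - Im (g (0, 1)))"
    proof (intro exI[of _ \<tau>'] conjI allI impI T)
      fix s assume s: "\<tau>' \<le> s \<and> s < 1"
      then show "Im (h (s, 1)) - Im (h (0, 1)) = Im (g (\<tau>', 1)) - Im (g (0, 1))"
        using d[of s 1] T(6)[of s 1] T(3) by linarith
    qed
  qed (use T(7) in simp)
  then show ?thesis by (rule that)
qed

lemma pl_dirs_joinpaths:
  assumes "pl_dirs \<gamma>1 0 1 ds1" "pl_dirs \<gamma>2 0 1 ds2" "\<gamma>1 1 = \<gamma>2 0"
  shows "pl_dirs (\<gamma>1 +++ \<gamma>2) 0 (1/2) ds1" "pl_dirs (\<gamma>1 +++ \<gamma>2) (1/2) 1 ds2"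
    "pl_dirs (\<gamma>1 +++ \<gamma>2) 0 1 (ds1 @ ds2)"
proof -
  show 1: "pl_dirs (\<gamma>1 +++ \<gamma>2) 0 (1/2) ds1"
    using pl_dirs_reparam[OF assms(1), of "1/2" "\<gamma>1 +++ \<gamma>2" 0] by (simp add: joinpaths_def)
  have "(\<gamma>1 +++ \<gamma>2) (1/2 * x + 1/2) = \<gamma>2 x" if "x \<in> {0..1}" for x
    using that assms(3) by (cases "x = 0") (auto simp: joinpaths_def field_simps)
  then show 2: "pl_dirs (\<gamma>1 +++ \<gamma>2) (1/2) 1 ds2"
    using pl_dirs_reparam[OF assms(2), of "1/2" "\<gamma>1 +++ \<gamma>2" "1/2"] by simp
  show "pl_dirs (\<gamma>1 +++ \<gamma>2) 0 1 (ds1 @ ds2)" by (rule pl_dirs_append[OF 1 2])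
qed

text \<open>In the secant triangle of the joined path, the turn from the first chord to the second
  leads from \<open>(0, 1/2)\<close> to \<open>(1/2, 1)\<close>. Going there through
  \<open>(0, 1)\<close> first winds \<open>\<gamma>2\<close> around the start of
  \<open>\<gamma>1\<close> and then \<open>\<gamma>1\<close> around the end of
  \<open>\<gamma>2\<close>.\<close>

lemma junction_turn:
  assumes arc: "arc (\<gamma>1 +++ \<gamma>2)" and join: "\<gamma>1 1 = \<gamma>2 0"
    and pl: "pl_dirs \<gamma>1 0 1 ds1" "pl_dirs \<gamma>2 0 1 ds2"
    and ends: "end_turns \<gamma>1 ds1 \<alpha>1 \<beta>1" "end_turns \<gamma>2 ds2 \<alpha>2 \<beta>2"
  shows "\<beta>1 + Arg (hd ds2 / last ds1) + \<alpha>2 =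
    2 * pi * Re (winding_number \<gamma>2 (\<gamma>1 0) + winding_number \<gamma>1 (\<gamma>2 1))"
proof -
  let ?W = "\<gamma>1 +++ \<gamma>2"
  have W1: "?W (s / 2) = \<gamma>1 s" if "s \<le> 1" for s using that by (simp add: joinpaths_def)
  have W2: "?W ((1 + s) / 2) = \<gamma>2 s" if "0 \<le> s" for s
    using that join by (cases "s = 0") (auto simp: joinpaths_def field_simps)
  have c: "continuous_on {0..1} ?W" "inj_on ?W {0..1}" using arc by (auto simp: arc_def path_def)
  have sub: "continuous_on {0..1/2} ?W" "inj_on ?W {0..1/2}" "continuous_on {1/2..1} ?W" "inj_on ?W {1/2..1}"
    by (rule continuous_on_subset[OF c(1)] inj_on_subset[OF c(2)]; simp)+
  obtain G where G: "secant_log ?W 0 1 G" using secant_log_exists c by blast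
  have G': "secant_log ?W 0 (1/2) G" "secant_log ?W (1/2) 1 G" using secant_log_subset[OF G] by auto
  note pls = pl_dirs_joinpaths[OF pl join]
  obtain a a' where A: "0 < a" "a' < 1"
    "\<And>s t. 0 \<le> s \<and> s < t \<and> t \<le> a \<longrightarrow> Im (G (s, t)) = Im (G (0, a))"
    "\<And>s t. a' \<le> s \<and> s < t \<and> t \<le> 1 \<longrightarrow> Im (G (s, t)) = Im (G (a', 1))"
    "Im (G (a', 1)) - Im (G (0, a)) = lturn (ds1 @ ds2)"
    using lturn_eq_secant_angle[OF pls(3) c G] by blast
  obtain b b' where B: "0 < b" "b' < 1/2"
    "\<And>s t. 0 \<le> s \<and> s < t \<and> t \<le> b \<longrightarrow> Im (G (s, t)) = Im (G (0, b))"
    "\<And>s t. b' \<le> s \<and> s < t \<and> t \<le> 1/2 \<longrightarrow> Im (G (s, t)) = Im (G (b', 1/2))"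
    "Im (G (b', 1/2)) - Im (G (0, b)) = lturn ds1"
    using lturn_eq_secant_angle[OF pls(1) sub(1,2) G'(1)] by blast
  obtain d d' where D: "1/2 < d" "d' < 1"
    "\<And>s t. 1/2 \<le> s \<and> s < t \<and> t \<le> d \<longrightarrow> Im (G (s, t)) = Im (G (1/2, d))"
    "\<And>s t. d' \<le> s \<and> s < t \<and> t \<le> 1 \<longrightarrow> Im (G (s, t)) = Im (G (d', 1))"
    "Im (G (d', 1)) - Im (G (1/2, d)) = lturn ds2"
    using lturn_eq_secant_angle[OF pls(2) sub(3,4) G'(2)] by blast
  have s: "Im (G (0, a)) = Im (G (0, b))"
    using A(3)[of 0 "min a b"] B(3)[of 0 "min a b"] A(1) B(1) by simp
  have e: "Im (G (a', 1)) = Im (G (d', 1))"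
    using A(4)[of "max a' d'" 1] D(4)[of "max a' d'" 1] A(2) D(2) by simp
  \<comment> \<open>Comparing the turning of the whole with that of its halves isolates the angle at
    the junction.\<close>
  have J: "Arg (hd ds2 / last ds1) = Im (G (1/2, d)) - Im (G (b', 1/2))"
    using A(5) B(5) D(5) s e pl by (simp add: lturn_append pl_dirs_nonempty)
  define g1 where "g1 = (\<lambda>(s, t). G (s / 2, t / 2))"
  define g2 where "g2 = (\<lambda>(s, t). G ((1 + s) / 2, (1 + t) / 2))"
  have cG: "continuous_on {(s, t). 0 \<le> s \<and> s < t \<and> t \<le> 1} G"
    and eG: "\<And>s t. 0 \<le> s \<Longrightarrow> s < t \<Longrightarrow> t \<le> 1 \<Longrightarrow> ?W t - ?W s = exp (G (s, t))"
    using G by (auto simp: secant_log_def)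
  have g1: "secant_log \<gamma>1 0 1 g1"
    unfolding secant_log_def
  proof (intro conjI allI impI)
    show "continuous_on {(s, t). 0 \<le> s \<and> s < t \<and> t \<le> 1} g1"
      unfolding g1_def case_prod_beta
      by (rule continuous_on_compose2[OF cG]) (auto intro!: continuous_intros)
    show "\<gamma>1 t - \<gamma>1 s = exp (g1 (s, t))" if "0 \<le> s \<and> s < t \<and> t \<le> 1" for s t
      using eG[of "s / 2" "t / 2"] W1[of s] W1[of t] that by (simp add: g1_def)
  qed
  have g2: "secant_log \<gamma>2 0 1 g2"
    unfolding secant_log_def
  proof (intro conjI allI impI)
    show "continuous_on {(s, t). 0 \<le> s \<and> s < t \<and> t \<le> 1} g2"
      unfolding g2_def case_prod_beta
      by (rule continuous_on_compose2[OF cG]) (auto intro!: continuous_intros)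
    show "\<gamma>2 t - \<gamma>2 s = exp (g2 (s, t))" if "0 \<le> s \<and> s < t \<and> t \<le> 1" for s t
      using eG[of "(1 + s) / 2" "(1 + t) / 2"] W2[of s] W2[of t] that by (simp add: g2_def)
  qed
  obtain u where u: "u < 1" "0 \<le> u" "\<And>s. u \<le> s \<and> s < 1 \<longrightarrow> Im (g1 (s, 1)) - Im (g1 (0, 1)) = \<beta>1"
    using ends(1) g1 unfolding end_turns_def by blast
  obtain v where v: "0 < v" "v \<le> 1" "\<And>t. 0 < t \<and> t \<le> v \<longrightarrow> Im (g2 (0, 1)) - Im (g2 (0, t)) = \<alpha>2"
    using ends(2) g2 unfolding end_turns_def by blast
  have b1: "\<beta>1 = Im (G (b', 1/2)) - Im (G (0, 1/2))"
  proof -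
    define s where "s = max u (2 * b')"
    have "u \<le> s" "s < 1" "b' \<le> s / 2" "s / 2 < 1 / 2" using u B(2) by (auto simp: s_def)
    then show ?thesis using u(3)[of s] B(4)[of "s / 2" "1/2"] by (simp add: g1_def)
  qed
  have a2: "\<alpha>2 = Im (G (1/2, 1)) - Im (G (1/2, d))"
  proof -
    define t where "t = min v (2 * d - 1)"
    have "0 < t" "t \<le> v" "1/2 < (1 + t) / 2" "(1 + t) / 2 \<le> d" using v D(1) by (auto simp: t_def)
    then show ?thesis using v(3)[of t] D(3)[of "1/2" "(1 + t) / 2"] by (simp add: g2_def)
  qed
  have w2: "winding_number \<gamma>2 (\<gamma>1 0) = (G (0, 1) - G (0, 1/2)) / (2 * of_real pi * \<i>)"
  proof -
    have "winding_number \<gamma>2 (\<gamma>1 0) = (G (0, (1 + 1) / 2) - G (0, (1 + 0) / 2)) / (2 * of_real pi * \<i>)"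
    proof (rule winding_number_exp_log[OF cG, of "\<lambda>t. (0, (1 + t) / 2)"])
      fix t :: real assume "t \<in> {0..1}"
      then show "\<gamma>2 t - \<gamma>1 0 = exp (G (0, (1 + t) / 2))"
        using eG[of 0 "(1 + t) / 2"] W1[of 0] W2[of t] by simp
    qed (auto intro!: continuous_intros)
    then show ?thesis by simp
  qed
  have w1: "winding_number \<gamma>1 (\<gamma>2 1) = (G (1/2, 1) - G (0, 1)) / (2 * of_real pi * \<i>)"
  proof -
    have "winding_number \<gamma>1 (\<gamma>2 1) =
      ((G (1 / 2, 1) + \<i> * of_real pi) - (G (0 / 2, 1) + \<i> * of_real pi)) / (2 * of_real pi * \<i>)"
    proof (rule winding_number_exp_log[of _ "\<lambda>p. G p + \<i> * of_real pi" "\<lambda>s. (s / 2, 1)"])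
      show "continuous_on {(s, t). 0 \<le> s \<and> s < t \<and> t \<le> 1} (\<lambda>p. G p + \<i> * of_real pi)"
        by (intro continuous_on_add cG continuous_on_const)
      fix s :: real assume "s \<in> {0..1}"
      then have "\<gamma>2 1 - \<gamma>1 s = exp (G (s / 2, 1))"
        using eG[of "s / 2" 1] W1[of s] W2[of 1] by simp
      then show "\<gamma>1 s - \<gamma>2 1 = exp (G (s / 2, 1) + \<i> * of_real pi)"
        by (simp add: exp_add algebra_simps)
    qed (auto intro!: continuous_intros)
    then show ?thesis by simp
  qed
  have R: "2 * pi * Re (z / (2 * of_real pi * \<i>)) = Im z" for z
    by (simp add: Re_divide power2_eq_square)
  have "2 * pi * Re (winding_number \<gamma>2 (\<gamma>1 0) + winding_number \<gamma>1 (\<gamma>2 1)) =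
     Im (G (0, 1) - G (0, 1/2)) + Im (G (1/2, 1) - G (0, 1))"
    unfolding w1 w2 plus_complex.sel distrib_left R ..
  then show ?thesis unfolding b1 a2 J by simp
qed

text \<open>The turning of each arc is split at its chord and regrouped around the junctions. By
  \<open>junction_turn\<close> every junction then contributes the windings
  \<open>A i (Suc i)\<close> and \<open>A (i + 2) i\<close> of adjacent arcs, whose sum
  \<open>hopf_sum\<close> evaluates.\<close>

lemma closed_chain_turning:
  fixes \<gamma> :: "nat \<Rightarrow> real \<Rightarrow> complex"
  assumes N: "3 \<le> N"
    and pl: "\<And>i. i < N \<Longrightarrow> pl_dirs (\<gamma> i) 0 1 (ds i)"
    and next': "\<And>i. i < N \<Longrightarrow> \<gamma> i 1 = \<gamma> (Suc i mod N) 0"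
    and arcs: "\<And>i. i < N \<Longrightarrow> arc (\<gamma> i)" "\<And>i. i < N \<Longrightarrow> arc (\<gamma> i +++ \<gamma> (Suc i mod N))"
    and off: "\<And>i j. i < N \<Longrightarrow> j < N \<Longrightarrow> i \<noteq> j \<Longrightarrow> i \<noteq> Suc j mod N \<Longrightarrow> \<gamma> i 0 \<notin> path_image (\<gamma> j)"
  obtains m :: int where "cturn (concat (map ds [0..<N])) =
    2 * pi * (1 + 2 * of_int m - (\<Sum>(i, j)\<in>nonadjacent_pairs N. Re (cross_index (\<gamma> i) (\<gamma> j))))"
proof -
  define A where "A i j = winding_number (\<gamma> (j mod N)) (\<gamma> (i mod N) 0)" for i j
  define c where "c i = \<gamma> (i mod N) 0" for i
  have "0 < N" using N by simp
  have nxt: "\<gamma> (j mod N) 1 = c (Suc j)" for j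
    using next'[of "j mod N"] \<open>0 < N\<close> by (simp add: c_def mod_Suc_eq)
  have inj0: "\<gamma> i 0 \<noteq> \<gamma> i 1" if "i < N" for i
    using arc_distinct_ends[OF arcs(1)[OF that]] by (auto simp: pathstart_def pathfinish_def)
  obtain m :: int where m: "(\<Sum>i<N. A i (Suc i) + A (i + 2) i) = of_int (1 + 2 * m)
      - (\<Sum>(i, j)\<in>nonadjacent_pairs N. A i j + A (Suc j) i - A (Suc i) j - A j i)"
  proof (rule hopf_sum[OF N, of A c])
    fix i j assume ij: "i < N" "j < N" "i \<noteq> j"
    show "c i \<noteq> c j"
    proof (cases "i = Suc j mod N")
      case True
      then show ?thesis using inj0[OF ij(2)] next'[OF ij(2)] ij by (simp add: c_def)
    next
      case False
      have "\<gamma> j 0 \<in> path_image (\<gamma> j)" by (simp add: path_image_def)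
      then show ?thesis using off[OF ij False] ij by (auto simp: c_def)
    qed
    assume "i \<noteq> Suc j mod N"
    then have "\<gamma> i 0 \<notin> path_image (\<gamma> j)" using off ij by simp
    then show "c (Suc j) - c i = exp (2 * of_real pi * \<i> * A i j) * (c j - c i)"
      using winding_number_exp_2pi[OF arc_imp_path[OF arcs(1)[OF ij(2)]], of "\<gamma> i 0"] nxt[of j] ij
      by (simp add: A_def c_def pathfinish_def pathstart_def)
  qed (auto simp: A_def c_def)
  have cross: "A i j + A (Suc j) i - A (Suc i) j - A j i = cross_index (\<gamma> i) (\<gamma> j)" if "i < N" "j < N" for i j
    using nxt[of i] nxt[of j] that by (simp add: cross_index_def A_def c_def)
  have "\<exists>\<alpha> \<beta>. end_turns (\<gamma> i) (ds i) \<alpha> \<beta>" if "i < N" for i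
    using end_turns_exist[OF arcs(1)[OF that] pl[OF that]] by blast
  then obtain \<alpha> \<beta> where ab: "\<And>i. i < N \<Longrightarrow> end_turns (\<gamma> i) (ds i) (\<alpha> i) (\<beta> i)" by metis
  have turn: "\<beta> i + Arg (hd (ds (Suc i mod N)) / last (ds i)) + \<alpha> (Suc i mod N) = 2 * pi * Re (A i (Suc i) + A (i + 2) i)"
    if "i < N" for i
  proof -
    have n: "Suc i mod N < N" using \<open>0 < N\<close> by simp
    have "\<gamma> (Suc i mod N) 1 = \<gamma> ((i + 2) mod N) 0" using nxt[of "Suc i"] by (simp add: c_def)
    then show ?thesis
      using junction_turn[OF arcs(2)[OF that] next'[OF that] pl[OF that] pl[OF n] ab[OF that] ab[OF n]] that
      by (simp add: A_def)
  qed
  have shift: "(\<Sum>i<N. f (Suc i mod N)) = sum f {..<N}" for f :: "nat \<Rightarrow> real"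
  proof -
    obtain n where n: "N = Suc n" using \<open>0 < N\<close> by (cases N) auto
    have "(\<Sum>i<N. f (Suc i mod N)) = (\<Sum>i<n. f (Suc i)) + f 0"
      using n by simp
    also have "\<dots> = sum f {..<N}" unfolding n sum.lessThan_Suc_shift by simp
    finally show ?thesis .
  qed
  have "cturn (concat (map ds [0..<N])) = (\<Sum>i<N. lturn (ds i) + Arg (hd (ds (Suc i mod N)) / last (ds i)))"
  proof -
    have "cturn (concat (map ds [0..<N])) = (\<Sum>i<length (map ds [0..<N]). lturn (map ds [0..<N] ! i)
      + Arg (hd (map ds [0..<N] ! (Suc i mod length (map ds [0..<N]))) / last (map ds [0..<N] ! i)))"
      using \<open>0 < N\<close> pl pl_dirs_nonempty by (intro cturn_concat) force+
    also have "\<dots> = (\<Sum>i<N. lturn (ds i) + Arg (hd (ds (Suc i mod N)) / last (ds i)))"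
      using \<open>0 < N\<close> by (intro sum.cong) auto
    finally show ?thesis .
  qed
  also have "\<dots> = (\<Sum>i<N. \<alpha> i) + (\<Sum>i<N. \<beta> i + Arg (hd (ds (Suc i mod N)) / last (ds i)))"
    unfolding sum.distrib[symmetric] using ab by (intro sum.cong) (auto simp: end_turns_def)
  also have "\<dots> = (\<Sum>i<N. \<beta> i + Arg (hd (ds (Suc i mod N)) / last (ds i)) + \<alpha> (Suc i mod N))"
    unfolding shift[of \<alpha>, symmetric] by (simp add: sum.distrib)
  also have "\<dots> = (\<Sum>i<N. 2 * pi * Re (A i (Suc i) + A (i + 2) i))"
    by (rule sum.cong[OF refl]) (use turn in simp)
  also have "\<dots> = 2 * pi * Re (\<Sum>i<N. A i (Suc i) + A (i + 2) i)"
    by (simp add: sum_distrib_left)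
  also have "\<dots> = 2 * pi * (1 + 2 * of_int m - (\<Sum>(i, j)\<in>nonadjacent_pairs N. Re (cross_index (\<gamma> i) (\<gamma> j))))"
  proof -
    have "(\<Sum>(i, j)\<in>nonadjacent_pairs N. A i j + A (Suc j) i - A (Suc i) j - A j i) =
       (\<Sum>(i, j)\<in>nonadjacent_pairs N. cross_index (\<gamma> i) (\<gamma> j))"
      by (intro sum.cong refl) (auto simp: nonadjacent_pairs_def cross)
    then show ?thesis unfolding m by (simp add: case_prod_beta)
  qed
  finally show ?thesis by (rule that)
qed

text \<open>Each arc ends where the next one starts, so windings around starts and ends cancel in
  the cyclic sum: two closed plane curves have intersection number 0.\<close>

lemma sum_cross_index_closed_chains:
  assumes "\<And>i. i < N \<Longrightarrow> \<gamma> i 1 = \<gamma> (Suc i mod N) 0" "\<And>j. j < M \<Longrightarrow> \<delta> j 1 = \<delta> (Suc j mod M) 0"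
  shows "(\<Sum>i<N. \<Sum>j<M. cross_index (\<gamma> i) (\<delta> j)) = 0"
proof -
  have shift: "(\<Sum>i<N. f (Suc i mod N)) = sum f {..<N}" for f :: "nat \<Rightarrow> complex" and N
  proof (cases N)
    case (Suc n)
    have "(\<Sum>i<N. f (Suc i mod N)) = (\<Sum>i<n. f (Suc i)) + f 0" using Suc by simp
    also have "\<dots> = sum f {..<N}" unfolding Suc sum.lessThan_Suc_shift by simp
    finally show ?thesis .
  qed simp
  have 1: "(\<Sum>i<N. winding_number (\<delta> j) (\<gamma> i 1)) = (\<Sum>i<N. winding_number (\<delta> j) (\<gamma> i 0))" for j
    using shift[of "\<lambda>i. winding_number (\<delta> j) (\<gamma> i 0)" N] assms(1) by simp
  have 2: "(\<Sum>j<M. winding_number (\<gamma> i) (\<delta> j 1)) = (\<Sum>j<M. winding_number (\<gamma> i) (\<delta> j 0))" for i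
    using shift[of "\<lambda>j. winding_number (\<gamma> i) (\<delta> j 0)" M] assms(2) by simp
  have "(\<Sum>i<N. \<Sum>j<M. cross_index (\<gamma> i) (\<delta> j)) =
     (\<Sum>i<N. \<Sum>j<M. winding_number (\<delta> j) (\<gamma> i 0) - winding_number (\<delta> j) (\<gamma> i 1))
     + (\<Sum>i<N. \<Sum>j<M. winding_number (\<gamma> i) (\<delta> j 1) - winding_number (\<gamma> i) (\<delta> j 0))"
    unfolding sum.distrib[symmetric] by (simp add: cross_index_def algebra_simps)
  also have "(\<Sum>i<N. \<Sum>j<M. winding_number (\<delta> j) (\<gamma> i 0) - winding_number (\<delta> j) (\<gamma> i 1)) = 0"
    by (subst sum.swap) (simp add: sum_subtractf 1)
  also have "(\<Sum>i<N. \<Sum>j<M. winding_number (\<gamma> i) (\<delta> j 1) - winding_number (\<gamma> i) (\<delta> j 0)) = 0"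
    by (simp add: sum_subtractf 2)
  finally show ?thesis by simp
qed

text \<open>The odd-numbered arcs \<open>Q\<close> carry all intersections; the even-numbered arcs \<open>B\<close> only separate them, so that
  intersecting arcs are never adjacent.\<close>

lemma alternating_chain_turning:
  fixes B Q :: "nat \<Rightarrow> real \<Rightarrow> complex"
  assumes M: "2 \<le> M"
    and pl: "\<And>k. k < M \<Longrightarrow> pl_dirs (B k) 0 1 (db k)" "\<And>k. k < M \<Longrightarrow> pl_dirs (Q k) 0 1 (dq k)"
    and ends: "\<And>k. k < M \<Longrightarrow> B k 1 = Q k 0" "\<And>k. k < M \<Longrightarrow> Q k 1 = B (Suc k mod M) 0"
    and arcs: "\<And>k. k < M \<Longrightarrow> arc (B k)" "\<And>k. k < M \<Longrightarrow> arc (Q k)"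
    and BQ: "\<And>k. k < M \<Longrightarrow> path_image (B k) \<inter> path_image (Q k) \<subseteq> {Q k 0}"
      "\<And>k. k < M \<Longrightarrow> path_image (Q k) \<inter> path_image (B (Suc k mod M)) \<subseteq> {Q k 1}"
    and disj: "\<And>j k. j < M \<Longrightarrow> k < M \<Longrightarrow> j \<noteq> k \<Longrightarrow> path_image (B j) \<inter> path_image (B k) = {}"
      "\<And>j k. j < M \<Longrightarrow> k < M \<Longrightarrow> j \<noteq> k \<Longrightarrow> j \<noteq> Suc k mod M \<Longrightarrow> path_image (B j) \<inter> path_image (Q k) = {}"
  obtains m :: int where "cturn (concat (map (\<lambda>k. db k @ dq k) [0..<M])) =
    2 * pi * (1 + 2 * of_int m - (\<Sum>(j, k)\<in>{(j, k). j < k \<and> k < M}. Re (cross_index (Q j) (Q k))))"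
proof -
  define \<gamma> where "\<gamma> i = (if even i then B (i div 2) else Q (i div 2))" for i :: nat
  define ds where "ds i = (if even i then db (i div 2) else dq (i div 2))" for i :: nat
  let ?N = "2 * M"
  have half: "i div 2 < M" if "i < ?N" for i using that by auto
  have even_next: "Suc i mod ?N = Suc i" "Suc i div 2 = i div 2" if "even i" "i < ?N" for i
  proof -
    have "Suc i < ?N" using that by presburger
    then show "Suc i mod ?N = Suc i" "Suc i div 2 = i div 2" using that by auto
  qed
  have odd_next: "even (Suc i mod ?N)" "(Suc i mod ?N) div 2 = Suc (i div 2) mod M" if "odd i" "i < ?N" for i
  proof -
    obtain k where k: "i = 2 * k + 1" using \<open>odd i\<close> by (elim oddE)
    have "Suc i mod ?N = 2 * (Suc k mod M)" unfolding k using mult_mod_right[of 2 "Suc k" M] by simp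
    then show "even (Suc i mod ?N)" "(Suc i mod ?N) div 2 = Suc (i div 2) mod M" using k by simp_all
  qed
  have start: "\<gamma> i 0 \<in> path_image (\<gamma> i)" "\<gamma> i 1 \<in> path_image (\<gamma> i)" for i by (auto simp: path_image_def)
  have arc: "arc (\<gamma> i)" if "i < ?N" for i using arcs half[OF that] by (simp add: \<gamma>_def)
  have nxt: "\<gamma> i 1 = \<gamma> (Suc i mod ?N) 0" if "i < ?N" for i
    using even_next[of i] odd_next[of i] ends half[OF that] that by (cases "even i") (simp_all add: \<gamma>_def)
  have adj: "path_image (\<gamma> i) \<inter> path_image (\<gamma> (Suc i mod ?N)) \<subseteq> {\<gamma> (Suc i mod ?N) 0}" if "i < ?N" for i
    unfolding nxt[OF that, symmetric]
    using even_next[of i] odd_next[of i] BQ half[OF that] ends that by (cases "even i") (simp_all add: \<gamma>_def)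
  have Suc_lt: "Suc i mod ?N < ?N" for i using M by simp
  have disjoint: "path_image (\<gamma> i) \<inter> path_image (\<gamma> j) = {}"
    if "i < ?N" "j < ?N" "i \<noteq> j" "j \<noteq> Suc i mod ?N" "i \<noteq> Suc j mod ?N" "even i \<or> even j" for i j
  proof -
    have ee: "path_image (\<gamma> i) \<inter> path_image (\<gamma> j) = {}" if "i < ?N" "j < ?N" "i \<noteq> j" "even i" "even j" for i j
    proof -
      have "i div 2 \<noteq> j div 2" using that by (metis dvd_mult_div_cancel)
      then show ?thesis using disj(1)[OF half half] that by (simp add: \<gamma>_def)
    qed
    have eo: "path_image (\<gamma> i) \<inter> path_image (\<gamma> j) = {}"
      if "i < ?N" "j < ?N" "j \<noteq> Suc i mod ?N" "i \<noteq> Suc j mod ?N" "even i" "odd j" for i j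
    proof -
      have "i div 2 \<noteq> j div 2"
      proof
        assume "i div 2 = j div 2"
        then have "j = Suc i" using that(5,6) by presburger
        then show False using even_next(1)[OF that(5,1)] that(3) by simp
      qed
      moreover have "i div 2 \<noteq> Suc (j div 2) mod M"
      proof
        assume "i div 2 = Suc (j div 2) mod M"
        then have "i div 2 = (Suc j mod ?N) div 2" using odd_next(2)[OF that(6,2)] by simp
        moreover have "i = 2 * (i div 2)" "Suc j mod ?N = 2 * ((Suc j mod ?N) div 2)"
          using odd_next(1)[OF that(6,2)] that(5) by simp_all
        ultimately have "i = Suc j mod ?N" by metis
        then show False using that(4) by simp
      qed
      ultimately show ?thesis using disj(2)[OF half half] that by (simp add: \<gamma>_def)
    qed
    show ?thesis
    proof (cases "even i")
      case True
      then show ?thesis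
        using ee[OF that(1-3)] eo[OF that(1,2,4,5)] by (cases "even j") blast+
    next
      case False
      then have "even j" using that(6) by blast
      from eo[OF that(2,1,5,4) this False] show ?thesis by blast
    qed
  qed
  have off: "\<gamma> i 0 \<notin> path_image (\<gamma> j)" if "i < ?N" "j < ?N" "i \<noteq> j" "i \<noteq> Suc j mod ?N" for i j
  proof (cases "j = Suc i mod ?N")
    case True
    have "\<gamma> i 0 \<noteq> \<gamma> i 1" using arc_distinct_ends[OF arc[OF that(1)]] by (simp add: pathstart_def pathfinish_def)
    then show ?thesis using adj[OF that(1)] True nxt[OF that(1)] start(1)[of i] by auto
  next
    case False
    show ?thesis
    proof (cases "even i \<or> even j")
      case True
      then show ?thesis using disjoint[OF that(1-3) False that(4)] start(1)[of i] by auto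
    next
      case oo: False
      \<comment> \<open>Two odd arcs may intersect. The start of arc \<open>i\<close> is therefore
        located as the end of the even arc before it, whose position relative to \<open>j\<close> is
        under control.\<close>
      define i' where "i' = i - 1"
      have i': "even i'" "i = Suc i'" "i' < ?N" using oo that by (auto simp: i'_def)
      have n': "Suc i' mod ?N = i" using even_next(1)[OF i'(1,3)] i'(2) by simp
      have e: "\<gamma> i 0 = \<gamma> i' 1" using nxt[OF i'(3)] n' by simp
      show ?thesis
      proof (cases "i' = Suc j mod ?N")
        case True
        have "\<gamma> i' 1 \<noteq> \<gamma> i' 0" using arc_distinct_ends[OF arc[OF i'(3)]] by (simp add: pathstart_def pathfinish_def)
        then show ?thesis using adj[OF that(2)] True nxt[OF that(2)] start(2)[of i'] e by auto
      next
        case False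
        have "i' \<noteq> j" using oo i' by auto
        then have "path_image (\<gamma> i') \<inter> path_image (\<gamma> j) = {}"
          using disjoint[OF i'(3) that(2) _ _ False] i'(1) n' that(3) by auto
        then show ?thesis using e start(2)[of i'] by auto
      qed
    qed
  qed
  have join: "arc (\<gamma> i +++ \<gamma> (Suc i mod ?N))" if "i < ?N" for i
    using arc_join[OF arc[OF that] arc[OF Suc_lt]] nxt[OF that] adj[OF that]
    by (simp add: pathstart_def pathfinish_def)
  have pl': "pl_dirs (\<gamma> i) 0 1 (ds i)" if "i < ?N" for i
    using pl half[OF that] by (simp add: \<gamma>_def ds_def)
  have "3 \<le> ?N" using M by simp
  then obtain m :: int where m: "cturn (concat (map ds [0..<?N])) =
    2 * pi * (1 + 2 * of_int m - (\<Sum>(i, j)\<in>nonadjacent_pairs ?N. Re (cross_index (\<gamma> i) (\<gamma> j))))"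
    using closed_chain_turning[of ?N \<gamma> ds] pl' nxt arc join off by blast
  have "concat (map ds [0..<2 * K]) = concat (map (\<lambda>k. db k @ dq k) [0..<K])" for K
    by (induction K) (simp_all add: ds_def)
  moreover have "(\<Sum>(i, j)\<in>nonadjacent_pairs ?N. Re (cross_index (\<gamma> i) (\<gamma> j))) =
    (\<Sum>(j, k)\<in>{(j, k). j < k \<and> k < M}. Re (cross_index (Q j) (Q k)))"
  proof -
    let ?P = "{(j, k). j < k \<and> k < M}" and ?f = "\<lambda>(j, k). (2 * j + 1, 2 * k + 1) :: nat \<times> nat"
    have fin: "finite (nonadjacent_pairs ?N)"
      by (rule finite_subset[of _ "{..<?N} \<times> {..<?N}"]) (auto simp: nonadjacent_pairs_def)
    have sub: "?f ` ?P \<subseteq> nonadjacent_pairs ?N" by (auto simp: nonadjacent_pairs_def)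
    have zero: "(\<lambda>(i, j). Re (cross_index (\<gamma> i) (\<gamma> j))) p = 0" if p: "p \<in> nonadjacent_pairs ?N - ?f ` ?P" for p
    proof -
      obtain i j where ij: "p = (i, j)" by force
      have b: "i + 2 \<le> j" "j < ?N" "(i, j) \<noteq> (0, ?N - 1)" using p ij by (auto simp: nonadjacent_pairs_def)
      have ev: "even i \<or> even j"
      proof (rule ccontr)
        assume "\<not> ?thesis"
        then obtain a c where "i = 2 * a + 1" "j = 2 * c + 1" by (auto elim!: oddE)
        moreover from this have "(a, c) \<in> ?P" using b by auto
        ultimately have "p \<in> ?f ` ?P" using ij by (auto intro!: image_eqI[of _ _ "(a, c)"])
        then show False using p by blast
      qed
      have "Suc i mod ?N = Suc i" using b by simp
      moreover have "Suc j mod ?N = (if j = ?N - 1 then 0 else Suc j)" using b by auto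
      ultimately have "path_image (\<gamma> i) \<inter> path_image (\<gamma> j) = {}"
        using b ev by (intro disjoint) (auto split: if_splits)
      then have "cross_index (\<gamma> i) (\<gamma> j) = 0"
        using arc_imp_path[OF arc[of i]] arc_imp_path[OF arc[of j]] b by (intro cross_index_disjoint) auto
      then show ?thesis by (simp add: ij)
    qed
    have "(\<Sum>p\<in>nonadjacent_pairs ?N. (\<lambda>(i, j). Re (cross_index (\<gamma> i) (\<gamma> j))) p)
       = (\<Sum>p\<in>?f ` ?P. (\<lambda>(i, j). Re (cross_index (\<gamma> i) (\<gamma> j))) p)"
      by (rule sum.mono_neutral_right[OF fin sub]) (use zero in blast)
    also have "\<dots> = (\<Sum>(j, k)\<in>?P. Re (cross_index (Q j) (Q k)))"
      by (subst sum.reindex) (auto simp: inj_on_def \<gamma>_def case_prod_beta intro!: sum.cong)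
    finally show ?thesis .
  qed
  ultimately show ?thesis using m that by simp
qed

section \<open>The polygon and its sides\<close>

lemma side_cases:
  fixes m g :: nat
  assumes "m \<in> {1..4 * g}"
  obtains j where "j < g" "m = Suc (4 * j)" | j where "j < g" "m = 4 * j + 2"
    | j where "j < g" "m = 4 * j + 3" | j where "j < g" "m = 4 * j + 4"
proof -
  define j where "j = (m - 1) div 4"
  have j: "j < g" using assms by (auto simp: j_def)
  define r where "r = (m - 1) mod 4"
  have "r = 0 \<or> r = 1 \<or> r = 2 \<or> r = 3" unfolding r_def by linarith
  moreover have "m = 4 * j + r + 1" using assms by (simp add: j_def r_def)
  ultimately have "m = Suc (4 * j) \<or> m = 4 * j + 2 \<or> m = 4 * j + 3 \<or> m = 4 * j + 4" by auto
  then show ?thesis using that j by blast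
qed

lemma side_numbers:
  "partner (Suc (4 * j)) = 4 * j + 3" "partner (4 * j + 2) = 4 * j + 4"
  "partner (4 * j + 3) = Suc (4 * j)" "partner (4 * j + 4) = 4 * j + 2"
  "bridge_of (Suc (4 * j)) = Suc (2 * j)" "bridge_of (4 * j + 2) = 2 * j + 2"
  "bridge_of (4 * j + 3) = Suc (2 * j)" "bridge_of (4 * j + 4) = 2 * j + 2"
  "bridge_side (Suc (2 * j)) = Suc (4 * j)" "bridge_side (2 * j + 2) = 4 * j + 2"
proof -
  have d: "(4 * j + 1) div 4 = j" "(4 * j + 2) div 4 = j" "(4 * j + 3) div 4 = j"
    "(4 * j + 1) mod 4 = 1" "(4 * j + 2) mod 4 = 2" "(4 * j + 3) mod 4 = 3" by presburger+
  have e: "4 * j + 2 - 1 = 4 * j + 1" "4 * j + 3 - 1 = 4 * j + 2" "4 * j + 4 - 1 = 4 * j + 3" by simp_all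
  show "partner (Suc (4 * j)) = 4 * j + 3" "partner (4 * j + 2) = 4 * j + 4"
    "partner (4 * j + 3) = Suc (4 * j)" "partner (4 * j + 4) = 4 * j + 2"
    unfolding partner_def e d by simp_all
  show "bridge_of (Suc (4 * j)) = Suc (2 * j)" "bridge_of (4 * j + 2) = 2 * j + 2"
    "bridge_of (4 * j + 3) = Suc (2 * j)" "bridge_of (4 * j + 4) = 2 * j + 2"
    unfolding bridge_of_def e d by simp_all
  show "bridge_side (Suc (2 * j)) = Suc (4 * j)" "bridge_side (2 * j + 2) = 4 * j + 2"
    unfolding bridge_side_def by simp_all
qed

lemma partner_props:
  assumes "m \<in> {1..4 * g}"
  shows "partner m \<in> {1..4 * g}" "partner (partner m) = m" "bridge_of (partner m) = bridge_of m"
    "bridge_of m \<in> {1..2 * g}" "partner m \<noteq> m"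
    "m = bridge_side (bridge_of m) \<and> partner m = bridge_side (bridge_of m) + 2 \<or>
     m = bridge_side (bridge_of m) + 2 \<and> partner m = bridge_side (bridge_of m)"
proof -
  have "partner m \<in> {1..4 * g} \<and> partner (partner m) = m \<and> bridge_of (partner m) = bridge_of m \<and>
    bridge_of m \<in> {1..2 * g} \<and> partner m \<noteq> m \<and> (m = bridge_side (bridge_of m) \<and> partner m = bridge_side (bridge_of m) + 2 \<or>
     m = bridge_side (bridge_of m) + 2 \<and> partner m = bridge_side (bridge_of m))"
    using assms by (cases rule: side_cases) (auto simp: side_numbers simp del: add_2_eq_Suc add_2_eq_Suc')
  then show "partner m \<in> {1..4 * g}" "partner (partner m) = m" "bridge_of (partner m) = bridge_of m"
    "bridge_of m \<in> {1..2 * g}" "partner m \<noteq> m"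
    "m = bridge_side (bridge_of m) \<and> partner m = bridge_side (bridge_of m) + 2 \<or>
     m = bridge_side (bridge_of m) + 2 \<and> partner m = bridge_side (bridge_of m)" by blast+
qed

lemma convex_polygon: "convex (polygon g)"
  by (simp add: polygon_def)

text \<open>A half-turn shifts the index of a corner by \<open>2 * g\<close>.\<close>

lemma polygon_uminus:
  assumes "z \<in> polygon g"
  shows "- z \<in> polygon g"
proof -
  have "- corner g k \<in> corner g ` {..<4 * g}" if "k < 4 * g" for k
  proof -
    have g: "0 < g" using that by simp
    have s: "corner g (k + 2 * g) = - corner g k" for k
    proof -
      have "2 * pi * real (k + 2 * g) / real (4 * g) = 2 * pi * real k / real (4 * g) + pi"
        using g by (simp add: field_simps)
      then show ?thesis unfolding corner_def by (simp add: cis_mult[symmetric] complex_eq_iff)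
    qed
    show ?thesis
    proof (cases "k < 2 * g")
      case True
      then show ?thesis using s[of k] by (intro image_eqI[of _ _ "k + 2 * g"]) auto
    next
      case False
      then show ?thesis using s[of "k - 2 * g"] that by (intro image_eqI[of _ _ "k - 2 * g"]) auto
    qed
  qed
  then have "uminus ` corner g ` {..<4 * g} \<subseteq> corner g ` {..<4 * g}" by auto
  then have "convex hull (uminus ` corner g ` {..<4 * g}) \<subseteq> polygon g"
    unfolding polygon_def by (rule hull_mono)
  moreover have "- z \<in> uminus ` (convex hull (corner g ` {..<4 * g}))" using assms by (simp add: polygon_def)
  moreover have "uminus ` (convex hull (corner g ` {..<4 * g})) = convex hull (uminus ` corner g ` {..<4 * g})"
    by (rule convex_hull_linear_image) (rule linear_uminus)
  ultimately show ?thesis by auto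
qed

lemma polygon_subset_cball: "polygon g \<subseteq> cball 0 1"
  unfolding polygon_def by (rule hull_minimal) (auto simp: corner_def)

text \<open>By symmetry and convexity the interior contains the midpoint of any interior point and
  its negative.\<close>

lemma zero_interior_polygon:
  assumes "interior (polygon g) \<noteq> {}"
  shows "0 \<in> interior (polygon g)"
proof -
  obtain z where z: "z \<in> interior (polygon g)" using assms by blast
  have "uminus ` interior (polygon g) \<subseteq> interior (polygon g)"
  proof (rule interior_maximal)
    show "uminus ` interior (polygon g) \<subseteq> polygon g"
      using interior_subset polygon_uminus by blast
    show "open (uminus ` interior (polygon g))"
      by (simp add: open_negations)
  qed
  then have "- z \<in> interior (polygon g)" using z by blast
  moreover have "convex (interior (polygon g))" by (simp add: convex_polygon convex_interior)
  ultimately have "(1/2) *\<^sub>R z + (1/2) *\<^sub>R (- z) \<in> interior (polygon g)"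
    using z unfolding convex_def by (metis field_sum_of_halves less_eq_real_def zero_le_divide_1_iff zero_le_numeral)
  then show ?thesis by simp
qed

lemma corner_mod: "0 < g \<Longrightarrow> corner g (4 * g) = corner g 0"
  by (simp add: corner_def)

lemma side_pt_in_polygon:
  assumes "m \<in> {1..4 * g}" "t \<in> {0..1}"
  shows "side_pt g m t \<in> polygon g"
proof -
  have "corner g k \<in> polygon g" if "k \<le> 4 * g" "0 < g" for k
  proof (cases "k = 4 * g")
    case True
    then show ?thesis using corner_mod[OF that(2)] that(2) by (auto simp: polygon_def intro!: hull_inc)
  qed (use that in \<open>auto simp: polygon_def intro!: hull_inc\<close>)
  then have "corner g (m - 1) \<in> polygon g" "corner g m \<in> polygon g" using assms(1) by auto
  then have "closed_segment (corner g (m - 1)) (corner g m) \<subseteq> polygon g"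
    by (simp add: closed_segment_subset convex_polygon)
  moreover have "side_pt g m t \<in> closed_segment (corner g (m - 1)) (corner g m)"
    unfolding side_pt_def using assms(2) by (metis imageI path_image_def path_image_linepath)
  ultimately show ?thesis by blast
qed

text \<open>The half-plane \<open>?H\<close> supports the polygon along the side: its normal
  \<open>\<nu>\<close> points to the midpoint of the side, and \<open>cos (pi / n)\<close> is the
  apothem of the polygon.\<close>

lemma side_pt_not_interior:
  assumes m: "m \<in> {1..4 * g}"
  shows "side_pt g m t \<notin> interior (polygon g)"
proof -
  define n where "n = real (4 * g)"
  have n: "0 < n" using assms by (auto simp: n_def)
  define \<nu> where "\<nu> = cis (pi * (2 * real m - 1) / n)"
  let ?H = "{z. inner \<nu> z \<le> cos (pi / n)}"
  have inn: "inner \<nu> (corner g k) = cos (pi * (2 * (real k - real m) + 1) / n)" for k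
  proof -
    have "inner \<nu> (corner g k) = cos (2 * pi * real k / n - pi * (2 * real m - 1) / n)"
      by (simp add: \<nu>_def corner_def n_def inner_complex_def cos_diff)
    also have "2 * pi * real k / n - pi * (2 * real m - 1) / n = pi * (2 * (real k - real m) + 1) / n"
      by (simp add: diff_divide_distrib[symmetric] algebra_simps)
    finally show ?thesis .
  qed
  \<comment> \<open>The difference of the cosines is twice the product of \<open>sin a\<close> and
    \<open>sin b\<close>, where \<open>b\<close> exceeds \<open>a\<close> by \<open>pi / n\<close>.
    As \<open>k - m\<close> is an integer, 0 is not strictly between \<open>a\<close> and
    \<open>b\<close>, so both angles lie in [0, pi] or both in [-pi, 0].\<close>
  have le: "cos (pi * (2 * (real k - real m) + 1) / n) \<le> cos (pi / n)" if k: "k < 4 * g" for k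
  proof -
    define j where "j = real k - real m"
    define a where "a = pi * j / n"
    define b where "b = pi * (j + 1) / n"
    have kn: "real k + 1 \<le> n" "1 \<le> real m" "real m \<le> n" using k m by (auto simp: n_def)
    have "cos (pi / n) - cos (pi * (2 * j + 1) / n) = 2 * sin ((pi / n + pi * (2 * j + 1) / n) / 2) * sin ((pi * (2 * j + 1) / n - pi / n) / 2)"
      by (rule cos_diff_cos)
    also have "(pi / n + pi * (2 * j + 1) / n) / 2 = b"
      using n by (simp add: b_def field_simps)
    also have "(pi * (2 * j + 1) / n - pi / n) / 2 = a"
      using n by (simp add: a_def field_simps)
    finally have d: "cos (pi / n) - cos (pi * (2 * j + 1) / n) = 2 * sin b * sin a" .
    have "0 \<le> sin b * sin a"
    proof (cases "m \<le> k")
      case True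
      then have "0 \<le> j" "j + 1 \<le> n" using kn by (auto simp: j_def)
      then have "0 \<le> a" "a \<le> pi" "0 \<le> b" "b \<le> pi" using n by (auto simp: a_def b_def divide_simps)
      then show ?thesis by (intro mult_nonneg_nonneg sin_ge_zero)
    next
      case False
      then have "real k + 1 \<le> real m" by linarith
      then have "j + 1 \<le> 0" "- n \<le> j" using kn by (auto simp: j_def)
      then have j: "0 \<le> - j" "- j \<le> n" "0 \<le> - (j + 1)" "- (j + 1) \<le> n" by auto
      have "- a = pi * (- j) / n" "- b = pi * (- (j + 1)) / n"
        unfolding a_def b_def mult_minus_right by simp_all
      moreover have "0 \<le> pi * x / n \<and> pi * x / n \<le> pi" if "0 \<le> x" "x \<le> n" for x
        using that n by (auto simp: divide_simps)
      ultimately have "0 \<le> - a" "- a \<le> pi" "0 \<le> - b" "- b \<le> pi" using j by metis+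
      then have "0 \<le> sin (- a)" "0 \<le> sin (- b)" using sin_ge_zero by blast+
      then have "0 \<le> sin (- a) * sin (- b)" by (rule mult_nonneg_nonneg)
      then show ?thesis by (simp add: mult.commute)
    qed
    then show ?thesis using d by (simp add: j_def)
  qed
  have "polygon g \<subseteq> ?H"
    unfolding polygon_def
  proof (rule hull_minimal)
    show "corner g ` {..<4 * g} \<subseteq> ?H" using inn le by auto
  qed (rule convex_halfspace_le)
  then have "interior (polygon g) \<subseteq> interior ?H" by (rule interior_mono)
  moreover have "\<nu> \<noteq> 0" by (simp add: \<nu>_def)
  ultimately have int: "interior (polygon g) \<subseteq> {z. inner \<nu> z < cos (pi / n)}"
    by (simp add: interior_halfspace_le)
  have "pi * (2 * (real (m - 1) - real m) + 1) / n = - (pi / n)" using m by (simp add: of_nat_diff)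
  then have c: "inner \<nu> (corner g (m - 1)) = cos (pi / n)" "inner \<nu> (corner g m) = cos (pi / n)"
    unfolding inn by (simp_all only: cos_minus) simp
  have "inner \<nu> (side_pt g m t) = cos (pi / n)"
    unfolding side_pt_def linepath_def inner_add_right inner_scaleR_right c by (simp add: algebra_simps)
  then show ?thesis using int by auto
qed

lemma chord_polar:
  assumes "0 < t" "t < 1" "0 < \<delta>" "\<delta> < pi"
  obtains r \<phi> where "0 < r" "0 < \<phi>" "\<phi> < \<delta>" "of_real (1 - t) + of_real t * cis \<delta> = of_real r * cis \<phi>"
proof -
  define z where "z = of_real (1 - t) + of_real t * cis \<delta>"
  have s: "0 < sin \<delta>" using assms by (intro sin_gt_zero) auto
  have "Im z = t * sin \<delta>" by (simp add: z_def)
  then have iz: "0 < Im z" using s assms by simp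
  then have A: "0 < Arg z" "Arg z < pi" using Arg_lt_pi by blast+
  have z: "z = of_real (norm z) * cis (Arg z)" using rcis_cmod_Arg[of z] by (simp add: rcis_def)
  have nz: "0 < norm z" using iz by auto
  \<comment> \<open>Rotated back by \<open>\<delta>\<close>, the point falls below the real axis;
    this bounds its angle from above.\<close>
  have "z * cis (- \<delta>) = of_real (norm z) * cis (Arg z - \<delta>)"
    by (subst z) (simp add: cis_mult)
  then have "Im (z * cis (- \<delta>)) = norm z * sin (Arg z - \<delta>)" by simp
  moreover have "Im (z * cis (- \<delta>)) = - ((1 - t) * sin \<delta>)"
    by (simp add: z_def algebra_simps)
  ultimately have "norm z * sin (Arg z - \<delta>) < 0" using s assms by simp
  then have "sin (Arg z - \<delta>) < 0" using nz by (simp add: mult_less_0_iff)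
  then have "Arg z < \<delta>"
    using sin_ge_zero[of "Arg z - \<delta>"] A assms by linarith
  then show ?thesis using that[of "norm z" "Arg z"] nz A z by (simp add: z_def)
qed

lemma side_pt_polar:
  assumes m: "m \<in> {1..4 * g}" and t: "0 < t" "t < 1"
  obtains r \<phi> where "0 < r" "2 * pi * real (m - 1) / real (4 * g) < \<phi>" "\<phi> < 2 * pi * real m / real (4 * g)"
    "side_pt g m t = of_real r * cis \<phi>"
proof -
  define \<delta> where "\<delta> = 2 * pi / real (4 * g)"
  have g: "1 \<le> g" using m by auto
  have "\<delta> \<le> 2 * pi / 4" unfolding \<delta>_def using g by (intro divide_left_mono) auto
  moreover have "0 < \<delta>" using g by (simp add: \<delta>_def)
  ultimately have \<delta>: "0 < \<delta>" "\<delta> < pi" using pi_gt_zero by linarith+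
  obtain r \<phi> where r: "0 < r" "0 < \<phi>" "\<phi> < \<delta>" "of_real (1 - t) + of_real t * cis \<delta> = of_real r * cis \<phi>"
    using chord_polar[OF t \<delta>] by blast
  have rm: "real m = real (m - 1) + 1" using m by auto
  let ?a = "2 * pi * real (m - 1) / real (4 * g)"
  have "2 * pi * real m / real (4 * g) = ?a + \<delta>" by (simp add: rm \<delta>_def add_divide_distrib algebra_simps)
  moreover from this have "side_pt g m t = of_real r * cis (?a + \<phi>)"
  proof -
    assume "2 * pi * real m / real (4 * g) = ?a + \<delta>"
    then have "corner g m = cis ?a * cis \<delta>" by (simp add: corner_def cis_mult)
    then have "side_pt g m t = cis ?a * (of_real (1 - t) + of_real t * cis \<delta>)"
      by (simp add: side_pt_def linepath_def corner_def scaleR_conv_of_real algebra_simps)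
    also have "\<dots> = of_real r * cis (?a + \<phi>)" unfolding r(4) by (simp add: cis_mult[symmetric] mult_ac)
    finally show ?thesis .
  qed
  ultimately show ?thesis using that[of r "?a + \<phi>"] r by simp
qed

lemma cross_index_rays:
  assumes r: "0 < ra" "0 < rb" "0 < rc" "0 < rd"
    and o: "a < c" "c < b" "b < d" "d < a + 2 * pi"
  shows "cross_index (linepath (of_real ra * cis a) 0 +++ linepath 0 (of_real rb * cis b))
     (linepath (of_real rc * cis c) 0 +++ linepath 0 (of_real rd * cis d)) = 1"
    and "of_real ra * cis a \<notin> closed_segment (of_real rc * cis c) 0 \<union> closed_segment 0 (of_real rd * cis d)"
      "of_real rb * cis b \<notin> closed_segment (of_real rc * cis c) 0 \<union> closed_segment 0 (of_real rd * cis d)"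
      "of_real rc * cis c \<notin> closed_segment (of_real ra * cis a) 0 \<union> closed_segment 0 (of_real rb * cis b)"
      "of_real rd * cis d \<notin> closed_segment (of_real ra * cis a) 0 \<union> closed_segment 0 (of_real rb * cis b)"
proof -
  let ?a = "of_real ra * cis a" and ?b = "of_real rb * cis b" and ?c = "of_real rc * cis c" and ?d = "of_real rd * cis d"
  have arg: "Arg2pi (of_real p * cis x / (of_real q * cis y)) = x - y"
    if "0 < p" "0 < q" "y \<le> x" "x < y + 2 * pi" for p q x y
  proof (rule Arg2pi_unique[of "p / q"])
    show "of_real (p / q) * exp (\<i> * of_real (x - y)) = of_real p * cis x / (of_real q * cis y)"
      unfolding cis_conv_exp using that by (simp add: right_diff_distrib exp_diff)
  qed (use that in auto)
  have ray: "of_real p * cis x / (of_real q * cis y) \<notin> \<real>\<^sub>\<ge>\<^sub>0"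
    if "0 < p" "0 < q" "y < x" "x < y + 2 * pi" for p q x y
  proof
    assume "of_real p * cis x / (of_real q * cis y) \<in> \<real>\<^sub>\<ge>\<^sub>0"
    then have "Arg2pi (of_real p * cis x / (of_real q * cis y)) = 0"
      by (auto simp: Arg2pi_eq_0 complex_nonneg_Reals_iff complex_is_Real_iff)
    then show False using arg[of p q y x] that by simp
  qed
  have ray': "of_real p * cis x / (of_real q * cis y) \<notin> \<real>\<^sub>\<ge>\<^sub>0"
    if "0 < p" "0 < q" "x < y" "y < x + 2 * pi" for p q x y
  proof -
    have "cis (x + 2 * pi) = cis x" by (simp add: cis_mult[symmetric])
    then show ?thesis using ray[of p q y "x + 2 * pi"] that by simp
  qed
  have nz: "?a \<noteq> 0" "?b \<noteq> 0" "?c \<noteq> 0" "?d \<noteq> 0" using r by auto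
  have rays: "(?a - 0) / (?c - 0) \<notin> \<real>\<^sub>\<ge>\<^sub>0" "(?a - 0) / (?d - 0) \<notin> \<real>\<^sub>\<ge>\<^sub>0" "(?b - 0) / (?c - 0) \<notin> \<real>\<^sub>\<ge>\<^sub>0" "(?b - 0) / (?d - 0) \<notin> \<real>\<^sub>\<ge>\<^sub>0"
    unfolding diff_zero using ray' ray r o by auto
  note off = cross_index_wedge_Arg(2-5)[OF nz rays]
  then show "?a \<notin> closed_segment ?c 0 \<union> closed_segment 0 ?d" "?b \<notin> closed_segment ?c 0 \<union> closed_segment 0 ?d"
    "?c \<notin> closed_segment ?a 0 \<union> closed_segment 0 ?b" "?d \<notin> closed_segment ?a 0 \<union> closed_segment 0 ?b" by auto
  have "Re (cross_index (linepath ?a 0 +++ linepath 0 ?b) (linepath ?c 0 +++ linepath 0 ?d)) = 1"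
    unfolding cross_index_wedge[OF nz rays] unfolding diff_zero using arg r o by simp
  \<comment> \<open>\<open>cross_index_wedge\<close> determines only the real part; integrality
    settles the rest.\<close>
  moreover have "cross_index (linepath ?a 0 +++ linepath 0 ?b) (linepath ?c 0 +++ linepath 0 ?d) \<in> \<int>"
  proof (rule cross_index_Ints)
    have e: "(linepath x 0 +++ linepath 0 y) 0 = x" "(linepath x 0 +++ linepath 0 y) 1 = y" for x y :: complex
      by (simp_all add: joinpaths_def linepath_def)
    have e': "path (linepath x 0 +++ linepath 0 y)"
      "path_image (linepath x 0 +++ linepath 0 y) = closed_segment x 0 \<union> closed_segment 0 y" for x y :: complex
      by (simp_all add: path_image_join)
    show "path (linepath ?a 0 +++ linepath 0 ?b)" "path (linepath ?c 0 +++ linepath 0 ?d)" by (rule e'(1))+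
    show "(linepath ?a 0 +++ linepath 0 ?b) 0 \<notin> path_image (linepath ?c 0 +++ linepath 0 ?d)"
      "(linepath ?a 0 +++ linepath 0 ?b) 1 \<notin> path_image (linepath ?c 0 +++ linepath 0 ?d)"
      "(linepath ?c 0 +++ linepath 0 ?d) 0 \<notin> path_image (linepath ?a 0 +++ linepath 0 ?b)"
      "(linepath ?c 0 +++ linepath 0 ?d) 1 \<notin> path_image (linepath ?a 0 +++ linepath 0 ?b)"
      unfolding e e'(2) by (rule off)+
  qed
  ultimately show "cross_index (linepath ?a 0 +++ linepath 0 ?b) (linepath ?c 0 +++ linepath 0 ?d) = 1"
    by (auto elim!: Ints_cases)
qed

section \<open>Steps of a drawn graph\<close>

text \<open>\<open>partner\<close> is an involution that preserves the range of side numbers, so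
  gluing relates the two points in both directions and they reach the same points.\<close>

lemma glued_sides_surface_pt:
  assumes "m \<in> {1..4 * g}" "t \<in> {0..1}"
  shows "surface_pt g (side_pt g m t) = surface_pt g (side_pt g (partner m) (1 - t))"
proof -
  let ?p = "side_pt g m t" and ?q = "side_pt g (partner m) (1 - t)"
  have "(?p, ?q) \<in> side_gluing g" using assms unfolding side_gluing_def by blast
  moreover have "(?q, ?p) \<in> side_gluing g"
  proof -
    have "(side_pt g (partner m) (1 - t), side_pt g (partner (partner m)) (1 - (1 - t))) \<in> side_gluing g"
      using assms partner_props(1)[OF assms(1)] unfolding side_gluing_def
      by (intro CollectI exI[of _ "partner m"] exI[of _ "1 - t"]) auto
    then show ?thesis using partner_props(2)[OF assms(1)] by simp
  qed
  ultimately show ?thesis unfolding surface_pt_def by (auto intro: converse_rtrancl_into_rtrancl)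
qed

lemma strand_ends:
  assumes "m \<in> {1..4 * g}"
  shows "strand g m t 0 = Base (side_pt g m t)" "strand g m t 1 = Base (side_pt g (partner m) (1 - t))"
  using partner_props(6)[OF assms] by (auto simp: strand_def bridge_pt_def)

text \<open>A strand and its reversal, which enters through the partner side, have the same position
  across the bridge; this is that position, counted from the side
  \<open>bridge_side\<close>.\<close>

definition bridge_coord :: "nat \<Rightarrow> real \<Rightarrow> real" where
  "bridge_coord m t = (if m = bridge_side (bridge_of m) then t else 1 - t)"

lemma strand_inner:
  assumes "0 < u" "u < 1"
  obtains u' where "0 < u'" "u' < 1" "strand g m t u = Bridge (bridge_of m) (bridge_coord m t) u'"
  using assms that[of u] that[of "1 - u"]
  by (cases "m = bridge_side (bridge_of m)") (auto simp: strand_def bridge_pt_def bridge_coord_def)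

lemma strand_partner:
  assumes "m \<in> {1..4 * g}"
  shows "strand g (partner m) (1 - t) u = strand g m t (1 - u)"
  using partner_props(3,5,6)[OF assms] by (auto simp: strand_def)

lemma strand_in_highway:
  assumes "m \<in> {1..4 * g}" "t \<in> {0..1}" "u \<in> {0..1}"
  shows "strand g m t u \<in> highway g"
proof (cases "u = 0 \<or> u = 1")
  case True
  then show ?thesis
    using strand_ends[OF assms(1)] side_pt_in_polygon[OF assms(1,2)]
      side_pt_in_polygon[OF partner_props(1)[OF assms(1)], of "1 - t"] assms(2)
    by (auto simp: highway_def)
next
  case False
  then have u: "0 < u" "u < 1" using assms(3) by auto
  obtain u' where "0 < u'" "u' < 1" "strand g m t u = Bridge (bridge_of m) (bridge_coord m t) u'"
    using strand_inner[OF u] by blast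
  then have "strand g m t u \<in> bridge (bridge_of m)"
    using assms(2) by (auto simp: bridge_def bridge_coord_def)
  then show ?thesis using partner_props(4)[OF assms(1)] by (auto simp: highway_def)
qed

lemma bridge_coord_eq:
  assumes "m \<in> {1..4 * g}" "m' \<in> {1..4 * g}" "bridge_of m = bridge_of m'" "bridge_coord m t = bridge_coord m' t'"
  shows "m' = m \<and> t' = t \<or> m' = partner m \<and> t' = 1 - t"
  using partner_props(5,6)[OF assms(1)] partner_props(5,6)[OF assms(2)] assms(3,4)
  by (auto simp: bridge_coord_def split: if_splits)

text \<open>A point of a strand remembers the crossing of the closed surface: an inner point by its
  bridge and its position across it, an end point by the glued pair to which it belongs. So
  different crossings have disjoint strands.\<close>

lemma strand_eq_imp_surface_pt_eq:
  assumes m: "m \<in> {1..4 * g}" "m' \<in> {1..4 * g}" and t: "t \<in> {0..1}" "t' \<in> {0..1}"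
    and u: "u \<in> {0..1}" "u' \<in> {0..1}" and eq: "strand g m t u = strand g m' t' u'"
  shows "surface_pt g (side_pt g m t) = surface_pt g (side_pt g m' t')"
proof -
  have ends: "(\<exists>z. strand g m t u = Base z \<and> surface_pt g z = surface_pt g (side_pt g m t)) \<or>
     (\<exists>u'. strand g m t u = Bridge (bridge_of m) (bridge_coord m t) u')"
    if "m \<in> {1..4 * g}" "t \<in> {0..1}" "u \<in> {0..1}" for m t u
  proof (cases "u = 0 \<or> u = 1")
    case True
    then show ?thesis using strand_ends[OF that(1), of t] glued_sides_surface_pt[OF that(1,2)] by auto
  next
    case False
    then have "0 < u" "u < 1" using that(3) by auto
    then show ?thesis using strand_inner by metis
  qed
  show ?thesis
  proof (cases "strand g m t u")
    case (Base z)
    then show ?thesis using ends[OF m(1) t(1) u(1)] ends[OF m(2) t(2) u(2)] unfolding eq by simp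
  next
    case (Bridge i c d)
    then have "bridge_of m = bridge_of m'" "bridge_coord m t = bridge_coord m' t'"
      using ends[OF m(1) t(1) u(1)] ends[OF m(2) t(2) u(2)] unfolding eq by simp_all
    from bridge_coord_eq[OF m this] show ?thesis
      using glued_sides_surface_pt[OF m(1) t(1)] by auto
  qed
qed

lemma strand_inj:
  assumes "m \<in> {1..4 * g}" "0 < t" "t < 1"
  shows "inj_on (strand g m t) {0..1}"
proof (rule inj_onI)
  have g: "0 < g" using assms(1) by auto
  \<comment> \<open>The two ends lie on different sides, whose open angular sectors around the
    centre are disjoint.\<close>
  have ne: "side_pt g m t \<noteq> side_pt g (partner m) (1 - t)"
  proof
    assume eq: "side_pt g m t = side_pt g (partner m) (1 - t)"
    obtain r \<phi> where 1: "0 < r" "2 * pi * real (m - 1) / real (4 * g) < \<phi>" "\<phi> < 2 * pi * real m / real (4 * g)"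
      "side_pt g m t = of_real r * cis \<phi>" using side_pt_polar[OF assms] by blast
    obtain r' \<phi>' where 2: "0 < r'" "2 * pi * real (partner m - 1) / real (4 * g) < \<phi>'"
      "\<phi>' < 2 * pi * real (partner m) / real (4 * g)"
      "side_pt g (partner m) (1 - t) = of_real r' * cis \<phi>'"
      using side_pt_polar[OF partner_props(1)[OF assms(1)], of "1 - t"] assms by auto
    have rng: "0 \<le> a \<and> a < 2 * pi"
      if "k \<in> {1..4 * g}" "2 * pi * real (k - 1) / real (4 * g) < a" "a < 2 * pi * real k / real (4 * g)" for k a
    proof -
      have "2 * pi * real k / real (4 * g) \<le> 2 * pi" using that(1) by (simp add: divide_le_eq)
      moreover have "0 \<le> 2 * pi * real (k - 1) / real (4 * g)" by simp
      ultimately show ?thesis using that by linarith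
    qed
    have "Arg2pi (of_real r * cis \<phi>) = \<phi>" "Arg2pi (of_real r' * cis \<phi>') = \<phi>'"
      using rng[OF assms(1) 1(2,3)] rng[OF partner_props(1)[OF assms(1)] 2(2,3)] 1(1) 2(1)
      by (auto intro!: Arg2pi_unique simp: cis_conv_exp)
    then have "\<phi> = \<phi>'" using eq 1(4) 2(4) by simp
    have "m < partner m \<or> partner m < m" using partner_props(5)[OF assms(1)] by linarith
    moreover have False if "k \<le> l - 1" "a < 2 * pi * real k / real (4 * g)" "2 * pi * real (l - 1) / real (4 * g) < a" for k l a
    proof -
      have "2 * pi * real k / real (4 * g) \<le> 2 * pi * real (l - 1) / real (4 * g)"
        using that(1) g by (intro divide_right_mono mult_left_mono) auto
      then show False using that by linarith
    qed
    ultimately show False using 1(2,3) 2(2,3) \<open>\<phi> = \<phi>'\<close>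
      by (metis Suc_diff_1 Suc_leI less_Suc_eq_le less_nat_zero_code not_gr_zero)
  qed
  fix u v assume uv: "u \<in> {0..1}" "v \<in> {0..1}" "strand g m t u = strand g m t v"
  show "u = v"
  proof (cases "m = bridge_side (bridge_of m)")
    case True
    then have "bridge_side (bridge_of m) + 2 = partner m" using partner_props(6)[OF assms(1)] by auto
    then show ?thesis using uv ne True by (auto simp: strand_def bridge_pt_def split: if_splits)
  next
    case False
    then have "bridge_side (bridge_of m) + 2 = m" "bridge_side (bridge_of m) = partner m"
      using partner_props(6)[OF assms(1)] by auto
    then show ?thesis using uv ne False by (auto simp: strand_def bridge_pt_def split: if_splits)
  qed
qed

type_synonym 'e step = "'e \<times> nat \<times> bool"

locale drawing =
  fixes g :: nat and G :: "('v, 'e) drawn_graph" and \<Phi> :: "hw_point \<Rightarrow> complex"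
  assumes embedded: "embedded_graph g G" and immersion: "highway_immersion g \<Phi>"
begin

lemma finite_verts: "finite (verts G)" and finite_edges: "finite (edges G)"
  and tail_verts: "e \<in> edges G \<Longrightarrow> tail G e \<in> verts G" and head_verts: "e \<in> edges G \<Longrightarrow> head G e \<in> verts G"
  and inj_pos: "inj_on (pos G) (verts G)" and pos_interior: "v \<in> verts G \<Longrightarrow> pos G v \<in> interior (polygon g)"
  using embedded unfolding embedded_graph_def by auto

lemma crossing_range:
  assumes "e \<in> edges G" "(m, t) \<in> set (crossings G e)"
  shows "m \<in> {1..4 * g}" "0 < t" "t < 1"
  using embedded assms unfolding embedded_graph_def by fastforce+

lemma length_segments: "length (segments g G e) = Suc (length (crossings G e))"
proof -
  have "length (route g a cs b) = Suc (length cs)" for a cs b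
    by (induction g a cs b rule: route.induct) auto
  then show ?thesis by (simp add: segments_def)
qed

lemma segments_nth:
  assumes "i \<le> length (crossings G e)"
  shows "fst (segments g G e ! i) = (if i = 0 then pos G (tail G e)
      else case crossings G e ! (i - 1) of (m, t) \<Rightarrow> side_pt g (partner m) (1 - t))"
    and "snd (segments g G e ! i) = (if i = length (crossings G e) then pos G (head G e)
      else case crossings G e ! i of (m, t) \<Rightarrow> side_pt g m t)"
proof -
  have "i \<le> length cs \<Longrightarrow> fst (route g a cs b ! i) = (if i = 0 then a
      else case cs ! (i - 1) of (m, t) \<Rightarrow> side_pt g (partner m) (1 - t)) \<and>
     snd (route g a cs b ! i) = (if i = length cs then b else case cs ! i of (m, t) \<Rightarrow> side_pt g m t)" for i a cs b
  proof (induction g a cs b arbitrary: i rule: route.induct)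
    case (2 g a m t cs b)
    then show ?case by (cases i) (auto simp: nth_Cons' split: if_splits)
  qed simp
  then show "fst (segments g G e ! i) = (if i = 0 then pos G (tail G e)
      else case crossings G e ! (i - 1) of (m, t) \<Rightarrow> side_pt g (partner m) (1 - t))"
    "snd (segments g G e ! i) = (if i = length (crossings G e) then pos G (head G e)
      else case crossings G e ! i of (m, t) \<Rightarrow> side_pt g m t)"
    using assms unfolding segments_def by blast+
qed

text \<open>A step \<open>(e, i, f)\<close> is a traversal of the \<open>i\<close>-th segment of the edge \<open>e\<close>, forwards iff \<open>f\<close>;
  \<open>exit\<close> tells through which point of which side the step leaves the polygon, if it does not end at a vertex.\<close>

definition valid_step :: "'e step \<Rightarrow> bool" where
  "valid_step = (\<lambda>(e, i, f). e \<in> edges G \<and> i \<le> length (crossings G e))"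

definition src :: "'e step \<Rightarrow> complex" where
  "src = (\<lambda>(e, i, f). (if f then fst else snd) (segments g G e ! i))"

definition dst :: "'e step \<Rightarrow> complex" where
  "dst = (\<lambda>(e, i, f). (if f then snd else fst) (segments g G e ! i))"

definition exit :: "'e step \<Rightarrow> (nat \<times> real) option" where
  "exit = (\<lambda>(e, i, f).
     if f then (if i < length (crossings G e) then Some (crossings G e ! i) else None)
     else (if 0 < i then Some (case crossings G e ! (i - 1) of (m, t) \<Rightarrow> (partner m, 1 - t)) else None))"

definition dart_of :: "'e step \<Rightarrow> 'e dart" where
  "dart_of = (\<lambda>(e, i, f). (e, f))"

definition follows :: "'e step \<Rightarrow> 'e step \<Rightarrow> bool" where
  "follows x y \<longleftrightarrow> src y = (case exit x of None \<Rightarrow> dst x | Some (m, t) \<Rightarrow> side_pt g (partner m) (1 - t))"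

lemma segment_facts:
  assumes "e \<in> edges G" "i \<le> length (crossings G e)"
  shows "fst (segments g G e ! i) \<noteq> snd (segments g G e ! i)"
    "open_segment (fst (segments g G e ! i)) (snd (segments g G e ! i)) \<subseteq> interior (polygon g) - pos G ` verts G"
proof -
  have "segments g G e ! i \<in> set (segments g G e)" using assms length_segments[of e] by (intro nth_mem) simp
  moreover have "\<forall>e\<in>edges G. \<forall>(a, b)\<in>set (segments g G e). a \<noteq> b \<and> open_segment a b \<subseteq> interior (polygon g) - pos G ` verts G"
    using embedded unfolding embedded_graph_def by (elim conjE)
  then have "\<forall>(a, b)\<in>set (segments g G e). a \<noteq> b \<and> open_segment a b \<subseteq> interior (polygon g) - pos G ` verts G"
    using assms(1) by (rule bspec)
  ultimately show "fst (segments g G e ! i) \<noteq> snd (segments g G e ! i)"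
    "open_segment (fst (segments g G e ! i)) (snd (segments g G e ! i)) \<subseteq> interior (polygon g) - pos G ` verts G"
    by (auto simp: case_prod_beta)
qed

lemma segments_disjoint:
  assumes "e \<in> edges G" "i \<le> length (crossings G e)" "e' \<in> edges G" "j \<le> length (crossings G e')" "(e, i) \<noteq> (e', j)"
  shows "open_segment (fst (segments g G e ! i)) (snd (segments g G e ! i)) \<inter>
     open_segment (fst (segments g G e' ! j)) (snd (segments g G e' ! j)) = {}"
proof -
  have "\<forall>e\<in>edges G. \<forall>e'\<in>edges G. \<forall>i<length (segments g G e). \<forall>j<length (segments g G e').
        (e, i) \<noteq> (e', j) \<longrightarrow>
        (case (segments g G e ! i, segments g G e' ! j) of
          ((a, b), (a', b')) \<Rightarrow> open_segment a b \<inter> open_segment a' b' = {})"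
    using embedded unfolding embedded_graph_def by (elim conjE)
  then have "case (segments g G e ! i, segments g G e' ! j) of
          ((a, b), (a', b')) \<Rightarrow> open_segment a b \<inter> open_segment a' b' = {}"
    using assms length_segments[of e] length_segments[of e'] by (metis less_Suc_eq_le)
  then show ?thesis by (simp add: case_prod_beta)
qed

lemma crossings_distinct:
  assumes "e \<in> edges G" "i < length (crossings G e)" "e' \<in> edges G" "j < length (crossings G e')" "(e, i) \<noteq> (e', j)"
    and "crossings G e ! i = (m, t)" "crossings G e' ! j = (m', t')"
  shows "surface_pt g (side_pt g m t) \<noteq> surface_pt g (side_pt g m' t')"
proof -
  have "\<forall>e\<in>edges G. \<forall>e'\<in>edges G. \<forall>i<length (crossings G e). \<forall>j<length (crossings G e').
        (e, i) \<noteq> (e', j) \<longrightarrow>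
        (case (crossings G e ! i, crossings G e' ! j) of
          ((m, t), (m', t')) \<Rightarrow> surface_pt g (side_pt g m t) \<noteq> surface_pt g (side_pt g m' t'))"
    using embedded unfolding embedded_graph_def by (elim conjE)
  from this[rule_format, OF assms(1,3,2,4,5)] show ?thesis using assms(6,7) by simp
qed

lemma src_neq_dst: "valid_step x \<Longrightarrow> src x \<noteq> dst x"
  using segment_facts(1)[of "fst x" "fst (snd x)"] by (cases x) (auto simp: valid_step_def src_def dst_def)

lemma step_interior: "valid_step x \<Longrightarrow> open_segment (src x) (dst x) \<subseteq> interior (polygon g) - pos G ` verts G"
  using segment_facts(2) by (cases x) (auto simp: valid_step_def src_def dst_def open_segment_commute)

lemma steps_disjoint:
  assumes "valid_step x" "valid_step y" "fst x \<noteq> fst y \<or> fst (snd x) \<noteq> fst (snd y)"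
  shows "open_segment (src x) (dst x) \<inter> open_segment (src y) (dst y) = {}"
proof -
  have "open_segment (src x) (dst x) =
      open_segment (fst (segments g G (fst x) ! fst (snd x))) (snd (segments g G (fst x) ! fst (snd x)))" for x
    by (cases x; cases "snd (snd x)")
      (simp_all add: src_def dst_def insert_commute)
  note seg = this[of x] this[of y]
  show ?thesis
    unfolding seg using segments_disjoint[of "fst x" "fst (snd x)" "fst y" "fst (snd y)"] assms
    by (simp add: valid_step_def case_prod_beta)
qed

lemma exit_Some:
  assumes "valid_step x" "exit x = Some (m, t)"
  shows "m \<in> {1..4 * g}" "0 < t" "t < 1" "dst x = side_pt g m t"
proof -
  obtain e i f where x: "x = (e, i, f)" by (metis prod_cases3)
  have e: "e \<in> edges G" "i \<le> length (crossings G e)" using assms(1) by (simp_all add: x valid_step_def)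
  have "m \<in> {1..4 * g} \<and> 0 < t \<and> t < 1 \<and> dst x = side_pt g m t"
  proof (cases f)
    case True
    then have c: "i < length (crossings G e)" "crossings G e ! i = (m, t)"
      using assms(2) by (auto simp: x exit_def split: if_splits)
    then have "(m, t) \<in> set (crossings G e)" by (metis nth_mem)
    then show ?thesis using crossing_range[OF e(1)] segments_nth(2)[OF e(2)] c True by (auto simp: x dst_def)
  next
    case False
    obtain m' t' where c': "crossings G e ! (i - 1) = (m', t')" by force
    have c: "0 < i" "m = partner m'" "t = 1 - t'"
      using assms(2) False c' by (auto simp: x exit_def split: if_splits)
    then have "(m', t') \<in> set (crossings G e)" using c' e(2) by (metis Suc_diff_1 Suc_le_eq nth_mem)
    then have "m' \<in> {1..4 * g}" "0 < t'" "t' < 1" using crossing_range[OF e(1)] by blast+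
    then show ?thesis using partner_props(1)[of m' g] segments_nth(1)[OF e(2)] c c' False by (simp add: x dst_def)
  qed
  then show "m \<in> {1..4 * g}" "0 < t" "t < 1" "dst x = side_pt g m t" by auto
qed

lemma exit_None:
  assumes "valid_step x" "exit x = None"
  shows "dst x = pos G (end_vert G (dart_of x))" "end_vert G (dart_of x) \<in> verts G"
proof -
  obtain e i f where x: "x = (e, i, f)" by (metis prod_cases3)
  have e: "e \<in> edges G" "i \<le> length (crossings G e)" using assms(1) by (simp_all add: x valid_step_def)
  have "if f then i = length (crossings G e) else i = 0"
    using assms(2) e(2) by (auto simp: x exit_def split: if_splits)
  then show "dst x = pos G (end_vert G (dart_of x))" "end_vert G (dart_of x) \<in> verts G"
    using segments_nth[OF e(2)] tail_verts[OF e(1)] head_verts[OF e(1)]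
    by (auto simp: x dst_def dart_of_def end_vert_def rev_dart_def start_vert_def)
qed

text \<open>One direction per edge means that different steps lie on different segments. The steps
  of a walk without repeated edges form such a set, and so do those of two edge-disjoint walks
  together.\<close>

definition coherent :: "'e step set \<Rightarrow> bool" where
  "coherent X \<longleftrightarrow> (\<forall>x\<in>X. valid_step x) \<and> (\<forall>x\<in>X. \<forall>y\<in>X. fst x = fst y \<longrightarrow> snd (snd x) = snd (snd y))"

lemma coherent_valid: "coherent X \<Longrightarrow> x \<in> X \<Longrightarrow> valid_step x"
  by (simp add: coherent_def)

lemma coherent_labels: "coherent X \<Longrightarrow> x \<in> X \<Longrightarrow> y \<in> X \<Longrightarrow> x \<noteq> y \<Longrightarrow> fst x \<noteq> fst y \<or> fst (snd x) \<noteq> fst (snd y)"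
proof (rule ccontr)
  assume X: "coherent X" "x \<in> X" "y \<in> X" "x \<noteq> y" and "\<not> (fst x \<noteq> fst y \<or> fst (snd x) \<noteq> fst (snd y))"
  then have "fst x = fst y" "fst (snd x) = fst (snd y)" by simp_all
  moreover from this have "snd (snd x) = snd (snd y)" using X(1-3) unfolding coherent_def by blast
  ultimately have "fst x = fst y" "fst (snd x) = fst (snd y)" "snd (snd x) = snd (snd y)" by simp_all
  then have "x = y" by (intro prod_eqI)
  then show False using X(4) by simp
qed

text \<open>Segment \<open>i\<close> leaves the polygon at crossing \<open>i\<close> when run
  forwards and at crossing \<open>i - 1\<close> when run backwards. With one direction per edge,
  different steps therefore use different crossings.\<close>

lemma coherent_exits:
  assumes X: "coherent X" "x \<in> X" "y \<in> X" "x \<noteq> y" and ex: "exit x = Some (m, t)" "exit y = Some (m', t')"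
  shows "surface_pt g (side_pt g m t) \<noteq> surface_pt g (side_pt g m' t')"
proof -
  have *: "\<exists>k m0 t0. k < length (crossings G (fst x)) \<and> (snd (snd x) \<longrightarrow> k = fst (snd x)) \<and> (\<not> snd (snd x) \<longrightarrow> Suc k = fst (snd x)) \<and>
     crossings G (fst x) ! k = (m0, t0) \<and> surface_pt g (side_pt g m t) = surface_pt g (side_pt g m0 t0)"
    if v: "valid_step x" and ex: "exit x = Some (m, t)" for x m t
  proof -
    obtain e i f where x: "x = (e, i, f)" by (metis prod_cases3)
    have e: "e \<in> edges G" "i \<le> length (crossings G e)" using v by (simp_all add: x valid_step_def)
    show ?thesis
    proof (cases f)
      case True
      then show ?thesis using ex by (auto simp: x exit_def split: if_splits)
    next
      case False
      obtain m' t' where c': "crossings G e ! (i - 1) = (m', t')" by force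
      have c: "0 < i" "m = partner m'" "t = 1 - t'"
        using ex False c' by (auto simp: x exit_def split: if_splits)
      then have k: "i - 1 < length (crossings G e)" "Suc (i - 1) = i" using e(2) by auto
      then have "(m', t') \<in> set (crossings G e)" using c' by (metis nth_mem)
      then have "m' \<in> {1..4 * g}" "0 < t'" "t' < 1" using crossing_range[OF e(1)] by blast+
      then have "surface_pt g (side_pt g m t) = surface_pt g (side_pt g m' t')"
        using glued_sides_surface_pt[of m' g t'] c by simp
      then show ?thesis using k c' False by (auto simp: x)
    qed
  qed
  obtain k m0 t0 where 1: "k < length (crossings G (fst x))" "snd (snd x) \<longrightarrow> k = fst (snd x)" "\<not> snd (snd x) \<longrightarrow> Suc k = fst (snd x)"
    "crossings G (fst x) ! k = (m0, t0)" "surface_pt g (side_pt g m t) = surface_pt g (side_pt g m0 t0)"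
    using *[OF coherent_valid[OF X(1,2)] ex(1)] by blast
  obtain k' m0' t0' where 2: "k' < length (crossings G (fst y))" "snd (snd y) \<longrightarrow> k' = fst (snd y)" "\<not> snd (snd y) \<longrightarrow> Suc k' = fst (snd y)"
    "crossings G (fst y) ! k' = (m0', t0')" "surface_pt g (side_pt g m' t') = surface_pt g (side_pt g m0' t0')"
    using *[OF coherent_valid[OF X(1,3)] ex(2)] by blast
  have "(fst x, k) \<noteq> (fst y, k')"
  proof
    assume "(fst x, k) = (fst y, k')"
    then have eq: "fst x = fst y" "k = k'" by auto
    then have "snd (snd x) = snd (snd y)" using X(1-3) unfolding coherent_def by blast
    then have "fst (snd x) = fst (snd y)" using 1(2,3) 2(2,3) eq(2) by (cases "snd (snd x)") auto
    then show False using coherent_labels[OF X] eq(1) by blast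
  qed
  moreover have "fst x \<in> edges G" "fst y \<in> edges G"
    using coherent_valid[OF X(1,2)] coherent_valid[OF X(1,3)] by (auto simp: valid_step_def)
  ultimately show ?thesis using crossings_distinct[OF _ 1(1) _ 2(1) _ 1(4) 2(4)] 1(5) 2(5) by simp
qed

lemma compact_polygon: "compact (polygon g)"
  unfolding polygon_def by (intro finite_imp_compact_convex_hull finite_imageI) simp

definition seg_pt :: "'e step \<Rightarrow> real \<Rightarrow> complex" where
  "seg_pt x u = linepath (src x) (dst x) u"

lemma seg_pt_open:
  assumes "valid_step x" "0 < u" "u < 1"
  shows "seg_pt x u \<in> open_segment (src x) (dst x)"
  using src_neq_dst[OF assms(1)] assms(2,3) unfolding seg_pt_def linepath_def in_segment by blast

lemma seg_pt_interior:
  assumes "valid_step x" "0 < u" "u < 1"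
  shows "seg_pt x u \<in> interior (polygon g)" "seg_pt x u \<notin> pos G ` verts G"
  using seg_pt_open[OF assms] step_interior[OF assms(1)] by auto

lemma seg_pt_polygon:
  assumes "valid_step x" "u \<in> {0..1}"
  shows "seg_pt x u \<in> polygon g"
proof -
  have "closure (open_segment (src x) (dst x)) \<subseteq> polygon g"
    using step_interior[OF assms(1)] interior_subset[of "polygon g"] compact_imp_closed[OF compact_polygon]
    by (intro closure_minimal) auto
  then have "closed_segment (src x) (dst x) \<subseteq> polygon g"
    using src_neq_dst[OF assms(1)] by simp
  moreover have "seg_pt x u \<in> closed_segment (src x) (dst x)"
    unfolding seg_pt_def using assms(2) by (metis imageI path_image_def path_image_linepath)
  ultimately show ?thesis by blast
qed

lemma seg_pt_inj:
  assumes "valid_step x" "seg_pt x u = seg_pt x v"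
  shows "u = v"
proof -
  have "(v - u) *\<^sub>R (dst x - src x) = seg_pt x v - seg_pt x u"
    by (simp add: seg_pt_def linepath_def algebra_simps)
  then show ?thesis using assms src_neq_dst[OF assms(1)] by simp
qed

lemma seg_pt_ends [simp]: "seg_pt x 0 = src x" "seg_pt x 1 = dst x"
  by (simp_all add: seg_pt_def linepath_def)

lemma seg_pt_eq:
  assumes X: "coherent X" "x \<in> X" "y \<in> X" and "0 < u" "u < 1" "0 < v" "v < 1" "seg_pt x u = seg_pt y v"
  shows "x = y \<and> u = v"
proof -
  have v: "valid_step x" "valid_step y" using coherent_valid X by blast+
  have "x = y"
  proof (rule ccontr)
    assume "x \<noteq> y"
    from steps_disjoint[OF v coherent_labels[OF X this]]
    show False using seg_pt_open[OF v(1) assms(4,5)] seg_pt_open[OF v(2) assms(6,7)] assms(8) by auto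
  qed
  then show ?thesis using seg_pt_inj[OF v(1)] assms(8) by blast
qed

text \<open>What lies between a step and any step that follows it: the vertex where they meet, or
  the closed strand that carries the walk over a bridge.\<close>

definition node :: "'e step \<Rightarrow> hw_point set" where
  "node x = (case exit x of None \<Rightarrow> {Base (dst x)} | Some (m, t) \<Rightarrow> strand g m t ` {0..1})"

lemma dst_in_node: "valid_step x \<Longrightarrow> Base (dst x) \<in> node x"
  using exit_Some[of x] strand_ends by (fastforce simp: node_def image_iff split: option.splits intro!: bexI[of _ 0])

lemma src_in_node:
  assumes "valid_step x" "follows x y"
  shows "Base (src y) \<in> node x"
proof (cases "exit x")
  case None
  then show ?thesis using assms(2) by (simp add: node_def follows_def)
next
  case (Some mt)
  obtain m t where mt: "mt = (m, t)" by force
  then have "Base (src y) = strand g m t 1"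
    using Some assms exit_Some[of x m t] strand_ends(2) by (simp add: follows_def)
  then show ?thesis using Some mt by (simp add: node_def)
qed

lemma node_in_highway: "valid_step x \<Longrightarrow> node x \<subseteq> highway g"
proof (cases "exit x")
  case None
  assume "valid_step x"
  then show ?thesis using None seg_pt_polygon[of x 1] by (auto simp: node_def highway_def)
next
  case (Some mt)
  assume "valid_step x"
  then show ?thesis using Some exit_Some[of x] strand_in_highway by (fastforce simp: node_def split: prod.splits)
qed

lemma seg_pt_not_in_node:
  assumes "valid_step x" "valid_step y" "0 < u" "u < 1"
  shows "Base (seg_pt y u) \<notin> node x"
proof
  assume n: "Base (seg_pt y u) \<in> node x"
  show False
  proof (cases "exit x")
    case None
    then show False using n exit_None[OF assms(1) None] seg_pt_interior(2)[OF assms(2-4)] by (auto simp: node_def)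
  next
    case (Some mt)
    obtain m t where mt: "mt = (m, t)" by force
    have m: "m \<in> {1..4 * g}" using exit_Some[OF assms(1)] Some mt by simp
    obtain v where v: "v \<in> {0..1}" "Base (seg_pt y u) = strand g m t v" using n Some mt by (auto simp: node_def)
    show False
    proof (cases "v = 0 \<or> v = 1")
      case True
      then show False
        using strand_ends[OF m, of t] v(2) seg_pt_interior(1)[OF assms(2-4)]
          side_pt_not_interior[OF m] side_pt_not_interior[OF partner_props(1)[OF m]] by auto
    next
      case False
      then have "0 < v" "v < 1" using v(1) by auto
      then show False using strand_inner v(2) by (metis hw_point.distinct(1))
    qed
  qed
qed

lemma nodes_meet:
  assumes X: "coherent X" "x \<in> X" "y \<in> X" "x \<noteq> y" and "p \<in> node x" "p \<in> node y"
  shows "exit x = None \<and> exit y = None \<and> dst x = dst y"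
proof -
  have v: "valid_step x" "valid_step y" using coherent_valid X by blast+
  have mixed: False if v: "valid_step x" "valid_step y" and ex: "exit x = None" "exit y = Some (m, t)" and p: "p \<in> node x" "p \<in> node y"
    for x y m t
  proof -
    have m: "m \<in> {1..4 * g}" using exit_Some[OF v(2) ex(2)] by simp
    obtain u where u: "u \<in> {0..1}" "Base (dst x) = strand g m t u" using p ex by (auto simp: node_def)
    have "dst x \<in> interior (polygon g)" using exit_None[OF v(1) ex(1)] pos_interior by simp
    moreover have "u = 0 \<or> u = 1"
    proof (rule ccontr)
      assume "\<not> ?thesis"
      then have "0 < u" "u < 1" using u(1) by auto
      then show False using strand_inner u(2) by (metis hw_point.distinct(1))
    qed
    ultimately show False
      using strand_ends[OF m, of t] u(2) side_pt_not_interior[OF m] side_pt_not_interior[OF partner_props(1)[OF m]] by auto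
  qed
  show ?thesis
  proof (cases "exit x"; cases "exit y")
    assume "exit x = None" "exit y = None"
    then show ?thesis using assms(5,6) by (simp add: node_def)
  next
    fix b assume "exit x = None" "exit y = Some b"
    then show ?thesis using mixed[OF v, of "fst b" "snd b"] assms(5,6) by simp
  next
    fix a assume "exit x = Some a" "exit y = None"
    then show ?thesis using mixed[OF v(2,1), of "fst a" "snd a"] assms(5,6) by simp
  next
    fix a b assume ab: "exit x = Some a" "exit y = Some b"
    obtain m t m' t' where mt: "a = (m, t)" "b = (m', t')" by force
    have e: "exit x = Some (m, t)" "exit y = Some (m', t')" using ab mt by simp_all
    have mx: "m \<in> {1..4 * g}" "t \<in> {0..1}" "m' \<in> {1..4 * g}" "t' \<in> {0..1}"
      using exit_Some[OF v(1) e(1)] exit_Some[OF v(2) e(2)] by auto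
    obtain u u' where u: "u \<in> {0..1}" "u' \<in> {0..1}" "strand g m t u = strand g m' t' u'"
      using assms(5,6) e by (auto simp: node_def)
    have "surface_pt g (side_pt g m t) = surface_pt g (side_pt g m' t')"
      by (rule strand_eq_imp_surface_pt_eq[OF mx(1,3,2,4) u])
    then show ?thesis using coherent_exits[OF X e] by blast
  qed
qed

section \<open>Images of segments, strands and nodes under the immersion\<close>

definition bridge_pair :: "nat \<Rightarrow> nat \<Rightarrow> bool" where
  "bridge_pair i j \<longleftrightarrow> (\<exists>k\<in>{1..g}. i = 2 * k - 1 \<and> j = 2 * k \<or> j = 2 * k - 1 \<and> i = 2 * k)"

lemma immersion_inj:
  assumes "p \<in> highway g" "q \<in> highway g" "p \<noteq> q" "\<Phi> p = \<Phi> q"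
  obtains i j where "bridge_pair i j" "p \<in> bridge i" "q \<in> bridge j"
proof -
  have "\<forall>x\<in>highway g. \<forall>y\<in>highway g. x \<noteq> y \<and> \<Phi> x = \<Phi> y \<longrightarrow>
        (\<exists>k\<in>{1..g}. x \<in> bridge (2 * k - 1) \<and> y \<in> bridge (2 * k) \<or>
                    y \<in> bridge (2 * k - 1) \<and> x \<in> bridge (2 * k))"
    using immersion unfolding highway_immersion_def by (elim conjE)
  then obtain k where "k \<in> {1..g}" "p \<in> bridge (2 * k - 1) \<and> q \<in> bridge (2 * k) \<or> q \<in> bridge (2 * k - 1) \<and> p \<in> bridge (2 * k)"
    using assms by blast
  then show ?thesis using that unfolding bridge_pair_def by blast
qed

lemma inj_base: "inj_on (\<lambda>z. \<Phi> (Base z)) (polygon g)"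
proof (rule inj_onI)
  fix z w assume zw: "z \<in> polygon g" "w \<in> polygon g" "\<Phi> (Base z) = \<Phi> (Base w)"
  show "z = w"
  proof (rule ccontr)
    assume "z \<noteq> w"
    then show False using immersion_inj[of "Base z" "Base w"] zw by (auto simp: highway_def bridge_def)
  qed
qed

lemma continuous_base: "continuous_on (polygon g) (\<lambda>z. \<Phi> (Base z))"
  using immersion unfolding highway_immersion_def by (elim conjE)

definition base_path :: "complex \<Rightarrow> complex \<Rightarrow> real \<Rightarrow> complex" where
  "base_path a b u = \<Phi> (Base (linepath a b u))"

definition strand_path :: "nat \<Rightarrow> real \<Rightarrow> real \<Rightarrow> complex" where
  "strand_path m t u = \<Phi> (strand g m t u)"

lemma base_path_facts:
  assumes "a \<in> polygon g" "b \<in> polygon g"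
  shows "path (base_path a b)" "base_path a b 0 = \<Phi> (Base a)" "base_path a b 1 = \<Phi> (Base b)"
    "path_image (base_path a b) = (\<lambda>z. \<Phi> (Base z)) ` closed_segment a b"
    "a \<noteq> b \<Longrightarrow> arc (base_path a b)"
    "a \<noteq> b \<Longrightarrow> \<exists>ps. pl_via (base_path a b) ps"
proof -
  have seg: "closed_segment a b \<subseteq> polygon g" using assms by (simp add: closed_segment_subset convex_polygon)
  have im: "linepath a b ` {0..1} = closed_segment a b" by (metis path_image_def path_image_linepath)
  have cont: "continuous_on {0..1} (base_path a b)"
    unfolding base_path_def by (rule continuous_on_compose2[OF continuous_base continuous_on_linepath]) (use seg im in auto)
  then show p: "path (base_path a b)" by (simp add: path_def)
  show "base_path a b 0 = \<Phi> (Base a)" "base_path a b 1 = \<Phi> (Base b)"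
    by (simp_all add: base_path_def linepath_def)
  show "path_image (base_path a b) = (\<lambda>z. \<Phi> (Base z)) ` closed_segment a b"
    unfolding path_image_def base_path_def im[symmetric] by (simp add: image_image)
  assume ab: "a \<noteq> b"
  have inj: "inj_on (linepath a b) {0..1}" using arc_linepath[OF ab] by (simp add: arc_def)
  have "inj_on (base_path a b) {0..1}"
  proof (rule inj_onI)
    fix u v :: real assume uv: "u \<in> {0..1}" "v \<in> {0..1}" "base_path a b u = base_path a b v"
    then have "linepath a b u \<in> polygon g" "linepath a b v \<in> polygon g" using seg im by auto
    then have "linepath a b u = linepath a b v" using inj_onD[OF inj_base] uv(3) by (auto simp: base_path_def)
    then show "u = v" using inj_onD[OF inj] uv by blast
  qed
  then show "arc (base_path a b)" using p by (simp add: arc_def)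
  have "\<forall>a\<in>polygon g. \<forall>b\<in>polygon g. a \<noteq> b \<longrightarrow> (\<exists>ps. pl_via (\<lambda>x. \<Phi> (Base (linepath a b x))) ps)"
    using immersion unfolding highway_immersion_def by (elim conjE)
  then show "\<exists>ps. pl_via (base_path a b) ps" using assms ab unfolding base_path_def by blast
qed

lemma pl_via_reverse:
  assumes "pl_via \<gamma> ps"
  shows "pl_via (\<lambda>u. \<gamma> (1 - u)) (rev ps)"
proof -
  define n where "n = length ps - 1"
  obtain \<tau> where len: "2 \<le> length ps" and \<tau>0: "\<tau> 0 = 0" "\<tau> n = 1"
    and \<tau>: "\<And>k. k < n \<Longrightarrow> \<tau> k < \<tau> (Suc k) \<and>
           ps ! k = \<gamma> (\<tau> k) \<and> ps ! Suc k = \<gamma> (\<tau> (Suc k)) \<and> ps ! k \<noteq> ps ! Suc k \<and>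
           \<gamma> ` {\<tau> k..\<tau> (Suc k)} = closed_segment (ps ! k) (ps ! Suc k)"
    using assms unfolding pl_via_def n_def by blast
  have n: "length ps = Suc n" "0 < n" using len by (auto simp: n_def)
  have "\<exists>\<sigma>. \<sigma> 0 = 0 \<and> \<sigma> (length (rev ps) - 1) = (1::real) \<and>
        (\<forall>k<length (rev ps) - 1. \<sigma> k < \<sigma> (Suc k) \<and>
           rev ps ! k = \<gamma> (1 - \<sigma> k) \<and> rev ps ! Suc k = \<gamma> (1 - \<sigma> (Suc k)) \<and> rev ps ! k \<noteq> rev ps ! Suc k \<and>
           (\<lambda>u. \<gamma> (1 - u)) ` {\<sigma> k..\<sigma> (Suc k)} = closed_segment (rev ps ! k) (rev ps ! Suc k))"
  proof (intro exI[of _ "\<lambda>k. 1 - \<tau> (n - k)"] conjI allI impI)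
    fix k assume "k < length (rev ps) - 1"
    then have k: "k < n" using n by simp
    define j where "j = n - Suc k"
    have j: "j < n" "n - k = Suc j" "rev ps ! k = ps ! Suc j" "rev ps ! Suc k = ps ! j"
      using k n by (auto simp: j_def rev_nth Suc_diff_Suc)
    note t = \<tau>[OF j(1)]
    show "1 - \<tau> (n - k) < 1 - \<tau> (n - Suc k)" using t j by (simp add: j_def)
    show "rev ps ! k = \<gamma> (1 - (1 - \<tau> (n - k)))" "rev ps ! Suc k = \<gamma> (1 - (1 - \<tau> (n - Suc k)))"
      "rev ps ! k \<noteq> rev ps ! Suc k" using t j by (auto simp: j_def)
    have "(\<lambda>u. \<gamma> (1 - u)) ` {1 - \<tau> (n - k)..1 - \<tau> (n - Suc k)} = \<gamma> ` ((\<lambda>u. 1 - u) ` {1 - \<tau> (Suc j)..1 - \<tau> j})"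
      unfolding j(2) j_def[symmetric] image_image ..
    also have "(\<lambda>u. 1 - u) ` {1 - \<tau> (Suc j)..1 - \<tau> j} = {\<tau> j..\<tau> (Suc j)}"
      by (simp add: image_diff_atLeastAtMost)
    finally show "(\<lambda>u. \<gamma> (1 - u)) ` {1 - \<tau> (n - k)..1 - \<tau> (n - Suc k)} = closed_segment (rev ps ! k) (rev ps ! Suc k)"
      using t j by (simp add: closed_segment_commute)
  qed (use \<tau>0 n in auto)
  then show ?thesis using len unfolding pl_via_def by simp
qed

lemma strand_path_facts:
  assumes m: "m \<in> {1..4 * g}" and t: "0 < t" "t < 1"
  shows "arc (strand_path m t)" "strand_path m t 0 = \<Phi> (Base (side_pt g m t))"
    "strand_path m t 1 = \<Phi> (Base (side_pt g (partner m) (1 - t)))"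
    "path_image (strand_path m t) = \<Phi> ` strand g m t ` {0..1}"
    "\<exists>ps. pl_via (strand_path m t) ps"
proof -
  let ?i = "bridge_of m"
  show "strand_path m t 0 = \<Phi> (Base (side_pt g m t))" "strand_path m t 1 = \<Phi> (Base (side_pt g (partner m) (1 - t)))"
    by (simp_all add: strand_path_def strand_ends[OF m])
  show "path_image (strand_path m t) = \<Phi> ` strand g m t ` {0..1}"
    by (auto simp: path_image_def strand_path_def)
  have i: "?i \<in> {1..2 * g}" by (rule partner_props(4)[OF m])
  have cont: "continuous_on {0..1} (\<lambda>u. \<Phi> (bridge_pt g ?i t u))" if "t \<in> {0..1}" for t
  proof -
    have "\<forall>i\<in>{1..2 * g}. continuous_on ({0..1} \<times> {0..1}) (\<lambda>(t, u). \<Phi> (bridge_pt g i t u))"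
      using immersion unfolding highway_immersion_def by (elim conjE)
    then have "continuous_on ({0..1} \<times> {0..1}) (\<lambda>(t, u). \<Phi> (bridge_pt g ?i t u))" using i by blast
    from continuous_on_compose2[OF this, of "{0..1}" "\<lambda>u. (t, u)"] show ?thesis
      using that by (simp add: continuous_on_Pair image_subset_iff)
  qed
  have pl: "\<exists>ps. pl_via (\<lambda>u. \<Phi> (bridge_pt g ?i t u)) ps" if "t \<in> {0..1}" for t
  proof -
    have "\<forall>i\<in>{1..2 * g}. \<forall>t\<in>{0..1}. \<exists>ps. pl_via (\<lambda>u. \<Phi> (bridge_pt g i t u)) ps"
      using immersion unfolding highway_immersion_def by (elim conjE)
    then show ?thesis using i that by blast
  qed
  have "continuous_on {0..1} (strand_path m t)"
  proof (cases "m = bridge_side ?i")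
    case False
    have "continuous_on {0..1} (\<lambda>u. \<Phi> (bridge_pt g ?i (1 - t) (1 - u)))"
      by (rule continuous_on_compose2[OF cont[of "1 - t"], of _ "\<lambda>u. 1 - u"]) (use t in \<open>auto intro!: continuous_intros\<close>)
    then show ?thesis using False by (simp add: strand_path_def[abs_def] strand_def)
  qed (use cont[of t] t in \<open>simp add: strand_path_def[abs_def] strand_def\<close>)
  \<comment> \<open>The two preimages of a double point of \<open>\<Phi>\<close> lie on different
    bridges, whereas a strand stays on one.\<close>
  moreover have "inj_on (strand_path m t) {0..1}"
  proof (rule inj_onI, rule ccontr)
    fix u v assume uv: "u \<in> {0..1}" "v \<in> {0..1}" "strand_path m t u = strand_path m t v" "u \<noteq> v"
    have ne: "strand g m t u \<noteq> strand g m t v" using strand_inj[OF m t] uv by (auto dest: inj_onD)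
    have "strand g m t u \<in> highway g" "strand g m t v \<in> highway g"
      using strand_in_highway[OF m _ uv(1)] strand_in_highway[OF m _ uv(2)] t by auto
    then obtain i j where ij: "bridge_pair i j" "strand g m t u \<in> bridge i" "strand g m t v \<in> bridge j"
      using immersion_inj[OF _ _ ne] uv(3) by (auto simp: strand_path_def)
    have "i = ?i" if "strand g m t u \<in> bridge i" for u i
      using that partner_props(6)[OF m] by (auto simp: bridge_def strand_def bridge_pt_def split: if_splits)
    then have "i = j" using ij by blast
    then show False using ij(1) by (auto simp: bridge_pair_def)
  qed
  ultimately show "arc (strand_path m t)" by (simp add: arc_def path_def)
  show "\<exists>ps. pl_via (strand_path m t) ps"
  proof (cases "m = bridge_side ?i")
    case False
    obtain ps where "pl_via (\<lambda>u. \<Phi> (bridge_pt g ?i (1 - t) u)) ps" using pl[of "1 - t"] t by auto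
    from pl_via_reverse[OF this] show ?thesis using False by (auto simp: strand_path_def[abs_def] strand_def)
  qed (use pl[of t] t in \<open>simp add: strand_path_def[abs_def] strand_def\<close>)
qed

definition seg_img :: "'e step \<Rightarrow> real set \<Rightarrow> hw_point set" where
  "seg_img x I = (\<lambda>u. Base (seg_pt x u)) ` I"

lemma closed_segment_seg_pt:
  assumes "a \<le> b"
  shows "closed_segment (seg_pt x a) (seg_pt x b) = seg_pt x ` {a..b}"
proof -
  have *: "linepath (seg_pt x a) (seg_pt x b) u = seg_pt x (a + (b - a) * u)" for u
    by (simp add: seg_pt_def linepath_def algebra_simps)
  have "closed_segment (seg_pt x a) (seg_pt x b) = linepath (seg_pt x a) (seg_pt x b) ` {0..1}"
    by (metis path_image_def path_image_linepath)
  also have "\<dots> = seg_pt x ` ((\<lambda>u. a + (b - a) * u) ` {0..1})" by (simp add: * image_image)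
  also have "(\<lambda>u. a + (b - a) * u) ` {0..1} = {a..b}"
    using assms image_affinity_atLeastAtMost[of "b - a" a 0 1] by (auto simp: add.commute)
  finally show ?thesis .
qed

text \<open>\<open>mid_cell\<close> is the middle third of a step and \<open>turn_cell x y\<close> leads from two thirds of \<open>x\<close> to one third of
  the following step \<open>y\<close>, across a bridge if \<open>x\<close> leaves the polygon.\<close>

definition piece :: "'e step \<Rightarrow> real \<Rightarrow> real \<Rightarrow> real \<Rightarrow> complex" where
  "piece x a b = base_path (seg_pt x a) (seg_pt x b)"

definition mid_cell :: "'e step \<Rightarrow> real \<Rightarrow> complex" where
  "mid_cell x = piece x (1/3) (2/3)"

definition turn_cell :: "'e step \<Rightarrow> 'e step \<Rightarrow> real \<Rightarrow> complex" where
  "turn_cell x y = (case exit x of None \<Rightarrow> piece x (2/3) 1 +++ piece y 0 (1/3)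
     | Some (m, t) \<Rightarrow> piece x (2/3) 1 +++ (strand_path m t +++ piece y 0 (1/3)))"

lemma piece_facts:
  assumes "valid_step x" "0 \<le> a" "a < b" "b \<le> 1"
  shows "arc (piece x a b)" "path (piece x a b)" "piece x a b 0 = \<Phi> (Base (seg_pt x a))" "piece x a b 1 = \<Phi> (Base (seg_pt x b))"
    "path_image (piece x a b) = \<Phi> ` seg_img x {a..b}" "\<exists>ps. pl_via (piece x a b) ps"
proof -
  have p: "seg_pt x a \<in> polygon g" "seg_pt x b \<in> polygon g" using seg_pt_polygon[OF assms(1)] assms by auto
  have n: "seg_pt x a \<noteq> seg_pt x b" using seg_pt_inj[OF assms(1)] assms(3) by blast
  note f = base_path_facts[OF p]
  show "arc (piece x a b)" "path (piece x a b)" "piece x a b 0 = \<Phi> (Base (seg_pt x a))" "piece x a b 1 = \<Phi> (Base (seg_pt x b))"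
    "\<exists>ps. pl_via (piece x a b) ps"
    unfolding piece_def by (rule f(5)[OF n] f(1-3) f(6)[OF n])+
  show "path_image (piece x a b) = \<Phi> ` seg_img x {a..b}"
    unfolding piece_def f(4) closed_segment_seg_pt[OF less_imp_le[OF assms(3)]] by (simp add: seg_img_def image_image)
qed

lemma seg_img_highway: "valid_step x \<Longrightarrow> I \<subseteq> {0..1} \<Longrightarrow> seg_img x I \<subseteq> highway g"
  unfolding seg_img_def highway_def using seg_pt_polygon by blast

text \<open>Double points of \<open>\<Phi>\<close> have both preimages on bridges. As soon as one of
  the sets lies in the polygon, their images can meet only in images of common points.\<close>

lemma image_disjoint:
  assumes "S \<subseteq> highway g" "T \<subseteq> highway g" "S \<subseteq> range Base \<or> T \<subseteq> range Base" "p \<in> \<Phi> ` S" "p \<in> \<Phi> ` T"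
  shows "p \<in> \<Phi> ` (S \<inter> T)"
proof -
  obtain a b where ab: "a \<in> S" "b \<in> T" "p = \<Phi> a" "p = \<Phi> b" using assms(4,5) by blast
  have "a = b"
  proof (rule ccontr)
    assume "a \<noteq> b"
    then obtain i j where "a \<in> bridge i" "b \<in> bridge j"
      using immersion_inj[of a b] ab assms(1,2) by (metis subsetD)
    then show False using assms(3) ab by (auto simp: bridge_def)
  qed
  then show ?thesis using ab by blast
qed

lemma seg_img_Base: "seg_img x I \<subseteq> range Base"
  by (auto simp: seg_img_def)

lemma seg_img_disjoint:
  assumes X: "coherent X" "x \<in> X" "y \<in> X" and I: "I \<subseteq> {0<..<1}" "J \<subseteq> {0<..<1}" and d: "x \<noteq> y \<or> I \<inter> J = {}"
  shows "\<Phi> ` seg_img x I \<inter> \<Phi> ` seg_img y J = {}"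
proof -
  have "seg_img x I \<inter> seg_img y J = {}"
  proof (rule equals0I)
    fix p assume "p \<in> seg_img x I \<inter> seg_img y J"
    then obtain u v where "u \<in> I" "v \<in> J" "seg_pt x u = seg_pt y v" by (auto simp: seg_img_def)
    moreover from this have "0 < u" "u < 1" "0 < v" "v < 1" using I by auto
    ultimately show False using seg_pt_eq[OF X, of u v] d by auto
  qed
  moreover have "seg_img x I \<subseteq> highway g" "seg_img y J \<subseteq> highway g"
  proof -
    have "{0<..<1} \<subseteq> {0..1::real}" by auto
    then show "seg_img x I \<subseteq> highway g" "seg_img y J \<subseteq> highway g"
      using I coherent_valid[OF X(1)] X(2,3) seg_img_highway by (meson order_trans)+
  qed
  ultimately show ?thesis using image_disjoint[of "seg_img x I" "seg_img y J"] seg_img_Base by blast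
qed

lemma seg_img_node_disjoint:
  assumes "valid_step x" "valid_step y" and I: "I \<subseteq> {0<..<1}"
  shows "\<Phi> ` seg_img x I \<inter> \<Phi> ` node y = {}"
proof -
  have "seg_img x I \<inter> node y = {}"
  proof (rule equals0I)
    fix p assume "p \<in> seg_img x I \<inter> node y"
    then obtain u where "u \<in> I" "Base (seg_pt x u) \<in> node y" by (auto simp: seg_img_def)
    moreover from this have "0 < u" "u < 1" using I by auto
    ultimately show False using seg_pt_not_in_node[OF assms(2,1)] by blast
  qed
  moreover have "seg_img x I \<subseteq> highway g" "node y \<subseteq> highway g"
  proof -
    have "{0<..<1} \<subseteq> {0..1::real}" by auto
    then show "seg_img x I \<subseteq> highway g"
      using I assms(1) seg_img_highway by (meson order_trans)
  qed (rule node_in_highway[OF assms(2)])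
  ultimately show ?thesis using image_disjoint[of "seg_img x I" "node y"] seg_img_Base by blast
qed

text \<open>Bridges are numbered from 1; the value 0 marks a step that ends at a vertex and belongs
  to no bridge pair.\<close>

definition exit_bridge :: "'e step \<Rightarrow> nat" where
  "exit_bridge x = (case exit x of None \<Rightarrow> 0 | Some (m, t) \<Rightarrow> bridge_of m)"

lemma node_bridge:
  assumes "valid_step x" "p \<in> node x" "p \<in> bridge i"
  shows "exit_bridge x = i"
proof (cases "exit x")
  case None
  then show ?thesis using assms(2,3) by (auto simp: node_def bridge_def)
next
  case (Some mt)
  obtain m t where mt: "mt = (m, t)" by force
  have m: "m \<in> {1..4 * g}" using exit_Some[OF assms(1)] Some mt by simp
  obtain u where u: "u \<in> {0..1}" "p = strand g m t u" using assms(2) Some mt by (auto simp: node_def)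
  have "p = Base (side_pt g m t) \<or> p = Base (side_pt g (partner m) (1 - t)) \<or>
     (\<exists>u'. p = Bridge (bridge_of m) (bridge_coord m t) u')"
  proof (cases "u = 0 \<or> u = 1")
    case True
    then show ?thesis using strand_ends[OF m, of t] u(2) by auto
  next
    case False
    then have "0 < u" "u < 1" using u(1) by auto
    then show ?thesis using strand_inner u(2) by metis
  qed
  then show ?thesis using assms(3) Some mt by (auto simp: bridge_def exit_bridge_def)
qed

text \<open>The images of two nodes can meet in two ways only: in the image of a common point, which
  is then a shared vertex, or in a double point of \<open>\<Phi>\<close>, which requires paired
  bridges.\<close>

lemma node_images_disjoint:
  assumes X: "coherent X" "x \<in> X" "y \<in> X" "x \<noteq> y"
    and "\<not> (exit x = None \<and> exit y = None \<and> dst x = dst y)" "\<not> bridge_pair (exit_bridge x) (exit_bridge y)"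
  shows "\<Phi> ` node x \<inter> \<Phi> ` node y = {}"
proof (rule equals0I)
  fix p assume "p \<in> \<Phi> ` node x \<inter> \<Phi> ` node y"
  then obtain a b where ab: "a \<in> node x" "b \<in> node y" "\<Phi> a = \<Phi> b" by force
  have v: "valid_step x" "valid_step y" using coherent_valid X by blast+
  show False
  proof (cases "a = b")
    case True
    then show False using nodes_meet[OF X] ab assms(5) by blast
  next
    case False
    moreover have "a \<in> highway g" "b \<in> highway g" using ab node_in_highway v by blast+
    ultimately obtain i j where "bridge_pair i j" "a \<in> bridge i" "b \<in> bridge j"
      using immersion_inj ab(3) by metis
    then show False using node_bridge[OF v(1) ab(1)] node_bridge[OF v(2) ab(2)] assms(6) by simp
  qed
qed

lemma mid_cell_facts:
  assumes "valid_step x"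
  shows "arc (mid_cell x)" "path_image (mid_cell x) = \<Phi> ` seg_img x {1/3..2/3}" "\<exists>ps. pl_via (mid_cell x) ps"
    "mid_cell x 0 = \<Phi> (Base (seg_pt x (1/3)))" "mid_cell x 1 = \<Phi> (Base (seg_pt x (2/3)))"
  using piece_facts[OF assms, of "1/3" "2/3"] by (auto simp: mid_cell_def)

text \<open>The outer ends of the thirds belong to the node. Half-open thirds thus give the same
  union, and to them the disjointness lemmas for parameters strictly between 0 and 1 apply.\<close>

lemma seg_img_union_node:
  assumes "valid_step x" "follows x y"
  shows "\<Phi> ` seg_img x {2/3..1} \<union> \<Phi> ` node x \<union> \<Phi> ` seg_img y {0..1/3} =
    \<Phi> ` seg_img x {2/3..<1} \<union> \<Phi> ` node x \<union> \<Phi> ` seg_img y {0<..1/3}"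
proof -
  have "{2/3..1} = insert 1 {2/3..<1::real}" "{0..1/3} = insert 0 {0<..1/3::real}" by auto
  then have "seg_img x {2/3..1} = insert (Base (dst x)) (seg_img x {2/3..<1})"
    "seg_img y {0..1/3} = insert (Base (src y)) (seg_img y {0<..1/3})"
    by (simp_all add: seg_img_def)
  then show ?thesis using dst_in_node[OF assms(1)] src_in_node[OF assms] by auto
qed

lemma turn_cell_facts:
  assumes X: "coherent X" "x \<in> X" "y \<in> X" "x \<noteq> y" and nxt: "follows x y"
  shows "arc (turn_cell x y)" "turn_cell x y 0 = \<Phi> (Base (seg_pt x (2/3)))" "turn_cell x y 1 = \<Phi> (Base (seg_pt y (1/3)))"
    "path_image (turn_cell x y) = \<Phi> ` seg_img x {2/3..<1} \<union> \<Phi> ` node x \<union> \<Phi> ` seg_img y {0<..1/3}"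
proof -
  have v: "valid_step x" "valid_step y" using coherent_valid X by blast+
  let ?C = "piece x (2/3) 1" and ?A = "piece y 0 (1/3)"
  have C: "arc ?C" "?C 0 = \<Phi> (Base (seg_pt x (2/3)))" "?C 1 = \<Phi> (Base (dst x))" "path_image ?C = \<Phi> ` seg_img x {2/3..1}"
    using piece_facts[OF v(1), of "2/3" 1] by auto
  have A: "arc ?A" "?A 0 = \<Phi> (Base (src y))" "?A 1 = \<Phi> (Base (seg_pt y (1/3)))" "path_image ?A = \<Phi> ` seg_img y {0..1/3}"
    using piece_facts[OF v(2), of 0 "1/3"] by auto
  have C1: "\<Phi> ` seg_img x {2/3..1} = insert (\<Phi> (Base (dst x))) (\<Phi> ` seg_img x {2/3..<1})"
  proof -
    have "{2/3..1} = insert 1 {2/3..<1::real}" by auto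
    then show ?thesis by (simp add: seg_img_def)
  qed
  have A0: "\<Phi> ` seg_img y {0..1/3} = insert (\<Phi> (Base (src y))) (\<Phi> ` seg_img y {0<..1/3})"
  proof -
    have "{0..1/3} = insert 0 {0<..1/3::real}" by auto
    then show ?thesis by (simp add: seg_img_def)
  qed
  have d: "\<Phi> ` seg_img x {2/3..<1} \<inter> \<Phi> ` seg_img y {0<..1/3} = {}"
    "\<Phi> ` seg_img x {2/3..<1} \<inter> \<Phi> ` node x = {}" "\<Phi> ` seg_img y {0<..1/3} \<inter> \<Phi> ` node x = {}"
  proof -
    have I: "{2/3..<1} \<subseteq> {0<..<1::real}" "{0<..1/3} \<subseteq> {0<..<1::real}" by auto
    show "\<Phi> ` seg_img x {2/3..<1} \<inter> \<Phi> ` seg_img y {0<..1/3} = {}"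
      using seg_img_disjoint[OF X(1-3) I] X(4) by blast
    show "\<Phi> ` seg_img x {2/3..<1} \<inter> \<Phi> ` node x = {}" "\<Phi> ` seg_img y {0<..1/3} \<inter> \<Phi> ` node x = {}"
      using seg_img_node_disjoint[OF v(1) v(1) I(1)] seg_img_node_disjoint[OF v(2) v(1) I(2)] by blast+
  qed
  have n: "Base (dst x) \<in> node x" "Base (src y) \<in> node x" using dst_in_node src_in_node v nxt by blast+
  have "arc (turn_cell x y) \<and> turn_cell x y 0 = ?C 0 \<and> turn_cell x y 1 = ?A 1 \<and>
    path_image (turn_cell x y) = \<Phi> ` seg_img x {2/3..1} \<union> \<Phi> ` node x \<union> \<Phi> ` seg_img y {0..1/3}"
  proof (cases "exit x")
    case None
    then have e: "src y = dst x" using nxt by (simp add: follows_def)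
    have "path_image ?C \<inter> path_image ?A \<subseteq> {pathstart ?A}"
      unfolding C(4) A(4) C1 A0 pathstart_def A(2) using d n e by auto
    then have "arc (?C +++ ?A)" using C A e by (intro arc_join) (auto simp: pathstart_def pathfinish_def)
    moreover have "path_image (?C +++ ?A) = path_image ?C \<union> path_image ?A"
      using C(3) A(2) e by (intro path_image_join) (simp add: pathstart_def pathfinish_def)
    moreover have "node x = {Base (dst x)}" using None by (simp add: node_def)
    ultimately show ?thesis using None C(4) A(4) C1 by (auto simp: turn_cell_def joinpaths_def)
  next
    case (Some mt)
    obtain m t where mt: "exit x = Some (m, t)" using Some by force
    note ex = exit_Some[OF v(1) mt]
    have e: "src y = side_pt g (partner m) (1 - t)" using nxt mt by (simp add: follows_def)
    let ?S = "strand_path m t"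
    note S = strand_path_facts[OF ex(1-3)]
    have nd: "\<Phi> ` node x = path_image ?S" using mt S(4) by (simp add: node_def)
    have ends: "pathfinish ?C = pathstart ?S" "pathfinish ?S = pathstart ?A"
      using C(3) A(2) S(2,3) ex(4) e by (simp_all add: pathstart_def pathfinish_def)
    have "path_image ?S \<inter> path_image ?A \<subseteq> {pathstart ?A}"
      unfolding A(4) A0 nd[symmetric] pathstart_def A(2) using d by auto
    then have SA: "arc (?S +++ ?A)" using S(1) A(1) ends by (intro arc_join)
    have imSA: "path_image (?S +++ ?A) = \<Phi> ` node x \<union> \<Phi> ` seg_img y {0..1/3}"
      using ends nd A(4) by (simp add: path_image_join)
    have ends': "pathfinish ?C = pathstart (?S +++ ?A)" using ends by simp
    have "path_image ?C \<inter> path_image (?S +++ ?A) \<subseteq> {pathstart (?S +++ ?A)}"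
    proof -
      have "pathstart (?S +++ ?A) = pathstart ?S" by simp
      then have "pathstart (?S +++ ?A) = \<Phi> (Base (dst x))" using S(2) ex(4) by (simp only: pathstart_def)
      moreover have "\<Phi> (Base (src y)) \<in> \<Phi> ` node x" using n by blast
      ultimately show ?thesis unfolding imSA C(4) C1 A0 using d by auto
    qed
    then have "arc (?C +++ (?S +++ ?A))" by (rule arc_join[OF C(1) SA ends'])
    moreover have "path_image (?C +++ (?S +++ ?A)) = path_image ?C \<union> path_image (?S +++ ?A)"
      using ends' by (rule path_image_join)
    ultimately show ?thesis using mt C(4) imSA by (auto simp: turn_cell_def joinpaths_def)
  qed
  then show "arc (turn_cell x y)" "turn_cell x y 0 = \<Phi> (Base (seg_pt x (2/3)))" "turn_cell x y 1 = \<Phi> (Base (seg_pt y (1/3)))"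
    "path_image (turn_cell x y) = \<Phi> ` seg_img x {2/3..<1} \<union> \<Phi> ` node x \<union> \<Phi> ` seg_img y {0<..1/3}"
    using seg_img_union_node[OF v(1) nxt] C(2) A(3) by simp_all
qed

lemma mid_cells_disjoint:
  assumes X: "coherent X" "x \<in> X" "y \<in> X" "x \<noteq> y"
  shows "path_image (mid_cell x) \<inter> path_image (mid_cell y) = {}"
  unfolding mid_cell_facts(2)[OF coherent_valid[OF X(1,2)]] mid_cell_facts(2)[OF coherent_valid[OF X(1,3)]]
  by (rule seg_img_disjoint[OF X(1-3)]) (use X(4) in auto)

lemma mid_turn_cells:
  assumes X: "coherent X" "x \<in> X" "y \<in> X" "z \<in> X" "x \<noteq> y" and nxt: "follows x y"
  shows "z \<noteq> x \<Longrightarrow> z \<noteq> y \<Longrightarrow> path_image (mid_cell z) \<inter> path_image (turn_cell x y) = {}"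
    and "path_image (mid_cell x) \<inter> path_image (turn_cell x y) \<subseteq> {turn_cell x y 0}"
    and "path_image (turn_cell x y) \<inter> path_image (mid_cell y) \<subseteq> {turn_cell x y 1}"
proof -
  have v: "valid_step x" "valid_step y" "valid_step z" using coherent_valid X by blast+
  note T = turn_cell_facts[OF X(1-3,5) nxt]
  have node: "\<Phi> ` seg_img w {1/3..2/3} \<inter> \<Phi> ` node x = {}" if "valid_step w" for w
    by (rule seg_img_node_disjoint[OF that v(1)]) auto
  have C: "\<Phi> ` seg_img w {1/3..2/3} \<inter> \<Phi> ` seg_img x {2/3..<1} = {}" if "w \<in> X" "w \<noteq> x" for w
    by (rule seg_img_disjoint[OF X(1) that(1) X(2)]) (use that in auto)
  have A: "\<Phi> ` seg_img w {1/3..2/3} \<inter> \<Phi> ` seg_img y {0<..1/3} = {}" if "w \<in> X" "w \<noteq> y" for w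
    by (rule seg_img_disjoint[OF X(1) that(1) X(3)]) (use that in auto)
  show "path_image (mid_cell z) \<inter> path_image (turn_cell x y) = {}" if "z \<noteq> x" "z \<noteq> y"
    unfolding T(4) mid_cell_facts(2)[OF v(3)] using node[OF v(3)] C[OF X(4) that(1)] A[OF X(4) that(2)] by blast
  have "\<Phi> ` seg_img x {1/3..2/3} \<inter> \<Phi> ` seg_img x {2/3<..<1} = {}"
    by (rule seg_img_disjoint[OF X(1,2,2)]) auto
  moreover have "\<Phi> ` seg_img x {2/3..<1} = insert (\<Phi> (Base (seg_pt x (2/3)))) (\<Phi> ` seg_img x {2/3<..<1})"
  proof -
    have "{2/3..<1} = insert (2/3) {2/3<..<1::real}" by auto
    then show ?thesis by (simp add: seg_img_def)
  qed
  moreover have "M \<inter> (insert p D \<union> N \<union> A) \<subseteq> {p}" if "M \<inter> D = {}" "M \<inter> N = {}" "M \<inter> A = {}"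
    for M D N A :: "complex set" and p
    using that by blast
  ultimately show "path_image (mid_cell x) \<inter> path_image (turn_cell x y) \<subseteq> {turn_cell x y 0}"
    unfolding T(4) mid_cell_facts(2)[OF v(1)] T(2) using node[OF v(1)] A[OF X(2,5)] by metis
  have "\<Phi> ` seg_img y {1/3..2/3} \<inter> \<Phi> ` seg_img y {0<..<1/3} = {}"
    by (rule seg_img_disjoint[OF X(1,3,3)]) auto
  moreover have "\<Phi> ` seg_img y {0<..1/3} = insert (\<Phi> (Base (seg_pt y (1/3)))) (\<Phi> ` seg_img y {0<..<1/3})"
  proof -
    have "{0<..1/3} = insert (1/3) {0<..<1/3::real}" by auto
    then show ?thesis by (simp add: seg_img_def)
  qed
  moreover have "(A \<union> N \<union> insert p D) \<inter> M \<subseteq> {p}" if "M \<inter> D = {}" "M \<inter> N = {}" "M \<inter> A = {}"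
    for M D N A :: "complex set" and p
    using that by blast
  ultimately show "path_image (turn_cell x y) \<inter> path_image (mid_cell y) \<subseteq> {turn_cell x y 1}"
    unfolding T(4) mid_cell_facts(2)[OF v(2)] T(3) using node[OF v(2)] C[OF X(3) not_sym[OF X(5)]] by metis
qed

end

section \<open>Crossing indices of steps\<close>

text \<open>All pieces of different paths are disjoint except possibly the two middle ones, so
  additivity leaves only these. It serves to strip turn cells on bridges down to their
  strands.\<close>

lemma cross_index_middle:
  assumes \<alpha>: "path a1" "path s" "path a2" "a1 1 = s 0" "s 1 = a2 0"
    and \<beta>: "path b1" "path r" "path b2" "b1 1 = r 0" "r 1 = b2 0"
    and disj: "path_image a1 \<inter> (path_image b1 \<union> path_image r \<union> path_image b2) = {}"
      "path_image a2 \<inter> (path_image b1 \<union> path_image r \<union> path_image b2) = {}"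
      "path_image s \<inter> (path_image b1 \<union> path_image b2) = {}"
  shows "cross_index (a1 +++ (s +++ a2)) (b1 +++ (r +++ b2)) = cross_index s r"
proof -
  have ends: "\<gamma> 0 \<in> path_image \<gamma>" "\<gamma> 1 \<in> path_image \<gamma>" for \<gamma> :: "real \<Rightarrow> complex"
    by (auto simp: path_image_def)
  have fin: "pathfinish a1 = pathstart s" "pathfinish s = pathstart a2" "pathfinish b1 = pathstart r" "pathfinish r = pathstart b2"
    using \<alpha> \<beta> by (simp_all add: pathfinish_def pathstart_def)
  have P: "path (s +++ a2)" "path (r +++ b2)" "path (b1 +++ (r +++ b2))" using fin \<alpha> \<beta> by simp_all
  have im: "path_image (r +++ b2) = path_image r \<union> path_image b2"
    "path_image (b1 +++ (r +++ b2)) = path_image b1 \<union> (path_image r \<union> path_image b2)"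
    using fin by (simp_all add: path_image_join)
  let ?\<beta> = "b1 +++ (r +++ b2)"
  have b01: "?\<beta> 0 = b1 0" "?\<beta> 1 = b2 1" by (simp_all add: joinpaths_def)
  have 1: "cross_index (a1 +++ (s +++ a2)) ?\<beta> = cross_index a1 ?\<beta> + cross_index (s +++ a2) ?\<beta>"
    using P \<alpha> fin disj ends[of b1] ends[of b2] b01
    by (intro cross_index_join_left) (auto simp: path_image_join)
  have 2: "cross_index (s +++ a2) ?\<beta> = cross_index s ?\<beta> + cross_index a2 ?\<beta>"
    using P \<alpha> fin disj ends[of b1] ends[of b2] b01
    by (intro cross_index_join_left) auto
  have 3: "cross_index a1 ?\<beta> = 0" "cross_index a2 ?\<beta> = 0"
    using P \<alpha> disj im by (auto intro!: cross_index_disjoint)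
  have s: "s 0 = a1 1" "s 1 = a2 0" using \<alpha> by simp_all
  have off: "s 0 \<notin> path_image b1 \<union> path_image r \<union> path_image b2" "s 1 \<notin> path_image b1 \<union> path_image r \<union> path_image b2"
    unfolding s using disj ends[of a1] ends[of a2] by blast+
  have 4: "cross_index s ?\<beta> = cross_index s b1 + cross_index s (r +++ b2)"
    using P \<beta> fin im off by (intro cross_index_join_right) auto
  have 5: "cross_index s (r +++ b2) = cross_index s r + cross_index s b2"
    using P \<beta> fin im off by (intro cross_index_join_right) auto
  have 6: "cross_index s b1 = 0" "cross_index s b2 = 0"
    using \<alpha> \<beta> disj by (auto intro!: cross_index_disjoint)
  show ?thesis by (simp add: 1 2 3 4 5 6)
qed

lemma cross_index_cong:
  assumes "\<And>t. t \<in> {0..1} \<Longrightarrow> \<alpha> t = \<alpha>' t" "\<And>t. t \<in> {0..1} \<Longrightarrow> \<beta> t = \<beta>' t"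
  shows "cross_index \<alpha> \<beta> = cross_index \<alpha>' \<beta>'"
proof -
  have "winding_number \<alpha> z = winding_number \<alpha>' z" "winding_number \<beta> z = winding_number \<beta>' z" for z
    using assms by (auto intro!: winding_number_cong)
  then show ?thesis using assms by (simp add: cross_index_def)
qed

lemma cross_index_reversepath_left:
  assumes "path \<alpha>" "\<beta> 0 \<notin> path_image \<alpha>" "\<beta> 1 \<notin> path_image \<alpha>"
  shows "cross_index (reversepath \<alpha>) \<beta> = - cross_index \<alpha> \<beta>"
  using assms by (simp add: cross_index_def winding_number_reversepath reversepath_def[abs_def, symmetric])
    (simp add: reversepath_def)

context drawing
begin

text \<open>The small circle that detects the orientation is taken around the centre, which is
  interior as soon as the polygon has any interior point.\<close>

lemma cross_index_in_polygon:
  assumes paths: "path \<alpha>" "path \<beta>" "path_image \<alpha> \<subseteq> polygon g" "path_image \<beta> \<subseteq> polygon g"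
    and ends: "\<alpha> 0 \<notin> path_image \<beta>" "\<alpha> 1 \<notin> path_image \<beta>" "\<beta> 0 \<notin> path_image \<alpha>" "\<beta> 1 \<notin> path_image \<alpha>"
    and ne: "interior (polygon g) \<noteq> {}"
  shows "cross_index (\<lambda>t. \<Phi> (Base (\<alpha> t))) (\<lambda>t. \<Phi> (Base (\<beta> t))) = cross_index \<alpha> \<beta>"
proof -
  obtain r where r: "0 < r" "cball 0 r \<subseteq> interior (polygon g)"
    using zero_interior_polygon[OF ne] open_contains_cball[of "interior (polygon g)"] by auto
  have "\<forall>z r. 0 < r \<and> cball z r \<subseteq> interior (polygon g) \<longrightarrow>
        winding_number (\<lambda>x. \<Phi> (Base (circlepath z r x))) (\<Phi> (Base z)) = 1"
    using immersion unfolding highway_immersion_def by (elim conjE)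
  then have w: "winding_number (\<lambda>x. \<Phi> (Base (circlepath 0 r x))) (\<Phi> (Base 0)) = 1" using r by blast
  have "cball 0 r \<subseteq> polygon g" using r(2) interior_subset by blast
  from cross_index_image[OF convex_polygon polygon_uminus polygon_subset_cball r(1) this continuous_base inj_base w paths ends]
  show ?thesis by (simp add: comp_def)
qed

lemma cross_index_base_join:
  assumes "a \<in> polygon g" "b \<in> polygon g" "c \<in> polygon g"
  shows "(base_path a b +++ base_path b c) t = \<Phi> (Base ((linepath a b +++ linepath b c) t))"
  by (simp add: joinpaths_def base_path_def)

lemma base_wedge_facts:
  assumes "a \<in> polygon g" "o' \<in> polygon g" "b \<in> polygon g"
  shows "path (base_path a o' +++ base_path o' b)" "(base_path a o' +++ base_path o' b) 0 = \<Phi> (Base a)"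
    "(base_path a o' +++ base_path o' b) 1 = \<Phi> (Base b)"
    "path_image (base_path a o' +++ base_path o' b) = (\<lambda>z. \<Phi> (Base z)) ` (closed_segment a o' \<union> closed_segment o' b)"
proof -
  note f = base_path_facts[OF assms(1,2)] base_path_facts[OF assms(2,3)]
  have e: "pathfinish (base_path a o') = pathstart (base_path o' b)" by (simp add: pathfinish_def pathstart_def f)
  show "path (base_path a o' +++ base_path o' b)" using e f by simp
  show "(base_path a o' +++ base_path o' b) 0 = \<Phi> (Base a)" "(base_path a o' +++ base_path o' b) 1 = \<Phi> (Base b)"
    by (simp_all add: joinpaths_def f)
  show "path_image (base_path a o' +++ base_path o' b) = (\<lambda>z. \<Phi> (Base z)) ` (closed_segment a o' \<union> closed_segment o' b)"
    using e by (simp add: path_image_join f image_Un)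
qed

lemma cross_index_base_wedges:
  assumes P: "a \<in> polygon g" "b \<in> polygon g" "c \<in> polygon g" "d \<in> polygon g" "o' \<in> polygon g"
    and ne: "interior (polygon g) \<noteq> {}"
    and off: "a \<notin> closed_segment c o' \<union> closed_segment o' d" "b \<notin> closed_segment c o' \<union> closed_segment o' d"
      "c \<notin> closed_segment a o' \<union> closed_segment o' b" "d \<notin> closed_segment a o' \<union> closed_segment o' b"
  shows "cross_index (base_path a o' +++ base_path o' b) (base_path c o' +++ base_path o' d) =
    cross_index (linepath a o' +++ linepath o' b) (linepath c o' +++ linepath o' d)"
proof -
  have "cross_index (base_path a o' +++ base_path o' b) (base_path c o' +++ base_path o' d) =
    cross_index (\<lambda>t. \<Phi> (Base ((linepath a o' +++ linepath o' b) t))) (\<lambda>t. \<Phi> (Base ((linepath c o' +++ linepath o' d) t)))"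
    by (rule cross_index_cong) (simp_all add: cross_index_base_join P)
  also have "\<dots> = cross_index (linepath a o' +++ linepath o' b) (linepath c o' +++ linepath o' d)"
  proof (rule cross_index_in_polygon[OF _ _ _ _ _ _ _ _ ne])
    have e: "(linepath x o' +++ linepath o' y) 0 = x" "(linepath x o' +++ linepath o' y) 1 = y" for x y
      by (simp_all add: joinpaths_def linepath_def)
    have e': "path (linepath x o' +++ linepath o' y)"
      "path_image (linepath x o' +++ linepath o' y) = closed_segment x o' \<union> closed_segment o' y" for x y
      by (simp_all add: path_image_join)
    show "path (linepath a o' +++ linepath o' b)" "path (linepath c o' +++ linepath o' d)" by (rule e'(1))+
    show "path_image (linepath a o' +++ linepath o' b) \<subseteq> polygon g" "path_image (linepath c o' +++ linepath o' d) \<subseteq> polygon g"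
      unfolding e'(2) using P by (simp_all add: closed_segment_subset convex_polygon)
    show "(linepath a o' +++ linepath o' b) 0 \<notin> path_image (linepath c o' +++ linepath o' d)"
      "(linepath a o' +++ linepath o' b) 1 \<notin> path_image (linepath c o' +++ linepath o' d)"
      "(linepath c o' +++ linepath o' d) 0 \<notin> path_image (linepath a o' +++ linepath o' b)"
      "(linepath c o' +++ linepath o' d) 1 \<notin> path_image (linepath a o' +++ linepath o' b)"
      unfolding e e'(2) by (rule off)+
  qed
  finally show ?thesis .
qed

text \<open>Two strands on crossing bridges are closed up through the centre of the polygon; the closed curves
  meet evenly, and the closing paths cross once.\<close>

lemma cross_index_strands_oriented:
  assumes j: "j < g" and t: "0 < t" "t < 1" "0 < t'" "t' < 1" and ne: "interior (polygon g) \<noteq> {}"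
  shows "cross_index (strand_path (Suc (4 * j)) t) (strand_path (4 * j + 2) t') = - 1"
proof -
  let ?n = "real (4 * g)"
  have g: "0 < ?n" using j by simp
  have m: "Suc (4 * j) \<in> {1..4 * g}" "4 * j + 2 \<in> {1..4 * g}" "4 * j + 3 \<in> {1..4 * g}" "4 * j + 4 \<in> {1..4 * g}" using j by auto
  define a where "a = side_pt g (Suc (4 * j)) t"
  define b where "b = side_pt g (4 * j + 3) (1 - t)"
  define c where "c = side_pt g (4 * j + 2) t'"
  define d where "d = side_pt g (4 * j + 4) (1 - t')"
  \<comment> \<open>\<open>f i\<close> is the angle of the corner \<open>4 * j + i\<close>. The ends
    of the two strands alternate around the centre in the order \<open>a\<close>, \<open>c\<close>,
    \<open>b\<close>, \<open>d\<close>; for \<open>g = 1\<close> the four sides fill the whole turn,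
    which is the equality case of \<open>wrap\<close>.\<close>
  define f where "f i = 2 * pi * (4 * real j + i) / ?n" for i
  have polar: "\<exists>r \<phi>. 0 < r \<and> f i < \<phi> \<and> \<phi> < f (i + 1) \<and> side_pt g m s = of_real r * cis \<phi>"
    if "m \<in> {1..4 * g}" "0 < s" "s < 1" "real m = 4 * real j + (i + 1)" for m s i
  proof -
    have e: "real (m - 1) = 4 * real j + i" using that(1,4) by (simp add: of_nat_diff)
    show ?thesis using side_pt_polar[OF that(1-3)] unfolding f_def e that(4) by metis
  qed
  have t': "0 < 1 - t" "1 - t < 1" "0 < 1 - t'" "1 - t' < 1" using t by auto
  obtain ra \<phi>a where A: "0 < ra" "f 0 < \<phi>a" "\<phi>a < f 1" "a = of_real ra * cis \<phi>a"
    using polar[OF m(1) t(1,2), of 0] by (auto simp: a_def)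
  obtain rc \<phi>c where C: "0 < rc" "f 1 < \<phi>c" "\<phi>c < f 2" "c = of_real rc * cis \<phi>c"
    using polar[OF m(2) t(3,4), of 1] by (auto simp: c_def)
  obtain rb \<phi>b where B: "0 < rb" "f 2 < \<phi>b" "\<phi>b < f 3" "b = of_real rb * cis \<phi>b"
    using polar[OF m(3) t'(1,2), of 2] by (auto simp: b_def)
  obtain rd \<phi>d where D: "0 < rd" "f 3 < \<phi>d" "\<phi>d < f 4" "d = of_real rd * cis \<phi>d"
    using polar[OF m(4) t'(3,4), of 3] by (auto simp: d_def)
  have wrap: "f 4 \<le> f 0 + 2 * pi"
  proof -
    have "f 4 - f 0 = 2 * pi * (4 / ?n)" using g by (simp add: f_def field_simps)
    also have "\<dots> \<le> 2 * pi" using j by (simp add: divide_le_eq)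
    finally show ?thesis by simp
  qed
  note rays = cross_index_rays[of ra rb rc rd \<phi>a \<phi>c \<phi>b \<phi>d, folded A(4) B(4) C(4) D(4)]
  have o: "0 < ra" "0 < rb" "0 < rc" "0 < rd" "\<phi>a < \<phi>c" "\<phi>c < \<phi>b" "\<phi>b < \<phi>d" "\<phi>d < \<phi>a + 2 * pi"
    using A B C D wrap by linarith+
  note off = rays(2-5)[OF o]
  have P: "a \<in> polygon g" "b \<in> polygon g" "c \<in> polygon g" "d \<in> polygon g" "0 \<in> polygon g"
    unfolding a_def b_def c_def d_def
    using m t t' subsetD[OF interior_subset zero_interior_polygon[OF ne]] by (auto intro!: side_pt_in_polygon)
  have one: "cross_index (base_path a 0 +++ base_path 0 b) (base_path c 0 +++ base_path 0 d) = 1"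
    using cross_index_base_wedges[OF P ne off] rays(1)[OF o] by simp
  define S where "S = strand_path (Suc (4 * j)) t"
  define R where "R = strand_path (4 * j + 2) t'"
  let ?K = "base_path a 0 +++ base_path 0 b" and ?L = "base_path c 0 +++ base_path 0 d"
  note S = strand_path_facts[OF m(1) t(1,2), unfolded side_numbers, folded a_def b_def S_def]
  note R = strand_path_facts[OF m(2) t(3,4), unfolded side_numbers, folded c_def d_def R_def]
  have K: "path ?K" "?K 0 = \<Phi> (Base a)" "?K 1 = \<Phi> (Base b)"
      "path_image ?K = (\<lambda>z. \<Phi> (Base z)) ` (closed_segment a 0 \<union> closed_segment 0 b)"
    by (rule base_wedge_facts[OF P(1,5,2)])+
  have L: "path ?L" "?L 0 = \<Phi> (Base c)" "?L 1 = \<Phi> (Base d)"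
      "path_image ?L = (\<lambda>z. \<Phi> (Base z)) ` (closed_segment c 0 \<union> closed_segment 0 d)"
    by (rule base_wedge_facts[OF P(3,5,4)])+
  have strand_Base: "z = side_pt g m t \<or> z = side_pt g (partner m) (1 - t)"
    if "m \<in> {1..4 * g}" "Base z \<in> strand g m t ` {0..1}" for z m t
  proof -
    from that(2) obtain u where u: "u \<in> {0..1}" "Base z = strand g m t u" by blast
    show ?thesis
    proof (cases "u = 0 \<or> u = 1")
      case True
      then show ?thesis using strand_ends[OF that(1), of t] u(2) by auto
    next
      case False
      then have "0 < u" "u < 1" using u(1) by auto
      then show ?thesis using strand_inner u(2) by (metis hw_point.distinct(1))
    qed
  qed
  \<comment> \<open>A strand touches the polygon only in its two end points, and no point of the
    polygon is a double point of \<open>\<Phi>\<close>.\<close>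
  have meet: "\<Phi> ` strand g m t ` {0..1} \<inter> (\<lambda>z. \<Phi> (Base z)) ` T = {}"
    if "m \<in> {1..4 * g}" "0 < t" "t < 1" "T \<subseteq> polygon g" "side_pt g m t \<notin> T" "side_pt g (partner m) (1 - t) \<notin> T" for m t T
  proof -
    have h1: "strand g m t ` {0..1} \<subseteq> highway g" using strand_in_highway that by auto
    have h2: "Base ` T \<subseteq> highway g" using that by (auto simp: highway_def)
    have e: "strand g m t ` {0..1} \<inter> Base ` T = {}"
    proof (rule equals0I)
      fix p assume p: "p \<in> strand g m t ` {0..1} \<inter> Base ` T"
      then obtain z where "z \<in> T" "p = Base z" by blast
      then show False using strand_Base[OF that(1), of z t] that(5,6) p by auto
    qed
    have h3: "strand g m t ` {0..1} \<subseteq> range Base \<or> Base ` T \<subseteq> range Base" by auto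
    have "\<Phi> ` strand g m t ` {0..1} \<inter> \<Phi> ` Base ` T = {}"
    proof (rule equals0I, erule IntE)
      fix p assume "p \<in> \<Phi> ` strand g m t ` {0..1}" "p \<in> \<Phi> ` Base ` T"
      from image_disjoint[OF h1 h2 h3 this] show False unfolding e by simp
    qed
    then show ?thesis by (simp only: image_image)
  qed
  have segP: "closed_segment x 0 \<union> closed_segment 0 y \<subseteq> polygon g" if "x \<in> polygon g" "y \<in> polygon g" for x y
    using that P(5) by (simp add: closed_segment_subset convex_polygon)
  have SL: "path_image S \<inter> path_image ?L = {}"
    unfolding S(4) L(4) by (rule meet[OF m(1) t(1,2) segP[OF P(3,4)]]) (use off in \<open>auto simp: side_numbers a_def b_def\<close>)
  have RK: "path_image R \<inter> path_image ?K = {}"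
    unfolding R(4) K(4) by (rule meet[OF m(2) t(3,4) segP[OF P(1,2)]]) (use off in \<open>auto simp: side_numbers c_def d_def simp del: add_2_eq_Suc'\<close>)
  define \<gamma> where "\<gamma> i = (if i = 0 then S else reversepath ?K)" for i :: nat
  define \<delta> where "\<delta> i = (if i = 0 then R else reversepath ?L)" for i :: nat
  have "(\<Sum>i<2. \<Sum>k<2. cross_index (\<gamma> i) (\<delta> k)) = 0"
    by (rule sum_cross_index_closed_chains)
      (auto simp: \<gamma>_def \<delta>_def less_2_cases_iff reversepath_def K(2,3) L(2,3) S(2,3) R(2,3))
  then have sum: "cross_index S R + cross_index S (reversepath ?L) + (cross_index (reversepath ?K) R
     + cross_index (reversepath ?K) (reversepath ?L)) = 0"
    by (simp add: \<gamma>_def \<delta>_def numeral_2_eq_2)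
  have z: "cross_index S (reversepath ?L) = 0" "cross_index (reversepath ?K) R = 0"
    using SL RK arc_imp_path[OF S(1)] arc_imp_path[OF R(1)] K(1) L(1)
    by (auto intro!: cross_index_disjoint)
  have offK: "?L 0 \<notin> path_image ?K" "?L 1 \<notin> path_image ?K" "?K 0 \<notin> path_image ?L" "?K 1 \<notin> path_image ?L"
  proof -
    have *: "\<Phi> (Base z) \<notin> (\<lambda>z. \<Phi> (Base z)) ` T" if "z \<in> polygon g" "T \<subseteq> polygon g" "z \<notin> T" for z T
      using that inj_onD[OF inj_base] by blast
    show "?L 0 \<notin> path_image ?K" "?L 1 \<notin> path_image ?K" "?K 0 \<notin> path_image ?L" "?K 1 \<notin> path_image ?L"
      unfolding K L
      by (rule *[OF P(3) segP[OF P(1,2)] off(3)] *[OF P(4) segP[OF P(1,2)] off(4)]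
        *[OF P(1) segP[OF P(3,4)] off(1)] *[OF P(2) segP[OF P(3,4)] off(2)])+
  qed
  have rev: "(reversepath ?L) 0 = ?L 1" "(reversepath ?L) 1 = ?L 0" by (simp_all add: reversepath_def)
  \<comment> \<open>Reversing both wedges preserves their index 1. The total over the two closed
    curves is 0, so the strands account for -1.\<close>
  have "cross_index (reversepath ?K) (reversepath ?L) = - cross_index ?K (reversepath ?L)"
    by (rule cross_index_reversepath_left[OF K(1)]) (simp_all only: rev offK not_False_eq_True)
  also have "\<dots> = cross_index (reversepath ?L) ?K" by (simp add: cross_index_commute[of ?K])
  also have "\<dots> = - cross_index ?L ?K" by (rule cross_index_reversepath_left[OF L(1) offK(3,4)])
  also have "\<dots> = 1" using one by (simp add: cross_index_commute[of ?L])
  finally show ?thesis using sum z unfolding S_def[symmetric] R_def[symmetric] by (simp add: add_eq_0_iff2)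
qed

end

text \<open>Two segments that leave \<open>o'\<close> in the same direction overlap there: if
  \<open>p - o'\<close> is \<open>r\<close> times \<open>q - o'\<close>, the weights
  \<open>u = 1 / (1 + r)\<close> towards \<open>p\<close> and \<open>u * r\<close> towards
  \<open>q\<close> give the same point, interior to both.\<close>

lemma disjoint_segments_rays:
  fixes o' :: complex
  assumes "p \<noteq> o'" "q \<noteq> o'" "open_segment o' p \<inter> open_segment o' q = {}" "0 < a" "0 < b"
  shows "(of_real a * (p - o')) / (of_real b * (q - o')) \<notin> \<real>\<^sub>\<ge>\<^sub>0"
proof
  assume "(of_real a * (p - o')) / (of_real b * (q - o')) \<in> \<real>\<^sub>\<ge>\<^sub>0"
  then obtain s where s: "0 \<le> s" "(of_real a * (p - o')) / (of_real b * (q - o')) = of_real s"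
    by (auto elim: nonneg_Reals_cases)
  define r where "r = s * b / a"
  have pq: "p - o' = of_real r * (q - o')"
  proof -
    have "of_real a * (p - o') = of_real s * (of_real b * (q - o'))" using s(2) assms by (simp add: field_simps)
    then show ?thesis using assms(4) by (simp add: r_def field_simps)
  qed
  have "r \<noteq> 0" using pq assms(1) by auto
  then have r: "0 < r" using s(1) assms by (simp add: r_def)
  define u where "u = 1 / (1 + r)"
  have u: "0 < u" "u < 1" "0 < u * r" "u * r < 1" using r by (auto simp: u_def field_simps)
  have "(1 - u) *\<^sub>R o' + u *\<^sub>R p = (1 - u * r) *\<^sub>R o' + (u * r) *\<^sub>R q"
  proof -
    have "(1 - u) *\<^sub>R o' + u *\<^sub>R p = o' + of_real u * (p - o')"
      by (simp add: scaleR_conv_of_real algebra_simps)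
    also have "\<dots> = (1 - u * r) *\<^sub>R o' + (u * r) *\<^sub>R q"
      unfolding pq by (simp add: scaleR_conv_of_real algebra_simps)
    finally show ?thesis .
  qed
  then have "(1 - u) *\<^sub>R o' + u *\<^sub>R p \<in> open_segment o' p \<inter> open_segment o' q"
    using u assms unfolding in_segment Int_iff by metis
  then show False using assms(3) by blast
qed

context drawing
begin

definition initial_step :: "'e step \<Rightarrow> bool" where
  "initial_step = (\<lambda>(e, i, f). if f then i = 0 else i = length (crossings G e))"

lemma direction_into_vertex:
  assumes "valid_step x" "exit x = None"
  shows "direction g G (rev_dart (dart_of x)) = src x - dst x"
proof -
  obtain e i f where x: "x = (e, i, f)" by (metis prod_cases3)
  have "if f then i = length (crossings G e) else i = 0"
    using assms by (auto simp: x valid_step_def exit_def split: if_splits)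
  moreover have "segments g G e \<noteq> []" using length_segments[of e] by auto
  ultimately show ?thesis
    using length_segments[of e]
    by (auto simp: x direction_def rev_dart_def dart_of_def src_def dst_def hd_conv_nth last_conv_nth case_prod_beta)
qed

lemma direction_from_vertex:
  assumes "initial_step x"
  shows "direction g G (dart_of x) = dst x - src x"
proof -
  obtain e i f where x: "x = (e, i, f)" by (metis prod_cases3)
  have "segments g G e \<noteq> []" using length_segments[of e] by auto
  then show ?thesis
    using length_segments[of e] assms
    by (auto simp: x initial_step_def direction_def dart_of_def src_def dst_def hd_conv_nth last_conv_nth case_prod_beta split: if_splits)
qed

definition chord_parity :: "'e step \<times> 'e dart \<Rightarrow> 'e step \<times> 'e dart \<Rightarrow> bit" where
  "chord_parity = (\<lambda>(x, d) (x', d'). of_bool (exit x = None \<and> exit x' = None \<and> dst x = dst x' \<and>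
     chords_cross g G (rev_dart (dart_of x), d) (rev_dart (dart_of x'), d')))"

definition strand_parity :: "'e step \<Rightarrow> 'e step \<Rightarrow> bit" where
  "strand_parity x x' = of_bool (bridge_pair (exit_bridge x) (exit_bridge x'))"

lemma turn_cells_disjoint:
  assumes X: "coherent X" "x \<in> X" "y \<in> X" "x' \<in> X" "y' \<in> X" "x \<noteq> x'" "y \<noteq> y'" "x \<noteq> y" "x' \<noteq> y'"
    and nxt: "follows x y" "follows x' y'"
    and free: "\<Phi> ` node x \<inter> \<Phi> ` node x' = {}"
  shows "path_image (turn_cell x y) \<inter> path_image (turn_cell x' y') = {}"
proof -
  have v: "valid_step x" "valid_step y" "valid_step x'" "valid_step y'" using coherent_valid X by blast+
  have I: "{2/3..<1} \<subseteq> {0<..<1::real}" "{0<..1/3} \<subseteq> {0<..<1::real}" "{2/3..<1} \<inter> {0<..1/3::real} = {}"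
    "{0<..1/3::real} \<inter> {2/3..<1} = {}" by auto
  show ?thesis
    unfolding turn_cell_facts(4)[OF X(1-3,8) nxt(1)] turn_cell_facts(4)[OF X(1,4,5,9) nxt(2)]
    using seg_img_disjoint[OF X(1,2,4) I(1,1)] seg_img_disjoint[OF X(1,2,5) I(1,2)]
      seg_img_disjoint[OF X(1,3,4) I(2,1)] seg_img_disjoint[OF X(1,3,5) I(2,2)] I(3,4) X(6,7)
      seg_img_node_disjoint[OF v(1,3) I(1)] seg_img_node_disjoint[OF v(2,3) I(2)]
      seg_img_node_disjoint[OF v(3,1) I(1)] seg_img_node_disjoint[OF v(4,1) I(2)] free
    by (simp add: Int_Un_distrib Int_Un_distrib2 Int_commute)
qed

text \<open>Both turn cells are images of straight wedges at the common vertex. The index is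
  transported back to the polygon, where \<open>cross_index_wedge\<close> compares angles just as
  the chord test does.\<close>

lemma cross_index_turns_at_vertex:
  assumes X: "coherent X" "x \<in> X" "y \<in> X" "x' \<in> X" "y' \<in> X" "x \<noteq> x'" "y \<noteq> y'"
    and nxt: "follows x y" "follows x' y'"
    and vert: "exit x = None" "exit x' = None" "dst x = dst x'" "initial_step y" "initial_step y'"
  shows "\<exists>n::int. cross_index (turn_cell x y) (turn_cell x' y') = of_int n \<and>
    of_int n = (of_bool (chords_cross g G (rev_dart (dart_of x), dart_of y) (rev_dart (dart_of x'), dart_of y')) :: bit)"
proof -
  have v: "valid_step x" "valid_step y" "valid_step x'" "valid_step y'" using coherent_valid X by blast+
  define o' where "o' = dst x"
  have o: "src y = o'" "dst x' = o'" "src y' = o'" using nxt vert by (auto simp: o'_def follows_def)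
  \<comment> \<open>A step that both ended and started at \<open>o'\<close> would be a segment with
    equal ends.\<close>
  have xy: "x \<noteq> y'" "y \<noteq> x'" using o src_neq_dst[OF v(1)] src_neq_dst[OF v(3)] by (auto simp: o'_def)
  define a b c d where "a = seg_pt x (2/3)" and "b = seg_pt y (1/3)" and "c = seg_pt x' (2/3)" and "d = seg_pt y' (1/3)"
  have sc: "a - o' = of_real (1/3) * (src x - o')" "c - o' = of_real (1/3) * (src x' - o')"
    "b - o' = of_real (1/3) * (dst y - o')" "d - o' = of_real (1/3) * (dst y' - o')"
    using o by (simp_all add: a_def b_def c_def d_def seg_pt_def linepath_def o'_def scaleR_conv_of_real algebra_simps)
  have ne: "src x \<noteq> o'" "src x' \<noteq> o'" "dst y \<noteq> o'" "dst y' \<noteq> o'"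
    using src_neq_dst[OF v(1)] src_neq_dst[OF v(2)] src_neq_dst[OF v(3)] src_neq_dst[OF v(4)] o by (auto simp: o'_def)
  have nz: "a \<noteq> o'" "b \<noteq> o'" "c \<noteq> o'" "d \<noteq> o'" using sc ne by auto
  have disj: "open_segment o' (src x) \<inter> open_segment o' (src x') = {}" "open_segment o' (src x) \<inter> open_segment o' (dst y') = {}"
    "open_segment o' (dst y) \<inter> open_segment o' (src x') = {}" "open_segment o' (dst y) \<inter> open_segment o' (dst y') = {}"
    using steps_disjoint[OF v(1,3) coherent_labels[OF X(1,2,4,6)]] steps_disjoint[OF v(1,4) coherent_labels[OF X(1,2,5) xy(1)]]
      steps_disjoint[OF v(2,3) coherent_labels[OF X(1,3,4) xy(2)]] steps_disjoint[OF v(2,4) coherent_labels[OF X(1,3,5,7)]] o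
    by (simp_all add: o'_def[symmetric] open_segment_commute[of "src x"] open_segment_commute[of "src x'"])
  have rays: "(a - o') / (c - o') \<notin> \<real>\<^sub>\<ge>\<^sub>0" "(a - o') / (d - o') \<notin> \<real>\<^sub>\<ge>\<^sub>0" "(b - o') / (c - o') \<notin> \<real>\<^sub>\<ge>\<^sub>0" "(b - o') / (d - o') \<notin> \<real>\<^sub>\<ge>\<^sub>0"
    unfolding sc
    by (rule disjoint_segments_rays[OF ne(1,2) disj(1)] disjoint_segments_rays[OF ne(1,4) disj(2)]
      disjoint_segments_rays[OF ne(3,2) disj(3)] disjoint_segments_rays[OF ne(3,4) disj(4)], simp, simp)+
  have dirs: "direction g G (rev_dart (dart_of x)) = src x - o'" "direction g G (rev_dart (dart_of x')) = src x' - o'"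
    "direction g G (dart_of y) = dst y - o'" "direction g G (dart_of y') = dst y' - o'"
    using direction_into_vertex[OF v(1) vert(1)] direction_into_vertex[OF v(3) vert(2)]
      direction_from_vertex[OF vert(4)] direction_from_vertex[OF vert(5)] o by (simp_all add: o'_def)
  define Xb Xc Xd where "Xb = Arg2pi ((b - o') / (a - o'))" and "Xc = Arg2pi ((c - o') / (a - o'))" and "Xd = Arg2pi ((d - o') / (a - o'))"
  have X': "Xb = Arg2pi ((dst y - o') / (src x - o'))" "Xc = Arg2pi ((src x' - o') / (src x - o'))"
    "Xd = Arg2pi ((dst y' - o') / (src x - o'))"
  proof -
    have "of_real (1/3) * p / (of_real (1/3) * q) = p / q" for p q :: complex by simp
    then show "Xb = Arg2pi ((dst y - o') / (src x - o'))" "Xc = Arg2pi ((src x' - o') / (src x - o'))"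
      "Xd = Arg2pi ((dst y' - o') / (src x - o'))"
      unfolding Xb_def Xc_def Xd_def sc by (simp_all only:)
  qed
  have P: "a \<in> polygon g" "b \<in> polygon g" "c \<in> polygon g" "d \<in> polygon g" "o' \<in> polygon g"
    using seg_pt_polygon[OF v(1), of "2/3"] seg_pt_polygon[OF v(2), of "1/3"] seg_pt_polygon[OF v(3), of "2/3"]
      seg_pt_polygon[OF v(4), of "1/3"] seg_pt_polygon[OF v(1), of 1] by (simp_all add: a_def b_def c_def d_def o'_def)
  have int: "interior (polygon g) \<noteq> {}" using exit_None(2)[OF v(1) vert(1)] pos_interior by blast
  have T: "turn_cell x y = base_path a o' +++ base_path o' b" "turn_cell x' y' = base_path c o' +++ base_path o' d"
    using vert o by (simp_all add: turn_cell_def piece_def a_def b_def c_def d_def o'_def)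
  note off = cross_index_wedge_Arg(2-5)[OF nz rays]
  have CI: "cross_index (turn_cell x y) (turn_cell x' y') = cross_index (linepath a o' +++ linepath o' b) (linepath c o' +++ linepath o' d)"
    unfolding T by (rule cross_index_base_wedges[OF P int off])
  have "cross_index (turn_cell x y) (turn_cell x' y') \<in> \<int>"
  proof (rule cross_index_Ints)
    have inj: "\<Phi> (Base z) \<notin> (\<lambda>z. \<Phi> (Base z)) ` T" if "z \<in> polygon g" "T \<subseteq> polygon g" "z \<notin> T" for z T
      using that inj_onD[OF inj_base] by blast
    have seg: "closed_segment p o' \<union> closed_segment o' q \<subseteq> polygon g" if "p \<in> polygon g" "q \<in> polygon g" for p q
      using that P(5) by (simp add: closed_segment_subset convex_polygon)
    note W = base_wedge_facts[OF P(1,5,2)] base_wedge_facts[OF P(3,5,4)]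
    show "path (turn_cell x y)" "path (turn_cell x' y')" unfolding T by (rule W)+
    show "turn_cell x y 0 \<notin> path_image (turn_cell x' y')" "turn_cell x y 1 \<notin> path_image (turn_cell x' y')"
      "turn_cell x' y' 0 \<notin> path_image (turn_cell x y)" "turn_cell x' y' 1 \<notin> path_image (turn_cell x y)"
      unfolding T W
      by (rule inj[OF P(1) seg[OF P(3,4)] off(1)] inj[OF P(2) seg[OF P(3,4)] off(2)]
        inj[OF P(3) seg[OF P(1,2)] off(3)] inj[OF P(4) seg[OF P(1,2)] off(4)])+
  qed
  then obtain n :: int where n: "cross_index (turn_cell x y) (turn_cell x' y') = of_int n" by (elim Ints_cases)
  have "real_of_int n = of_bool (Xb < Xd) - of_bool (Xb < Xc)"
  proof -
    have "real_of_int n = Re (cross_index (turn_cell x y) (turn_cell x' y'))" using n by simp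
    then show ?thesis unfolding CI cross_index_wedge[OF nz rays] Xb_def Xc_def Xd_def .
  qed
  also have "\<dots> = real_of_int (of_bool (Xb < Xd) - of_bool (Xb < Xc))" by simp
  finally have n': "n = of_bool (Xb < Xd) - of_bool (Xb < Xc)" by (simp only: of_int_eq_iff)
  have Arg_ne: "Arg2pi (p / r) \<noteq> Arg2pi (q / r)" if "p / q \<notin> \<real>\<^sub>\<ge>\<^sub>0" "r \<noteq> 0" "q \<noteq> 0" for p q r
  proof
    assume eq: "Arg2pi (p / r) = Arg2pi (q / r)"
    have "p / r = of_real (norm (p / r)) * exp (\<i> * of_real (Arg2pi (q / r)))" using Arg2pi_eq[of "p / r"] eq by simp
    moreover have "q / r = of_real (norm (q / r)) * exp (\<i> * of_real (Arg2pi (q / r)))" using Arg2pi_eq[of "q / r"] by simp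
    ultimately have "(p / r) / (q / r) = of_real (norm (p / r) / norm (q / r))"
      using that by (metis (no_types, lifting) exp_not_eq_zero mult_divide_mult_cancel_right of_real_divide)
    then have "p / q = of_real (norm (p / r) / norm (q / r))" using that by simp
    then show False using that(1) by (metis divide_nonneg_nonneg nonneg_Reals_of_real_iff norm_ge_zero)
  qed
  have inv: "q / p \<notin> \<real>\<^sub>\<ge>\<^sub>0" if "p / q \<notin> \<real>\<^sub>\<ge>\<^sub>0" for p q :: complex
  proof
    assume "q / p \<in> \<real>\<^sub>\<ge>\<^sub>0"
    then obtain r where "0 \<le> r" "q / p = of_real r" by (elim nonneg_Reals_cases) auto
    then have "p / q = of_real (1 / r)" by (metis inverse_divide inverse_eq_divide of_real_inverse)
    then show False using that \<open>0 \<le> r\<close> by (simp add: nonneg_Reals_of_real_iff)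
  qed
  \<comment> \<open>The index tests whether \<open>Xb\<close> is below \<open>Xc\<close> and
    \<open>Xd\<close>, the chord test whether these are below \<open>Xb\<close>; the tests are
    complementary because the rays are distinct.\<close>
  have ne': "Xb \<noteq> Xc" "Xb \<noteq> Xd"
    unfolding Xb_def Xc_def Xd_def using Arg_ne[OF rays(3)] Arg_ne[OF rays(4)] nz by auto
  have "Arg2pi ((a - o') / (a - o')) = 0" using nz Arg2pi_eq_0[of 1] by simp
  then have pos: "0 < Xc" "0 < Xd"
    using Arg_ne[OF inv[OF rays(1)], of "a - o'"] Arg_ne[OF inv[OF rays(2)], of "a - o'"] nz
      Arg2pi[of "(c - o') / (a - o')"] Arg2pi[of "(d - o') / (a - o')"]
    by (auto simp: Xc_def Xd_def less_le)
  have "chords_cross g G (rev_dart (dart_of x), dart_of y) (rev_dart (dart_of x'), dart_of y') \<longleftrightarrow> (Xc < Xb) \<noteq> (Xd < Xb)"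
    unfolding chords_cross_def between_def case_prod_conv dirs X'[symmetric] using pos by simp
  then have "of_int n = (of_bool (chords_cross g G (rev_dart (dart_of x), dart_of y) (rev_dart (dart_of x'), dart_of y')) :: bit)"
    unfolding n' using ne' by (auto simp: of_bool_def)
  then show ?thesis using n by blast
qed

text \<open>Up to reversal, each strand starts on one of the first two sides of its block of four.
  Reversing a strand or exchanging the two changes only the sign, which is irrelevant modulo
  2.\<close>

lemma cross_index_strands:
  assumes m: "m \<in> {1..4 * g}" "m' \<in> {1..4 * g}" and t: "0 < t" "t < 1" "0 < t'" "t' < 1"
    and pair: "bridge_pair (bridge_of m) (bridge_of m')" and ne: "interior (polygon g) \<noteq> {}"
    and off: "strand_path m t 0 \<notin> path_image (strand_path m' t')" "strand_path m t 1 \<notin> path_image (strand_path m' t')"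
      "strand_path m' t' 0 \<notin> path_image (strand_path m t)" "strand_path m' t' 1 \<notin> path_image (strand_path m t)"
  shows "cross_index (strand_path m t) (strand_path m' t') \<in> {1, - 1}"
proof -
  define j where "j = (bridge_of m - 1) div 2"
  have rev: "strand_path m t = reversepath (strand_path (partner m) (1 - t))" if "m \<in> {1..4 * g}" for m t
    using strand_partner[OF that, of t] by (simp add: fun_eq_iff strand_path_def reversepath_def)
  have norm: "\<exists>m0 s. (m0 = Suc (4 * j) \<or> m0 = 4 * j + 2) \<and> bridge_of m0 = bridge_of m \<and> 0 < s \<and> s < 1 \<and>
     (strand_path m t = strand_path m0 s \<or> strand_path m t = reversepath (strand_path m0 s))"
    if m: "m \<in> {1..4 * g}" "0 < t" "t < 1" and b: "bridge_of m = 2 * j + 1 \<or> bridge_of m = 2 * j + 2" for m t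
    using m(1)
  proof (cases rule: side_cases)
    case (1 i)
    then have "i = j" using b side_numbers[of i] by auto
    then show ?thesis using 1 m by blast
  next
    case (2 i)
    then have "i = j" using b side_numbers[of i] by auto
    then show ?thesis using 2 m by blast
  next
    case (3 i)
    then have "i = j" using b side_numbers[of i] by auto
    then show ?thesis using 3 m rev[OF m(1), of t] side_numbers[of i]
      by (intro exI[of _ "Suc (4 * j)"] exI[of _ "1 - t"]) auto
  next
    case (4 i)
    then have "i = j" using b side_numbers[of i] by auto
    then show ?thesis using 4 m rev[OF m(1), of t] side_numbers[of i]
      by (intro exI[of _ "4 * j + 2"] exI[of _ "1 - t"]) (auto simp del: add_2_eq_Suc')
  qed
  obtain k where k: "k \<in> {1..g}" "bridge_of m = 2 * k - 1 \<and> bridge_of m' = 2 * k \<or> bridge_of m' = 2 * k - 1 \<and> bridge_of m = 2 * k"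
    using pair unfolding bridge_pair_def by blast
  have jk: "k = Suc j" using k unfolding j_def by auto
  have j: "j < g" using jk k by simp
  have b: "bridge_of m = 2 * j + 1 \<and> bridge_of m' = 2 * j + 2 \<or> bridge_of m' = 2 * j + 1 \<and> bridge_of m = 2 * j + 2"
    using k(2) jk by auto
  obtain m0 s where N: "m0 = Suc (4 * j) \<or> m0 = 4 * j + 2" "bridge_of m0 = bridge_of m" "0 < s" "s < 1"
     "strand_path m t = strand_path m0 s \<or> strand_path m t = reversepath (strand_path m0 s)"
    using norm[OF m(1) t(1,2)] b by blast
  obtain m0' s' where N': "m0' = Suc (4 * j) \<or> m0' = 4 * j + 2" "bridge_of m0' = bridge_of m'" "0 < s'" "s' < 1"
     "strand_path m' t' = strand_path m0' s' \<or> strand_path m' t' = reversepath (strand_path m0' s')"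
    using norm[OF m(2) t(3,4)] b by blast
  have cases: "m0 = Suc (4 * j) \<and> m0' = 4 * j + 2 \<or> m0' = Suc (4 * j) \<and> m0 = 4 * j + 2"
    using N(1,2) N'(1,2) b side_numbers[of j] by auto
  have one: "cross_index (strand_path m0 s) (strand_path m0' s') \<in> {1, - 1}"
    using cases
  proof
    assume "m0 = Suc (4 * j) \<and> m0' = 4 * j + 2"
    then show ?thesis using cross_index_strands_oriented[OF j N(3,4) N'(3,4) ne] by simp
  next
    assume "m0' = Suc (4 * j) \<and> m0 = 4 * j + 2"
    then have "cross_index (strand_path m0' s') (strand_path m0 s) = - 1"
      using cross_index_strands_oriented[OF j N'(3,4) N(3,4) ne] by simp
    then show ?thesis unfolding cross_index_commute[of "strand_path m0 s" "strand_path m0' s'"] by simp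
  qed
  have r: "reversepath \<gamma> 0 = \<gamma> 1" "reversepath \<gamma> 1 = \<gamma> 0" for \<gamma> :: "real \<Rightarrow> complex" by (simp_all add: reversepath_def)
  have m0: "m0 \<in> {1..4 * g}" "m0' \<in> {1..4 * g}" using cases j by auto
  note P = arc_imp_path[OF strand_path_facts(1)[OF m0(1) N(3,4)]] arc_imp_path[OF strand_path_facts(1)[OF m0(2) N'(3,4)]]
  have off0: "strand_path m0 s 0 \<notin> path_image (strand_path m0' s')" "strand_path m0 s 1 \<notin> path_image (strand_path m0' s')"
    "strand_path m0' s' 0 \<notin> path_image (strand_path m0 s)" "strand_path m0' s' 1 \<notin> path_image (strand_path m0 s)"
    using off N(5) N'(5) by (auto simp: r)
  have A: "cross_index (strand_path m t) (strand_path m0' s') \<in> {1, - 1}"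
    using N(5) one cross_index_reversepath_left[OF P(1) off0(3,4)] by auto
  have off1: "strand_path m t 0 \<notin> path_image (strand_path m0' s')" "strand_path m t 1 \<notin> path_image (strand_path m0' s')"
    using off N'(5) by auto
  show ?thesis
    using N'(5)
  proof
    assume e: "strand_path m' t' = reversepath (strand_path m0' s')"
    have "cross_index (strand_path m t) (strand_path m' t') = - cross_index (reversepath (strand_path m0' s')) (strand_path m t)"
      unfolding e by (rule cross_index_commute)
    also have "\<dots> = cross_index (strand_path m0' s') (strand_path m t)"
      using cross_index_reversepath_left[OF P(2) off1] by simp
    also have "\<dots> = - cross_index (strand_path m t) (strand_path m0' s')" by (rule cross_index_commute)
    finally show ?thesis using A by auto
  qed (use A in simp)
qed

text \<open>Two cells at the same vertex are compared by their chords. In all other cases their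
  images can meet only if the steps leave over paired bridges, where the connecting pieces drop out
  and the strands contribute 1 or -1.\<close>

lemma cross_index_turn_cells:
  assumes X: "coherent X" "x \<in> X" "y \<in> X" "x' \<in> X" "y' \<in> X" "x \<noteq> x'" "y \<noteq> y'" "x \<noteq> y" "x' \<noteq> y'"
    and nxt: "follows x y" "follows x' y'" and ne: "interior (polygon g) \<noteq> {}"
    and init: "exit x = None \<Longrightarrow> initial_step y" "exit x' = None \<Longrightarrow> initial_step y'"
  shows "\<exists>n::int. cross_index (turn_cell x y) (turn_cell x' y') = of_int n \<and>
    of_int n = chord_parity (x, dart_of y) (x', dart_of y') + strand_parity x x'"
proof (cases "exit x = None \<and> exit x' = None \<and> dst x = dst x'")
  case True
  then have "strand_parity x x' = 0"
    by (auto simp: strand_parity_def bridge_pair_def exit_bridge_def)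
  moreover have "chord_parity (x, dart_of y) (x', dart_of y') =
     of_bool (chords_cross g G (rev_dart (dart_of x), dart_of y) (rev_dart (dart_of x'), dart_of y'))"
    using True by (simp add: chord_parity_def)
  ultimately show ?thesis using cross_index_turns_at_vertex[OF X(1-7) nxt] True init by simp
next
  case nv: False
  then have ch: "chord_parity (x, dart_of y) (x', dart_of y') = 0" by (auto simp: chord_parity_def)
  have v: "valid_step x" "valid_step y" "valid_step x'" "valid_step y'" using coherent_valid X by blast+
  show ?thesis
  proof (cases "bridge_pair (exit_bridge x) (exit_bridge x')")
    case False
    have "path_image (turn_cell x y) \<inter> path_image (turn_cell x' y') = {}"
      using turn_cells_disjoint[OF X nxt node_images_disjoint[OF X(1,2,4,6) nv False]] .
    then have "cross_index (turn_cell x y) (turn_cell x' y') = 0"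
      using turn_cell_facts(1)[OF X(1-3,8) nxt(1)] turn_cell_facts(1)[OF X(1,4,5,9) nxt(2)]
      by (intro cross_index_disjoint) (auto intro: arc_imp_path)
    then show ?thesis using ch False by (intro exI[of _ 0]) (simp add: strand_parity_def)
  next
    case True
    then have "exit_bridge x \<noteq> 0" "exit_bridge x' \<noteq> 0" by (auto simp: bridge_pair_def)
    then have "exit x \<noteq> None" "exit x' \<noteq> None"
      by (cases "exit x"; cases "exit x'"; simp add: exit_bridge_def)+
    then obtain m t m' t' where ex: "exit x = Some (m, t)" "exit x' = Some (m', t')" by force
    note m = exit_Some[OF v(1) ex(1)] and m' = exit_Some[OF v(3) ex(2)]
    let ?C = "piece x (2/3) 1" and ?A = "piece y 0 (1/3)" and ?C' = "piece x' (2/3) 1" and ?A' = "piece y' 0 (1/3)"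
    let ?S = "strand_path m t" and ?S' = "strand_path m' t'"
    note S = strand_path_facts[OF m(1-3)] and S' = strand_path_facts[OF m'(1-3)]
    have nd: "path_image ?S = \<Phi> ` node x" "path_image ?S' = \<Phi> ` node x'" using S(4) S'(4) ex by (simp_all add: node_def)
    have C: "path ?C" "?C 1 = ?S 0" "path_image ?C = insert (\<Phi> (Base (dst x))) (\<Phi> ` seg_img x {2/3..<1})"
      and C': "path ?C'" "?C' 1 = ?S' 0" "path_image ?C' = insert (\<Phi> (Base (dst x'))) (\<Phi> ` seg_img x' {2/3..<1})"
      and A: "path ?A" "?S 1 = ?A 0" "path_image ?A = insert (\<Phi> (Base (src y))) (\<Phi> ` seg_img y {0<..1/3})"
      and A': "path ?A'" "?S' 1 = ?A' 0" "path_image ?A' = insert (\<Phi> (Base (src y'))) (\<Phi> ` seg_img y' {0<..1/3})"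
    proof -
      have i: "{2/3..1} = insert 1 {2/3..<1::real}" "{0..1/3} = insert 0 {0<..1/3::real}" by auto
      show "path ?C" "?C 1 = ?S 0" "path_image ?C = insert (\<Phi> (Base (dst x))) (\<Phi> ` seg_img x {2/3..<1})"
        "path ?C'" "?C' 1 = ?S' 0" "path_image ?C' = insert (\<Phi> (Base (dst x'))) (\<Phi> ` seg_img x' {2/3..<1})"
        using piece_facts[OF v(1), of "2/3" 1] piece_facts[OF v(3), of "2/3" 1] S(2) S'(2) m(4) m'(4)
        by (simp_all add: seg_img_def i)
      show "path ?A" "?S 1 = ?A 0" "path_image ?A = insert (\<Phi> (Base (src y))) (\<Phi> ` seg_img y {0<..1/3})"
        "path ?A'" "?S' 1 = ?A' 0" "path_image ?A' = insert (\<Phi> (Base (src y'))) (\<Phi> ` seg_img y' {0<..1/3})"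
        using piece_facts[OF v(2), of 0 "1/3"] piece_facts[OF v(4), of 0 "1/3"] S(3) S'(3) nxt ex
        by (simp_all add: seg_img_def i follows_def)
    qed
    have I: "{2/3..<1} \<subseteq> {0<..<1::real}" "{0<..1/3} \<subseteq> {0<..<1::real}" "{2/3..<1} \<inter> {0<..1/3::real} = {}"
      "{0<..1/3::real} \<inter> {2/3..<1} = {}" by auto
    let ?E = "\<lambda>z. \<Phi> (Base z)"
    have ends: "?E (dst x) \<in> \<Phi> ` node x" "?E (src y) \<in> \<Phi> ` node x" "?E (dst x') \<in> \<Phi> ` node x'" "?E (src y') \<in> \<Phi> ` node x'"
      using dst_in_node src_in_node v nxt by blast+
    have off: "?E z \<notin> \<Phi> ` node w'" if "Base z \<in> node w" "w \<in> X" "w' \<in> X" "w \<noteq> w'" "exit w' \<noteq> None" for z w w'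
    proof
      assume "?E z \<in> \<Phi> ` node w'"
      moreover have "Base z \<in> highway g" "node w' \<subseteq> highway g"
        using node_in_highway coherent_valid[OF X(1)] that by blast+
      ultimately have "?E z \<in> \<Phi> ` ({Base z} \<inter> node w')" by (intro image_disjoint) auto
      then have "Base z \<in> node w'" by auto
      then show False using nodes_meet[OF X(1) that(2-4,1)] that(5) by blast
    qed
    have E: "?E (dst x) \<notin> \<Phi> ` node x'" "?E (src y) \<notin> \<Phi> ` node x'" "?E (dst x') \<notin> \<Phi> ` node x" "?E (src y') \<notin> \<Phi> ` node x"
      using off[OF dst_in_node[OF v(1)] X(2,4,6)] off[OF src_in_node[OF v(1) nxt(1)] X(2,4,6)]
        off[OF dst_in_node[OF v(3)] X(4,2) not_sym[OF X(6)]] off[OF src_in_node[OF v(3) nxt(2)] X(4,2) not_sym[OF X(6)]] ex by auto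
    have segs: "\<Phi> ` seg_img x {2/3..<1} \<inter> \<Phi> ` seg_img x' {2/3..<1} = {}" "\<Phi> ` seg_img x {2/3..<1} \<inter> \<Phi> ` seg_img y' {0<..1/3} = {}"
      "\<Phi> ` seg_img y {0<..1/3} \<inter> \<Phi> ` seg_img x' {2/3..<1} = {}" "\<Phi> ` seg_img y {0<..1/3} \<inter> \<Phi> ` seg_img y' {0<..1/3} = {}"
      using seg_img_disjoint[OF X(1,2,4) I(1,1)] seg_img_disjoint[OF X(1,2,5) I(1,2)]
        seg_img_disjoint[OF X(1,3,4) I(2,1)] seg_img_disjoint[OF X(1,3,5) I(2,2)] I(3,4) X(6,7) by blast+
    have nodes: "\<Phi> ` seg_img x {2/3..<1} \<inter> \<Phi> ` node x' = {}" "\<Phi> ` seg_img y {0<..1/3} \<inter> \<Phi> ` node x' = {}"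
      "\<Phi> ` seg_img x' {2/3..<1} \<inter> \<Phi> ` node x = {}" "\<Phi> ` seg_img y' {0<..1/3} \<inter> \<Phi> ` node x = {}"
      using seg_img_node_disjoint[OF v(1,3) I(1)] seg_img_node_disjoint[OF v(2,3) I(2)]
        seg_img_node_disjoint[OF v(3,1) I(1)] seg_img_node_disjoint[OF v(4,1) I(2)] by blast+
    have dj: "(insert e M) \<inter> (insert f M') = {}" "(insert e M) \<inter> N' = {}" "N \<inter> (insert f M') = {}"
      if "e \<in> N" "f \<in> N'" "e \<notin> N'" "f \<notin> N" "M \<inter> M' = {}" "M \<inter> N' = {}" "M' \<inter> N = {}" for e f and M M' N N' :: "complex set"
      using that by blast+
    note d1 = dj[OF ends(1,3) E(1,3) segs(1) nodes(1,3)] and d2 = dj[OF ends(1,4) E(1,4) segs(2) nodes(1,4)]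
      and d3 = dj[OF ends(2,3) E(2,3) segs(3) nodes(2,3)] and d4 = dj[OF ends(2,4) E(2,4) segs(4) nodes(2,4)]
    have "cross_index (?C +++ (?S +++ ?A)) (?C' +++ (?S' +++ ?A')) = cross_index ?S ?S'"
    proof (rule cross_index_middle[OF C(1) arc_imp_path[OF S(1)] A(1) C(2) A(2) C'(1) arc_imp_path[OF S'(1)] A'(1) C'(2) A'(2)])
      show "path_image ?C \<inter> (path_image ?C' \<union> path_image ?S' \<union> path_image ?A') = {}"
        unfolding C(3) C'(3) A'(3) nd Int_Un_distrib d1 d2 by simp
      show "path_image ?A \<inter> (path_image ?C' \<union> path_image ?S' \<union> path_image ?A') = {}"
        unfolding A(3) C'(3) A'(3) nd Int_Un_distrib d3 d4 by simp
      show "path_image ?S \<inter> (path_image ?C' \<union> path_image ?A') = {}"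
        unfolding C'(3) A'(3) nd Int_Un_distrib d1 d2 by simp
    qed
    moreover have "turn_cell x y = ?C +++ (?S +++ ?A)" "turn_cell x' y' = ?C' +++ (?S' +++ ?A')"
      using ex by (simp_all add: turn_cell_def)
    moreover have "cross_index ?S ?S' \<in> {1, - 1}"
    proof (rule cross_index_strands[OF m(1) m'(1) m(2,3) m'(2,3) _ ne])
      show "bridge_pair (bridge_of m) (bridge_of m')" using True ex by (simp add: exit_bridge_def)
      show "?S 0 \<notin> path_image ?S'" "?S 1 \<notin> path_image ?S'" "?S' 0 \<notin> path_image ?S" "?S' 1 \<notin> path_image ?S"
        using E nd S(2,3) S'(2,3) m(4) m'(4) nxt ex by (simp_all add: follows_def)
    qed
    ultimately have c: "cross_index (turn_cell x y) (turn_cell x' y') \<in> {1, - 1}" by simp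
    have "strand_parity x x' = 1" using True by (simp add: strand_parity_def)
    with c show ?thesis unfolding ch
      by (elim insertE) (auto intro: exI[of _ 1] exI[of _ "- 1"])
  qed
qed

end

section \<open>Rotation numbers of closed walks\<close>

lemma pl_dirs_one_minus:
  assumes "pl_dirs \<gamma> 0 1 ds"
  shows "pl_dirs (\<lambda>u. \<gamma> (1 - u)) 0 1 (map uminus (rev ds))"
proof -
  have "pl_dirs (\<lambda>x. \<gamma> (- x)) (- 1) (- 0) (map uminus (rev ds))"
    by (rule pl_dirs_reverse[OF assms]) simp
  from pl_dirs_reparam[OF this, of 1 "\<lambda>u. \<gamma> (1 - u)" 1] show ?thesis by simp
qed

lemma hd_butlast: "2 \<le> length xs \<Longrightarrow> hd (butlast xs) = hd xs"
  by (cases xs) auto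

lemma rev_interleaved:
  "rev (concat (map (\<lambda>i. b i @ (if i < n then s i else [])) [0..<Suc n])) =
   concat (map (\<lambda>i. rev (b i) @ (if 0 < i then rev (s (i - 1)) else [])) (rev [0..<Suc n]))"
proof (induction n)
  case (Suc n)
  have "concat (map (\<lambda>i. b i @ (if i < Suc n then s i else [])) [0..<Suc (Suc n)]) =
      concat (map (\<lambda>i. b i @ (if i < n then s i else [])) [0..<Suc n]) @ s n @ b (Suc n)"
  proof -
    have m: "map (\<lambda>i. b i @ (if i < Suc n then s i else [])) [0..<n] = map (\<lambda>i. b i @ (if i < n then s i else [])) [0..<n]"
      by (rule map_cong) auto
    show ?thesis by (simp add: m)
  qed
  then show ?case using Suc by simp
qed simp

lemma concat_rotate_pieces:
  "concat (map (\<lambda>k. a k @ r k) [0..<n]) @ a n = a 0 @ concat (map (\<lambda>k. r k @ a (Suc k)) [0..<n])"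
  by (induction n) simp_all

text \<open>Applied to \<open>a k\<close>, the first third of step \<open>k\<close>, it moves this
  third to the end of the preceding turn cell, so that the cells become consecutive blocks of the
  cyclic list.\<close>

lemma cturn_rotate_pieces:
  "cturn (concat (map (\<lambda>k. a k @ r k) [0..<n])) = cturn (concat (map (\<lambda>k. r k @ a (Suc k mod n)) [0..<n]))"
proof (cases n)
  case (Suc m)
  let ?R = "concat (map (\<lambda>k. r k @ a (Suc k)) [0..<m])"
  have "concat (map (\<lambda>k. a k @ r k) [0..<n]) = a 0 @ (?R @ r m)"
    using concat_rotate_pieces[of a r m] by (simp add: Suc)
  moreover have "concat (map (\<lambda>k. r k @ a (Suc k mod n)) [0..<n]) = (?R @ r m) @ a 0"
  proof -
    have m: "map (\<lambda>k. r k @ a (Suc k mod Suc m)) [0..<m] = map (\<lambda>k. r k @ a (Suc k)) [0..<m]"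
      by (rule map_cong) auto
    show ?thesis by (simp add: Suc m)
  qed
  ultimately show ?thesis by (simp only: cturn_append_commute)
qed simp

definition path_dirs :: "(real \<Rightarrow> complex) \<Rightarrow> complex list" where
  "path_dirs \<gamma> = dirs (pl_points \<gamma>)"

lemma path_dirs:
  assumes "\<exists>ps. pl_via \<gamma> ps"
  shows "pl_dirs \<gamma> 0 1 (path_dirs \<gamma>)" "hd (pl_points \<gamma>) = \<gamma> 0" "last (pl_points \<gamma>) = \<gamma> 1" "2 \<le> length (pl_points \<gamma>)"
  using pl_via_imp_pl_dirs[OF someI_ex[OF assms]] by (simp_all add: path_dirs_def pl_points_def)

context drawing
begin

definition strand_dirs :: "'e step \<Rightarrow> complex list" where
  "strand_dirs x = (case exit x of None \<Rightarrow> [] | Some (m, t) \<Rightarrow> path_dirs (strand_path m t))"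

definition step_dirs :: "'e step \<Rightarrow> complex list" where
  "step_dirs x = path_dirs (piece x 0 (1/3)) @ path_dirs (mid_cell x) @ path_dirs (piece x (2/3) 1) @ strand_dirs x"

definition dart_steps :: "'e dart \<Rightarrow> 'e step list" where
  "dart_steps = (\<lambda>(e, f). let xs = map (\<lambda>i. (e, i, f)) [0..<Suc (length (crossings G e))] in if f then xs else rev xs)"

lemma pl_dirs_piece:
  assumes "valid_step x" "0 \<le> a" "a < b" "b \<le> 1"
  shows "pl_dirs (base_path (src x) (dst x)) a b (path_dirs (piece x a b))"
proof -
  have "pl_dirs (base_path (src x) (dst x)) ((b - a) * 0 + a) ((b - a) * 1 + a) (path_dirs (piece x a b))"
  proof (rule pl_dirs_reparam[OF path_dirs(1)[OF piece_facts(6)[OF assms]]])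
    fix u :: real
    have "linepath (seg_pt x a) (seg_pt x b) u = seg_pt x ((b - a) * u + a)"
      by (simp add: seg_pt_def linepath_def algebra_simps)
    then show "base_path (src x) (dst x) ((b - a) * u + a) = piece x a b u"
      by (simp add: base_path_def piece_def seg_pt_def)
  qed (use assms in simp)
  then show ?thesis by simp
qed

text \<open>The vertices for a whole segment and for its thirds are chosen independently; as
  subdivisions of one arc they are comparable by \<open>turn_equivI\<close>.\<close>

lemma base_turn_equiv:
  assumes "valid_step x" "pl_dirs (base_path (src x) (dst x)) 0 1 ds"
  shows "turn_equiv ds (path_dirs (piece x 0 (1/3)) @ path_dirs (mid_cell x) @ path_dirs (piece x (2/3) 1))"
proof -
  have "pl_dirs (base_path (src x) (dst x)) 0 1 (path_dirs (piece x 0 (1/3)) @ path_dirs (mid_cell x) @ path_dirs (piece x (2/3) 1))"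
    unfolding mid_cell_def
    by (rule pl_dirs_append[OF pl_dirs_piece[of x 0 "1/3"] pl_dirs_append[OF pl_dirs_piece[of x "1/3" "2/3"] pl_dirs_piece[of x "2/3" 1]]])
      (use assms in simp_all)
  moreover have "arc (base_path (src x) (dst x))"
    using base_path_facts(5)[OF seg_pt_polygon[OF assms(1), of 0, simplified] seg_pt_polygon[OF assms(1), of 1, simplified]]
      src_neq_dst[OF assms(1)] by simp
  ultimately show ?thesis using turn_equivI[OF assms(2)] by (simp add: arc_def path_def)
qed

lemma strand_turn_equiv:
  assumes "valid_step x" "exit x = Some (m, t)" "pl_dirs (strand_path m t) 0 1 ds"
  shows "turn_equiv ds (strand_dirs x)"
proof -
  note S = strand_path_facts[OF exit_Some(1-3)[OF assms(1,2)]]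
  show ?thesis
    using turn_equivI[OF assms(3) path_dirs(1)[OF S(5)]] S(1) assms(2) by (simp add: strand_dirs_def arc_def path_def)
qed

lemma route_points_dirs:
  assumes "\<And>p q. (p, q) \<in> set (route g a cs b) \<Longrightarrow> p \<in> polygon g \<and> q \<in> polygon g \<and> p \<noteq> q"
    and "\<And>m t. (m, t) \<in> set cs \<Longrightarrow> m \<in> {1..4 * g} \<and> 0 < t \<and> t < 1"
  shows "dirs (route_points g \<Phi> a cs b) = concat (map (\<lambda>i.
      path_dirs (base_path (fst (route g a cs b ! i)) (snd (route g a cs b ! i))) @
      (if i < length cs then path_dirs (strand_path (fst (cs ! i)) (snd (cs ! i))) else [])) [0..<Suc (length cs)])
    \<and> hd (route_points g \<Phi> a cs b) = \<Phi> (Base a) \<and> last (route_points g \<Phi> a cs b) = \<Phi> (Base b)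
    \<and> 2 \<le> length (route_points g \<Phi> a cs b)"
  using assms
proof (induction cs arbitrary: a)
  case Nil
  then have "a \<in> polygon g" "b \<in> polygon g" "a \<noteq> b" by auto
  note f = base_path_facts[OF this(1,2)]
  have "route_points g \<Phi> a [] b = pl_points (base_path a b)" by (simp add: base_path_def[abs_def])
  then show ?case using path_dirs(2-4)[OF f(6)[OF \<open>a \<noteq> b\<close>]] f(2,3) by (simp add: path_dirs_def)
next
  case (Cons c cs)
  obtain m t where c: "c = (m, t)" by force
  have m: "m \<in> {1..4 * g}" "0 < t" "t < 1" using Cons.prems(2) c by auto
  let ?p = "side_pt g m t" and ?a' = "side_pt g (partner m) (1 - t)"
  have ap: "a \<in> polygon g" "?p \<in> polygon g" "a \<noteq> ?p" using Cons.prems(1)[of a ?p] c by auto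
  have IH1: "dirs (route_points g \<Phi> ?a' cs b) = concat (map (\<lambda>i.
      path_dirs (base_path (fst (route g ?a' cs b ! i)) (snd (route g ?a' cs b ! i))) @
      (if i < length cs then path_dirs (strand_path (fst (cs ! i)) (snd (cs ! i))) else [])) [0..<Suc (length cs)])"
    (is ?this1)
    and IH2: "hd (route_points g \<Phi> ?a' cs b) = \<Phi> (Base ?a')" (is ?this2)
    and IH3: "last (route_points g \<Phi> ?a' cs b) = \<Phi> (Base b)" (is ?this3)
    and IH4: "2 \<le> length (route_points g \<Phi> ?a' cs b)" (is ?this4)
  proof -
    have "p \<in> polygon g \<and> q \<in> polygon g \<and> p \<noteq> q" if "(p, q) \<in> set (route g ?a' cs b)" for p q
      using Cons.prems(1)[of p q] that c by simp
    moreover have "m \<in> {1..4 * g} \<and> 0 < t \<and> t < 1" if "(m, t) \<in> set cs" for m t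
      using Cons.prems(2)[of m t] that by simp
    ultimately have C: "?this1 \<and> ?this2 \<and> ?this3 \<and> ?this4" by (rule Cons.IH)
    show ?this1 by (rule C[THEN conjunct1])
    show ?this2 by (rule C[THEN conjunct2, THEN conjunct1])
    show ?this3 by (rule C[THEN conjunct2, THEN conjunct2, THEN conjunct1])
    show ?this4 by (rule C[THEN conjunct2, THEN conjunct2, THEN conjunct2])
  qed
  note IH = IH1 IH2 IH3 IH4
  note f = base_path_facts[OF ap(1,2)] and s = strand_path_facts[OF m]
  let ?A = "pl_points (base_path a ?p)" and ?S = "pl_points (strand_path m t)" and ?R = "route_points g \<Phi> ?a' cs b"
  note A = path_dirs(2-4)[OF f(6)[OF ap(3)]] and S = path_dirs(2-4)[OF s(5)]
  have r: "route_points g \<Phi> a (c # cs) b = butlast ?A @ butlast ?S @ ?R"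
    by (simp add: c base_path_def[abs_def] strand_path_def[abs_def])
  have ne: "?A \<noteq> []" "?S \<noteq> []" "?R \<noteq> []" "butlast ?A \<noteq> []" "butlast ?S \<noteq> []" using A(3) S(3) IH(4)
    by (auto simp: butlast_conv_take)
  have h: "hd (butlast ?S @ ?R) = hd ?S" using ne S(3) by (simp add: hd_butlast)
  have "dirs (butlast ?A @ (butlast ?S @ ?R)) = dirs ?A @ dirs (butlast ?S @ ?R)"
    using ne h A S f s by (intro dirs_join) auto
  also have "dirs (butlast ?S @ ?R) = dirs ?S @ dirs ?R" using ne S s IH(2) by (intro dirs_join) auto
  finally have d: "dirs (route_points g \<Phi> a (c # cs) b) = path_dirs (base_path a ?p) @ path_dirs (strand_path m t) @ dirs ?R"
    unfolding r path_dirs_def .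
  have l: "length (butlast ?A) \<ge> 1" using A(3) by simp
  have "hd (route_points g \<Phi> a (c # cs) b) = \<Phi> (Base a)" unfolding r using ne A f by (simp add: hd_butlast)
  moreover have "last (route_points g \<Phi> a (c # cs) b) = \<Phi> (Base b)" unfolding r using ne IH(3) by simp
  moreover have "2 \<le> length (route_points g \<Phi> a (c # cs) b)" unfolding r using IH(4) by simp
  ultimately show ?case unfolding d IH(1) by (simp add: map_upt_Suc c del: upt_Suc route_points.simps cong: if_cong)
qed

lemma dart_steps_valid: "fst d \<in> edges G \<Longrightarrow> x \<in> set (dart_steps d) \<Longrightarrow> valid_step x"
  by (cases d) (auto simp: dart_steps_def valid_step_def Let_def split: if_splits)

lemma edge_points_dirs:
  assumes "e \<in> edges G"
  shows "dirs (edge_points g \<Phi> G e) = concat (map (\<lambda>i.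
      path_dirs (base_path (fst (segments g G e ! i)) (snd (segments g G e ! i))) @
      (if i < length (crossings G e) then path_dirs (strand_path (fst (crossings G e ! i)) (snd (crossings G e ! i))) else []))
      [0..<Suc (length (crossings G e))])"
    "hd (edge_points g \<Phi> G e) = \<Phi> (Base (pos G (tail G e)))" "last (edge_points g \<Phi> G e) = \<Phi> (Base (pos G (head G e)))"
    "2 \<le> length (edge_points g \<Phi> G e)"
proof -
  have seg: "p \<in> polygon g \<and> q \<in> polygon g \<and> p \<noteq> q" if pq: "(p, q) \<in> set (segments g G e)" for p q
  proof -
    obtain i where i: "i \<le> length (crossings G e)" "segments g G e ! i = (p, q)"
      using pq length_segments[of e] by (metis in_set_conv_nth less_Suc_eq_le)
    have v: "valid_step (e, i, True)" using assms i by (simp add: valid_step_def)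
    have "src (e, i, True) = p" "dst (e, i, True) = q" using i by (simp_all add: src_def dst_def)
    then show ?thesis using seg_pt_polygon[OF v, of 0] seg_pt_polygon[OF v, of 1] src_neq_dst[OF v] by simp
  qed
  have "(m, t) \<in> set (crossings G e) \<Longrightarrow> m \<in> {1..4 * g} \<and> 0 < t \<and> t < 1" for m t
    using crossing_range[OF assms] by blast
  from route_points_dirs[of "pos G (tail G e)" "crossings G e" "pos G (head G e)", folded segments_def, OF seg this]
  show "dirs (edge_points g \<Phi> G e) = concat (map (\<lambda>i.
      path_dirs (base_path (fst (segments g G e ! i)) (snd (segments g G e ! i))) @
      (if i < length (crossings G e) then path_dirs (strand_path (fst (crossings G e ! i)) (snd (crossings G e ! i))) else []))
      [0..<Suc (length (crossings G e))])"
    "hd (edge_points g \<Phi> G e) = \<Phi> (Base (pos G (tail G e)))" "last (edge_points g \<Phi> G e) = \<Phi> (Base (pos G (head G e)))"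
    "2 \<le> length (edge_points g \<Phi> G e)"
    unfolding edge_points_def by blast+
qed

lemma turn_equiv_step_dirs:
  assumes v: "valid_step x" and b: "pl_dirs (base_path (src x) (dst x)) 0 1 b"
    and s: "\<And>m t. exit x = Some (m, t) \<Longrightarrow> pl_dirs (strand_path m t) 0 1 s" "exit x = None \<Longrightarrow> s = []"
  shows "turn_equiv (b @ s) (step_dirs x)"
proof -
  note base = base_turn_equiv[OF v b]
  show ?thesis
  proof (cases "exit x")
    case None
    then show ?thesis using base s(2) by (simp add: step_dirs_def strand_dirs_def)
  next
    case (Some mt)
    then have "turn_equiv s (strand_dirs x)" using strand_turn_equiv[OF v, of "fst mt" "snd mt"] s(1)[of "fst mt" "snd mt"] by simp
    from turn_equiv_append[OF base this] show ?thesis by (simp add: step_dirs_def)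
  qed
qed

lemma dart_points_turn:
  assumes "fst d \<in> edges G"
  shows "turn_equiv (dirs (dart_points g \<Phi> G d)) (concat (map step_dirs (dart_steps d)))"
    "hd (dart_points g \<Phi> G d) = \<Phi> (Base (pos G (start_vert G d)))"
    "last (dart_points g \<Phi> G d) = \<Phi> (Base (pos G (end_vert G d)))" "2 \<le> length (dart_points g \<Phi> G d)"
proof -
  obtain e f where d: "d = (e, f)" by force
  have e: "e \<in> edges G" using assms d by simp
  note E = edge_points_dirs[OF e]
  have ne: "edge_points g \<Phi> G e \<noteq> []" using E(4) by auto
  show "hd (dart_points g \<Phi> G d) = \<Phi> (Base (pos G (start_vert G d)))"
    "last (dart_points g \<Phi> G d) = \<Phi> (Base (pos G (end_vert G d)))" "2 \<le> length (dart_points g \<Phi> G d)"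
    using E ne by (auto simp: d dart_points_def start_vert_def end_vert_def rev_dart_def hd_rev last_rev)
  let ?n = "length (crossings G e)"
  let ?b = "\<lambda>i. path_dirs (base_path (fst (segments g G e ! i)) (snd (segments g G e ! i)))"
  let ?s = "\<lambda>i. path_dirs (strand_path (fst (crossings G e ! i)) (snd (crossings G e ! i)))"
  have valid: "valid_step (e, i, f)" if "i < Suc ?n" for i f using that e by (simp add: valid_step_def)
  have ends: "fst (segments g G e ! i) = src (e, i, True)" "snd (segments g G e ! i) = dst (e, i, True)"
    "snd (segments g G e ! i) = src (e, i, False)" "fst (segments g G e ! i) = dst (e, i, False)" for i
    by (simp_all add: src_def dst_def)
  have b: "pl_dirs (base_path (src (e, i, True)) (dst (e, i, True))) 0 1 (?b i)" if "i < Suc ?n" for i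
    unfolding ends(1,2)
    by (rule path_dirs(1)) (use base_path_facts(6) seg_pt_polygon[OF valid[OF that], of 0 True] seg_pt_polygon[OF valid[OF that], of 1 True]
        src_neq_dst[OF valid[OF that]] in simp)
  have s: "pl_dirs (strand_path (fst (crossings G e ! i)) (snd (crossings G e ! i))) 0 1 (?s i)"
    and crange: "fst (crossings G e ! i) \<in> {1..4 * g}" if "i < ?n" for i
  proof -
    have "(fst (crossings G e ! i), snd (crossings G e ! i)) \<in> set (crossings G e)" using that by simp
    note c = crossing_range[OF e this]
    show "fst (crossings G e ! i) \<in> {1..4 * g}" by (rule c(1))
    show "pl_dirs (strand_path (fst (crossings G e ! i)) (snd (crossings G e ! i))) 0 1 (?s i)"
      by (rule path_dirs(1)[OF strand_path_facts(5)[OF c]])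
  qed
  show "turn_equiv (dirs (dart_points g \<Phi> G d)) (concat (map step_dirs (dart_steps d)))"
  proof (cases f)
    case True
    have "turn_equiv (concat (map (\<lambda>i. ?b i @ (if i < ?n then ?s i else [])) [0..<Suc ?n]))
       (concat (map (\<lambda>i. step_dirs (e, i, True)) [0..<Suc ?n]))"
    proof (rule turn_equiv_concat)
      have "turn_equiv (?b i @ (if i < ?n then ?s i else [])) (step_dirs (e, i, True))" if "i \<in> set [0..<Suc ?n]" for i
      proof -
        have i: "i < Suc ?n" using that by auto
        show ?thesis
        proof (rule turn_equiv_step_dirs[OF valid[OF i] b[OF i]])
          show "pl_dirs (strand_path m t) 0 1 (if i < ?n then ?s i else [])" if "exit (e, i, True) = Some (m, t)" for m t
            using that s[of i] by (auto simp: exit_def split: if_splits)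
        qed (auto simp: exit_def split: if_splits)
      qed
      then show "list_all2 turn_equiv (map (\<lambda>i. ?b i @ (if i < ?n then ?s i else [])) [0..<Suc ?n])
         (map (\<lambda>i. step_dirs (e, i, True)) [0..<Suc ?n])"
        unfolding list_all2_map1 list_all2_map2 by (intro list_all2_same[THEN iffD2] ballI)
    qed simp
    then show ?thesis using True E(1) by (simp add: d dart_points_def dart_steps_def comp_def del: upt_Suc)
  next
    case False
    \<comment> \<open>For a backward dart the drawn points are those of the edge in reverse, while
      \<open>step_dirs\<close> chooses its own points on the reversed segments. Both subdivide the
      same paths, so they agree up to \<open>turn_equiv\<close>.\<close>
    let ?b' = "\<lambda>i. map uminus (rev (?b i))" and ?s' = "\<lambda>i. map uminus (rev (?s i))"
    have "dirs (dart_points g \<Phi> G d) = map uminus (rev (dirs (edge_points g \<Phi> G e)))"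
      using False by (simp add: d dart_points_def dirs_rev)
    also have "\<dots> = concat (map (\<lambda>i. ?b' i @ (if 0 < i then ?s' (i - 1) else [])) (rev [0..<Suc ?n]))"
    proof -
      have "map uminus (if c then xs else []) = (if c then map uminus xs else [])" for c and xs :: "complex list" by simp
      then show ?thesis unfolding E(1) rev_interleaved by (simp only: map_concat map_map comp_def map_append)
    qed
    finally have D: "dirs (dart_points g \<Phi> G d) = concat (map (\<lambda>i. ?b' i @ (if 0 < i then ?s' (i - 1) else [])) (rev [0..<Suc ?n]))" .
    have "turn_equiv (concat (map (\<lambda>i. ?b' i @ (if 0 < i then ?s' (i - 1) else [])) (rev [0..<Suc ?n])))
       (concat (map (\<lambda>i. step_dirs (e, i, False)) (rev [0..<Suc ?n])))"
    proof (rule turn_equiv_concat)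
      have "turn_equiv (?b' i @ (if 0 < i then ?s' (i - 1) else [])) (step_dirs (e, i, False))" if i: "i \<in> set (rev [0..<Suc ?n])" for i
      proof (rule turn_equiv_step_dirs)
        have i: "i < Suc ?n" using i by auto
        show "valid_step (e, i, False)" by (rule valid[OF i])
        have "(\<lambda>u. base_path (src (e, i, True)) (dst (e, i, True)) (1 - u)) = base_path (src (e, i, False)) (dst (e, i, False))"
          by (simp add: fun_eq_iff base_path_def linepath_def src_def dst_def algebra_simps)
        then show "pl_dirs (base_path (src (e, i, False)) (dst (e, i, False))) 0 1 (?b' i)"
          using pl_dirs_one_minus[OF b[OF i]] by simp
        show "pl_dirs (strand_path m t) 0 1 (if 0 < i then ?s' (i - 1) else [])" if ex: "exit (e, i, False) = Some (m, t)" for m t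
        proof -
          have i0: "0 < i" "m = partner (fst (crossings G e ! (i - 1)))" "t = 1 - snd (crossings G e ! (i - 1))"
            using ex by (auto simp: exit_def split: if_splits prod.splits)
          then have j: "i - 1 < ?n" using i by simp
          have "(\<lambda>u. strand_path (fst (crossings G e ! (i - 1))) (snd (crossings G e ! (i - 1))) (1 - u)) = strand_path m t"
            using strand_partner[OF crange[OF j]] i0 by (simp add: fun_eq_iff strand_path_def)
          then show ?thesis using pl_dirs_one_minus[OF s[OF j]] i0(1) by simp
        qed
        show "(if 0 < i then ?s' (i - 1) else []) = []" if "exit (e, i, False) = None"
          using that by (auto simp: exit_def split: if_splits)
      qed
      then show "list_all2 turn_equiv (map (\<lambda>i. ?b' i @ (if 0 < i then ?s' (i - 1) else [])) (rev [0..<Suc ?n]))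
         (map (\<lambda>i. step_dirs (e, i, False)) (rev [0..<Suc ?n]))"
        unfolding list_all2_map1 list_all2_map2 by (intro list_all2_same[THEN iffD2] ballI)
    qed simp
    then show ?thesis unfolding D using False by (simp add: d dart_steps_def rev_map[symmetric] comp_def del: upt_Suc)
  qed
qed

end

section \<open>Sums over pairs of list entries\<close>

fun pair_sum :: "('a \<Rightarrow> 'a \<Rightarrow> 'b::comm_monoid_add) \<Rightarrow> 'a list \<Rightarrow> 'b" where
  "pair_sum F [] = 0"
| "pair_sum F (x # xs) = (\<Sum>y\<leftarrow>xs. F x y) + pair_sum F xs"

lemma pair_sum_append: "pair_sum F (xs @ ys) = pair_sum F xs + (\<Sum>x\<leftarrow>xs. \<Sum>y\<leftarrow>ys. F x y) + pair_sum F ys"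
  by (induction xs) (simp_all only: append_Cons append_Nil pair_sum.simps list.map map_append sum_list_append
    sum_list.Cons sum_list.Nil add.assoc add.commute add.left_commute add_0_left)

lemma pair_sum_add: "pair_sum (\<lambda>x y. F x y + F' x y) xs = pair_sum F xs + pair_sum F' xs"
  by (induction xs) (simp_all only: pair_sum.simps sum_list_addf add.assoc add.commute add.left_commute add_0_left)

lemma pair_sum_nth: "pair_sum F xs = (\<Sum>(i, j)\<in>{(i, j). i < j \<and> j < length xs}. F (xs ! i) (xs ! j))"
proof (induction xs)
  case (Cons x xs)
  let ?P = "{(i, j). i < j \<and> j < length xs}" and ?h = "\<lambda>(i, j). (Suc i, Suc j) :: nat \<times> nat"
  have e: "{(i, j). i < j \<and> j < length (x # xs)} = Pair 0 ` Suc ` {..<length xs} \<union> ?h ` ?P" (is "?L = ?R")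
  proof
    show "?L \<subseteq> ?R"
    proof clarify
      fix i j assume ij: "i < j" "j < length (x # xs)" "(i, j) \<notin> ?h ` ?P"
      obtain j' where j: "j = Suc j'" using ij(1) by (cases j) auto
      have "i = 0"
      proof (rule ccontr)
        assume "i \<noteq> 0"
        then obtain i' where "i = Suc i'" by (cases i) auto
        then have "(i, j) = ?h (i', j')" "(i', j') \<in> ?P" using ij j by auto
        then show False using ij(3) by blast
      qed
      then show "(i, j) \<in> Pair 0 ` Suc ` {..<length xs}" using ij j by auto
    qed
  qed auto
  have fin: "finite ?P" by (rule finite_subset[of _ "{..<length xs} \<times> {..<length xs}"]) auto
  have "(\<Sum>(i, j)\<in>?L. F ((x # xs) ! i) ((x # xs) ! j)) =
    (\<Sum>(i, j)\<in>Pair 0 ` Suc ` {..<length xs}. F ((x # xs) ! i) ((x # xs) ! j)) + (\<Sum>(i, j)\<in>?h ` ?P. F ((x # xs) ! i) ((x # xs) ! j))"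
    unfolding e by (rule sum.union_disjoint) (use fin in auto)
  also have "(\<Sum>(i, j)\<in>Pair 0 ` Suc ` {..<length xs}. F ((x # xs) ! i) ((x # xs) ! j)) = (\<Sum>j<length xs. F x (xs ! j))"
    by (simp add: image_image sum.reindex inj_on_def)
  also have "\<dots> = (\<Sum>y\<leftarrow>xs. F x y)" by (simp add: sum_list_sum_nth atLeast0LessThan)
  also have "(\<Sum>(i, j)\<in>?h ` ?P. F ((x # xs) ! i) ((x # xs) ! j)) = pair_sum F xs"
    unfolding Cons.IH by (subst sum.reindex) (auto simp: inj_on_def case_prod_beta)
  finally show ?case by simp
qed simp

lemma successively_cyclic_nth:
  assumes "successively P (xs @ [hd xs])" "k < length xs"
  shows "P (xs ! k) (xs ! (Suc k mod length xs))"
proof -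
  have "P ((xs @ [hd xs]) ! k) ((xs @ [hd xs]) ! Suc k)"
    using assms by (simp add: successively_conv_nth)
  moreover have "(xs @ [hd xs]) ! Suc k = xs ! (Suc k mod length xs)"
  proof (cases "Suc k = length xs")
    case True
    moreover have "hd xs = xs ! 0" using assms(2) by (cases xs) auto
    ultimately show ?thesis by (simp add: nth_append)
  qed (use assms(2) in \<open>simp add: nth_append\<close>)
  ultimately show ?thesis using assms(2) by (simp add: nth_append)
qed

context drawing
begin

section \<open>Closed walks and their cyclic sequences of steps\<close>

definition closed_walk :: "'e dart list \<Rightarrow> bool" where
  "closed_walk w \<longleftrightarrow> w \<noteq> [] \<and> fst ` set w \<subseteq> edges G \<and> distinct (map fst w) \<and>
     (\<forall>j<length w. end_vert G (w ! j) = start_vert G (next_dart w j))"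

text \<open>Every step carries the dart that comes after its own dart. At the last step of a dart,
  where the walk passes through a vertex, the two determine the chord of the transition;
  \<open>d0\<close> closes the walk up.\<close>

fun turns_until :: "'e dart list \<Rightarrow> 'e dart \<Rightarrow> ('e step \<times> 'e dart) list" where
  "turns_until [] d0 = []"
| "turns_until (d # ds) d0 = map (\<lambda>x. (x, hd (ds @ [d0]))) (dart_steps d) @ turns_until ds d0"

definition turns :: "'e dart list \<Rightarrow> ('e step \<times> 'e dart) list" where
  "turns w = turns_until w (hd w)"

definition walk_steps :: "'e dart list \<Rightarrow> 'e step list" where
  "walk_steps w = concat (map dart_steps w)"

lemma map_fst_turns: "map fst (turns w) = walk_steps w"
proof -
  have "map fst (turns_until ds d0) = concat (map dart_steps ds)" for ds d0
    by (induction ds d0 rule: turns_until.induct) (simp_all add: comp_def)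
  then show ?thesis by (simp add: turns_def walk_steps_def)
qed

lemma dart_steps_props:
  assumes "fst d \<in> edges G"
  shows "dart_steps d \<noteq> []" "initial_step (hd (dart_steps d))" "exit (last (dart_steps d)) = None"
    "x \<in> set (dart_steps d) \<Longrightarrow> dart_of x = d" "distinct (dart_steps d)"
    "x \<in> set (butlast (dart_steps d)) \<Longrightarrow> exit x \<noteq> None"
    "successively follows (dart_steps d)"
    "src (hd (dart_steps d)) = pos G (start_vert G d)"
proof -
  obtain e f where d: "d = (e, f)" by force
  have e: "e \<in> edges G" using assms d by simp
  let ?n = "length (crossings G e)"
  have T: "dart_steps (e, True) = map (\<lambda>i. (e, i, True)) [0..<Suc ?n]"
    "dart_steps (e, False) = map (\<lambda>i. (e, i, False)) (rev [0..<Suc ?n])"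
    by (simp_all add: dart_steps_def rev_map)
  show "dart_steps d \<noteq> []" by (simp add: d dart_steps_def Let_def)
  show "x \<in> set (dart_steps d) \<Longrightarrow> dart_of x = d"
    by (cases f) (auto simp: d T dart_of_def)
  show "distinct (dart_steps d)" by (cases f) (auto simp: d T distinct_map inj_on_def simp del: upt_Suc)
  have hd0: "hd (dart_steps (e, True)) = (e, 0, True)" "hd (dart_steps (e, False)) = (e, ?n, False)"
    "last (dart_steps (e, True)) = (e, ?n, True)" "last (dart_steps (e, False)) = (e, 0, False)"
    unfolding T upt_conv_Cons[OF zero_less_Suc] by (simp_all only: list.map list.sel rev.simps last_map last_rev hd_append)
      (simp_all add: last_map hd_append hd_map hd_rev last_conv_nth upt_conv_Cons[symmetric] del: upt_Suc)
  show "initial_step (hd (dart_steps d))" "exit (last (dart_steps d)) = None"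
    using hd0 by (cases f; simp add: d initial_step_def exit_def)+
  show "src (hd (dart_steps d)) = pos G (start_vert G d)"
    using hd0 segments_nth[of 0 e] segments_nth[of ?n e] by (cases f) (simp_all add: d src_def start_vert_def)
  have "butlast (dart_steps (e, True)) = map (\<lambda>i. (e, i, True)) [0..<?n]" unfolding T by simp
  moreover have "butlast (dart_steps (e, False)) = map (\<lambda>i. (e, i, False)) (rev [Suc 0..<Suc ?n])"
    unfolding T upt_conv_Cons[OF zero_less_Suc] by simp
  ultimately show "x \<in> set (butlast (dart_steps d)) \<Longrightarrow> exit x \<noteq> None"
    by (cases f) (auto simp: d exit_def simp del: upt_Suc)
  have fw: "follows (e, i, True) (e, Suc i, True)" if "i < ?n" for i
    using segments_nth(1)[of "Suc i" e] that by (auto simp: follows_def exit_def src_def split: prod.splits)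
  have bw: "follows (e, Suc i, False) (e, i, False)" if "i < ?n" for i
  proof -
    obtain m t where c: "crossings G e ! i = (m, t)" by force
    then have "(m, t) \<in> set (crossings G e)" using that by (metis nth_mem)
    then have "partner (partner m) = m" using crossing_range(1)[OF e] partner_props(2) by blast
    then show ?thesis using segments_nth(2)[of i e] that c by (simp add: follows_def exit_def src_def)
  qed
  show "successively follows (dart_steps d)"
  proof (cases f)
    case True
    then show ?thesis unfolding d by (simp add: T successively_conv_nth fw del: upt_Suc)
  next
    case False
    have "successively follows (dart_steps (e, False))"
      unfolding successively_conv_nth
    proof (intro allI impI)
      fix i assume "Suc i < length (dart_steps (e, False))"
      then have i: "Suc i < Suc ?n" unfolding T by simp
      then have "rev [0..<Suc ?n] ! i = ?n - i" "rev [0..<Suc ?n] ! Suc i = ?n - Suc i"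
        by (simp_all add: rev_nth del: upt_Suc)
      moreover have "?n - i = Suc (?n - Suc i)" using i by simp
      ultimately show "follows (dart_steps (e, False) ! i) (dart_steps (e, False) ! Suc i)"
        unfolding T using i bw[of "?n - Suc i"] by (simp del: upt_Suc)
    qed
    then show ?thesis using False d by simp
  qed
qed

definition turn_step :: "'e step \<times> 'e dart \<Rightarrow> 'e step \<times> 'e dart \<Rightarrow> bool" where
  "turn_step = (\<lambda>(x, d) (y, d'). follows x y \<and> (exit x = None \<longrightarrow> initial_step y \<and> dart_of y = d))"

text \<open>Appending the first step of \<open>d0\<close> reduces the cyclic successor relation to
  one between consecutive list entries.\<close>

lemma turns_until_successively:
  assumes "fst ` set ds \<subseteq> edges G" "fst d0 \<in> edges G"
    and "\<And>j. j < length ds \<Longrightarrow> end_vert G (ds ! j) = start_vert G ((ds @ [d0]) ! Suc j)"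
  shows "successively turn_step (turns_until ds d0 @ [(hd (dart_steps d0), d')]) \<and>
    fst (hd (turns_until ds d0 @ [(hd (dart_steps d0), d')])) = hd (dart_steps (hd (ds @ [d0])))"
  using assms
proof (induction ds)
  case (Cons d ds)
  define n where "n = hd (ds @ [d0])"
  let ?R = "turns_until ds d0 @ [(hd (dart_steps d0), d')]"
  have IH: "successively turn_step ?R" "fst (hd ?R) = hd (dart_steps n)"
  proof -
    have "end_vert G (ds ! j) = start_vert G ((ds @ [d0]) ! Suc j)" if "j < length ds" for j
      using Cons.prems(3)[of "Suc j"] that by simp
    then show "successively turn_step ?R" "fst (hd ?R) = hd (dart_steps n)"
      using Cons.IH Cons.prems(1,2) by (auto simp: n_def)
  qed
  have n: "fst n \<in> edges G" using Cons.prems(1,2) by (cases ds) (auto simp: n_def)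
  have dE: "fst d \<in> edges G" using Cons.prems(1) by simp
  note p = dart_steps_props[OF dE]
  have sv: "end_vert G d = start_vert G n"
    using Cons.prems(3)[of 0] by (cases ds) (auto simp: n_def)
  let ?L = "map (\<lambda>x. (x, n)) (dart_steps d)"
  have "successively turn_step ?L"
    unfolding successively_conv_nth
  proof (intro allI impI)
    fix i assume i: "Suc i < length ?L"
    then have "follows (dart_steps d ! i) (dart_steps d ! Suc i)"
      using p(7) by (simp add: successively_conv_nth)
    moreover have "dart_steps d ! i \<in> set (butlast (dart_steps d))"
      using i by (metis Suc_lessD length_butlast length_map less_diff_conv nth_butlast nth_mem Suc_eq_plus1)
    then have "exit (dart_steps d ! i) \<noteq> None" by (rule p(6))
    with \<open>follows (dart_steps d ! i) (dart_steps d ! Suc i)\<close> show "turn_step (?L ! i) (?L ! Suc i)"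
      using i by (auto simp: turn_step_def)
  qed
  moreover have "turn_step (last ?L) (hd ?R)"
  proof -
    obtain d'' where hr: "hd ?R = (hd (dart_steps n), d'')" using IH(2) by (metis prod.collapse)
    have l: "last ?L = (last (dart_steps d), n)" using p(1) by (simp add: last_map)
    have li: "last (dart_steps d) \<in> set (dart_steps d)" using p(1) by simp
    have "dst (last (dart_steps d)) = pos G (end_vert G d)"
      using exit_None(1)[OF dart_steps_valid[OF dE li] p(3)] p(4)[OF li] by simp
    then have "follows (last (dart_steps d)) (hd (dart_steps n))"
      using p(3) sv dart_steps_props(8)[OF n] by (simp add: follows_def)
    then show ?thesis unfolding hr l
      using dart_steps_props(2)[OF n] dart_steps_props(4)[OF n hd_in_set[OF dart_steps_props(1)[OF n]]]
      by (simp add: turn_step_def)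
  qed
  ultimately have "successively turn_step (?L @ ?R)"
    using IH(1) p(1) by (simp add: successively_append_iff)
  moreover have "turns_until (d # ds) d0 @ [(hd (dart_steps d0), d')] = ?L @ ?R" by (simp add: n_def)
  moreover have "fst (hd (?L @ ?R)) = hd (dart_steps d)" using p(1) by (simp add: hd_append hd_map)
  ultimately show ?case by (simp only: append_Cons list.sel)
qed simp

lemma walk_steps_props:
  assumes "closed_walk w"
  shows "turns w \<noteq> []" "coherent (set (walk_steps w))" "distinct (walk_steps w)"
    "k < length (turns w) \<Longrightarrow> turn_step (turns w ! k) (turns w ! (Suc k mod length (turns w)))"
    "2 \<le> length (turns w)"
proof -
  have w: "w \<noteq> []" "fst ` set w \<subseteq> edges G" "distinct (map fst w)"
    and nxt: "\<And>j. j < length w \<Longrightarrow> end_vert G (w ! j) = start_vert G (next_dart w j)"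
    using assms by (auto simp: closed_walk_def)
  have dE: "fst d \<in> edges G" if "d \<in> set w" for d using that w by auto
  have ne: "walk_steps w \<noteq> []" using w(1) dart_steps_props(1)[OF dE] by (cases w) (auto simp: walk_steps_def)
  then show t: "turns w \<noteq> []" using map_fst_turns[of w] by auto
  have member: "fst x = fst d \<and> snd (snd x) = snd d" if "x \<in> set (dart_steps d)" "d \<in> set w" for x d
    using dart_steps_props(4)[OF dE[OF that(2)] that(1)] by (cases x) (auto simp: dart_of_def)
  show coh: "coherent (set (walk_steps w))"
    unfolding coherent_def
  proof (intro conjI ballI impI)
    fix x assume "x \<in> set (walk_steps w)"
    then obtain d where d: "d \<in> set w" "x \<in> set (dart_steps d)" by (auto simp: walk_steps_def)
    show "valid_step x" by (rule dart_steps_valid[OF dE[OF d(1)] d(2)])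
    fix y assume "y \<in> set (walk_steps w)" "fst x = fst y"
    then obtain d' where d': "d' \<in> set w" "y \<in> set (dart_steps d')" by (auto simp: walk_steps_def)
    have "fst d = fst d'" using member[OF d(2,1)] member[OF d'(2,1)] \<open>fst x = fst y\<close> by simp
    then have "d = d'" using w(3) d(1) d'(1) by (simp add: distinct_map inj_on_def)
    then show "snd (snd x) = snd (snd y)" using member[OF d(2,1)] member[OF d'(2,1)] by simp
  qed
  show dist: "distinct (walk_steps w)"
    unfolding walk_steps_def using w(2,3) member
  proof (induction w)
    case (Cons d w)
    have "x \<notin> set (dart_steps d')" if "x \<in> set (dart_steps d)" "d' \<in> set w" for x d'
    proof
      assume "x \<in> set (dart_steps d')"
      then have "fst x = fst d'" using Cons.prems(3)[of x d'] that(2) by simp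
      moreover have "fst x = fst d" using Cons.prems(3)[of x d] that(1) by simp
      ultimately show False using Cons.prems(2) that(2) by force
    qed
    then have disj: "set (dart_steps d) \<inter> set (concat (map dart_steps w)) = {}" by auto
    have "distinct (concat (map dart_steps w))"
      by (rule Cons.IH) (use Cons.prems in auto)
    moreover have "distinct (dart_steps d)" using Cons.prems(1) by (intro dart_steps_props(5)) simp
    ultimately show ?case using disj by simp
  qed simp
  have "successively turn_step (turns w @ [(hd (dart_steps (hd w)), snd (hd (turns w)))]) \<and>
    fst (hd (turns w @ [(hd (dart_steps (hd w)), snd (hd (turns w)))])) = hd (dart_steps (hd (w @ [hd w])))"
    unfolding turns_def
  proof (rule turns_until_successively[OF w(2) dE[OF hd_in_set[OF w(1)]]])
    fix j assume "j < length w"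
    then have "(w @ [hd w]) ! Suc j = next_dart w j"
      using w(1) by (cases "Suc j = length w") (auto simp: next_dart_def nth_append hd_conv_nth)
    then show "end_vert G (w ! j) = start_vert G ((w @ [hd w]) ! Suc j)" using nxt[OF \<open>j < length w\<close>] by simp
  qed
  moreover from this have "(hd (dart_steps (hd w)), snd (hd (turns w))) = hd (turns w)"
    using t w(1) by (intro prod_eqI) simp_all
  ultimately have "successively turn_step (turns w @ [hd (turns w)])" by simp
  from successively_cyclic_nth[OF this]
  show cyc: "k < length (turns w) \<Longrightarrow> turn_step (turns w ! k) (turns w ! (Suc k mod length (turns w)))" for k .
  \<comment> \<open>A lone step would follow itself at a vertex and be a segment with equal ends; a
    loop has to leave the polygon at least once.\<close>
  show "2 \<le> length (turns w)"
  proof (rule ccontr)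
    assume "\<not> ?thesis"
    then have one: "length (turns w) = 1" using t by (cases "turns w") (auto simp: not_le less_Suc_eq)
    then have "turn_step (turns w ! 0) (turns w ! 0)" using cyc[of 0] by simp
    moreover define x where "x = fst (turns w ! 0)"
    ultimately have f: "follows x x" by (auto simp: turn_step_def case_prod_beta)
    have "walk_steps w = [x]" using one map_fst_turns[of w] by (cases "turns w") (auto simp: x_def)
    then have xs: "x \<in> set (walk_steps w)" by simp
    have v: "valid_step x" using coh xs by (rule coherent_valid)
    obtain d where d: "d \<in> set w" "x \<in> set (dart_steps d)" using xs by (auto simp: walk_steps_def)
    have "dart_steps d = [x]"
    proof -
      have "set (dart_steps d) \<subseteq> set (walk_steps w)" using d(1) unfolding walk_steps_def by auto
      then have "set (dart_steps d) \<subseteq> {x}" using \<open>walk_steps w = [x]\<close> by simp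
      moreover have "distinct (dart_steps d)" by (rule dart_steps_props(5)[OF dE[OF d(1)]])
      ultimately show ?thesis using d(2) by (cases "dart_steps d" rule: remdups_adj.cases) auto
    qed
    then have "exit x = None" using dart_steps_props(3)[OF dE[OF d(1)]] by simp
    then show False using f src_neq_dst[OF v] by (simp add: follows_def)
  qed
qed

lemma pl_dirs_turn_cell:
  assumes X: "coherent X" "x \<in> X" "y \<in> X" and nxt: "follows x y"
  shows "pl_dirs (turn_cell x y) 0 1 (path_dirs (piece x (2/3) 1) @ strand_dirs x @ path_dirs (piece y 0 (1/3)))"
proof -
  note v = coherent_valid[OF X(1,2)] coherent_valid[OF X(1,3)]
  have x: "pl_dirs (piece x (2/3) 1) 0 1 (path_dirs (piece x (2/3) 1))"
    by (rule path_dirs(1)[OF piece_facts(6)[OF v(1)]]) auto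
  have y: "pl_dirs (piece y 0 (1/3)) 0 1 (path_dirs (piece y 0 (1/3)))"
    by (rule path_dirs(1)[OF piece_facts(6)[OF v(2)]]) auto
  have xe: "piece x (2/3) 1 1 = \<Phi> (Base (dst x))" using piece_facts(4)[OF v(1), of "2/3" 1] by simp
  have ys: "piece y 0 (1/3) 0 = \<Phi> (Base (src y))" using piece_facts(3)[OF v(2), of 0 "1/3"] by simp
  show ?thesis
  proof (cases "exit x")
    case None
    then have "turn_cell x y = piece x (2/3) 1 +++ piece y 0 (1/3)" "strand_dirs x = []"
      by (simp_all add: turn_cell_def strand_dirs_def)
    moreover have "piece x (2/3) 1 1 = piece y 0 (1/3) 0" using xe ys nxt None by (simp add: follows_def)
    ultimately show ?thesis using pl_dirs_joinpaths(3)[OF x y] by simp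
  next
    case (Some mt)
    obtain m t where mt: "mt = (m, t)" by force
    note e = exit_Some[OF v(1) Some[unfolded mt]]
    note S = strand_path_facts[OF e(1-3)]
    have s: "pl_dirs (strand_path m t) 0 1 (path_dirs (strand_path m t))" by (rule path_dirs(1)[OF S(5)])
    have "strand_path m t 1 = piece y 0 (1/3) 0" using ys nxt Some mt S(3) by (simp add: follows_def)
    note sy = pl_dirs_joinpaths(3)[OF s y this]
    have "piece x (2/3) 1 1 = (strand_path m t +++ piece y 0 (1/3)) 0"
      using xe S(2) e(4) by (simp add: joinpaths_def)
    note pl_dirs_joinpaths(3)[OF x sy this]
    moreover have "turn_cell x y = piece x (2/3) 1 +++ (strand_path m t +++ piece y 0 (1/3))"
      "strand_dirs x = path_dirs (strand_path m t)" using Some mt by (simp_all add: turn_cell_def strand_dirs_def)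
    ultimately show ?thesis by simp
  qed
qed

lemma walk_step_nth:
  assumes w: "closed_walk w" and k: "k < length (walk_steps w)"
  defines "x \<equiv> walk_steps w ! k" and "y \<equiv> walk_steps w ! (Suc k mod length (walk_steps w))"
  shows "x \<in> set (walk_steps w)" "y \<in> set (walk_steps w)" "x \<noteq> y" "follows x y"
    "fst (turns w ! k) = x" "exit x = None \<Longrightarrow> initial_step y \<and> dart_of y = snd (turns w ! k)"
proof -
  have L: "length (turns w) = length (walk_steps w)" by (simp flip: map_fst_turns)
  have f: "fst (turns w ! i) = walk_steps w ! i" if "i < length (walk_steps w)" for i
    using that L nth_map[of i "turns w" fst] by (simp add: map_fst_turns)
  have k': "Suc k mod length (walk_steps w) < length (walk_steps w)" using k by (intro mod_less_divisor) linarith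
  show "x \<in> set (walk_steps w)" "y \<in> set (walk_steps w)" using k k' by (simp_all add: x_def y_def)
  have "k \<noteq> Suc k mod length (walk_steps w)"
  proof (cases "Suc k = length (walk_steps w)")
    case True
    then show ?thesis using walk_steps_props(5)[OF w] L by simp
  next
    case False
    then show ?thesis using k by simp
  qed
  then show "x \<noteq> y" using walk_steps_props(3)[OF w] k k' by (simp add: x_def y_def nth_eq_iff_index_eq)
  show "fst (turns w ! k) = x" using f[OF k] by (simp add: x_def)
  have "turn_step (turns w ! k) (turns w ! (Suc k mod length (turns w)))" using walk_steps_props(4)[OF w] k L by simp
  then show "follows x y" "exit x = None \<Longrightarrow> initial_step y \<and> dart_of y = snd (turns w ! k)"
    using f[OF k] f[OF k'] L by (auto simp: turn_step_def case_prod_beta x_def y_def)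
qed

definition turn_parity :: "'e step \<times> 'e dart \<Rightarrow> 'e step \<times> 'e dart \<Rightarrow> bit" where
  "turn_parity a b = chord_parity a b + strand_parity (fst a) (fst b)"

lemma cross_index_walks:
  assumes w: "closed_walk w" "closed_walk w'" and X: "coherent X" "set (walk_steps w) \<subseteq> X" "set (walk_steps w') \<subseteq> X"
    and ne: "interior (polygon g) \<noteq> {}"
    and jk: "j < length (walk_steps w)" "k < length (walk_steps w')" "walk_steps w ! j \<noteq> walk_steps w' ! k"
      "walk_steps w ! (Suc j mod length (walk_steps w)) \<noteq> walk_steps w' ! (Suc k mod length (walk_steps w'))"
  shows "\<exists>n::int. cross_index (turn_cell (walk_steps w ! j) (walk_steps w ! (Suc j mod length (walk_steps w))))
      (turn_cell (walk_steps w' ! k) (walk_steps w' ! (Suc k mod length (walk_steps w')))) = of_int n \<and>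
    of_int n = turn_parity (turns w ! j) (turns w' ! k)"
proof -
  let ?x = "walk_steps w ! j" and ?y = "walk_steps w ! (Suc j mod length (walk_steps w))"
  let ?x' = "walk_steps w' ! k" and ?y' = "walk_steps w' ! (Suc k mod length (walk_steps w'))"
  note p = walk_step_nth[OF w(1) jk(1)] and q = walk_step_nth[OF w(2) jk(2)]
  have "chord_parity (?x, dart_of ?y) (?x', dart_of ?y') = chord_parity (turns w ! j) (turns w' ! k)"
  proof (cases "exit ?x = None \<and> exit ?x' = None")
    case True
    then have "turns w ! j = (?x, dart_of ?y)" "turns w' ! k = (?x', dart_of ?y')"
      using p(5,6) q(5,6) by (simp_all add: prod_eq_iff)
    then show ?thesis by simp
  next
    case False
    then show ?thesis using p(5) q(5) by (auto simp: chord_parity_def case_prod_beta)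
  qed
  moreover have "\<exists>n::int. cross_index (turn_cell ?x ?y) (turn_cell ?x' ?y') = of_int n \<and>
    of_int n = chord_parity (?x, dart_of ?y) (?x', dart_of ?y') + strand_parity ?x ?x'"
    by (rule cross_index_turn_cells[OF X(1) subsetD[OF X(2) p(1)] subsetD[OF X(2) p(2)] subsetD[OF X(3) q(1)]
        subsetD[OF X(3) q(2)] jk(3,4) p(3) q(3) p(4) q(4) ne])
      (use p(6) q(6) in blast)+
  ultimately show ?thesis using p(5) q(5) by (simp only: turn_parity_def)
qed

lemma cturn_walk:
  assumes w: "closed_walk w"
  shows "total_turning (walk_points g \<Phi> G w) = cturn (concat (map step_dirs (walk_steps w)))"
proof -
  have nonempty: "w \<noteq> []" and E: "\<And>d. d \<in> set w \<Longrightarrow> fst d \<in> edges G"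
    and nxt: "\<And>j. j < length w \<Longrightarrow> end_vert G (w ! j) = start_vert G (next_dart w j)"
    using w by (auto simp: closed_walk_def)
  let ?P = "map (dart_points g \<Phi> G) w"
  let ?ps = "concat (map butlast ?P) @ [last (last ?P)]"
  have P: "?P \<noteq> []" "\<And>ps. ps \<in> set ?P \<Longrightarrow> 2 \<le> length ps" using nonempty E dart_points_turn(4) by auto
  have ends: "last (?P ! i) = \<Phi> (Base (pos G (end_vert G (w ! i))))" "hd (?P ! i) = \<Phi> (Base (pos G (start_vert G (w ! i))))"
    if "i < length w" for i using that E dart_points_turn(2,3)[of "w ! i"] by simp_all
  have "dirs ?ps = concat (map dirs ?P) \<and> hd ?ps = hd (hd ?P)"
  proof (rule dirs_concat_butlast[OF P(1)])
    show "ps \<noteq> []" if "ps \<in> set ?P" for ps using P(2)[OF that] by auto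
    fix i assume "Suc i < length ?P"
    then show "last (?P ! i) = hd (?P ! Suc i)" using ends[of i] ends[of "Suc i"] nxt[of i] by (simp add: next_dart_def)
  qed
  moreover have "last ?ps = hd (hd ?P)"
  proof -
    let ?n = "length w - 1"
    have n: "?n < length w" "Suc ?n = length w" using nonempty by (cases w; simp)+
    have "last ?ps = last (?P ! ?n)" using nonempty by (simp add: last_conv_nth)
    also have "\<dots> = \<Phi> (Base (pos G (start_vert G (w ! 0))))" using ends(1)[OF n(1)] nxt[OF n(1)] n(2) by (simp add: next_dart_def)
    also have "\<dots> = hd (hd ?P)" using nonempty ends(2)[of 0] by (simp add: hd_conv_nth)
    finally show ?thesis .
  qed
  moreover have "2 \<le> length ?ps"
  proof -
    have "1 \<le> length (butlast (hd ?P))" using P(2)[OF hd_in_set[OF P(1)]] unfolding length_butlast by linarith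
    then show ?thesis using nonempty by (cases w) auto
  qed
  ultimately have "total_turning (butlast ?ps) = cturn (concat (map dirs ?P))"
    using total_turning_eq_cturn[of ?ps] by simp
  moreover have "butlast ?ps = walk_points g \<Phi> G w" by (simp add: walk_points_def comp_def)
  moreover have "turn_equiv (concat (map dirs ?P)) (concat (map (\<lambda>d. concat (map step_dirs (dart_steps d))) w))"
    by (rule turn_equiv_concat) (use nonempty E dart_points_turn(1) in \<open>auto simp: list_all2_conv_all_nth\<close>)
  moreover have "concat (map (\<lambda>d. concat (map step_dirs (dart_steps d))) w) = concat (map step_dirs (walk_steps w))"
    unfolding walk_steps_def by (induction w) simp_all
  ultimately show ?thesis using turn_equiv_cturn by metis
qed

text \<open>After moving the first thirds, the drawn curve is an alternating closed chain of mid
  cells and turn cells. Its turning is \<open>2 * pi\<close> times an odd number minus the crossing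
  indices of all pairs of turn cells, and modulo 2 these indices are the values of
  \<open>turn_parity\<close>.\<close>

lemma rot0_eq_pair_sum:
  assumes w: "closed_walk w" and ne: "interior (polygon g) \<noteq> {}"
  shows "rot0 g \<Phi> G w = 1 + pair_sum turn_parity (turns w)"
proof -
  define st where "st = walk_steps w"
  define M where "M = length st"
  have L: "length (turns w) = M" by (simp add: M_def st_def flip: map_fst_turns)
  have M: "2 \<le> M" using walk_steps_props(5)[OF w] L by simp
  define nx where "nx k = st ! (Suc k mod M)" for k
  note W = walk_step_nth[OF w, folded st_def, folded M_def, folded nx_def]
  have coh: "coherent (set st)" using walk_steps_props(2)[OF w] by (simp add: st_def)
  have v: "valid_step (st ! k)" if "k < M" for k using coherent_valid[OF coh W(1)[OF that]] .
  have dist: "st ! j \<noteq> st ! k" if "j < M" "k < M" "j \<noteq> k" for j k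
    using walk_steps_props(3)[OF w] that by (simp add: st_def M_def nth_eq_iff_index_eq)
  have sm: "Suc k mod M < M" for k using M by simp
  let ?A = "\<lambda>k. path_dirs (piece (st ! k) 0 (1/3))" and ?db = "\<lambda>k. path_dirs (mid_cell (st ! k))"
    and ?C = "\<lambda>k. path_dirs (piece (st ! k) (2/3) 1) @ strand_dirs (st ! k)"
  let ?Q = "\<lambda>k. turn_cell (st ! k) (nx k)" and ?B = "\<lambda>k. mid_cell (st ! k)"
  let ?dq = "\<lambda>k. path_dirs (piece (st ! k) (2/3) 1) @ strand_dirs (st ! k) @ path_dirs (piece (nx k) 0 (1/3))"
  obtain m :: int where m: "cturn (concat (map (\<lambda>k. ?db k @ ?dq k) [0..<M])) =
    2 * pi * (1 + 2 * of_int m - (\<Sum>(j, k)\<in>{(j, k). j < k \<and> k < M}. Re (cross_index (?Q j) (?Q k))))"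
  proof (rule alternating_chain_turning[of M ?B ?db ?Q ?dq])
    show "2 \<le> M" by (rule M)
    fix k assume k: "k < M"
    note T = turn_cell_facts[OF coh W(1)[OF k] W(2)[OF k] W(3)[OF k] W(4)[OF k]] and Bf = mid_cell_facts[OF v[OF k]]
    note MT = mid_turn_cells[OF coh W(1)[OF k] W(2)[OF k] _ W(3)[OF k] W(4)[OF k]]
    show "pl_dirs (?B k) 0 1 (?db k)" by (rule path_dirs(1)[OF Bf(3)])
    show "pl_dirs (?Q k) 0 1 (?dq k)" by (rule pl_dirs_turn_cell[OF coh W(1)[OF k] W(2)[OF k] W(4)[OF k]])
    show "?B k 1 = ?Q k 0" using T(2) Bf(5) by simp
    show "?Q k 1 = ?B (Suc k mod M) 0" using T(3) mid_cell_facts(4)[OF v[OF sm]] by (simp add: nx_def)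
    show "arc (?B k)" by (rule Bf(1))
    show "arc (?Q k)" by (rule T(1))
    show "path_image (?B k) \<inter> path_image (?Q k) \<subseteq> {?Q k 0}" by (rule MT(2)[OF W(1)[OF k]])
    show "path_image (?Q k) \<inter> path_image (?B (Suc k mod M)) \<subseteq> {?Q k 1}"
      using MT(3)[OF W(1)[OF k]] by (simp add: nx_def)
    fix j assume j: "j < M"
    show "path_image (?B j) \<inter> path_image (?B k) = {}" if "j \<noteq> k"
      by (rule mid_cells_disjoint[OF coh W(1)[OF j] W(1)[OF k] dist[OF j k that]])
    show "path_image (?B j) \<inter> path_image (?Q k) = {}" if "j \<noteq> k" "j \<noteq> Suc k mod M"
    proof (rule MT(1)[OF W(1)[OF j] dist[OF j k that(1)]])
      show "st ! j \<noteq> nx k" unfolding nx_def by (rule dist[OF j sm that(2)])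
    qed
  qed
  let ?PP = "{(j, k). j < k \<and> k < M}"
  have "\<exists>n::int. cross_index (?Q j) (?Q k) = of_int n \<and> of_int n = turn_parity (turns w ! j) (turns w ! k)"
    if "j < k" "k < M" for j k
  proof -
    have jM: "j < M" using that by simp
    have "Suc j mod M \<noteq> Suc k mod M" using that by (cases "Suc k = M") auto
    then have "st ! (Suc j mod M) \<noteq> st ! (Suc k mod M)" by (rule dist[OF sm sm])
    moreover have "st ! j \<noteq> st ! k" using dist[OF jM that(2)] that(1) by simp
    ultimately show ?thesis
      using cross_index_walks[OF w w walk_steps_props(2)[OF w] order.refl order.refl ne, of j k] that
      by (simp add: nx_def M_def st_def)
  qed
  then obtain n :: "nat \<Rightarrow> nat \<Rightarrow> int" where n: "\<And>j k. j < k \<Longrightarrow> k < M \<Longrightarrow> cross_index (?Q j) (?Q k) = of_int (n j k)"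
    "\<And>j k. j < k \<Longrightarrow> k < M \<Longrightarrow> of_int (n j k) = turn_parity (turns w ! j) (turns w ! k)" by metis
  have e: "(\<Sum>(j, k)\<in>?PP. Re (cross_index (?Q j) (?Q k))) = of_int (\<Sum>(j, k)\<in>?PP. n j k)"
    unfolding of_int_sum by (rule sum.cong) (auto simp: n(1))
  have "concat (map step_dirs st) = concat (map (\<lambda>k. ?A k @ ?db k @ ?C k) [0..<M])"
  proof -
    have "map step_dirs st = map (\<lambda>k. step_dirs (st ! k)) [0..<M]"
      by (rule nth_equalityI) (simp_all add: M_def)
    then show ?thesis by (simp add: step_dirs_def)
  qed
  moreover have "cturn (concat (map (\<lambda>k. ?A k @ ?db k @ ?C k) [0..<M])) =
      cturn (concat (map (\<lambda>k. (?db k @ ?C k) @ ?A (Suc k mod M)) [0..<M]))" by (rule cturn_rotate_pieces)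
  ultimately have "cturn (concat (map step_dirs st)) = cturn (concat (map (\<lambda>k. ?db k @ ?dq k) [0..<M]))"
    by (simp only: append_assoc nx_def)
  then have "total_turning (walk_points g \<Phi> G w) = 2 * pi * of_int (1 + 2 * m - (\<Sum>(j, k)\<in>?PP. n j k))"
    using cturn_walk[OF w] m e by (simp add: st_def)
  \<comment> \<open>The quotient by \<open>2 * pi\<close> is exactly an integer here, so the floor
    in \<open>rot0\<close> changes nothing.\<close>
  then have "rot0 g \<Phi> G w = of_int (1 + 2 * m - (\<Sum>(j, k)\<in>?PP. n j k))"
    by (simp add: rot0_def del: of_int_add of_int_diff of_int_mult of_int_sum)
  also have "\<dots> = 1 + of_int (\<Sum>(j, k)\<in>?PP. n j k)"
    by (simp del: of_int_sum)
  also have "of_int (\<Sum>(j, k)\<in>?PP. n j k) = (\<Sum>(j, k)\<in>?PP. turn_parity (turns w ! j) (turns w ! k))"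
    unfolding of_int_sum by (rule sum.cong) (auto simp: n(2))
  also have "\<dots> = pair_sum turn_parity (turns w)" unfolding pair_sum_nth L ..
  finally show ?thesis .
qed

text \<open>The drawings of the two walks are closed plane curves with total crossing index 0. Mid
  cells meet no cell of the other walk, so the whole index comes from pairs of turn cells.\<close>

lemma disjoint_walks_turn_parity:
  assumes w: "closed_walk w" "closed_walk w'" and disj: "fst ` set w \<inter> fst ` set w' = {}"
    and ne: "interior (polygon g) \<noteq> {}"
  shows "(\<Sum>a\<leftarrow>turns w. \<Sum>b\<leftarrow>turns w'. turn_parity a b) = 0"
proof -
  define st where "st = walk_steps w"
  define st' where "st' = walk_steps w'"
  define M where "M = length st"
  define M' where "M' = length st'"
  define X where "X = set st \<union> set st'"
  have L: "length (turns w) = M" "length (turns w') = M'" by (simp_all add: M_def M'_def st_def st'_def flip: map_fst_turns)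
  have M: "2 \<le> M" "2 \<le> M'" using walk_steps_props(5)[OF w(1)] walk_steps_props(5)[OF w(2)] L by simp_all
  define nx where "nx k = st ! (Suc k mod M)" for k
  define nx' where "nx' k = st' ! (Suc k mod M')" for k
  note W = walk_step_nth[OF w(1), folded st_def, folded M_def, folded nx_def]
  note W' = walk_step_nth[OF w(2), folded st'_def, folded M'_def, folded nx'_def]
  have edge: "fst x \<in> fst ` set w" if "x \<in> set st" "closed_walk w" "st = walk_steps w" for x w and st :: "'e step list"
  proof -
    from that(1,3) obtain d where d: "d \<in> set w" "x \<in> set (dart_steps d)" unfolding walk_steps_def by force
    have "fst d \<in> edges G" using that(2) d(1) by (auto simp: closed_walk_def)
    from dart_steps_props(4)[OF this d(2)] have "fst x = fst d" by (cases x) (auto simp: dart_of_def)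
    then show ?thesis using d(1) by blast
  qed
  have sep: "fst x \<noteq> fst y" if "x \<in> set st" "y \<in> set st'" for x y
    using edge[OF that(1) w(1) st_def] edge[OF that(2) w(2) st'_def] disj by (metis disjoint_iff)
  have c1: "coherent (set st)" "coherent (set st')" using walk_steps_props(2) w by (simp_all add: st_def st'_def)
  have coh: "coherent X"
    unfolding coherent_def
  proof (intro conjI ballI impI)
    fix x assume x: "x \<in> X"
    then show "valid_step x" unfolding X_def using coherent_valid[OF c1(1)] coherent_valid[OF c1(2)] by blast
    fix y assume y: "y \<in> X" "fst x = fst y"
    then consider "x \<in> set st" "y \<in> set st" | "x \<in> set st'" "y \<in> set st'"
      using x sep[of x y] sep[of y x] unfolding X_def by fastforce
    then show "snd (snd x) = snd (snd y)" using c1 y(2) unfolding coherent_def by cases blast+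
  qed
  have sub: "set st \<subseteq> X" "set st' \<subseteq> X" by (auto simp: X_def)
  have sm: "Suc k mod M < M" "Suc k mod M' < M'" for k using M by simp_all
  let ?Q = "\<lambda>k. turn_cell (st ! k) (nx k)" and ?B = "\<lambda>k. mid_cell (st ! k)"
  let ?Q' = "\<lambda>k. turn_cell (st' ! k) (nx' k)" and ?B' = "\<lambda>k. mid_cell (st' ! k)"
  \<comment> \<open>Each mid cell is joined to the turn cell after it, which makes one arc per step
    and matches the index set of the turns.\<close>
  have chains: "(\<Sum>j<M. \<Sum>k<M'. cross_index (?B j +++ ?Q j) (?B' k +++ ?Q' k)) = 0"
  proof (rule sum_cross_index_closed_chains)
    fix j assume j: "j < M"
    show "(?B j +++ ?Q j) 1 = (?B (Suc j mod M) +++ ?Q (Suc j mod M)) 0"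
      using turn_cell_facts(3)[OF c1(1) W(1)[OF j] W(2)[OF j] W(3)[OF j] W(4)[OF j]]
        mid_cell_facts(4)[OF coherent_valid[OF c1(1) W(2)[OF j]]]
      by (simp add: joinpaths_def nx_def)
  next
    fix j assume j: "j < M'"
    show "(?B' j +++ ?Q' j) 1 = (?B' (Suc j mod M') +++ ?Q' (Suc j mod M')) 0"
      using turn_cell_facts(3)[OF c1(2) W'(1)[OF j] W'(2)[OF j] W'(3)[OF j] W'(4)[OF j]]
        mid_cell_facts(4)[OF coherent_valid[OF c1(2) W'(2)[OF j]]]
      by (simp add: joinpaths_def nx'_def)
  qed
  have "\<exists>n::int. cross_index (?B j +++ ?Q j) (?B' k +++ ?Q' k) = of_int n \<and> of_int n = turn_parity (turns w ! j) (turns w' ! k)"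
    if jk: "j < M" "k < M'" for j k
  proof -
    note x = subsetD[OF sub(1) W(1)[OF jk(1)]] subsetD[OF sub(1) W(2)[OF jk(1)]] W(3)[OF jk(1)] W(4)[OF jk(1)]
    note y = subsetD[OF sub(2) W'(1)[OF jk(2)]] subsetD[OF sub(2) W'(2)[OF jk(2)]] W'(3)[OF jk(2)] W'(4)[OF jk(2)]
    have neq: "st ! j \<noteq> st' ! k" "st ! j \<noteq> nx' k" "nx j \<noteq> st' ! k" "nx j \<noteq> nx' k"
      using sep[OF W(1)[OF jk(1)] W'(1)[OF jk(2)]] sep[OF W(1)[OF jk(1)] W'(2)[OF jk(2)]]
        sep[OF W(2)[OF jk(1)] W'(1)[OF jk(2)]] sep[OF W(2)[OF jk(1)] W'(2)[OF jk(2)]] by fastforce+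
    note v = coherent_valid[OF coh x(1)] coherent_valid[OF coh y(1)]
    note T = turn_cell_facts[OF coh x] and T' = turn_cell_facts[OF coh y]
    note Bf = mid_cell_facts[OF v(1)] and Bf' = mid_cell_facts[OF v(2)]
    have path: "path (?B j)" "path (?Q j)" "path (?B' k)" "path (?Q' k)" using T(1) T'(1) Bf(1) Bf'(1) by (simp_all add: arc_imp_path)
    have e: "?B j 1 = ?Q j 0" "?B' k 1 = ?Q' k 0" using T(2) T'(2) Bf(5) Bf'(5) by simp_all
    have d1: "path_image (?B j) \<inter> path_image (?B' k) = {}" by (rule mid_cells_disjoint[OF coh x(1) y(1) neq(1)])
    have d2: "path_image (?B j) \<inter> path_image (?Q' k) = {}"
      by (rule mid_turn_cells(1)[OF coh y(1,2) x(1) y(3,4) neq(1,2)])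
    have d3: "path_image (?B' k) \<inter> path_image (?Q j) = {}"
      by (rule mid_turn_cells(1)[OF coh x(1,2) y(1) x(3,4) neq(1)[symmetric] neq(3)[symmetric]])
    note u = coherent_valid[OF coh x(2)] coherent_valid[OF coh y(2)]
    have in_image: "\<gamma> 0 \<in> path_image \<gamma>" "\<gamma> 1 \<in> path_image \<gamma>" for \<gamma> :: "real \<Rightarrow> complex" by (auto simp: path_image_def)
    \<comment> \<open>Turn cells of the two walks may intersect, but a turn cell ends on the next
      mid cell, which avoids the other walk. So the end points satisfy what additivity of the index
      demands.\<close>
    have "?Q j 1 \<in> path_image (mid_cell (nx j))" "?Q' k 1 \<in> path_image (mid_cell (nx' k))"
      using T(3) T'(3) mid_cell_facts(4)[OF u(1)] mid_cell_facts(4)[OF u(2)] in_image(1) by metis+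
    then have off: "?Q j 1 \<notin> path_image (?B' k)" "?Q j 1 \<notin> path_image (?Q' k)"
        "?Q' k 1 \<notin> path_image (?B j)" "?Q' k 1 \<notin> path_image (?Q j)"
      using mid_cells_disjoint[OF coh x(2) y(1) neq(3)] mid_turn_cells(1)[OF coh y(1,2) x(2) y(3,4) neq(3,4)]
        mid_cells_disjoint[OF coh x(1) y(2) neq(2)]
        mid_turn_cells(1)[OF coh x(1,2) y(2) x(3,4) neq(2)[symmetric] neq(4)[symmetric]] by blast+
    have off': "?B j 0 \<notin> path_image (?B' k) \<union> path_image (?Q' k)" "?B' k 0 \<notin> path_image (?B j) \<union> path_image (?Q j)"
        "?B' k 1 \<notin> path_image (?B j) \<union> path_image (?Q j)"
      using d1 d2 d3 in_image[of "?B j"] in_image[of "?B' k"] by blast+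
    have J: "(?B j +++ ?Q j) 0 = ?B j 0" "(?B j +++ ?Q j) 1 = ?Q j 1" by (simp_all add: joinpaths_def)
    have pf: "pathfinish (?B j) = pathstart (?Q j)" "pathfinish (?B' k) = pathstart (?Q' k)"
      using e by (simp_all add: pathstart_def pathfinish_def)
    have "cross_index (?B j +++ ?Q j) (?B' k +++ ?Q' k) = cross_index (?B j +++ ?Q j) (?B' k) + cross_index (?B j +++ ?Q j) (?Q' k)"
      by (rule cross_index_join_right[OF path(3,4) pf(2)]) (use J off off' in auto)
    also have "cross_index (?B j +++ ?Q j) (?B' k) = cross_index (?B j) (?B' k) + cross_index (?Q j) (?B' k)"
      by (rule cross_index_join_left[OF path(1,2) pf(1) off'(2,3)])
    also have "cross_index (?B j) (?B' k) = 0" by (rule cross_index_disjoint[OF path(1,3) d1])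
    also have "cross_index (?Q j) (?B' k) = 0" by (rule cross_index_disjoint[OF path(2,3)]) (use d3 in blast)
    also have "cross_index (?B j +++ ?Q j) (?Q' k) = cross_index (?B j) (?Q' k) + cross_index (?Q j) (?Q' k)"
      by (rule cross_index_join_left[OF path(1,2) pf(1)]) (use e off off' in auto)
    also have "cross_index (?B j) (?Q' k) = 0" by (rule cross_index_disjoint[OF path(1,4) d2])
    finally have "cross_index (?B j +++ ?Q j) (?B' k +++ ?Q' k) = cross_index (?Q j) (?Q' k)" by simp
    moreover have "\<exists>n::int. cross_index (?Q j) (?Q' k) = of_int n \<and> of_int n = turn_parity (turns w ! j) (turns w' ! k)"
      using cross_index_walks[OF w coh sub[unfolded st_def st'_def] ne] jk neq(1,4)
      by (simp add: nx_def nx'_def M_def M'_def st_def st'_def)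
    ultimately show ?thesis by simp
  qed
  then obtain n :: "nat \<Rightarrow> nat \<Rightarrow> int" where n: "\<And>j k. j < M \<Longrightarrow> k < M' \<Longrightarrow> cross_index (?B j +++ ?Q j) (?B' k +++ ?Q' k) = of_int (n j k)"
    "\<And>j k. j < M \<Longrightarrow> k < M' \<Longrightarrow> of_int (n j k) = turn_parity (turns w ! j) (turns w' ! k)" by metis
  have "(of_int (\<Sum>j<M. \<Sum>k<M'. n j k) :: complex) = 0" using chains by (simp add: n(1))
  then have z: "(\<Sum>j<M. \<Sum>k<M'. n j k) = 0" by (simp only: of_int_eq_0_iff)
  have "(\<Sum>a\<leftarrow>turns w. \<Sum>b\<leftarrow>turns w'. turn_parity a b) = (\<Sum>j<M. \<Sum>k<M'. turn_parity (turns w ! j) (turns w' ! k))"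
    by (simp add: sum_list_sum_nth L atLeast0LessThan)
  also have "\<dots> = of_int (\<Sum>j<M. \<Sum>k<M'. n j k)" unfolding of_int_sum by (intro sum.cong refl) (simp add: n(2))
  finally show ?thesis using z by simp
qed

end

section \<open>Self-intersections and the bridge form\<close>

lemma pair_sum_filter:
  assumes "\<And>x y. \<not> (P x \<and> P y) \<Longrightarrow> F x y = 0"
  shows "pair_sum F xs = pair_sum F (filter P xs)"
proof -
  have "(\<Sum>y\<leftarrow>xs. F x y) = (\<Sum>y\<leftarrow>filter P xs. F x y)" for x xs
    using assms by (induction xs) auto
  moreover have "(\<Sum>y\<leftarrow>xs. F x y) = 0" if "\<not> P x" for x xs
    using assms that by (induction xs) auto
  ultimately show ?thesis by (induction xs) auto
qed

lemma pair_sum_map: "pair_sum F (map f xs) = pair_sum (\<lambda>x y. F (f x) (f y)) xs"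
  by (induction xs) (simp_all add: comp_def)

lemma pair_sum_eq_0:
  assumes "\<And>i j. i < j \<Longrightarrow> j < length xs \<Longrightarrow> F (xs ! i) (xs ! j) = 0"
  shows "pair_sum F xs = 0"
  unfolding pair_sum_nth by (rule sum.neutral) (use assms in auto)

text \<open>Expanding the product of the two sums gives diagonal terms, which vanish, and for every
  pair of positions both mixed products.\<close>

lemma pair_sum_symmetric_product:
  fixes a b :: "'k \<Rightarrow> 'a \<Rightarrow> 'b::comm_semiring_1"
  assumes "\<And>k x. k \<in> K \<Longrightarrow> a k x * b k x = 0"
  shows "pair_sum (\<lambda>x y. \<Sum>k\<in>K. a k x * b k y + b k x * a k y) xs = (\<Sum>k\<in>K. (\<Sum>x\<leftarrow>xs. a k x) * (\<Sum>x\<leftarrow>xs. b k x))"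
proof (induction xs)
  case (Cons x xs)
  have "(\<Sum>y\<leftarrow>xs. \<Sum>k\<in>K. a k x * b k y + b k x * a k y) =
      (\<Sum>k\<in>K. a k x * (\<Sum>y\<leftarrow>xs. b k y) + b k x * (\<Sum>y\<leftarrow>xs. a k y))"
    by (induction xs) (simp_all add: algebra_simps sum.distrib)
  then have "pair_sum (\<lambda>x y. \<Sum>k\<in>K. a k x * b k y + b k x * a k y) (x # xs) =
      (\<Sum>k\<in>K. a k x * (\<Sum>y\<leftarrow>xs. b k y) + b k x * (\<Sum>y\<leftarrow>xs. a k y) + (\<Sum>x\<leftarrow>xs. a k x) * (\<Sum>x\<leftarrow>xs. b k x))"
    using Cons.IH by (simp add: sum.distrib)
  also have "\<dots> = (\<Sum>k\<in>K. (a k x + (\<Sum>x\<leftarrow>xs. a k x)) * (b k x + (\<Sum>x\<leftarrow>xs. b k x)))"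
    by (rule sum.cong) (simp_all add: distrib_left distrib_right assms add_ac mult_ac)
  finally show ?case by simp
qed simp

lemma pair_sum_concat:
  "pair_sum F (concat xss) = (\<Sum>xs\<leftarrow>xss. pair_sum F xs) + pair_sum (\<lambda>xs ys. \<Sum>x\<leftarrow>xs. \<Sum>y\<leftarrow>ys. F x y) xss"
proof (induction xss)
  case (Cons xs xss)
  have "(\<Sum>x\<leftarrow>xs. \<Sum>y\<leftarrow>concat xss. F x y) = (\<Sum>ys\<leftarrow>xss. \<Sum>x\<leftarrow>xs. \<Sum>y\<leftarrow>ys. F x y)"
    by (induction xss) (simp_all add: sum_list_addf)
  then show ?case using Cons.IH by (simp add: pair_sum_append add_ac)
qed simp

lemma sum_list_concat_map: "(\<Sum>x\<leftarrow>concat xss. f x) = (\<Sum>xs\<leftarrow>xss. \<Sum>x\<leftarrow>xs. f x)"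
  by (induction xss) simp_all

lemma sum_mult_sum_list:
  fixes c :: "'k \<Rightarrow> 'b::comm_semiring_1"
  shows "(\<Sum>i\<in>A. c i * (\<Sum>w\<leftarrow>W. f w i)) = (\<Sum>w\<leftarrow>W. \<Sum>i\<in>A. c i * f w i)"
  by (induction W) (simp_all add: sum.distrib distrib_left)

lemma sum_list_of_bool: "(\<Sum>x\<leftarrow>xs. of_bool (P x)) = of_nat (length (filter P xs))"
  by (induction xs) auto

context drawing
begin

definition transitions :: "'e dart list \<Rightarrow> ('e dart \<times> 'e dart) list" where
  "transitions w = map (\<lambda>j. (w ! j, next_dart w j)) [0..<length w]"

definition dart_parity :: "'e dart \<times> 'e dart \<Rightarrow> 'e dart \<times> 'e dart \<Rightarrow> bit" where
  "dart_parity = (\<lambda>(d, n) (d', n'). of_bool (end_vert G d = end_vert G d' \<and> chords_cross g G (rev_dart d, n) (rev_dart d', n')))"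

text \<open>Only the last step of a dart ends at a vertex, so exactly one turn per transition
  survives.\<close>

lemma filter_turns:
  assumes "fst ` set w \<subseteq> edges G"
  shows "filter (\<lambda>a. exit (fst a) = None) (turns w) = map (\<lambda>(d, n). (last (dart_steps d), n)) (transitions w)"
proof -
  have block: "filter (\<lambda>a. exit (fst a) = None) (map (\<lambda>x. (x, n)) (dart_steps d)) = [(last (dart_steps d), n)]"
    if "fst d \<in> edges G" for d n
  proof -
    note p = dart_steps_props[OF that]
    have "filter (\<lambda>x. exit x = None) (butlast (dart_steps d)) = []" using p(6) by (auto simp: filter_empty_conv)
    moreover have "dart_steps d = butlast (dart_steps d) @ [last (dart_steps d)]" using p(1) by simp
    moreover have "filter (\<lambda>x. exit x = None) (butlast (dart_steps d) @ [last (dart_steps d)]) =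
        filter (\<lambda>x. exit x = None) (butlast (dart_steps d)) @ [last (dart_steps d)]"
      using p(3) by (simp only: filter_append filter.simps simp_thms if_True)
    ultimately have "filter (\<lambda>x. exit x = None) (dart_steps d) = [last (dart_steps d)]" by simp
    then show ?thesis by (simp add: filter_map comp_def)
  qed
  have "filter (\<lambda>a. exit (fst a) = None) (turns_until ds d0) =
      map (\<lambda>(d, n). (last (dart_steps d), n)) (map (\<lambda>j. (ds ! j, (ds @ [d0]) ! Suc j)) [0..<length ds])"
    if "fst ` set ds \<subseteq> edges G" for ds d0
    using that
  proof (induction ds)
    case (Cons d ds)
    have "hd (ds @ [d0]) = (ds @ [d0]) ! 0" by (cases ds) auto
    moreover have "[0..<length (d # ds)] = 0 # map Suc [0..<length ds]" by (simp add: upt_conv_Cons map_Suc_upt del: upt_Suc)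
    ultimately show ?case using Cons block[of d] by (simp add: comp_def del: upt_Suc)
  qed simp
  from this[OF assms, of "hd w"] have "filter (\<lambda>a. exit (fst a) = None) (turns w) =
      map (\<lambda>(d, n). (last (dart_steps d), n)) (map (\<lambda>j. (w ! j, (w @ [hd w]) ! Suc j)) [0..<length w])"
    by (simp only: turns_def)
  also have "map (\<lambda>j. (w ! j, (w @ [hd w]) ! Suc j)) [0..<length w] = transitions w"
    unfolding transitions_def
  proof (rule map_cong[OF refl])
    fix j assume "j \<in> set [0..<length w]"
    then have "w \<noteq> []" "j < length w" by auto
    then have "(w @ [hd w]) ! Suc j = next_dart w j"
      by (cases "Suc j = length w") (auto simp: next_dart_def nth_append hd_conv_nth)
    then show "(w ! j, (w @ [hd w]) ! Suc j) = (w ! j, next_dart w j)" by simp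
  qed
  finally show ?thesis .
qed

lemma chord_parity_last_steps:
  assumes "fst d \<in> edges G" "fst d' \<in> edges G"
  shows "chord_parity (last (dart_steps d), n) (last (dart_steps d'), n') = dart_parity (d, n) (d', n')"
proof -
  have *: "exit (last (dart_steps d)) = None \<and> dart_of (last (dart_steps d)) = d \<and>
      dst (last (dart_steps d)) = pos G (end_vert G d) \<and> end_vert G d \<in> verts G" if d: "fst d \<in> edges G" for d
  proof -
    have l: "last (dart_steps d) \<in> set (dart_steps d)" by (rule last_in_set[OF dart_steps_props(1)[OF d]])
    note e = dart_steps_props(3)[OF d] dart_steps_props(4)[OF d l]
    show ?thesis using e exit_None[OF dart_steps_valid[OF d l] e(1)] by simp
  qed
  show ?thesis
    using *[OF assms(1)] *[OF assms(2)] inj_pos by (simp add: chord_parity_def dart_parity_def inj_on_eq_iff)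
qed

lemma pair_sum_chord_parity:
  assumes "\<And>w. w \<in> set W \<Longrightarrow> fst ` set w \<subseteq> edges G"
  shows "pair_sum chord_parity (concat (map turns W)) = pair_sum dart_parity (concat (map transitions W))"
proof -
  let ?h = "\<lambda>(d, n). (last (dart_steps d), n)"
  let ?D = "concat (map transitions W)"
  have "pair_sum chord_parity (concat (map turns W)) =
      pair_sum chord_parity (filter (\<lambda>a. exit (fst a) = None) (concat (map turns W)))"
    by (rule pair_sum_filter) (auto simp: chord_parity_def)
  also have "filter (\<lambda>a. exit (fst a) = None) (concat (map turns W)) = map ?h ?D"
    using assms by (induction W) (simp_all add: filter_turns)
  also have "pair_sum chord_parity (map ?h ?D) = pair_sum dart_parity ?D"
    unfolding pair_sum_map unfolding pair_sum_nth
  proof (rule sum.cong[OF refl], clarify)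
    fix i j assume ij: "i < j" "j < length ?D"
    have E: "fst (fst a) \<in> edges G" if "a \<in> set ?D" for a
      using that assms by (fastforce simp: transitions_def)
    have "fst (fst (?D ! i)) \<in> edges G" "fst (fst (?D ! j)) \<in> edges G"
      using ij by (auto intro!: E nth_mem)
    then show "chord_parity (?h (?D ! i)) (?h (?D ! j)) = dart_parity (?D ! i) (?D ! j)"
      using chord_parity_last_steps by (simp add: case_prod_beta)
  qed
  finally show ?thesis .
qed

lemma pair_sum_dart_parity:
  assumes "fst ` set w \<subseteq> edges G"
  shows "pair_sum dart_parity (transitions w) = of_nat (self_intersections g G w)"
proof -
  let ?C = "\<lambda>j k. chords_cross g G (transition w j) (transition w k)"
  let ?S = "\<lambda>v. {(j, k). j < k \<and> k < length w \<and> end_vert G (w ! j) = v \<and> end_vert G (w ! k) = v \<and> ?C j k}"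
  let ?P = "{(j, k). j < k \<and> k < length w}"
  let ?A = "{(j, k). j < k \<and> k < length w \<and> end_vert G (w ! j) = end_vert G (w ! k) \<and> ?C j k}"
  have fin: "finite ?P" by (rule finite_subset[of _ "{..<length w} \<times> {..<length w}"]) auto
  have vert: "end_vert G (w ! k) \<in> verts G" if "k < length w" for k
  proof -
    have "fst (w ! k) \<in> edges G" using assms nth_mem[OF that] by blast
    then show ?thesis using tail_verts head_verts by (simp add: end_vert_def start_vert_def rev_dart_def)
  qed
  have "self_intersections g G w = card (\<Union>v\<in>verts G. ?S v)"
    unfolding self_intersections_def
    by (rule card_UN_disjoint[symmetric]) (use finite_verts in \<open>auto intro: finite_subset[OF _ fin]\<close>)
  also have "(\<Union>v\<in>verts G. ?S v) = ?A" using vert by fastforce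
  also have "?A = ?P \<inter> {a. a \<in> ?A}" by auto
  finally have "of_nat (self_intersections g G w) = (of_nat (card (?P \<inter> {a. a \<in> ?A})) :: bit)" by (simp only:)
  also have "of_nat (card (?P \<inter> {a. a \<in> ?A})) = (\<Sum>a\<in>?P. of_bool (a \<in> ?A) :: bit)"
    by (rule sum_of_bool_eq[symmetric]; rule fin)
  finally have "of_nat (self_intersections g G w) = (\<Sum>a\<in>?P. of_bool (a \<in> ?A) :: bit)" .
  also have "\<dots> = pair_sum dart_parity (transitions w)"
    unfolding pair_sum_nth
  proof (rule sum.cong)
    show "?P = {(j, k). j < k \<and> k < length (transitions w)}" by (simp add: transitions_def)
  qed (auto simp: transitions_def dart_parity_def transition_def)
  finally show ?thesis ..
qed

text \<open>Written with indicators, the parity is a symmetric bilinear form to which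
  \<open>pair_sum_symmetric_product\<close> applies. Paired bridges match a single \<open>k\<close>,
  in one order only.\<close>

lemma strand_parity_sum:
  "strand_parity x y = (\<Sum>k\<in>{1..g}. of_bool (exit_bridge x = 2 * k - 1) * of_bool (exit_bridge y = 2 * k)
     + of_bool (exit_bridge x = 2 * k) * of_bool (exit_bridge y = 2 * k - 1))"
proof (cases "bridge_pair (exit_bridge x) (exit_bridge y)")
  case True
  then obtain k where k: "k \<in> {1..g}" "exit_bridge x = 2 * k - 1 \<and> exit_bridge y = 2 * k \<or>
      exit_bridge y = 2 * k - 1 \<and> exit_bridge x = 2 * k" by (auto simp: bridge_pair_def)
  have "(\<Sum>k'\<in>{1..g}. of_bool (exit_bridge x = 2 * k' - 1) * of_bool (exit_bridge y = 2 * k')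
      + of_bool (exit_bridge x = 2 * k') * of_bool (exit_bridge y = 2 * k' - 1)) = (\<Sum>k'\<in>{1..g}. if k = k' then 1 else (0::bit))"
  proof (rule sum.cong[OF refl])
    fix k' assume "k' \<in> {1..g}"
    then have n: "(2 * k = 2 * k' - 1) = False" "(2 * k - 1 = 2 * k') = False" "(2 * k - 1 = 2 * k' - 1) = (k = k')"
      "(2 * k = 2 * k') = (k = k')"
      using k(1) unfolding atLeastAtMost_iff by presburger+
    then show "of_bool (exit_bridge x = 2 * k' - 1) * of_bool (exit_bridge y = 2 * k')
      + of_bool (exit_bridge x = 2 * k') * of_bool (exit_bridge y = 2 * k' - 1) = (if k = k' then 1 else (0::bit))"
      using k(2) by (elim disjE conjE; cases "k = k'") (simp_all only: n, simp_all)
  qed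
  also have "\<dots> = 1" using k(1) by simp
  finally show ?thesis using True by (simp add: strand_parity_def)
next
  case False
  have "(\<Sum>k'\<in>{1..g}. of_bool (exit_bridge x = 2 * k' - 1) * of_bool (exit_bridge y = 2 * k')
      + of_bool (exit_bridge x = 2 * k') * of_bool (exit_bridge y = 2 * k' - 1)) = (0 :: bit)"
    by (rule sum.neutral) (use False in \<open>auto simp: bridge_pair_def\<close>)
  then show ?thesis using False by (simp add: strand_parity_def)
qed

text \<open>Run backwards, an edge meets its crossings in reverse order and through the partner
  sides, but on the same bridges. Excluding 0 discards the step that ends at a vertex.\<close>

lemma dart_steps_bridges:
  assumes "fst d \<in> edges G" "i \<noteq> 0"
  shows "(\<Sum>x\<leftarrow>dart_steps d. of_bool (exit_bridge x = i)) = (of_nat (bridge_count G (fst d) i) :: bit)"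
proof -
  obtain e f where d: "d = (e, f)" by force
  let ?cs = "crossings G e"
  let ?n = "length ?cs"
  have count: "(\<Sum>k\<leftarrow>[0..<?n]. of_bool (bridge_of (fst (?cs ! k)) = i)) = (of_nat (bridge_count G e i) :: bit)"
  proof -
    have "map (\<lambda>k. of_bool (bridge_of (fst (?cs ! k)) = i) :: bit) [0..<?n] = map (\<lambda>c. of_bool (bridge_of (fst c) = i)) ?cs"
      by (rule nth_equalityI) simp_all
    then show ?thesis by (simp only: sum_list_of_bool bridge_count_def case_prod_beta')
  qed
  show ?thesis
  proof (cases f)
    case True
    have "(\<Sum>x\<leftarrow>dart_steps d. of_bool (exit_bridge x = i)) =
        (\<Sum>k\<leftarrow>[0..<?n]. of_bool (exit_bridge (e, k, True) = i)) + (of_bool (exit_bridge (e, ?n, True) = i) :: bit)"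
      by (simp add: d True dart_steps_def comp_def)
    also have "exit_bridge (e, ?n, True) = 0" by (simp add: exit_bridge_def exit_def)
    also have "map (\<lambda>k. of_bool (exit_bridge (e, k, True) = i) :: bit) [0..<?n] = map (\<lambda>k. of_bool (bridge_of (fst (?cs ! k)) = i)) [0..<?n]"
      by (simp add: exit_bridge_def exit_def case_prod_beta)
    finally show ?thesis using count assms(2) by (simp add: d)
  next
    case False
    have "(\<Sum>x\<leftarrow>dart_steps d. of_bool (exit_bridge x = i)) = (\<Sum>k\<leftarrow>rev [0..<Suc ?n]. of_bool (exit_bridge (e, k, False) = i) :: bit)"
      by (simp add: d False dart_steps_def comp_def rev_map del: upt_Suc)
    also have "\<dots> = (\<Sum>k\<leftarrow>[0..<Suc ?n]. of_bool (exit_bridge (e, k, False) = i))"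
      by (simp only: rev_map[symmetric] sum_list_rev)
    also have "[0..<Suc ?n] = 0 # map Suc [0..<?n]" by (simp add: upt_conv_Cons map_Suc_upt del: upt_Suc)
    also have "(\<Sum>k\<leftarrow>0 # map Suc [0..<?n]. of_bool (exit_bridge (e, k, False) = i)) =
        of_bool (exit_bridge (e, 0, False) = i) + (\<Sum>k\<leftarrow>[0..<?n]. of_bool (exit_bridge (e, Suc k, False) = i) :: bit)"
      by (simp only: list.map sum_list.Cons map_map comp_def)
    also have "exit_bridge (e, 0, False) = 0" by (simp add: exit_bridge_def exit_def)
    also have "map (\<lambda>k. of_bool (exit_bridge (e, Suc k, False) = i) :: bit) [0..<?n] = map (\<lambda>k. of_bool (bridge_of (fst (?cs ! k)) = i)) [0..<?n]"
    proof (rule map_cong[OF refl])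
      fix k assume "k \<in> set [0..<?n]"
      then have "(fst (?cs ! k), snd (?cs ! k)) \<in> set ?cs" by simp
      then have "fst (?cs ! k) \<in> {1..4 * g}" using crossing_range(1)[of e "fst (?cs ! k)" "snd (?cs ! k)"] assms(1) d by simp
      then have "bridge_of (partner (fst (?cs ! k))) = bridge_of (fst (?cs ! k))" using partner_props by simp
      then show "(of_bool (exit_bridge (e, Suc k, False) = i) :: bit) = of_bool (bridge_of (fst (?cs ! k)) = i)"
        by (simp add: exit_bridge_def exit_def case_prod_beta)
    qed
    finally show ?thesis using count assms(2) by (simp add: d)
  qed
qed

definition bridge_parity :: "'e set \<Rightarrow> nat \<Rightarrow> bit" where
  "bridge_parity E' i = (\<Sum>e\<in>E'. of_nat (bridge_count G e i))"

lemma sum_list_bridge_parity: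
  assumes "distinct (map fst w)"
  shows "(\<Sum>d\<leftarrow>w. of_nat (bridge_count G (fst d) i)) = bridge_parity (fst ` set w) i"
  using sum_list_distinct_conv_sum_set[OF assms, of "\<lambda>e. of_nat (bridge_count G e i) :: bit"]
  by (simp add: bridge_parity_def comp_def)

lemma pair_sum_strand_parity:
  assumes "fst ` set (concat W) \<subseteq> edges G" "distinct (map fst (concat W))"
  shows "pair_sum (\<lambda>a b. strand_parity (fst a) (fst b)) (concat (map turns W)) =
    (\<Sum>k\<in>{1..g}. bridge_parity (fst ` set (concat W)) (2 * k - 1) * bridge_parity (fst ` set (concat W)) (2 * k))"
proof -
  let ?S = "concat (map dart_steps (concat W))"
  have S: "map fst (concat (map turns W)) = ?S"
    by (induction W) (simp_all add: map_fst_turns walk_steps_def)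
  have count: "(\<Sum>x\<leftarrow>?S. of_bool (exit_bridge x = i)) = bridge_parity (fst ` set (concat W)) i" if "i \<noteq> 0" for i
  proof -
    have "(\<Sum>x\<leftarrow>concat (map dart_steps ds). of_bool (exit_bridge x = i)) = (\<Sum>d\<leftarrow>ds. of_nat (bridge_count G (fst d) i) :: bit)"
      if "fst ` set ds \<subseteq> edges G" for ds
    proof -
      have "map (\<lambda>d. \<Sum>x\<leftarrow>dart_steps d. of_bool (exit_bridge x = i)) ds = map (\<lambda>d. of_nat (bridge_count G (fst d) i) :: bit) ds"
        by (rule map_cong[OF refl], rule dart_steps_bridges) (use that \<open>i \<noteq> 0\<close> in auto)
      then show ?thesis by (simp only: sum_list_concat_map map_map comp_def)
    qed
    then show ?thesis using assms(1) sum_list_bridge_parity[OF assms(2)] by (simp only:)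
  qed
  have sp: "strand_parity = (\<lambda>x y. \<Sum>k\<in>{1..g}. of_bool (exit_bridge x = 2 * k - 1) * of_bool (exit_bridge y = 2 * k)
     + of_bool (exit_bridge x = 2 * k) * of_bool (exit_bridge y = 2 * k - 1))"
    by (intro ext) (rule strand_parity_sum)
  have "pair_sum (\<lambda>a b. strand_parity (fst a) (fst b)) (concat (map turns W)) = pair_sum strand_parity ?S"
    by (simp only: S[symmetric] pair_sum_map)
  also have "pair_sum strand_parity ?S = (\<Sum>k\<in>{1..g}. (\<Sum>x\<leftarrow>?S. of_bool (exit_bridge x = 2 * k - 1)) * (\<Sum>x\<leftarrow>?S. of_bool (exit_bridge x = 2 * k)))"
    unfolding sp by (rule pair_sum_symmetric_product[of "{1..g}" "\<lambda>k x. of_bool (exit_bridge x = 2 * k - 1)" "\<lambda>k x. of_bool (exit_bridge x = 2 * k)"])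
      (auto simp: of_bool_def)
  also have "\<dots> = (\<Sum>k\<in>{1..g}. bridge_parity (fst ` set (concat W)) (2 * k - 1) * bridge_parity (fst ` set (concat W)) (2 * k))"
  proof (rule sum.cong[OF refl])
    fix k assume "k \<in> {1..g}"
    then have "2 * k - 1 \<noteq> 0" "2 * k \<noteq> 0" by auto
    then show "(\<Sum>x\<leftarrow>?S. of_bool (exit_bridge x = 2 * k - 1)) * (\<Sum>x\<leftarrow>?S. of_bool (exit_bridge x = 2 * k)) =
      bridge_parity (fst ` set (concat W)) (2 * k - 1) * bridge_parity (fst ` set (concat W)) (2 * k)"
      by (simp only: count[OF \<open>2 * k - 1 \<noteq> 0\<close>] count[OF \<open>2 * k \<noteq> 0\<close>])
  qed
  finally show ?thesis .
qed

text \<open>A quadratic refinement of the intersection form modulo 2: bridges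
  \<open>2 * k - 1\<close> and \<open>2 * k\<close> belong to one handle and are dual to each other,
  and \<open>s\<close> chooses among the refinements.\<close>

definition bridge_form :: "(nat \<Rightarrow> bit) \<Rightarrow> 'e set \<Rightarrow> bit" where
  "bridge_form s E' = (\<Sum>k\<in>{1..g}. bridge_parity E' (2 * k - 1) * bridge_parity E' (2 * k)) +
     (\<Sum>i\<in>{1..2 * g}. s i * bridge_parity E' i)"

lemma closed_walk_interior: "closed_walk w \<Longrightarrow> interior (polygon g) \<noteq> {}"
proof -
  assume w: "closed_walk w"
  then obtain d where "d \<in> set w" by (cases w) (auto simp: closed_walk_def)
  then have "fst d \<in> edges G" using w by (auto simp: closed_walk_def)
  then show ?thesis using pos_interior[OF tail_verts] by blast
qed

lemma rot_eq_pair_sum: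
  assumes "closed_walk w"
  shows "rot g \<Phi> G s w = 1 + pair_sum turn_parity (turns w) + (\<Sum>i\<in>{1..2 * g}. s i * bridge_parity (fst ` set w) i)"
proof -
  have "distinct (map fst w)" using assms by (simp add: closed_walk_def)
  moreover have "of_nat (\<Sum>d\<leftarrow>w. n d) = (\<Sum>d\<leftarrow>w. of_nat (n d) :: bit)" for n :: "'e dart \<Rightarrow> nat"
    by (induction w) simp_all
  ultimately have "of_nat (\<Sum>d\<leftarrow>w. bridge_count G (fst d) i) = bridge_parity (fst ` set w) i" for i
    by (simp only: sum_list_bridge_parity)
  then show ?thesis
    using rot0_eq_pair_sum[OF assms closed_walk_interior[OF assms]] by (simp only: rot_def)
qed

lemma pair_sum_turn_parity:
  "pair_sum turn_parity xs = pair_sum chord_parity xs + pair_sum (\<lambda>a b. strand_parity (fst a) (fst b)) xs"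
proof -
  have "turn_parity = (\<lambda>a b. chord_parity a b + strand_parity (fst a) (fst b))" by (intro ext) (simp only: turn_parity_def)
  then show ?thesis by (simp only: pair_sum_add)
qed

lemma rot_closed_walk:
  assumes w: "closed_walk w"
  shows "rot g \<Phi> G s w = 1 + of_nat (self_intersections g G w) + bridge_form s (fst ` set w)"
proof -
  have E: "fst ` set w \<subseteq> edges G" "distinct (map fst w)" using w by (simp_all add: closed_walk_def)
  have "pair_sum turn_parity (turns w) = of_nat (self_intersections g G w) +
      (\<Sum>k\<in>{1..g}. bridge_parity (fst ` set w) (2 * k - 1) * bridge_parity (fst ` set w) (2 * k))"
    using pair_sum_turn_parity[of "turns w"] pair_sum_chord_parity[of "[w]"] pair_sum_strand_parity[of "[w]"]
      pair_sum_dart_parity[OF E(1)] E by simp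
  then show ?thesis unfolding rot_eq_pair_sum[OF w] bridge_form_def by (simp only: add.assoc)
qed

text \<open>The turns of all walks are put into one list. Its chord pairs contribute nothing because
  no chords cross, and its strand pairs give the quadratic part for the whole of \<open>E'\<close>.
  Pairs of turns from different walks add up to 0, so the same total is also the sum over the single
  walks.\<close>

lemma sum_rot_noncrossing_decomposition:
  assumes E': "even_edge_set G E'" and T: "noncrossing_pairing g G E' T" and W: "walk_decomposition E' T W"
  shows "(\<Sum>w\<leftarrow>W. 1 + rot g \<Phi> G s w) = bridge_form s E'"
proof -
  have dist: "distinct (map fst (concat W))" and E: "fst ` set (concat W) = E'"
    and nxt: "\<And>w j. w \<in> set W \<Longrightarrow> j < length w \<Longrightarrow> next_dart w j = T (rev_dart (w ! j))"
    and ne: "\<And>w. w \<in> set W \<Longrightarrow> w \<noteq> []"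
    using W by (auto simp: walk_decomposition_def)
  have sub: "E' \<subseteq> edges G" using E' by (simp add: even_edge_set_def)
  have Tp: "T d \<in> ends_at G E' (start_vert G d) \<and> (\<forall>d'\<in>ends_at G E' (start_vert G d) - {d, T d}. \<not> chords_cross g G (d, T d) (d', T d'))"
    if "fst d \<in> E'" for d
  proof -
    have "start_vert G d \<in> verts G" using that sub tail_verts head_verts by (auto simp: start_vert_def)
    moreover have "d \<in> ends_at G E' (start_vert G d)" using that by (simp add: ends_at_def)
    ultimately show ?thesis using T unfolding noncrossing_pairing_def by blast
  qed
  have inE: "fst d \<in> E'" if "w \<in> set W" "d \<in> set w" for w d using that E by auto
  have rv: "fst (rev_dart d) = fst d" for d :: "'e dart" by (simp add: rev_dart_def)
  have cw: "closed_walk w" if w: "w \<in> set W" for w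
    unfolding closed_walk_def
  proof (intro conjI allI impI)
    show "w \<noteq> []" by (rule ne[OF w])
    show "fst ` set w \<subseteq> edges G" using inE[OF w] sub by blast
    show "distinct (map fst w)" using dist w by (induction W) auto
    fix j assume j: "j < length w"
    have "T (rev_dart (w ! j)) \<in> ends_at G E' (start_vert G (rev_dart (w ! j)))"
      using Tp[of "rev_dart (w ! j)"] inE[OF w nth_mem[OF j]] by (simp add: rv)
    then show "end_vert G (w ! j) = start_vert G (next_dart w j)" using nxt[OF w j] by (simp add: ends_at_def end_vert_def)
  qed
  let ?D = "concat (map transitions W)"
  have fstD: "map fst ?D = concat W"
  proof -
    have "map fst (transitions w) = w" for w :: "'e dart list" by (simp add: transitions_def comp_def map_nth)
    then show ?thesis by (induction W) simp_all
  qed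
  have D: "n = T (rev_dart d) \<and> d \<in> set (concat W) \<and> n \<in> set (concat W)" if "(d, n) \<in> set ?D" for d n
  proof -
    from that obtain w j where w: "w \<in> set W" "j < length w" "d = w ! j" "n = next_dart w j" by (auto simp: transitions_def)
    have "n \<in> set w" unfolding w(4) next_dart_def using w(2) by (intro nth_mem mod_less_divisor) linarith
    moreover have "d \<in> set w" using w(2,3) by simp
    ultimately show ?thesis using w(1,3,4) nxt[OF w(1,2)] by auto
  qed
  have "pair_sum dart_parity ?D = 0"
  proof (rule pair_sum_eq_0)
    fix i j assume ij: "i < j" "j < length ?D"
    obtain d n where dn: "?D ! i = (d, n)" by (cases "?D ! i")
    obtain d' n' where dn': "?D ! j = (d', n')" by (cases "?D ! j")
    have mem: "(d, n) \<in> set ?D" "(d', n') \<in> set ?D" using ij dn dn' nth_mem[of i ?D] nth_mem[of j ?D] by auto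
    have len: "length ?D = length (concat W)" by (simp flip: fstD)
    have "d = concat W ! i" "d' = concat W ! j" using ij dn dn' by (simp_all flip: fstD)
    then have "fst d = map fst (concat W) ! i" "fst d' = map fst (concat W) ! j" using ij len by simp_all
    moreover have "map fst (concat W) ! i \<noteq> map fst (concat W) ! j"
      using nth_eq_iff_index_eq[OF dist, of i j] ij len by (simp del: nth_map)
    ultimately have neq: "fst d \<noteq> fst d'" by (simp only: not_False_eq_True)
    \<comment> \<open>The noncrossing condition concerns chords with different ends. A common end
      would make the walks use the edge of \<open>d'\<close> in both directions, but each edge
      occurs once.\<close>
    have "rev_dart d' \<noteq> n"
    proof
      assume n: "rev_dart d' = n"
      then have "fst n = fst d'" by (auto simp: rev_dart_def)
      then have "n = d'" using D[OF mem(1)] D[OF mem(2)] dist by (meson distinct_map inj_onD)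
      then show False using n by (auto simp: rev_dart_def prod_eq_iff)
    qed
    moreover have "rev_dart d' \<noteq> rev_dart d" using neq by (auto simp: rev_dart_def)
    moreover have dE: "fst (rev_dart d) \<in> E'" "fst (rev_dart d') \<in> E'" using D[OF mem(1)] D[OF mem(2)] E by (auto simp: rv)
    ultimately have "\<not> chords_cross g G (rev_dart d, n) (rev_dart d', n')" if "end_vert G d = end_vert G d'"
      using Tp[OF dE(1)] D[OF mem(1)] D[OF mem(2)] that by (simp add: ends_at_def end_vert_def)
    then show "dart_parity (?D ! i) (?D ! j) = 0" by (simp add: dn dn' dart_parity_def)
  qed
  moreover have "pair_sum chord_parity (concat (map turns W)) = pair_sum dart_parity ?D"
    by (rule pair_sum_chord_parity) (use inE sub in blast)
  ultimately have "pair_sum turn_parity (concat (map turns W)) =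
      (\<Sum>k\<in>{1..g}. bridge_parity E' (2 * k - 1) * bridge_parity E' (2 * k))"
    using pair_sum_turn_parity[of "concat (map turns W)"] pair_sum_strand_parity[of W, unfolded E, OF sub dist]
    by (simp only: add_0_left)
  moreover have "pair_sum turn_parity (concat (map turns W)) = (\<Sum>w\<leftarrow>W. pair_sum turn_parity (turns w))"
  proof -
    have "pair_sum (\<lambda>xs ys. \<Sum>x\<leftarrow>xs. \<Sum>y\<leftarrow>ys. turn_parity x y) (map turns W) = 0"
    proof (rule pair_sum_eq_0)
      fix i j assume ij: "i < j" "j < length (map turns W)"
      then have W': "W ! i \<in> set W" "W ! j \<in> set W" by simp_all
      have "fst ` set (W ! i) \<inter> fst ` set (W ! j) = {}"
        using dist ij
      proof (induction W arbitrary: i j)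
        case (Cons w W)
        obtain j' where j: "j = Suc j'" using Cons.prems(2) by (cases j) auto
        show ?case
        proof (cases i)
          case 0
          have "W ! j' \<in> set W" using Cons.prems(3) j by simp
          then have "fst ` set (W ! j') \<subseteq> fst ` set (concat W)" by (intro image_mono) auto
          then show ?thesis using Cons.prems(1) 0 j by auto
        next
          case (Suc i')
          then show ?thesis using Cons.IH[of i' j'] Cons.prems j by simp
        qed
      qed simp
      then show "(\<Sum>x\<leftarrow>map turns W ! i. \<Sum>y\<leftarrow>map turns W ! j. turn_parity x y) = 0"
        using disjoint_walks_turn_parity[OF cw[OF W'(1)] cw[OF W'(2)]] closed_walk_interior[OF cw[OF W'(1)]] ij by simp
    qed
    then show ?thesis by (simp add: pair_sum_concat comp_def)
  qed
  moreover have "(\<Sum>w\<leftarrow>W. 1 + rot g \<Phi> G s w) = (\<Sum>w\<leftarrow>W. pair_sum turn_parity (turns w)) +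
      (\<Sum>i\<in>{1..2 * g}. s i * bridge_parity E' i)"
  proof -
    have "bridge_parity E' i = (\<Sum>w\<leftarrow>W. bridge_parity (fst ` set w) i)" for i
      using dist unfolding E[symmetric]
    proof (induction W)
      case (Cons w W)
      have "bridge_parity (fst ` set w \<union> fst ` set (concat W)) i = bridge_parity (fst ` set w) i + bridge_parity (fst ` set (concat W)) i"
        unfolding bridge_parity_def by (rule sum.union_disjoint) (use Cons.prems in auto)
      then show ?case using Cons by (simp add: image_Un del: add_bit_eq_xor)
    qed (simp add: bridge_parity_def)
    then have "(\<Sum>i\<in>{1..2 * g}. s i * bridge_parity E' i) = (\<Sum>w\<leftarrow>W. \<Sum>i\<in>{1..2 * g}. s i * bridge_parity (fst ` set w) i)"
      by (simp only: sum_mult_sum_list)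
    moreover have "map (\<lambda>w. 1 + rot g \<Phi> G s w) W = map (\<lambda>w. pair_sum turn_parity (turns w) + (\<Sum>i\<in>{1..2 * g}. s i * bridge_parity (fst ` set w) i)) W"
    proof (rule map_cong[OF refl])
      have "(1 :: bit) + 1 = 0" by simp
      then have bit: "1 + (1 + a + b) = a + b" for a b :: bit by (simp only: add.assoc[symmetric] add_0_left)
      fix w assume "w \<in> set W"
      then show "1 + rot g \<Phi> G s w = pair_sum turn_parity (turns w) + (\<Sum>i\<in>{1..2 * g}. s i * bridge_parity (fst ` set w) i)"
        using rot_eq_pair_sum[OF cw] by (simp only: bit)
    qed
    ultimately show ?thesis by (simp only: sum_list_addf)
  qed
  ultimately show ?thesis by (simp only: bridge_form_def)
qed

end

section \<open>Noncrossing decompositions into closed walks\<close>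

text \<open>Neighbours in the order of \<open>key\<close> are paired, the two smallest first and the
  rest by induction; then nothing separates the members of a pair.\<close>

lemma pairing_by_rank:
  fixes key :: "'a \<Rightarrow> real"
  assumes "finite A" "even (card A)" "inj_on key A"
  shows "\<exists>T. \<forall>d\<in>A. T d \<in> A \<and> T d \<noteq> d \<and> T (T d) = d \<and> (\<forall>c\<in>A. \<not> (key d < key c \<and> key c < key (T d)))"
  using assms
proof (induction "card A" arbitrary: A rule: less_induct)
  case less
  show ?case
  proof (cases "A = {}")
    case False
    define a where "a = arg_min_on key A"
    have a: "a \<in> A" "\<And>c. c \<in> A \<Longrightarrow> key a \<le> key c"
      using arg_min_if_finite(1)[OF less.prems(1) False, of key] arg_min_least[OF less.prems(1) False, of _ key] by (auto simp: a_def)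
    have "A - {a} \<noteq> {}"
    proof
      assume "A - {a} = {}"
      then have "A = {a}" using a(1) by auto
      then show False using less.prems(2) by simp
    qed
    then have ne: "A - {a} \<noteq> {}" and fin: "finite (A - {a})" using less.prems(1) by auto
    define b where "b = arg_min_on key (A - {a})"
    have b: "b \<in> A - {a}" "\<And>c. c \<in> A - {a} \<Longrightarrow> key b \<le> key c"
      using arg_min_if_finite(1)[OF fin ne, of key] arg_min_least[OF fin ne, of _ key] by (auto simp: b_def)
    let ?A = "A - {a, b}"
    have "a \<noteq> b" using b(1) by auto
    then have "card {a, b} = 2" by simp
    then have "card ?A = card A - 2" using a(1) b(1) less.prems(1) card_Diff_subset[of "{a, b}" A] by simp
    moreover have "card A > 0" using False less.prems(1) by (simp add: card_gt_0_iff)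
    ultimately have c: "card ?A < card A" "even (card ?A)" using less.prems(2) by auto
    obtain T where T: "\<And>d. d \<in> ?A \<Longrightarrow> T d \<in> ?A \<and> T d \<noteq> d \<and> T (T d) = d \<and> (\<forall>c\<in>?A. \<not> (key d < key c \<and> key c < key (T d)))"
      using less.hyps[OF c(1) _ c(2)] less.prems by (meson finite_Diff inj_on_diff)
    let ?T = "T(a := b, b := a)"
    have ab: "a \<noteq> b" using b(1) by auto
    have "?T d \<in> A \<and> ?T d \<noteq> d \<and> ?T (?T d) = d \<and> (\<forall>c\<in>A. \<not> (key d < key c \<and> key c < key (?T d)))" if d: "d \<in> A" for d
    proof -
      consider "d = a" | "d = b" | "d \<in> ?A" using d by blast
      then show ?thesis
      proof cases
        case 1
        then show ?thesis using ab a b by (auto simp: not_less)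
      next
        case 2
        then show ?thesis using ab a b by (auto simp: not_less)
      next
        case 3
        have "\<not> (key d < key c \<and> key c < key (T d))" if "c \<in> A" for c
        proof (cases "c \<in> ?A")
          case False
          then have "c = a \<or> c = b" using that by blast
          then show ?thesis using a(2)[of d] b(2)[of d] 3 by auto
        qed (use T[OF 3] in blast)
        then show ?thesis using T[OF 3] 3 ab by auto
      qed
    qed
    then show ?thesis by blast
  qed simp
qed

text \<open>An orbit that reached the reverse of its start would be a palindrome. Removing one dart
  at either end shortens it by two until a fixed point of \<open>r\<close> (length 0) or of
  \<open>T\<close> (length 1) is left.\<close>

lemma orbit_avoids_reverse:
  fixes T r :: "'a \<Rightarrow> 'a"
  assumes T: "\<And>d. d \<in> D \<Longrightarrow> T d \<in> D \<and> T d \<noteq> d \<and> T (T d) = d" and r: "\<And>d. d \<in> D \<Longrightarrow> r d \<in> D \<and> r d \<noteq> d \<and> r (r d) = d"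
    and d: "d \<in> D"
  shows "((\<lambda>d. T (r d)) ^^ n) d \<noteq> r d"
  using d
proof (induction n arbitrary: d rule: less_induct)
  case (less n)
  let ?P = "\<lambda>d. T (r d)"
  have D: "(?P ^^ k) x \<in> D" if "x \<in> D" for k x using that T r by (induction k) auto
  consider "n = 0" | "n = 1" | m where "n = Suc (Suc m)" by (metis One_nat_def not0_implies_Suc)
  then show ?case
  proof cases
    case 3
    show ?thesis
    proof
      assume e: "(?P ^^ n) d = r d"
      let ?x = "(?P ^^ m) (?P d)"
      have x: "?x \<in> D" by (rule D) (use less.prems T r in auto)
      have "(?P ^^ n) d = T (r ?x)" unfolding 3 using funpow_swap1[of ?P m d] by simp
      then have "r ?x = T (r d)" using e T r x less.prems by metis
      then have "?x = r (?P d)" using r[OF x] by metis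
      moreover have "?P d \<in> D" using less.prems T r by blast
      ultimately show False using less.IH[of m "?P d"] 3 by simp
    qed
  next
    case 1
    then show ?thesis using r[OF less.prems] by auto
  next
    case 2
    then show ?thesis using T[of "r d"] r[OF less.prems] by simp
  qed
qed

text \<open>The walks are orbits of \<open>T\<close> after reversal. By
  \<open>orbit_avoids_reverse\<close> an orbit never meets an edge in both directions, so it uses
  each of its edges once; removing these edges leaves a smaller set closed under
  \<open>T\<close>.\<close>

lemma orbit_decomposition:
  fixes T :: "'e dart \<Rightarrow> 'e dart"
  assumes "finite E'" "\<And>d. fst d \<in> E' \<Longrightarrow> fst (T d) \<in> E' \<and> T d \<noteq> d \<and> T (T d) = d"
  shows "\<exists>W. walk_decomposition E' T W"
  using assms
proof (induction "card E'" arbitrary: E' rule: less_induct)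
  case less
  show ?case
  proof (cases "E' = {}")
    case True
    then show ?thesis by (intro exI[of _ "[]"]) (simp add: walk_decomposition_def)
  next
    case False
    then obtain e where e: "e \<in> E'" by blast
    define D where "D = {d :: 'e dart. fst d \<in> E'}"
    have "D = E' \<times> UNIV" by (auto simp: D_def)
    then have fin: "finite D" using less.prems(1) by simp
    let ?P = "\<lambda>d. T (rev_dart d)"
    define d0 where "d0 = (e, True)"
    have d0: "d0 \<in> D" using e by (simp add: D_def d0_def)
    have T: "T d \<in> D \<and> T d \<noteq> d \<and> T (T d) = d" if "d \<in> D" for d using less.prems(2) that by (simp add: D_def)
    have R: "rev_dart d \<in> D \<and> rev_dart d \<noteq> d \<and> rev_dart (rev_dart d) = d" if "d \<in> D" for d
      using that by (auto simp: D_def rev_dart_def prod_eq_iff)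
    have PD: "(?P ^^ k) x \<in> D" if "x \<in> D" for k x by (induction k) (simp_all add: that T[THEN conjunct1] R[THEN conjunct1])
    have inj: "x = y" if "?P x = ?P y" "x \<in> D" "y \<in> D" for x y using that T R by metis
    have inj_pow: "x = y" if "(?P ^^ k) x = (?P ^^ k) y" "x \<in> D" "y \<in> D" for x y k
      using that
    proof (induction k)
      case (Suc k)
      then have "?P ((?P ^^ k) x) = ?P ((?P ^^ k) y)" by simp
      then have "(?P ^^ k) x = (?P ^^ k) y" by (rule inj[OF _ PD[OF Suc.prems(2)] PD[OF Suc.prems(3)]])
      then show ?case by (rule Suc.IH[OF _ Suc.prems(2,3)])
    qed simp
    \<comment> \<open>Finiteness forces a repetition, and injectivity of the step map pulls it back
      to the starting dart.\<close>
    have "\<not> inj_on (\<lambda>k. (?P ^^ k) d0) UNIV"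
      using finite_imageD[of "\<lambda>k. (?P ^^ k) d0" UNIV] finite_subset[OF _ fin, of "range (\<lambda>k. (?P ^^ k) d0)"] PD[OF d0] by auto
    then obtain i j where "i < j" "(?P ^^ i) d0 = (?P ^^ j) d0" by (metis (mono_tags, lifting) inj_onI linorder_neqE_nat)
    moreover have add: "(?P ^^ (k + l)) x = (?P ^^ k) ((?P ^^ l) x)" for k l x by (simp add: funpow_add)
    ultimately have "(?P ^^ i) d0 = (?P ^^ i) ((?P ^^ (j - i)) d0)" using add[of i "j - i" d0] by simp
    then have "d0 = (?P ^^ (j - i)) d0" using inj_pow d0 PD by blast
    then have ex: "\<exists>n>0. (?P ^^ n) d0 = d0" using \<open>i < j\<close> by (metis zero_less_diff)
    define n where "n = (LEAST n. 0 < n \<and> (?P ^^ n) d0 = d0)"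
    have n: "0 < n" "(?P ^^ n) d0 = d0" using LeastI_ex[OF ex] by (simp_all add: n_def)
    have least: "(?P ^^ k) d0 \<noteq> d0" if "0 < k" "k < n" for k using not_less_Least[of k] that by (auto simp: n_def)
    define w where "w = map (\<lambda>k. (?P ^^ k) d0) [0..<n]"
    have lw: "length w = n" by (simp add: w_def)
    have nth: "w ! k = (?P ^^ k) d0" if "k < n" for k using that by (simp add: w_def)
    have nxt: "next_dart w j = T (rev_dart (w ! j))" if "j < n" for j
    proof (cases "Suc j = n")
      case True
      then show ?thesis using n(2) nth[OF that] nth[OF n(1)] True[symmetric] by (simp add: next_dart_def lw)
    next
      case False
      then show ?thesis using nth[OF that] nth[of "Suc j"] that by (simp add: next_dart_def lw)
    qed
    have wD: "set w \<subseteq> D" using PD[OF d0] by (auto simp: w_def)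
    have diff: "(?P ^^ (k - j)) ((?P ^^ j) d0) = (?P ^^ k) d0" if "j \<le> k" for j k
      using that add[of "k - j" j d0] by simp
    have "fst (w ! j) \<noteq> fst (w ! k)" if jk: "j < k" "k < n" for j k
    proof
      assume eq: "fst (w ! j) = fst (w ! k)"
      have q: "(?P ^^ (k - j)) (w ! j) = w ! k" using diff[of j k] jk nth by simp
      have jD: "w ! j \<in> D" using nth PD[OF d0] jk by simp
      have "w ! k \<noteq> rev_dart (w ! j)" using orbit_avoids_reverse[of D T rev_dart, OF T R jD, of "k - j"] q by simp
      then have "w ! j = w ! k" using eq by (auto simp: rev_dart_def prod_eq_iff)
      then have "(?P ^^ j) ((?P ^^ (k - j)) d0) = (?P ^^ j) d0"
        using nth[of j] nth[of k] jk add[of j "k - j" d0] by simp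
      then have "(?P ^^ (k - j)) d0 = d0" using inj_pow PD[OF d0] d0 by blast
      then show False using least[of "k - j"] jk by simp
    qed
    then have "fst (w ! j) \<noteq> fst (w ! k)" if "j < n" "k < n" "j \<noteq> k" for j k
      using that by (metis linorder_neqE_nat)
    then have dw: "distinct (map fst w)" by (simp add: distinct_conv_nth lw)
    let ?E = "E' - fst ` set w"
    have w0: "d0 \<in> set w" using nth[OF n(1)] n(1) lw by (metis funpow_0 nth_mem)
    have "fst d0 \<in> E' \<inter> fst ` set w" using w0 d0 by (auto simp: D_def)
    then have "?E \<subset> E'" by blast
    then have c: "card ?E < card E'" by (rule psubset_card_mono[OF less.prems(1)])
    have pre: "\<exists>d\<in>set w. ?P d = x" if "x \<in> set w" for x
    proof -
      from that obtain k where k: "k < n" "x = w ! k" unfolding in_set_conv_nth lw by blast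
      show ?thesis
      proof (cases k)
        case 0
        obtain m where m: "n = Suc m" using n(1) by (cases n) auto
        have "?P (w ! m) = x" using nth[of m] nth[of 0] n(2) k 0 m by simp
        then show ?thesis using m lw by (metis lessI nth_mem)
      next
        case (Suc m)
        have "?P (w ! m) = x" using nth[of m] nth[of "Suc m"] k Suc by simp
        then show ?thesis using k Suc lw by (metis Suc_lessD nth_mem)
      qed
    qed
    have "\<exists>W. walk_decomposition ?E T W"
    proof (rule less.hyps[OF c])
      show "finite ?E" using less.prems(1) by simp
      fix d :: "'e dart" assume d: "fst d \<in> ?E"
      then have dD: "d \<in> D" by (simp add: D_def)
      \<comment> \<open>If \<open>T d\<close> is a dart of the orbit, then \<open>d\<close> is the
        reverse of its predecessor; if it is the reverse of such a dart, then \<open>d\<close> is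
        the successor of that dart. Either way the edge of \<open>d\<close> would already be
        used.\<close>
      have "fst (T d) \<notin> fst ` set w"
      proof
        assume "fst (T d) \<in> fst ` set w"
        then obtain x where x: "x \<in> set w" "fst (T d) = fst x" by auto
        then consider "T d = x" | "T d = rev_dart x" by (auto simp: rev_dart_def prod_eq_iff)
        then show False
        proof cases
          case 1
          obtain y where y: "y \<in> set w" "T (rev_dart y) = x" using pre[OF x(1)] by auto
          then have "d = rev_dart y" using 1 T R wD dD by (metis subsetD)
          then show False using d y(1) by (auto simp: rev_dart_def)
        next
          case 2
          then have "d = T (rev_dart x)" using T dD by metis
          moreover obtain j where j: "j < n" "x = w ! j" using x(1) lw by (metis in_set_conv_nth)
          ultimately have "d = next_dart w j" using nxt by simp
          then have "d \<in> set w" using n(1) lw by (simp add: next_dart_def)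
          then show False using d by simp
        qed
      qed
      then show "fst (T d) \<in> ?E \<and> T d \<noteq> d \<and> T (T d) = d" using T[OF dD] by (simp add: D_def)
    qed
    then obtain W where W: "walk_decomposition ?E T W" ..
    have "walk_decomposition E' T (w # W)"
      unfolding walk_decomposition_def
    proof (intro conjI)
      have sub: "fst ` set w \<subseteq> E'" using wD by (auto simp: D_def)
      have W': "distinct (map fst (concat W))" "fst ` set (concat W) = ?E" using W by (simp_all add: walk_decomposition_def)
      have "set (map fst w) \<inter> set (map fst (concat W)) = {}" unfolding set_map W'(2) by blast
      then show "distinct (map fst (concat (w # W)))" using dw W'(1) by (simp only: concat.simps map_append distinct_append)
      show "fst ` set (concat (w # W)) = E'" unfolding concat.simps set_append image_Un W'(2) using sub by blast
      show "\<forall>w'\<in>set (w # W). w' \<noteq> [] \<and> (\<forall>j<length w'. next_dart w' j = T (rev_dart (w' ! j)))"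
        using W nxt lw n(1) by (auto simp: walk_decomposition_def)
    qed
    then show ?thesis ..
  qed
qed

text \<open>Edge ends at \<open>v\<close> are departures or reversed arrivals of the walk. The
  cyclic shift maps arrivals bijectively to departures, so there are equally many of both; a loop is
  counted with two ends.\<close>

lemma even_edge_set_closed_walk:
  assumes p: "p \<noteq> []" "fst ` set p \<subseteq> edges G" "distinct (map fst p)"
    and nxt: "\<And>j. j < length p \<Longrightarrow> end_vert G (p ! j) = start_vert G (next_dart p j)"
  shows "even_edge_set G (fst ` set p)"
  unfolding even_edge_set_def
proof (intro conjI ballI)
  fix v assume "v \<in> verts G"
  define n where "n = length p"
  have n: "0 < n" using p(1) by (simp add: n_def)
  have dist: "distinct p" using p(3) by (simp add: distinct_map)
  let ?A = "{j\<in>{..<n}. start_vert G (p ! j) = v}" and ?B = "{j\<in>{..<n}. end_vert G (p ! j) = v}"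
  have inj: "inj_on ((!) p) S" if "S \<subseteq> {..<n}" for S
    using dist that by (auto simp: inj_on_def n_def nth_eq_iff_index_eq subset_iff)
  have inj': "inj_on (\<lambda>j. rev_dart (p ! j)) S" if "S \<subseteq> {..<n}" for S
  proof (rule inj_onI)
    fix i j assume ij: "i \<in> S" "j \<in> S" "rev_dart (p ! i) = rev_dart (p ! j)"
    then have "p ! i = p ! j" by (simp add: rev_dart_def prod_eq_iff)
    then show "i = j" using inj[OF that] ij(1,2) by (simp add: inj_on_def)
  qed
  have ends: "ends_at G (fst ` set p) v = (!) p ` ?A \<union> (\<lambda>j. rev_dart (p ! j)) ` ?B"
  proof (intro equalityI subsetI)
    fix d assume "d \<in> ends_at G (fst ` set p) v"
    then obtain x where x: "x \<in> set p" "fst d = fst x" and s: "start_vert G d = v" by (auto simp: ends_at_def)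
    obtain j where j: "j < n" "x = p ! j" using x(1) by (metis in_set_conv_nth n_def)
    have "d = x \<or> d = rev_dart x" using x(2) by (auto simp: rev_dart_def prod_eq_iff)
    then show "d \<in> (!) p ` ?A \<union> (\<lambda>j. rev_dart (p ! j)) ` ?B" using j s by (auto simp: end_vert_def)
  next
    fix d assume "d \<in> (!) p ` ?A \<union> (\<lambda>j. rev_dart (p ! j)) ` ?B"
    then show "d \<in> ends_at G (fst ` set p) v" by (auto simp: ends_at_def end_vert_def rev_dart_def n_def)
  qed
  have disj: "(!) p ` ?A \<inter> (\<lambda>j. rev_dart (p ! j)) ` ?B = {}"
  proof -
    have "p ! i \<noteq> rev_dart (p ! j)" if ij: "i < n" "j < n" for i j
    proof
      assume e: "p ! i = rev_dart (p ! j)"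
      then have "map fst p ! i = map fst p ! j" using ij by (simp add: rev_dart_def n_def)
      then have "i = j" using nth_eq_iff_index_eq[OF p(3), of i j] ij by (simp add: n_def del: nth_map)
      then show False using e by (auto simp: rev_dart_def prod_eq_iff)
    qed
    then show ?thesis by (fastforce dest: sym)
  qed
  have "bij_betw (\<lambda>j. Suc j mod n) ?B ?A"
  proof (rule bij_betw_byWitness[where f' = "\<lambda>j. if j = 0 then n - 1 else j - 1"])
    show "\<forall>j\<in>?B. (if Suc j mod n = 0 then n - 1 else Suc j mod n - 1) = j"
    proof
      fix j assume "j \<in> ?B"
      then show "(if Suc j mod n = 0 then n - 1 else Suc j mod n - 1) = j" by (cases "Suc j = n") auto
    qed
    show right: "\<forall>j\<in>?A. Suc (if j = 0 then n - 1 else j - 1) mod n = j" by auto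
    show "(\<lambda>j. Suc j mod n) ` ?B \<subseteq> ?A" using nxt n by (auto simp: next_dart_def n_def)
    show "(\<lambda>j. if j = 0 then n - 1 else j - 1) ` ?A \<subseteq> ?B"
    proof
      fix i assume "i \<in> (\<lambda>j. if j = 0 then n - 1 else j - 1) ` ?A"
      then obtain j where j: "j \<in> ?A" "i = (if j = 0 then n - 1 else j - 1)" by auto
      then have "i < n" using n by auto
      moreover have "Suc i mod n = j" using right j by simp
      ultimately show "i \<in> ?B" using nxt[of i] j by (simp add: next_dart_def n_def)
    qed
  qed
  then have "card ?B = card ?A" by (rule bij_betw_same_card)
  moreover have "card (ends_at G (fst ` set p) v) = card ?A + card ?B"
  proof -
    have S: "?A \<subseteq> {..<n}" "?B \<subseteq> {..<n}" by auto
    have "finite ?A" "finite ?B" by simp_all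
    then show ?thesis unfolding ends
      by (simp only: card_Un_disjoint[OF finite_imageI finite_imageI disj] card_image[OF inj[OF S(1)]] card_image[OF inj'[OF S(2)]])
  qed
  ultimately show "even (card (ends_at G (fst ` set p) v))" by simp
qed (use p(2) in auto)

context drawing
begin

lemma direction_rays:
  assumes d: "fst d \<in> edges G" "fst d' \<in> edges G" "d \<noteq> d'" "start_vert G d = start_vert G d'"
  shows "direction g G d \<noteq> 0" "direction g G d / direction g G d' \<notin> \<real>\<^sub>\<ge>\<^sub>0"
proof -
  have *: "\<exists>x. x \<in> set (dart_steps d) \<and> valid_step x \<and> dart_of x = d \<and> src x = pos G (start_vert G d) \<and> direction g G d = dst x - src x"
    if "fst d \<in> edges G" for d
  proof -
    have h: "hd (dart_steps d) \<in> set (dart_steps d)" by (rule hd_in_set[OF dart_steps_props(1)[OF that]])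
    show ?thesis
      using h dart_steps_valid[OF that h] dart_steps_props(4)[OF that h] dart_steps_props(8)[OF that]
        direction_from_vertex[OF dart_steps_props(2)[OF that]] by metis
  qed
  obtain x where x: "valid_step x" "dart_of x = d" "src x = pos G (start_vert G d)" "direction g G d = dst x - src x"
    using *[OF d(1)] by blast
  obtain y where y: "valid_step y" "dart_of y = d'" "src y = pos G (start_vert G d')" "direction g G d' = dst y - src y"
    using *[OF d(2)] by blast
  show "direction g G d \<noteq> 0" using x(4) src_neq_dst[OF x(1)] by simp
  have eq: "src x = src y" using x(3) y(3) d(4) by simp
  \<comment> \<open>Two opposite traversals of one segment with a common start would give that
    segment equal ends.\<close>
  have "fst x \<noteq> fst y \<or> fst (snd x) \<noteq> fst (snd y)"
  proof (rule ccontr)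
    assume same: "\<not> ?thesis"
    then have "snd (snd x) \<noteq> snd (snd y)" using x(2) y(2) d(3) by (auto simp: dart_of_def case_prod_beta)
    then have "src y = dst x" using same by (cases x; cases y) (auto simp: src_def dst_def)
    then show False using eq src_neq_dst[OF x(1)] by simp
  qed
  then have "open_segment (src x) (dst x) \<inter> open_segment (src x) (dst y) = {}"
    using steps_disjoint[OF x(1) y(1)] eq by simp
  then show "direction g G d / direction g G d' \<notin> \<real>\<^sub>\<ge>\<^sub>0"
    using disjoint_segments_rays[of "dst x" "src x" "dst y" 1 1] src_neq_dst[OF x(1)] src_neq_dst[OF y(1)] x(4) y(4) eq by auto
qed

text \<open>If no argument of \<open>x\<close> separates those of \<open>a\<close> and
  \<open>b\<close>, the position of \<open>x\<close> no longer matters: the sector from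
  \<open>a\<close> to \<open>b\<close> misses \<open>x\<close> when \<open>a\<close> comes first,
  and wraps around through \<open>x\<close> when \<open>b\<close> does. So both ends of another
  chord are on the same side.\<close>

lemma between_adjacent:
  assumes nz: "direction g G a \<noteq> 0" "direction g G b \<noteq> 0" "direction g G x \<noteq> 0"
    and key: "Arg2pi (direction g G x) \<noteq> Arg2pi (direction g G a)" "Arg2pi (direction g G x) \<noteq> Arg2pi (direction g G b)"
    and adj: "\<not> (Arg2pi (direction g G a) < Arg2pi (direction g G x) \<and> Arg2pi (direction g G x) < Arg2pi (direction g G b))"
      "\<not> (Arg2pi (direction g G b) < Arg2pi (direction g G x) \<and> Arg2pi (direction g G x) < Arg2pi (direction g G a))"
  shows "between g G a b x \<longleftrightarrow> Arg2pi (direction g G b) < Arg2pi (direction g G a)"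
proof -
  let ?k = "\<lambda>z. Arg2pi (direction g G z)"
  have k: "Arg2pi (direction g G z / direction g G a) = (if ?k a \<le> ?k z then ?k z - ?k a else ?k z - ?k a + 2 * pi)"
    if "direction g G z \<noteq> 0" for z
    by (rule Arg2pi_divide[OF that nz(1)])
  have "0 \<le> ?k z \<and> ?k z < 2 * pi" for z using Arg2pi_ge_0 Arg2pi_lt_2pi by blast
  from this[of a] this[of b] this[of x] show ?thesis
    unfolding between_def k[OF nz(2)] k[OF nz(3)] using key adj by (auto split: if_splits)
qed

lemma noncrossing_pairing_exists:
  assumes E': "even_edge_set G E'"
  shows "\<exists>T. noncrossing_pairing g G E' T"
proof -
  let ?key = "\<lambda>d. Arg2pi (direction g G d)"
  let ?A = "ends_at G E'"
  have sub: "E' \<subseteq> edges G" using E' by (simp add: even_edge_set_def)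
  have nz: "direction g G d \<noteq> 0" if "d \<in> ?A v" for d v
  proof -
    have h: "fst d \<in> edges G" using that sub by (auto simp: ends_at_def)
    then have "hd (dart_steps d) \<in> set (dart_steps d)" by (rule hd_in_set[OF dart_steps_props(1)])
    from src_neq_dst[OF dart_steps_valid[OF h this]] show ?thesis
      using direction_from_vertex[OF dart_steps_props(2)[OF h]] dart_steps_props(4)[OF h \<open>hd (dart_steps d) \<in> set (dart_steps d)\<close>] by simp
  qed
  have key: "inj_on ?key (?A v)" for v
  proof (rule inj_onI, rule ccontr)
    fix d d' assume d: "d \<in> ?A v" "d' \<in> ?A v" "?key d = ?key d'" "d \<noteq> d'"
    have "direction g G d / direction g G d' \<notin> \<real>\<^sub>\<ge>\<^sub>0"
      by (rule direction_rays(2)) (use d sub in \<open>auto simp: ends_at_def\<close>)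
    moreover have "direction g G d / direction g G d' = of_real (norm (direction g G d) / norm (direction g G d'))"
      using d(3) nz[OF d(2)] by (subst (1) Arg2pi_eq[of "direction g G d"], subst (1) Arg2pi_eq[of "direction g G d'"]) simp
    ultimately show False by (metis divide_nonneg_nonneg nonneg_Reals_of_real_iff norm_ge_zero)
  qed
  have "\<exists>T. \<forall>d\<in>?A v. T d \<in> ?A v \<and> T d \<noteq> d \<and> T (T d) = d \<and> (\<forall>c\<in>?A v. \<not> (?key d < ?key c \<and> ?key c < ?key (T d)))" if "v \<in> verts G" for v
  proof (rule pairing_by_rank)
    have "?A v \<subseteq> E' \<times> UNIV" by (auto simp: ends_at_def)
    then show "finite (?A v)" using finite_subset[OF sub finite_edges] by (auto intro: finite_subset)
    show "even (card (?A v))" using E' that by (simp add: even_edge_set_def)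
    show "inj_on ?key (?A v)" by (rule key)
  qed
  then obtain T where T: "\<And>v d. v \<in> verts G \<Longrightarrow> d \<in> ?A v \<Longrightarrow> T v d \<in> ?A v \<and> T v d \<noteq> d \<and> T v (T v d) = d \<and>
      (\<forall>c\<in>?A v. \<not> (?key d < ?key c \<and> ?key c < ?key (T v d)))" by metis
  have "noncrossing_pairing g G E' (\<lambda>d. T (start_vert G d) d)"
    unfolding noncrossing_pairing_def
  proof (intro ballI)
    fix v d assume v: "v \<in> verts G" and d: "d \<in> ?A v"
    have s: "start_vert G x = v" if "x \<in> ?A v" for x using that by (simp add: ends_at_def)
    note Td = T[OF v d]
    have nocross: "\<not> chords_cross g G (d, T v d) (d', T v d')" if d': "d' \<in> ?A v - {d, T v d}" for d'
    proof -
      have Td': "T v d' \<in> ?A v" "T v d' \<noteq> d" "T v d' \<noteq> T v d" using T[OF v, of d'] Td d' by auto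
      have "between g G d (T v d) x \<longleftrightarrow> ?key (T v d) < ?key d" if x: "x \<in> ?A v" "x \<noteq> d" "x \<noteq> T v d" for x
      proof (rule between_adjacent)
        show "direction g G d \<noteq> 0" "direction g G (T v d) \<noteq> 0" "direction g G x \<noteq> 0" using nz d Td x(1) by blast+
        show "?key x \<noteq> ?key d" "?key x \<noteq> ?key (T v d)" using key[of v] d Td x by (auto simp: inj_on_def)
        show "\<not> (?key d < ?key x \<and> ?key x < ?key (T v d))" using Td x(1) by blast
        show "\<not> (?key (T v d) < ?key x \<and> ?key x < ?key d)" using T[OF v, of "T v d"] Td x(1) by auto
      qed
      from this[of d'] this[of "T v d'"] show ?thesis using d' Td' by (simp add: chords_cross_def)
    qed
    show "T (start_vert G d) d \<in> ?A v \<and> T (start_vert G d) d \<noteq> d \<and>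
        T (start_vert G (T (start_vert G d) d)) (T (start_vert G d) d) = d \<and>
        (\<forall>d'\<in>?A v - {d, T (start_vert G d) d}. \<not> chords_cross g G (d, T (start_vert G d) d) (d', T (start_vert G d') d'))"
      using Td nocross s d by auto
  qed
  then show ?thesis by blast
qed

lemma walk_decomposition_exists:
  assumes E': "even_edge_set G E'" and T: "noncrossing_pairing g G E' T"
  shows "\<exists>W. walk_decomposition E' T W"
proof (rule orbit_decomposition)
  have sub: "E' \<subseteq> edges G" using E' by (simp add: even_edge_set_def)
  then show "finite E'" using finite_edges finite_subset by blast
  fix d :: "'e dart" assume d: "fst d \<in> E'"
  have "start_vert G d \<in> verts G" using d sub tail_verts head_verts by (auto simp: start_vert_def)
  moreover have "d \<in> ends_at G E' (start_vert G d)" using d by (simp add: ends_at_def)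
  ultimately have "T d \<in> ends_at G E' (start_vert G d) \<and> T d \<noteq> d \<and> T (T d) = d"
    using T unfolding noncrossing_pairing_def by blast
  then show "fst (T d) \<in> E' \<and> T d \<noteq> d \<and> T (T d) = d" by (simp add: ends_at_def)
qed

end

section \<open>Homology invariance of bridge parities\<close>

text \<open>The linear extension of \<open>n\<close> from simplices to chains, realised by
  \<open>frag_extend\<close> with values in the free group on the one element of
  \<open>unit\<close>.\<close>

definition chain_eval :: "('a \<Rightarrow> int) \<Rightarrow> ('a \<Rightarrow>\<^sub>0 int) \<Rightarrow> int" where
  "chain_eval n c = Poly_Mapping.lookup (frag_extend (\<lambda>x. frag_cmul (n x) (frag_of ())) c) ()"

lemma chain_eval_simps:
  "chain_eval n 0 = 0" "chain_eval n (frag_of x) = n x" "chain_eval n (a + b) = chain_eval n a + chain_eval n b"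
  "chain_eval n (a - b) = chain_eval n a - chain_eval n b" "chain_eval n (frag_cmul k a) = k * chain_eval n a"
  by (simp_all add: chain_eval_def frag_extend_add frag_extend_diff frag_extend_cmul lookup_add lookup_minus)

lemma chain_eval_sum: "chain_eval n (\<Sum>i\<in>A. f i) = (\<Sum>i\<in>A. chain_eval n (f i))"
  by (induction A rule: infinite_finite_induct) (simp_all add: chain_eval_simps)

lemma chain_eval_sum_list: "chain_eval n (\<Sum>i\<leftarrow>xs. f i) = (\<Sum>i\<leftarrow>xs. chain_eval n (f i))"
  by (induction xs) (simp_all add: chain_eval_simps)

definition simplex_path :: "((nat \<Rightarrow> real) \<Rightarrow> 'a) \<Rightarrow> real \<Rightarrow> 'a" where
  "simplex_path \<sigma> t = \<sigma> (\<lambda>i. if i = 0 then 1 - t else if i = 1 then t else 0)"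

text \<open>The winding of \<open>F\<close> along a singular 1-simplex, made integral by subtracting a logarithm of
  \<open>F\<close> at the two ends.  The logarithm is not continuous, but its choice drops out on cycles.\<close>

definition index_cochain :: "('a \<Rightarrow> complex) \<Rightarrow> ((nat \<Rightarrow> real) \<Rightarrow> 'a) \<Rightarrow> int" where
  "index_cochain F \<sigma> = \<lfloor>Re (winding_number (\<lambda>t. F (simplex_path \<sigma> t)) 0 -
     (Ln (F (simplex_path \<sigma> 1)) - Ln (F (simplex_path \<sigma> 0))) / (2 * of_real pi * \<i>))\<rfloor>"

text \<open>The sheet of the logarithm on which \<open>z\<close> lies, counted from the principal
  one.\<close>

definition log_defect :: "complex \<Rightarrow> int" where
  "log_defect z = \<lfloor>Re ((z - Ln (exp z)) / (2 * of_real pi * \<i>))\<rfloor>"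

lemma log_defect: "of_int (log_defect z) = (z - Ln (exp z)) / (2 * of_real pi * \<i>)"
proof -
  have "exp z = exp (Ln (exp z))" by simp
  then obtain n :: int where n: "z = Ln (exp z) + complex_of_real (real_of_int (2 * n) * pi) * \<i>" unfolding exp_eq by blast
  then have "z - Ln (exp z) = complex_of_real (real_of_int (2 * n) * pi) * \<i>" by (metis add_diff_cancel_left')
  then have e: "(z - Ln (exp z)) / (2 * of_real pi * \<i>) = of_int n" by simp
  then show ?thesis unfolding log_defect_def by simp
qed

text \<open>Where \<open>F\<close> has a continuous logarithm along the simplex, the cochain is the
  coboundary of the sheet number: the principal logarithms subtracted in the cochain are exactly
  those in \<open>log_defect\<close>.\<close>

lemma index_cochain_eq:
  assumes "continuous_on S L" "continuous_on {0..1} c" "c ` {0..1} \<subseteq> S"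
    and "\<And>t. t \<in> {0..1} \<Longrightarrow> F (simplex_path \<sigma> t) = exp (L (c t))"
  shows "index_cochain F \<sigma> = log_defect (L (c 1)) - log_defect (L (c 0))"
proof -
  have "winding_number (\<lambda>t. F (simplex_path \<sigma> t)) 0 = (L (c 1) - L (c 0)) / (2 * of_real pi * \<i>)"
    by (rule winding_number_exp_log[OF assms(1-3)]) (use assms(4) in simp)
  then have "winding_number (\<lambda>t. F (simplex_path \<sigma> t)) 0 -
     (Ln (F (simplex_path \<sigma> 1)) - Ln (F (simplex_path \<sigma> 0))) / (2 * of_real pi * \<i>) =
     of_int (log_defect (L (c 1)) - log_defect (L (c 0)))"
    using assms(4)[of 0] assms(4)[of 1] unfolding of_int_diff log_defect by (simp add: diff_divide_distrib)
  then show ?thesis by (simp only: index_cochain_def complex_Re_of_int floor_of_int)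
qed

text \<open>The triangle is convex, so \<open>F\<close> has a logarithm on all of it. On each face
  the cochain is then the difference of the sheet numbers at two corners, and the alternating sum
  over the faces vanishes.\<close>

lemma index_cochain_boundary:
  assumes \<tau>: "singular_simplex 2 X \<tau>" and F: "continuous_map X euclidean F" "\<And>x. x \<in> topspace X \<Longrightarrow> F x \<noteq> 0"
  shows "chain_eval (index_cochain F) (chain_boundary 2 (frag_of \<tau>)) = 0"
proof -
  define S where "S = {(s, t). 0 \<le> s \<and> 0 \<le> t \<and> s + t \<le> (1 :: real)}"
  \<comment> \<open>Coordinates 1 and 2 identify the standard simplex with a plane triangle, where
    convexity and continuity are those of a Euclidean space.\<close>
  define e where "e = (\<lambda>(s, t) (i::nat). if i = 0 then 1 - s - t else if i = 1 then s else if i = 2 then t else (0 :: real))"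
  have e_in: "e p \<in> standard_simplex 2" if "p \<in> S" for p
    using that by (auto simp: S_def e_def standard_simplex_def numeral_2_eq_2)
  have "continuous_map (top_of_set S) (powertop_real UNIV) e"
  proof (unfold continuous_map_componentwise_UNIV, intro allI)
    fix i :: nat
    consider "i = 0" | "i = 1" | "i = 2" | "i \<noteq> 0" "i \<noteq> 1" "i \<noteq> 2" by blast
    then show "continuous_map (top_of_set S) euclideanreal (\<lambda>p. e p i)"
      by cases (simp_all add: e_def case_prod_beta continuous_intros)
  qed
  then have "continuous_map (top_of_set S) (subtopology (powertop_real UNIV) (standard_simplex 2)) e"
    using e_in by (auto simp: continuous_map_in_subtopology)
  then have \<tau>e: "continuous_map (top_of_set S) X (\<tau> \<circ> e)"
    using \<tau> unfolding singular_simplex_def by (blast intro: continuous_map_compose)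
  then have "continuous_map (top_of_set S) euclidean (F \<circ> (\<tau> \<circ> e))" using F(1) by (rule continuous_map_compose)
  then have cont: "continuous_on S (F \<circ> (\<tau> \<circ> e))" by simp
  have nz: "(F \<circ> (\<tau> \<circ> e)) p \<noteq> 0" if "p \<in> S" for p
    using continuous_map_image_subset_topspace[OF \<tau>e] F(2) that by auto
  have "convex S"
  proof (rule convexI)
    fix x y and u v :: real assume xy: "x \<in> S" "y \<in> S" and uv: "0 \<le> u" "0 \<le> v" "u + v = 1"
    have "u * (fst x + snd x) + v * (fst y + snd y) \<le> u * 1 + v * 1"
      using xy uv by (intro add_mono mult_left_mono) (auto simp: S_def)
    moreover have "0 \<le> u * fst x + v * fst y" "0 \<le> u * snd x + v * snd y" using xy uv by (auto simp: S_def)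
    ultimately show "u *\<^sub>R x + v *\<^sub>R y \<in> S" using uv(3) by (simp add: S_def case_prod_beta algebra_simps)
  qed
  then obtain L where L: "continuous_on S L" "\<And>p. p \<in> S \<Longrightarrow> (F \<circ> (\<tau> \<circ> e)) p = exp (L p)"
    using continuous_logarithm_on_contractible[OF cont convex_imp_contractible nz] by metis
  have face: "index_cochain F (singular_face 2 k \<tau>) = log_defect (L (c 1)) - log_defect (L (c 0))"
    if c: "continuous_on {0..1} c" "c ` {0..1} \<subseteq> S"
      and ck: "\<And>t. t \<in> {0..1} \<Longrightarrow> simplical_face k (\<lambda>i. if i = 0 then 1 - t else if i = 1 then t else 0) = e (c t)" for k c
  proof (rule index_cochain_eq[OF L(1) c])
    fix t :: real assume t: "t \<in> {0..1}"
    have "(\<lambda>i. if i = 0 then 1 - t else if i = 1 then t else 0) \<in> standard_simplex 1"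
      using t by (auto simp: standard_simplex_def)
    then have "simplex_path (singular_face 2 k \<tau>) t = \<tau> (e (c t))"
      unfolding simplex_path_def singular_face_def using ck[OF t] by simp
    moreover have "c t \<in> S" using c(2) t by blast
    ultimately show "F (simplex_path (singular_face 2 k \<tau>) t) = exp (L (c t))" using L(2)[of "c t"] by simp
  qed
  have ext3: "x = y" if "x 0 = y 0" "x 1 = y 1" "x 2 = y 2" "\<And>i. 2 < i \<Longrightarrow> x i = y i" for x y :: "nat \<Rightarrow> real"
  proof
    fix i :: nat
    consider "i = 0" | "i = 1" | "i = 2" | "2 < i" by linarith
    then show "x i = y i" by cases (use that in simp_all)
  qed
  have "index_cochain F (singular_face 2 0 \<tau>) = log_defect (L (1 - 1, 1)) - log_defect (L (1 - 0, 0))"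
    by (rule face[of "\<lambda>t. (1 - t, t)"], intro continuous_intros, force simp: S_def, rule ext3)
      (auto simp: e_def simplical_face_def)
  then have f0: "index_cochain F (singular_face 2 0 \<tau>) = log_defect (L (0, 1)) - log_defect (L (1, 0))" by simp
  have f1: "index_cochain F (singular_face 2 1 \<tau>) = log_defect (L (0, 1)) - log_defect (L (0, 0))"
    by (rule face[of "\<lambda>t. (0, t)"], intro continuous_intros, force simp: S_def, rule ext3)
      (auto simp: e_def simplical_face_def)
  have f2: "index_cochain F (singular_face 2 2 \<tau>) = log_defect (L (1, 0)) - log_defect (L (0, 0))"
    by (rule face[of "\<lambda>t. (t, 0)"], intro continuous_intros, force simp: S_def, rule ext3)
      (auto simp: e_def simplical_face_def)
  have "{..2::nat} = {0, 1, 2}" by auto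
  then show ?thesis using f0 f1 f2 by (simp add: chain_boundary_of chain_eval_sum chain_eval_simps)
qed

text \<open>Boundaries evaluate to 0 and doubles to even numbers.\<close>

lemma index_cochain_homologous_mod2:
  assumes F: "continuous_map X euclidean F" "\<And>x. x \<in> topspace X \<Longrightarrow> F x \<noteq> 0" and h: "homologous_mod2 X c c'"
  shows "even (chain_eval (index_cochain F) c - chain_eval (index_cochain F) c')"
proof -
  obtain d b where db: "singular_chain 2 X d" "c - c' = chain_boundary 2 d + frag_cmul 2 b"
    using h by (auto simp: homologous_mod2_def)
  have "Poly_Mapping.keys d \<subseteq> {\<tau>. singular_simplex 2 X \<tau>}" using db(1) by (simp add: singular_chain_def)
  then have "chain_eval (index_cochain F) (chain_boundary 2 d) = 0"
  proof (induction d rule: frag_induction)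
    case (diff a b)
    then show ?case by (simp add: chain_boundary_diff chain_eval_simps)
  qed (simp_all add: chain_eval_simps index_cochain_boundary[OF _ F])
  then have "chain_eval (index_cochain F) (c - c') = 2 * chain_eval (index_cochain F) b"
    unfolding db(2) by (simp add: chain_eval_simps)
  then show ?thesis by (simp add: chain_eval_simps)
qed

text \<open>The function \<open>bump\<close> is 1 on the side \<open>Suc a\<close>, falls linearly to 0 along the two
  neighbouring sides, and vanishes on all other sides.\<close>

definition bump :: "nat \<Rightarrow> nat \<Rightarrow> complex \<Rightarrow> real" where
  "bump g a z = max 0 ((Re (z * cis (- (2 * pi * (real a + 1/2) / real (4 * g)))) - cos (3 * pi / real (4 * g))) /
     (cos (pi / real (4 * g)) - cos (3 * pi / real (4 * g))))"

lemma continuous_on_bump: "continuous_on S (bump g a)"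
proof -
  have "continuous_on S (\<lambda>z. (Re (z * c) - b) * d)" for b c d by (intro continuous_intros)
  then show ?thesis unfolding bump_def divide_inverse by (intro continuous_on_max continuous_on_const)
qed

text \<open>The formula is an affine height in the direction of the midpoint of the side
  \<open>Suc a\<close>, clipped at 0. The two corners of that side have height
  \<open>cos (pi / N)\<close>, their outer neighbours \<open>cos (3 * pi / N)\<close>, and all other
  corners are no higher; along each side the height is interpolated linearly.\<close>

lemma bump_side_pt:
  assumes g: "g \<ge> 1" and a: "1 \<le> a" "a + 2 \<le> 4 * g" and m: "m \<in> {1..4 * g}" and t: "t \<in> {0..1}"
  shows "bump g a (side_pt g m t) = (if m = a then t else if m = Suc a then 1 else if m = a + 2 then 1 - t else 0)"
proof -
  define N where "N = real (4 * g)"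
  have N: "4 \<le> N" using g by (simp add: N_def)
  define l where "l z = Re (z * cis (- (2 * pi * (real a + 1/2) / N)))" for z
  define \<alpha> where "\<alpha> = cos (pi / N)"
  define \<beta> where "\<beta> = cos (3 * pi / N)"
  have lc: "l (corner g k) = cos (2 * pi * (real k - real a - 1/2) / N)" for k
    by (simp add: l_def corner_def cis_mult N_def diff_divide_distrib ring_distribs algebra_simps)
  have "3 * pi / N \<le> 3 * pi / 4" using N by (intro divide_left_mono) auto
  then have le_pi: "3 * pi / N \<le> pi" using pi_gt_zero by linarith
  have "\<beta> < \<alpha>" unfolding \<alpha>_def \<beta>_def
  proof (rule cos_monotone_0_pi)
    show "0 \<le> pi / N" using N by simp
    show "pi / N < 3 * pi / N" using N by (intro divide_strict_right_mono) auto
  qed (rule le_pi)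
  have "2 * pi * (real a - real a - 1/2) / N = - (pi / N)" "2 * pi * (real (Suc a) - real a - 1/2) / N = pi / N"
    "2 * pi * (real (a - 1) - real a - 1/2) / N = - (3 * pi / N)" "2 * pi * (real (a + 2) - real a - 1/2) / N = 3 * pi / N"
    using a(1) by (simp_all add: of_nat_diff)
  then have c1: "l (corner g a) = \<alpha>" "l (corner g (Suc a)) = \<alpha>" and c2: "l (corner g (a - 1)) = \<beta>" "l (corner g (a + 2)) = \<beta>"
    unfolding lc \<alpha>_def \<beta>_def by (simp_all only: cos_minus)
  have c3: "l (corner g k) \<le> \<beta>" if k: "k \<le> 4 * g" "k \<noteq> a" "k \<noteq> Suc a" for k
  proof -
    define x where "x = 2 * pi * \<bar>real k - real a - 1/2\<bar> / N"
    have r: "3/2 \<le> \<bar>real k - real a - 1/2\<bar>" "\<bar>real k - real a - 1/2\<bar> \<le> N - 3/2" using k a by (auto simp: N_def abs_if)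
    have x: "3 * pi / N \<le> x" "x \<le> 2 * pi - 3 * pi / N"
    proof -
      have "2 * pi * (3/2) / N \<le> x" "x \<le> 2 * pi * (N - 3/2) / N" unfolding x_def
        using r N by (intro divide_right_mono mult_left_mono; simp)+
      moreover have "2 * pi * (N - 3/2) / N = 2 * pi - 3 * pi / N" using N by (simp add: field_simps)
      ultimately show "3 * pi / N \<le> x" "x \<le> 2 * pi - 3 * pi / N" by simp_all
    qed
    \<comment> \<open>\<open>x\<close> is the angle between the corner and the axis of the bump,
      possibly measured the long way round; beyond \<open>pi\<close> it is replaced by
      \<open>2 * pi - x\<close>.\<close>
    have "cos x \<le> \<beta>"
    proof (cases "x \<le> pi")
      case True
      then show ?thesis unfolding \<beta>_def using x(1) N by (intro cos_monotone_0_pi_le) simp_all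
    next
      case False
      have "cos x = cos (2 * pi - x)" by simp
      also have "\<dots> \<le> \<beta>" unfolding \<beta>_def
      proof (rule cos_monotone_0_pi_le)
        show "0 \<le> 3 * pi / N" using N by simp
        show "3 * pi / N \<le> 2 * pi - x" using x(2) by linarith
        show "2 * pi - x \<le> pi" using False by linarith
      qed
      finally show ?thesis .
    qed
    moreover have "l (corner g k) = cos x"
    proof -
      have xe: "x = \<bar>2 * pi * (real k - real a - 1/2) / N\<bar>" unfolding x_def using N by (simp add: abs_mult)
      show ?thesis unfolding lc xe by (rule cos_abs_real[symmetric])
    qed
    ultimately show ?thesis by simp
  qed
  have ls: "l (side_pt g m t) = (1 - t) * l (corner g (m - 1)) + t * l (corner g m)"
    by (simp add: l_def side_pt_def linepath_def algebra_simps)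
  have b: "bump g a z = max 0 ((l z - \<beta>) / (\<alpha> - \<beta>))" for z by (simp add: bump_def l_def \<alpha>_def \<beta>_def N_def)
  have t': "0 \<le> t" "0 \<le> 1 - t" using t by auto
  consider "m = a" | "m = Suc a" | "m = a + 2" | "m \<noteq> a" "m \<noteq> Suc a" "m \<noteq> a + 2" by blast
  then show ?thesis
  proof cases
    case 1
    then have "l (side_pt g m t) - \<beta> = t * (\<alpha> - \<beta>)" using ls c1 c2 by (simp add: algebra_simps)
    then show ?thesis using 1 b t' \<open>\<beta> < \<alpha>\<close> by simp
  next
    case 2
    then have "l (side_pt g m t) - \<beta> = \<alpha> - \<beta>" using ls c1 by (simp add: algebra_simps)
    then show ?thesis using 2 b \<open>\<beta> < \<alpha>\<close> by simp
  next
    case 3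
    then have "l (side_pt g m t) - \<beta> = (1 - t) * (\<alpha> - \<beta>)" using ls c1 c2 by (simp add: algebra_simps)
    then show ?thesis using 3 b t' \<open>\<beta> < \<alpha>\<close> by simp
  next
    case 4
    have "m - 1 \<noteq> a" "m - 1 \<noteq> Suc a" using 4 m by auto
    then have "l (corner g (m - 1)) \<le> \<beta>" "l (corner g m) \<le> \<beta>" using 4 m by (auto intro!: c3)
    then have "l (side_pt g m t) \<le> (1 - t) * \<beta> + t * \<beta>" unfolding ls using t' by (intro add_mono mult_left_mono)
    then have "l (side_pt g m t) - \<beta> \<le> 0" by (simp add: algebra_simps)
    then have "(l (side_pt g m t) - \<beta>) / (\<alpha> - \<beta>) \<le> 0" using \<open>\<beta> < \<alpha>\<close> by (simp add: divide_nonpos_pos)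
    then show ?thesis using 4 b by simp
  qed
qed

text \<open>The plateau of the bump is placed on one of the two sides of bridge \<open>i\<close>;
  its ramps then fall on the two sides of the other bridge of the same handle. Gluing reverses
  sides, so the rising and the falling ramp agree at glued points, and only bridge \<open>i\<close>
  sees a jump, of height 1.\<close>

definition bump_index :: "nat \<Rightarrow> nat" where
  "bump_index i = (if odd i then 2 * i else 2 * i - 3)"

lemma bump_glued_sides:
  assumes i: "i \<in> {1..2 * g}" and m: "m \<in> {1..4 * g}" and t: "t \<in> {0..1}"
  shows "bump g (bump_index i) (side_pt g m t) - bump g (bump_index i) (side_pt g (partner m) (1 - t)) \<in>
    (if bridge_of m = i then {1, - 1} else {0})"
proof -
  define b where "b = bump_index i"
  have g: "g \<ge> 1" using i by simp
  have t1: "1 - t \<in> {0..1}" using t by auto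
  have a: "1 \<le> bump_index i" "bump_index i + 2 \<le> 4 * g"
  proof -
    have "1 \<le> bump_index i \<and> bump_index i + 2 \<le> 4 * g"
      using i unfolding bump_index_def atLeastAtMost_iff by (cases "odd i") (auto, presburger+)
    then show "1 \<le> bump_index i" "bump_index i + 2 \<le> 4 * g" by auto
  qed
  note B = bump_side_pt[OF g a m t, folded b_def] bump_side_pt[OF g a partner_props(1)[OF m] t1, folded b_def]
  obtain k where k: "i = Suc (2 * k) \<and> b = 4 * k + 2 \<or> i = 2 * k + 2 \<and> b = Suc (4 * k)"
  proof (cases "odd i")
    case True
    then obtain k where "i = 2 * k + 1" by (rule oddE)
    then show ?thesis using that[of k] by (simp add: b_def bump_index_def)
  next
    case False
    then obtain k where "i = 2 * k" by blast
    then show ?thesis using that[of "k - 1"] i by (cases k) (simp_all add: b_def bump_index_def)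
  qed
  have rng: "4 * k + 1 \<le> b" "b + 2 \<le> 4 * k + 4" "2 * k + 1 \<le> i" "i \<le> 2 * k + 2" using k by auto
  have far: "bump g b (side_pt g m t) - bump g b (side_pt g (partner m) (1 - t)) \<in> (if bridge_of m = i then {1, - 1} else {0})"
    if "m \<noteq> b" "m \<noteq> Suc b" "m \<noteq> b + 2" "partner m \<noteq> b" "partner m \<noteq> Suc b" "partner m \<noteq> b + 2" "bridge_of m \<noteq> i"
    unfolding B using that by simp
  have "bump g b (side_pt g m t) - bump g b (side_pt g (partner m) (1 - t)) \<in> (if bridge_of m = i then {1, - 1} else {0})"
    using m
  proof (cases rule: side_cases)
    case (1 j)
    show ?thesis
    proof (cases "j = k")
      case True
      then show ?thesis using k unfolding B unfolding 1 side_numbers by (elim disjE conjE) simp_all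
    next
      case False
      then have "j < k \<or> k < j" by (rule linorder_neqE_nat) simp_all
      then show ?thesis by (elim disjE; intro far; unfold 1 side_numbers; insert rng; linarith)
    qed
  next
    case (2 j)
    show ?thesis
    proof (cases "j = k")
      case True
      then show ?thesis using k unfolding B unfolding 2 side_numbers by (elim disjE conjE) simp_all
    next
      case False
      then have "j < k \<or> k < j" by (rule linorder_neqE_nat) simp_all
      then show ?thesis by (elim disjE; intro far; unfold 2 side_numbers; insert rng; linarith)
    qed
  next
    case (3 j)
    show ?thesis
    proof (cases "j = k")
      case True
      then show ?thesis using k unfolding B unfolding 3 side_numbers by (elim disjE conjE) simp_all
    next
      case False
      then have "j < k \<or> k < j" by (rule linorder_neqE_nat) simp_all
      then show ?thesis by (elim disjE; intro far; unfold 3 side_numbers; insert rng; linarith)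
    qed
  next
    case (4 j)
    show ?thesis
    proof (cases "j = k")
      case True
      then show ?thesis using k unfolding B unfolding 4 side_numbers by (elim disjE conjE) simp_all
    next
      case False
      then have "j < k \<or> k < j" by (rule linorder_neqE_nat) simp_all
      then show ?thesis by (elim disjE; intro far; unfold 4 side_numbers; insert rng; linarith)
    qed
  qed
  then show ?thesis by (simp only: b_def)
qed

section \<open>Circle-valued maps and segment simplices on the surface\<close>

lemma topspace_surface: "topspace (surface g) = surface_pt g ` polygon g"
proof
  show "topspace (surface g) \<subseteq> surface_pt g ` polygon g"
    using openin_surface[of g "topspace (surface g)"] by simp
  have "{z \<in> polygon g. surface_pt g z \<in> surface_pt g ` polygon g} = polygon g" by auto
  then have "openin (surface g) (surface_pt g ` polygon g)" unfolding openin_surface by simp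
  then show "surface_pt g ` polygon g \<subseteq> topspace (surface g)" by (rule openin_subset)
qed

lemma continuous_map_surface_pt: "continuous_map (top_of_set (polygon g)) (surface g) (surface_pt g)"
  unfolding continuous_map_def topspace_surface openin_surface by auto

text \<open>The bump jumps by integers at glued points, so its exponential descends to the quotient.
  The resulting circle-valued map winds once, up to sign, for each crossing of bridge
  \<open>i\<close>.\<close>

lemma bridge_map_exists:
  assumes i: "i \<in> {1..2 * g}"
  obtains F :: "complex set \<Rightarrow> complex" where "continuous_map (surface g) euclidean F" "\<And>x. x \<in> topspace (surface g) \<Longrightarrow> F x \<noteq> 0"
    "\<And>z. z \<in> polygon g \<Longrightarrow> F (surface_pt g z) = exp (2 * of_real pi * \<i> * of_real (bump g (bump_index i) z))"
proof -
  define f where "f z = exp (2 * of_real pi * \<i> * of_real (bump g (bump_index i) z))" for z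
  have glue: "f z = f z'" if "(z, z') \<in> side_gluing g" for z z'
  proof -
    from that obtain m t where mt: "z = side_pt g m t" "z' = side_pt g (partner m) (1 - t)" "m \<in> {1..4 * g}" "t \<in> {0..1}"
      unfolding side_gluing_def by blast
    obtain n :: int where "bump g (bump_index i) z - bump g (bump_index i) z' = of_int n"
      using bump_glued_sides[OF i mt(3,4)] mt(1,2) by (auto split: if_splits) (metis of_int_1 of_int_minus of_int_0)+
    then have "bump g (bump_index i) z = bump g (bump_index i) z' + of_int n" by simp
    then show ?thesis unfolding f_def exp_eq by (intro exI[of _ n]) (simp add: algebra_simps)
  qed
  have "f z = f z'" if "(z, z') \<in> (side_gluing g)\<^sup>*" for z z'
    using that by induction (auto dest: glue)
  then have eq: "f z = f z'" if "surface_pt g z = surface_pt g z'" for z z'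
    using that unfolding surface_pt_def by blast
  define F where "F x = f (SOME z. surface_pt g z = x)" for x
  have F: "F (surface_pt g z) = f z" for z
    unfolding F_def by (rule eq) (rule someI[of "\<lambda>z'. surface_pt g z' = surface_pt g z" z], rule refl)
  have cf: "continuous_on (polygon g) f" unfolding f_def by (intro continuous_intros continuous_on_bump)
  have "continuous_map (surface g) euclidean F"
    unfolding continuous_map_def
  proof (intro conjI allI impI)
    fix U :: "complex set" assume "openin euclidean U"
    then have "openin (top_of_set (polygon g)) (polygon g \<inter> f -` U)"
      using continuous_openin_preimage_gen[OF cf] by simp
    moreover have "{z \<in> polygon g. surface_pt g z \<in> {x \<in> topspace (surface g). F x \<in> U}} = polygon g \<inter> f -` U"
      by (auto simp: F topspace_surface)
    ultimately show "openin (surface g) {x \<in> topspace (surface g). F x \<in> U}"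
      unfolding openin_surface by (auto simp: topspace_surface)
  qed simp
  moreover have "F x \<noteq> 0" if "x \<in> topspace (surface g)" for x
    using that F by (auto simp: topspace_surface f_def)
  ultimately show ?thesis using that[of F] F by (simp add: f_def)
qed

lemma standard_simplex_1_linepath:
  assumes "x \<in> standard_simplex 1"
  shows "x 0 *\<^sub>R a + x 1 *\<^sub>R b = linepath a b (x 1)" "x 1 \<in> {0..1}"
  using assms by (auto simp: standard_simplex_def linepath_def)

lemma singular_simplex_segment:
  assumes "a \<in> polygon g" "b \<in> polygon g"
  shows "singular_simplex 1 (surface g) (segment_simplex g (a, b))"
proof -
  let ?K = "subtopology (powertop_real UNIV) (standard_simplex 1)"
  let ?h = "linepath a b \<circ> (\<lambda>x :: nat \<Rightarrow> real. x 1)"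
  have "continuous_map ?K euclideanreal (\<lambda>x. x 1)"
    by (intro continuous_map_from_subtopology continuous_map_product_projection) simp
  moreover have "continuous_map euclideanreal euclidean (linepath a b)" by (simp add: continuous_on_linepath)
  ultimately have "continuous_map ?K euclidean ?h" by (rule continuous_map_compose)
  moreover have "?h x \<in> polygon g" if "x \<in> standard_simplex 1" for x
  proof -
    have "linepath a b (x 1) \<in> closed_segment a b" using standard_simplex_1_linepath(2)[OF that] by (auto intro: linepath_in_path)
    then show ?thesis using closed_segment_subset[OF assms convex_polygon] unfolding comp_apply by (rule rev_subsetD)
  qed
  ultimately have "continuous_map ?K (top_of_set (polygon g)) ?h"
    by (auto simp: continuous_map_in_subtopology)
  then have "continuous_map ?K (surface g) (surface_pt g \<circ> ?h)" using continuous_map_surface_pt by (rule continuous_map_compose)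
  then have "continuous_map ?K (surface g) (segment_simplex g (a, b))"
  proof (rule continuous_map_eq)
    fix x assume "x \<in> topspace ?K"
    then have x: "x \<in> standard_simplex 1" by (simp only: topspace_subtopology Int_iff)
    show "(surface_pt g \<circ> ?h) x = segment_simplex g (a, b) x"
      unfolding segment_simplex_def using x standard_simplex_1_linepath(1)[OF x, of a b]
      by (simp only: comp_apply prod.case restrict_apply if_True)
  qed
  then show ?thesis unfolding singular_simplex_def by (simp add: segment_simplex_def)
qed

lemma index_cochain_segment:
  assumes ab: "a \<in> polygon g" "b \<in> polygon g"
    and F: "\<And>z. z \<in> polygon g \<Longrightarrow> F (surface_pt g z) = exp (L z)" and L: "continuous_on (polygon g) L"
  shows "index_cochain F (segment_simplex g (a, b)) = log_defect (L b) - log_defect (L a)"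
proof -
  have sub: "linepath a b ` {0..1} \<subseteq> polygon g"
    using closed_segment_subset[OF ab convex_polygon] by (simp add: linepath_image_01)
  have "index_cochain F (segment_simplex g (a, b)) = log_defect (L (linepath a b 1)) - log_defect (L (linepath a b 0))"
  proof (rule index_cochain_eq[OF L _ sub])
    fix t :: real assume t: "t \<in> {0..1}"
    have x: "(\<lambda>i. if i = 0 then 1 - t else if i = 1 then t else 0) \<in> standard_simplex 1"
      using t by (auto simp: standard_simplex_def)
    have "simplex_path (segment_simplex g (a, b)) t = surface_pt g (linepath a b t)"
      unfolding simplex_path_def segment_simplex_def using x by (simp add: linepath_def)
    moreover have "linepath a b t \<in> polygon g" using sub t by blast
    ultimately show "F (simplex_path (segment_simplex g (a, b)) t) = exp (L (linepath a b t))" using F by simp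
  qed (simp add: continuous_on_linepath)
  then show ?thesis by (simp add: linepath_def)
qed

lemma sum_route:
  fixes k :: "complex \<Rightarrow> int"
  shows "(\<Sum>ab\<leftarrow>route g a cs b. k (snd ab) - k (fst ab)) =
    k b - k a + (\<Sum>(m, t)\<leftarrow>cs. k (side_pt g m t) - k (side_pt g (partner m) (1 - t)))"
  by (induction cs arbitrary: a) auto

context drawing
begin

lemma segment_in_polygon:
  assumes "e \<in> edges G" "ab \<in> set (segments g G e)"
  shows "fst ab \<in> polygon g" "snd ab \<in> polygon g"
proof -
  obtain i where i: "i \<le> length (crossings G e)" "ab = segments g G e ! i"
    using assms(2) length_segments[of e] by (metis in_set_conv_nth less_Suc_eq_le)
  have v: "valid_step (e, i, True)" using assms(1) i(1) by (simp add: valid_step_def)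
  show "fst ab \<in> polygon g" "snd ab \<in> polygon g"
    using seg_pt_polygon[OF v, of 0] seg_pt_polygon[OF v, of 1] i(2) by (simp_all add: src_def dst_def)
qed

lemma singular_chain_edge_set:
  assumes "E' \<subseteq> edges G"
  shows "singular_chain 1 (surface g) (edge_set_chain g G E')"
  unfolding edge_set_chain_def
proof (rule singular_chain_sum)
  fix e assume e: "e \<in> E'"
  have "singular_chain 1 (surface g) (\<Sum>ab\<leftarrow>xs. frag_of (segment_simplex g ab))" if "set xs \<subseteq> set (segments g G e)" for xs
    using that
  proof (induction xs)
    case (Cons ab xs)
    have "singular_simplex 1 (surface g) (segment_simplex g ab)"
      using singular_simplex_segment[of "fst ab" g "snd ab"] segment_in_polygon[of e ab] Cons.prems e assms by auto
    then have "singular_chain 1 (surface g) (frag_of (segment_simplex g ab))" by (simp only: singular_chain_of)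
    then show ?case using Cons by (simp add: singular_chain_add)
  qed simp
  then show "singular_chain 1 (surface g) (\<Sum>ab\<leftarrow>segments g G e. frag_of (segment_simplex g ab))" by simp
qed

text \<open>Regrouped by vertices, the value at a vertex is counted once for each edge end of
  \<open>E'\<close> there, an even number of times.\<close>

lemma sum_ends_even:
  assumes E': "even_edge_set G E'"
  shows "(\<Sum>e\<in>E'. h (tail G e) + h (head G e)) = (0 :: bit)"
proof -
  have sub: "E' \<subseteq> edges G" using E' by (simp add: even_edge_set_def)
  then have fin: "finite E'" using finite_edges finite_subset by blast
  have "(\<Sum>e\<in>E'. h (tail G e) + h (head G e)) = (\<Sum>e\<in>E'. \<Sum>f\<in>UNIV. h (start_vert G (e, f)))"
    by (rule sum.cong) (simp_all add: UNIV_bool start_vert_def add.commute del: add_bit_eq_xor)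
  also have "\<dots> = (\<Sum>d\<in>E' \<times> UNIV. h (start_vert G d))" by (simp only: sum.cartesian_product) (simp add: case_prod_beta)
  also have "\<dots> = (\<Sum>v\<in>verts G. \<Sum>d\<in>{d \<in> E' \<times> UNIV. start_vert G d = v}. h (start_vert G d))"
    by (rule sum.group[symmetric]) (use fin finite_verts sub tail_verts head_verts in \<open>auto simp: start_vert_def\<close>)
  also have "\<dots> = 0"
  proof (rule sum.neutral, intro ballI)
    fix v assume v: "v \<in> verts G"
    have "{d \<in> E' \<times> UNIV. start_vert G d = v} = ends_at G E' v" by (auto simp: ends_at_def)
    then have "(\<Sum>d\<in>{d \<in> E' \<times> UNIV. start_vert G d = v}. h (start_vert G d)) = of_nat (card (ends_at G E' v)) * h v"
      by (simp add: ends_at_def)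
    moreover have "of_nat (card (ends_at G E' v)) = (0 :: bit)"
    proof -
      obtain k where "card (ends_at G E' v) = k + k" using E' v by (auto simp: even_edge_set_def mult_2 elim!: evenE)
      then show ?thesis by (simp only: of_nat_add) simp
    qed
    ultimately show "(\<Sum>d\<in>{d \<in> E' \<times> UNIV. start_vert G d = v}. h (start_vert G d)) = 0" by simp
  qed
  finally show ?thesis .
qed

text \<open>On the chain of an even edge set the index cochain of the map for bridge
  \<open>i\<close> telescopes along the edges. The vertex terms cancel modulo 2, and the jumps at
  glued points count the crossings of bridge \<open>i\<close>; modulo 2 the evaluation depends only
  on the class.\<close>

lemma bridge_parity_homology:
  assumes E': "even_edge_set G E'" and E'': "even_edge_set G E''"
    and eq: "homology_class g G E' = homology_class g G E''" and i: "i \<in> {1..2 * g}"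
  shows "bridge_parity E' i = bridge_parity E'' i"
proof -
  obtain F :: "complex set \<Rightarrow> complex" where F: "continuous_map (surface g) euclidean F" "\<And>x. x \<in> topspace (surface g) \<Longrightarrow> F x \<noteq> 0"
    "\<And>z. z \<in> polygon g \<Longrightarrow> F (surface_pt g z) = exp (2 * of_real pi * \<i> * of_real (bump g (bump_index i) z))"
    using bridge_map_exists[OF i] by blast
  define L where "L z = 2 * of_real pi * \<i> * complex_of_real (bump g (bump_index i) z)" for z
  have L: "continuous_on (polygon g) L" unfolding L_def by (intro continuous_intros continuous_on_bump)
  let ?k = "\<lambda>z. log_defect (L z)"
  have cross: "of_int (?k (side_pt g m t) - ?k (side_pt g (partner m) (1 - t))) = (of_bool (bridge_of m = i) :: bit)"
    if mt: "m \<in> {1..4 * g}" "t \<in> {0..1}" for m t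
  proof -
    let ?z = "side_pt g m t" and ?z' = "side_pt g (partner m) (1 - t)"
    have t1: "1 - t \<in> {0..1}" using mt(2) by auto
    have P: "?z \<in> polygon g" "?z' \<in> polygon g"
      using side_pt_in_polygon mt t1 partner_props(1)[OF mt(1)] by blast+
    \<comment> \<open>At glued points the principal logarithms in \<open>log_defect\<close>
      coincide, so the difference of the sheet numbers is the jump of the bump.\<close>
    have "exp (L ?z) = exp (L ?z')"
      using F(3)[OF P(1)] F(3)[OF P(2)] glued_sides_surface_pt[OF mt] by (simp add: L_def)
    then have "of_int (?k ?z - ?k ?z') = complex_of_real (bump g (bump_index i) ?z - bump g (bump_index i) ?z')"
      unfolding of_int_diff log_defect by (simp add: L_def diff_divide_distrib)
    then have "real_of_int (?k ?z - ?k ?z') = bump g (bump_index i) ?z - bump g (bump_index i) ?z'"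
      by (metis of_real_eq_iff of_real_of_int_eq)
    then have "real_of_int (?k ?z - ?k ?z') \<in> (if bridge_of m = i then {1, - 1} else {0})"
      using bump_glued_sides[OF i mt] by simp
    then have "?k ?z - ?k ?z' \<in> (if bridge_of m = i then {1, - 1} else {0})" by (auto split: if_splits)
    moreover have "of_int n = (of_bool (bridge_of m = i) :: bit)" if "n \<in> (if bridge_of m = i then {1, - 1} else {0})" for n :: int
      using that by (auto split: if_splits)
    ultimately show ?thesis by blast
  qed
  have edge: "of_int (chain_eval (index_cochain F) (\<Sum>ab\<leftarrow>segments g G e. frag_of (segment_simplex g ab))) =
      of_int (?k (pos G (tail G e))) + of_int (?k (pos G (head G e))) + (of_nat (bridge_count G e i) :: bit)" if e: "e \<in> edges G" for e
  proof -
    have "chain_eval (index_cochain F) (\<Sum>ab\<leftarrow>segments g G e. frag_of (segment_simplex g ab)) =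
        (\<Sum>ab\<leftarrow>segments g G e. index_cochain F (segment_simplex g ab))"
      by (simp only: chain_eval_sum_list chain_eval_simps)
    also have "map (\<lambda>ab. index_cochain F (segment_simplex g ab)) (segments g G e) = map (\<lambda>ab. ?k (snd ab) - ?k (fst ab)) (segments g G e)"
    proof (rule map_cong[OF refl])
      fix ab assume ab: "ab \<in> set (segments g G e)"
      show "index_cochain F (segment_simplex g ab) = ?k (snd ab) - ?k (fst ab)"
        using index_cochain_segment[OF segment_in_polygon[OF e ab] F(3)[folded L_def] L] by simp
    qed
    also have "(\<Sum>ab\<leftarrow>segments g G e. ?k (snd ab) - ?k (fst ab)) = ?k (pos G (head G e)) - ?k (pos G (tail G e)) +
        (\<Sum>(m, t)\<leftarrow>crossings G e. ?k (side_pt g m t) - ?k (side_pt g (partner m) (1 - t)))"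
      unfolding segments_def by (rule sum_route)
    finally have *: "of_int (chain_eval (index_cochain F) (\<Sum>ab\<leftarrow>segments g G e. frag_of (segment_simplex g ab))) =
        (of_int (?k (pos G (head G e)) - ?k (pos G (tail G e))) +
        of_int (\<Sum>(m, t)\<leftarrow>crossings G e. ?k (side_pt g m t) - ?k (side_pt g (partner m) (1 - t))) :: bit)"
      by (simp only: of_int_add)
    have "of_int (\<Sum>(m, t)\<leftarrow>cs. ?k (side_pt g m t) - ?k (side_pt g (partner m) (1 - t))) =
        (of_nat (length (filter (\<lambda>(m, t). bridge_of m = i) cs)) :: bit)" if "set cs \<subseteq> set (crossings G e)" for cs
      using that
    proof (induction cs)
      case (Cons c cs)
      obtain m t where c: "c = (m, t)" by force
      then have mt: "m \<in> {1..4 * g}" "t \<in> {0..1}" using crossing_range[OF e, of m t] Cons.prems by auto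
      have "of_int (\<Sum>(m, t)\<leftarrow>c # cs. ?k (side_pt g m t) - ?k (side_pt g (partner m) (1 - t))) =
         (of_int (?k (side_pt g m t) - ?k (side_pt g (partner m) (1 - t))) :: bit) +
         of_int (\<Sum>(m, t)\<leftarrow>cs. ?k (side_pt g m t) - ?k (side_pt g (partner m) (1 - t)))"
        unfolding c list.map sum_list.Cons prod.case of_int_add ..
      also have "\<dots> = of_bool (bridge_of m = i) + of_nat (length (filter (\<lambda>(m, t). bridge_of m = i) cs))"
        unfolding cross[OF mt] using Cons by simp
      also have "\<dots> = of_nat (length (filter (\<lambda>(m, t). bridge_of m = i) (c # cs)))"
        by (simp add: c)
      finally show ?case .
    qed simp
    from this[OF order.refl] have c: "of_int (\<Sum>(m, t)\<leftarrow>crossings G e. ?k (side_pt g m t) - ?k (side_pt g (partner m) (1 - t))) =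
        (of_nat (bridge_count G e i) :: bit)" by (simp only: bridge_count_def)
    have "of_int (x - y) = (of_int y + of_int x :: bit)" for x y :: int
      by (cases "of_int x = (0 :: bit)"; cases "of_int y = (0 :: bit)") simp_all
    then show ?thesis unfolding * c by (simp only:)
  qed
  have parity: "of_int (chain_eval (index_cochain F) (edge_set_chain g G E)) = bridge_parity E i" if E: "even_edge_set G E" for E
  proof -
    have "of_int (chain_eval (index_cochain F) (edge_set_chain g G E)) =
        (\<Sum>e\<in>E. of_int (chain_eval (index_cochain F) (\<Sum>ab\<leftarrow>segments g G e. frag_of (segment_simplex g ab))) :: bit)"
      by (simp only: edge_set_chain_def chain_eval_sum of_int_sum)
    also have "\<dots> = (\<Sum>e\<in>E. of_int (?k (pos G (tail G e))) + of_int (?k (pos G (head G e))) + of_nat (bridge_count G e i))"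
      by (rule sum.cong[OF refl], rule edge) (use E in \<open>auto simp: even_edge_set_def\<close>)
    also have "\<dots> = bridge_parity E i"
      unfolding sum.distrib[of "\<lambda>e. of_int (?k (pos G (tail G e))) + of_int (?k (pos G (head G e)))"]
        sum_ends_even[OF E, of "\<lambda>v. of_int (?k (pos G v))"] bridge_parity_def by (rule add_0_left)
    finally show ?thesis .
  qed
  have sub: "E' \<subseteq> edges G" "E'' \<subseteq> edges G" using E' E'' by (simp_all add: even_edge_set_def)
  \<comment> \<open>A class contains its own chain. Read through the equality of the two classes,
    this relates the two chains directly.\<close>
  have "homologous_mod2 (surface g) c c" for c :: "complex set chain"
    unfolding homologous_mod2_def by (rule exI[of _ 0], rule exI[of _ 0]) simp
  then have "edge_set_chain g G E' \<in> homology_class g G E'"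
    using singular_chain_edge_set[OF sub(1)] by (simp add: homology_class_def H1_class_def)
  then have "homologous_mod2 (surface g) (edge_set_chain g G E'') (edge_set_chain g G E')"
    unfolding eq by (simp add: homology_class_def H1_class_def)
  note even = index_cochain_homologous_mod2[OF F(1,2) this]
  have "of_int a = (of_int b :: bit)" if "even (a - b)" for a b :: int
  proof -
    from that obtain c where "a - b = 2 * c" by (rule evenE)
    then have "a = b + (c + c)" by simp
    then show ?thesis by (simp only: of_int_add) simp
  qed
  from this[OF even]
  have "of_int (chain_eval (index_cochain F) (edge_set_chain g G E'')) = (of_int (chain_eval (index_cochain F) (edge_set_chain g G E')) :: bit)" .
  then show ?thesis using parity[OF E'] parity[OF E''] by simp
qed

lemma bridge_form_homology:
  assumes "even_edge_set G E'" "even_edge_set G E''" "homology_class g G E' = homology_class g G E''"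
  shows "bridge_form s E' = bridge_form s E''"
proof -
  note h = bridge_parity_homology[OF assms]
  have "(\<Sum>k\<in>{1..g}. bridge_parity E' (2 * k - 1) * bridge_parity E' (2 * k)) =
      (\<Sum>k\<in>{1..g}. bridge_parity E'' (2 * k - 1) * bridge_parity E'' (2 * k))"
  proof (rule sum.cong[OF refl])
    fix k assume "k \<in> {1..g}"
    then have "2 * k - 1 \<in> {1..2 * g}" "2 * k \<in> {1..2 * g}" by auto
    from this[THEN h] show "bridge_parity E' (2 * k - 1) * bridge_parity E' (2 * k) =
      bridge_parity E'' (2 * k - 1) * bridge_parity E'' (2 * k)" by (simp only:)
  qed
  moreover have "(\<Sum>i\<in>{1..2 * g}. s i * bridge_parity E' i) = (\<Sum>i\<in>{1..2 * g}. s i * bridge_parity E'' i)"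
    by (rule sum.cong[OF refl]) (simp only: h)
  ultimately show ?thesis by (simp only: bridge_form_def)
qed

text \<open>\<open>the_elem\<close> needs a singleton: any two values agree because the bridge form
  depends only on the class, and a noncrossing pairing with its walks supplies at least one
  value.\<close>

lemma q_form_eq_bridge_form:
  assumes "even_edge_set G E'"
  shows "q_form g \<Phi> G s (homology_class g G E') = bridge_form s E'"
proof -
  have "q_values g \<Phi> G s (homology_class g G E') = {bridge_form s E'}"
  proof
    show "q_values g \<Phi> G s (homology_class g G E') \<subseteq> {bridge_form s E'}"
    proof
      fix x assume "x \<in> q_values g \<Phi> G s (homology_class g G E')"
      then obtain E'' T W where "x = (\<Sum>w\<leftarrow>W. 1 + rot g \<Phi> G s w)" "even_edge_set G E''"
        "homology_class g G E'' = homology_class g G E'" "noncrossing_pairing g G E'' T" "walk_decomposition E'' T W"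
        unfolding q_values_def by blast
      then show "x \<in> {bridge_form s E'}"
        using sum_rot_noncrossing_decomposition bridge_form_homology assms by (metis singleton_iff)
    qed
    obtain T where T: "noncrossing_pairing g G E' T" using noncrossing_pairing_exists[OF assms] by blast
    obtain W where W: "walk_decomposition E' T W" using walk_decomposition_exists[OF assms T] by blast
    have "bridge_form s E' = (\<Sum>w\<leftarrow>W. 1 + rot g \<Phi> G s w)"
      by (rule sum_rot_noncrossing_decomposition[OF assms T W, symmetric])
    then show "{bridge_form s E'} \<subseteq> q_values g \<Phi> G s (homology_class g G E')"
      unfolding q_values_def using assms T W by blast
  qed
  then show ?thesis by (simp only: q_form_def the_elem_eq)
qed

end

theorem theorem2p14:
  fixes g :: nat
    and G :: "('v, 'e) drawn_graph"
    and \<Phi> :: "hw_point \<Rightarrow> complex"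
    and s :: "nat \<Rightarrow> bit"
    and p :: "'e dart list"
  assumes "g \<ge> 1"
    and "embedded_graph g G"
    and "highway_immersion g \<Phi>"
    and "prime_reduced_cycle G p"
    and "distinct (map fst p)"
  shows "rot g \<Phi> G s p =
    1 + of_nat (self_intersections g G p) + q_form g \<Phi> G s (homology_class g G (fst ` set p))"
proof -
  interpret drawing g G \<Phi> using assms(2,3) by unfold_locales
  have p: "p \<noteq> []" "fst ` set p \<subseteq> edges G" "\<And>j. j < length p \<Longrightarrow> end_vert G (p ! j) = start_vert G (next_dart p j)"
    using assms(4) by (auto simp: prime_reduced_cycle_def)
  then have "closed_walk p" using assms(5) by (simp add: closed_walk_def)
  moreover have "even_edge_set G (fst ` set p)" by (rule even_edge_set_closed_walk[OF p(1,2) assms(5) p(3)])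
  ultimately show ?thesis by (simp only: rot_closed_walk q_form_eq_bridge_form)
qed

end
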